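(* Let $a,x$ be positive real numbers, put $\mathcal L:=\log(100x)+|\log a|$ (natural logarithm), $\alpha_0:=\max(a,1/\sqrt a)$ and $y:=73.6\,a^{1/8}\,x^{3/16}\,\mathcal L^{3/8}$, and suppose that $1\le y\le \frac{x}{3}$. Then the lattice discrepancy $$P_{\mathcal E}(x)=\#\Big\{(u_1,u_2,u_3)\in\mathbb Z^3:\ \frac{u_1^2+u_2^2}{a}+a^2u_3^2\le x\Big\}-\frac{4\pi}{3}\,x^{3/2}$$ of the ellipsoid of rotation $\frac{u_1^2+u_2^2}{a}+a^2u_3^2\le x$ satisfies $$\begin{aligned}|P_{\mathcal E}(x)|\le\ &1237\,a^{1/8}x^{11/16}\mathcal L^{3/8}+12\,a^{-69/64}x^{81/128}\mathcal L^{145/64}\\&+\Big(a^{1/4}\big(134\,\mathcal L^{5/2}+543\,\mathcal L^{1/4}\big)+20\,\frac{\mathcal L^{5/2}}{a^{1/4}}\Big)x^{5/8}+12\,a^{-39/64}x^{75/128}\mathcal L^{139/64}\\&+\Big(268\,\frac{\mathcal L}{a}+159\,\alpha_0^3+2000\Big)x^{1/2}+\alpha_0^3\,(4.4\,\mathcal L+104.5).\end{aligned}$$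
   Context: All decimal constants are exact real numbers. The ellipsoid $\frac{u_1^2+u_2^2}{a}+a^2u_3^2\le 1$ has volume $\frac{4\pi}{3}$, so $P_{\mathcal E}(x)$ is the number of integer points minus the volume of the dilated ellipsoid. Under the hypothesis $1\le y\le x/3$ one has $x\ge 3$, so $\mathcal L>0$ (and $y$ is understood to be defined by real powers with $\mathcal L>0$). *)

theory Defs
  imports "HOL-Analysis.Analysis"
begin

definition ellipsoid_lattice_points :: "real \<Rightarrow> real \<Rightarrow> (int \<times> int \<times> int) set" where
  "ellipsoid_lattice_points a x =
     {(u1, u2, u3).
        ((real_of_int u1)\<^sup>2 + (real_of_int u2)\<^sup>2) / a + a\<^sup>2 * (real_of_int u3)\<^sup>2 \<le> x}"

text \<open>
  For \<open>a > 0\<close> the set of lattice points is finite, so \<open>card\<close> is the genuine count,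
  and the subtracted term is the volume of the real ellipsoid.
\<close>

definition lattice_discrepancy :: "real \<Rightarrow> real \<Rightarrow> real" where
  "lattice_discrepancy a x =
     real (card (ellipsoid_lattice_points a x)) - 4 * pi / 3 * x powr (3/2)"

end

(* Put A(t) for the sum of max(0, t - Q(u))^2 / 2 over the lattice points u, Q being the quadratic
   form of the ellipsoid. The second difference of A with step h, divided by h^2, lies between the
   lattice point counts at t and t + 2h. Poisson summation turns A(t) into a series whose zero
   term yields the volume and whose other terms are weighted oscillations in 2 pi sqrt(t) kappa,
   where kappa^2 = a (j^2 + k^2) + (l/a)^2.
   The frequencies on the plane l = 0 and on the axis j = k = 0 are estimated trivially. The others are split
   into dyadic boundary layers, where Cauchy-Schwarz over n = j^2 + k^2 (using the mean square of r_2)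
   and the Weyl-van der Corput inequality in l lead to sums over n of the phase
   kappa(n, l + d) - kappa(n, l), to which the second difference test applies. For kappa
   below sqrt(x)/h the second difference is bounded by second derivatives in t, above it by the decay
   of the kernel; balancing with the volume error gives h = y/4. *)

theory Submission
  imports Defs "HOL-Real_Asymp.Real_Asymp"
begin

section \<open>A second difference test for exponential sums\<close>

text \<open>The obstacle is the coefficient r_2(n), too irregular to be summed against an
  oscillation in n. Cauchy-Schwarz discards it at the cost of the square root of a logarithm.
  Opening the remaining square in l leaves an unweighted n and a pair of frequencies whose squares
  differ by d (2l + d) / a^2, independently of n; hence the first two n-derivatives of the phase
  have a fixed sign and explicit size. The layers are differences of boxes n \<le> Z^2/a, l \<le> a
  Z rather than shells of \<kappa>: for fixed l the admissible n form an interval, and this range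
  only grows with l. Order two of the mean makes the transformed terms O(\<kappa>^(-4)), so the
  triple series converges absolutely. In a low layer the mean value theorem is applied to the whole
  layer sum: all its frequencies are then taken at one common t and keep their oscillation. The
  layer bounds decay geometrically on both sides of \<kappa> = sqrt(x)/h, so only the layer there
  determines the size of the result.\<close>

lemma sin_pi_ge:
  fixes \<theta> d :: real
  assumes "0 < \<theta>" "\<theta> \<le> d" "d \<le> 1 - \<theta>"
  shows "2 * \<theta> \<le> sin (pi * d)"
proof -
  \<comment> \<open>Jordan's inequality: the concave sine lies above its chord on [0, pi/2]. The
    rest of the range follows by reflecting d to 1 - d.\<close>
  have *: "2 * t \<le> sin (pi * t)" if "0 \<le> t" "t \<le> 1/2" for t :: real
  proof -
    have cvx: "concave_on {0..pi/2} sin"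
    proof (rule f''_le0_imp_concave)
      show "convex {0..pi/2}" by simp
      show "DERIV sin x :> cos x" for x :: real by (rule DERIV_sin)
      show "DERIV cos x :> - sin x" for x :: real by (rule DERIV_cos)
      show "- sin x \<le> 0" if "x \<in> {0..pi/2}" for x :: real
        using that by (auto intro!: sin_ge_zero)
    qed
    have "sin ((1 - 2*t) * 0 + (2*t) * (pi/2)) \<ge> (1-2*t) * sin 0 + (2*t) * sin (pi/2)"
      using concave_onD[OF cvx, of "2*t" 0 "pi/2"] that by simp
    thus ?thesis by (simp add: mult.commute)
  qed
  show ?thesis
  proof (cases "d \<le> 1/2")
    case True thus ?thesis using *[of d] assms by auto
  next
    case False
    have "sin (pi * d) = sin (pi * (1 - d))" by (simp add: right_diff_distrib)
    thus ?thesis using *[of "1-d"] assms False by auto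
  qed
qed

lemma cot_antimono:
  assumes "0 < x" "x \<le> y" "y < pi"
  shows "cot y \<le> cot (x::real)"
proof -
  have s: "sin x > 0" "sin y > 0" using assms by (auto intro!: sin_gt_zero)
  have "cot x - cot y = sin (y - x) / (sin x * sin y)"
    using s by (simp add: cot_def sin_diff field_simps)
  also have "\<dots> \<ge> 0" using s assms by (intro divide_nonneg_pos sin_ge_zero) auto
  finally show ?thesis by simp
qed

text \<open>With e(u) = exp(2 pi i u), this is 1 / (e(\<delta>) - 1) = -1/2 - (i/2) cot(pi
  \<delta>). The real part is constant, so in a summation by parts only the monotone cotangent
  varies.\<close>

lemma cis_recip:
  fixes \<delta> :: real
  assumes "sin (pi * \<delta>) \<noteq> 0"
  shows "Complex (-1/2) (- cot (pi * \<delta>) / 2) * (cis (2 * pi * \<delta>) - 1) = 1"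
proof -
  define s where "s = sin (pi*\<delta>)"
  define c where "c = cos (pi*\<delta>)"
  have sc: "s\<^sup>2 + c\<^sup>2 = 1" unfolding s_def c_def by simp
  have C: "cos (2*pi*\<delta>) = 1 - 2 * s\<^sup>2" "sin (2*pi*\<delta>) = 2 * s * c"
    using cos_double_sin[of "pi*\<delta>"] sin_double[of "pi*\<delta>"] unfolding s_def c_def by (simp_all add: mult.assoc)
  have s0: "s \<noteq> 0" using assms s_def by simp
  have 1: "- (1/2) * (1 - 2* s\<^sup>2 - 1) - (- (c/s)/2) * (2* s*c) = 1"
    using s0 sc by (simp add: power2_eq_square)
  have 2: "- (1/2) * (2* s*c) + (-(c/s)/2) * (1 - 2* s\<^sup>2 - 1) = 0"
    using s0 by (simp add: power2_eq_square)
  show ?thesis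
    unfolding complex_eq_iff using 1 2 C
    by (simp add: cot_def s_def[symmetric] c_def[symmetric])
qed

text \<open>The two numbers differ only in the sign of their real part 1/2, hence share one modulus.
  They are the boundary factors of the summation by parts.\<close>

lemma norm_recip:
  fixes \<delta> :: real
  assumes "sin (pi * \<delta>) > 0"
  shows "norm (Complex (-1/2) (- cot (pi * \<delta>) / 2)) = 1 / (2 * sin (pi*\<delta>))"
    and "norm (1 + Complex (-1/2) (- cot (pi * \<delta>) / 2)) = 1 / (2 * sin (pi*\<delta>))"
proof -
  define s where "s = sin (pi*\<delta>)"
  define c where "c = cos (pi*\<delta>)"
  have sc: "s\<^sup>2 + c\<^sup>2 = 1" unfolding s_def c_def by simp
  have s0: "s > 0" using assms s_def by simp
  have *: "(1/2)\<^sup>2 + (- (c/s)/2)\<^sup>2 = (1/(2* s))\<^sup>2"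
    using s0 sc by (simp add: power2_eq_square field_simps)
  have **: "sqrt ((1/2)\<^sup>2 + (- (c/s)/2)\<^sup>2) = 1/(2* s)"
    unfolding * using s0 by simp
  show "norm (Complex (-1/2) (- cot (pi * \<delta>) / 2)) = 1 / (2 * sin (pi*\<delta>))"
    using ** by (simp add: cmod_def cot_def s_def[symmetric] c_def[symmetric])
  show "norm (1 + Complex (-1/2) (- cot (pi * \<delta>) / 2)) = 1 / (2 * sin (pi*\<delta>))"
    using ** by (simp add: cmod_def cot_def s_def[symmetric] c_def[symmetric])
qed

text \<open>The Kusmin-Landau inequality. Each term is \<open>G n\<close> times the difference of
  consecutive terms; the phase increments increase within (0, 1), so their cotangents decrease and
  the total variation of \<open>G\<close> telescopes.\<close>

lemma kusmin_landau0:
  fixes \<phi> :: "nat \<Rightarrow> real" and \<theta> :: real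
  assumes AB: "A < B" and \<theta>: "0 < \<theta>"
    and rng: "\<And>n. n \<in> {A..<B} \<Longrightarrow> \<theta> \<le> \<phi> (Suc n) - \<phi> n \<and> \<phi> (Suc n) - \<phi> n \<le> 1 - \<theta>"
    and mono: "\<And>n. n \<in> {A..<B} \<Longrightarrow> Suc n < B \<Longrightarrow> \<phi> (Suc n) - \<phi> n \<le> \<phi> (Suc (Suc n)) - \<phi> (Suc n)"
  shows "norm (\<Sum>n=A..B. cis (2*pi*\<phi> n)) \<le> 1 / \<theta>"
proof -
  define d where "d n = \<phi> (Suc n) - \<phi> n" for n
  define e where "e n = cis (2*pi*\<phi> n)" for n
  define G where "G n = Complex (-1/2) (- cot (pi * d n) / 2)" for n
  have sn: "sin (pi * d n) \<ge> 2*\<theta>" if "n \<in> {A..<B}" for n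
    using sin_pi_ge[OF \<theta>, of "d n"] rng[OF that] by (simp add: d_def)
  have e_eq: "e n = G n * (e (Suc n) - e n)" if "n \<in> {A..<B}" for n
  proof -
    have "e (Suc n) = e n * cis (2*pi*d n)"
      by (simp add: e_def d_def cis_mult algebra_simps)
    hence "G n * (e (Suc n) - e n) = e n * (G n * (cis (2*pi*d n) - 1))" by (simp add: algebra_simps)
    also have "G n * (cis (2*pi*d n) - 1) = 1"
      unfolding G_def by (rule cis_recip) (use sn[OF that] \<theta> in auto)
    finally show ?thesis by simp
  qed
  have ne: "norm (e n) = 1" for n by (simp add: e_def)
  \<comment> \<open>The two boundary terms are taken out of the sum, so that the induction starts
    from 0 and each step adds one difference of cotangents.\<close>
  have step: "norm ((\<Sum>n=A..<Suc K. e n) - G K * e (Suc K) + G A * e A) \<le> (cot (pi * d A) - cot (pi * d K)) / 2"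
    if "A \<le> K" "K < B" for K
    using that
  proof (induction K rule: dec_induct)
    case base
    have "e A = G A * e (Suc A) - G A * e A" using e_eq[of A] base AB by (simp add: algebra_simps)
    hence "e A - G A * e (Suc A) + G A * e A = 0" by (simp add: algebra_simps)
    thus ?case by simp
  next
    case (step K)
    have eq: "(\<Sum>n=A..<Suc (Suc K). e n) - G (Suc K) * e (Suc (Suc K)) + G A * e A
       = ((\<Sum>n=A..<Suc K. e n) - G K * e (Suc K) + G A * e A) + (G K - G (Suc K)) * e (Suc K)"
      using e_eq[of "Suc K"] step by (simp add: algebra_simps)
    have cle: "cot (pi * d (Suc K)) \<le> cot (pi * d K)"
    proof (rule cot_antimono)
      show "0 < pi * d K" using rng[of K] step \<theta> by (simp add: d_def)
      show "pi * d K \<le> pi * d (Suc K)" using mono[of K] step by (simp add: d_def)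
      have "d (Suc K) < 1" using rng[of "Suc K"] step \<theta> by (simp add: d_def)
      thus "pi * d (Suc K) < pi" by simp
    qed
    have "G K - G (Suc K) = Complex 0 ((cot (pi * d (Suc K)) - cot (pi * d K))/2)"
      by (simp add: G_def complex_eq_iff field_simps)
    hence "norm (G K - G (Suc K)) = (cot (pi * d K) - cot (pi * d (Suc K)))/2"
      using cle by (simp add: cmod_def)
    hence "norm ((G K - G (Suc K)) * e (Suc K)) = (cot (pi * d K) - cot (pi * d (Suc K)))/2"
      by (simp add: norm_mult ne)
    hence "norm ((\<Sum>n=A..<Suc (Suc K). e n) - G (Suc K) * e (Suc (Suc K)) + G A * e A)
       \<le> (cot (pi * d A) - cot (pi * d K)) / 2 + (cot (pi * d K) - cot (pi * d (Suc K)))/2"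
      unfolding eq using step by (intro norm_triangle_mono) auto
    thus ?case by (simp add: field_simps)
  qed
  obtain K where K: "B = Suc K" using AB by (cases B) auto
  have KA: "A \<le> K" using AB K by simp
  define X where "X = (\<Sum>n=A..<Suc K. e n) - G K * e (Suc K) + G A * e A"
  have "(\<Sum>n=A..B. e n) = (\<Sum>n=A..<Suc K. e n) + e (Suc K)"
    using K KA by (simp add: atLeastLessThanSuc_atLeastAtMost)
  also have "\<dots> = X + (1 + G K) * e (Suc K) - G A * e A" by (simp add: X_def algebra_simps)
  finally have eq: "(\<Sum>n=A..B. e n) = X + (1 + G K) * e (Suc K) - G A * e A" .
  have sA: "sin (pi * d A) \<ge> 2*\<theta>" and sK: "sin (pi * d K) \<ge> 2*\<theta>" using sn[of A] sn[of K] K KA by auto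
  have n1: "norm (G A * e A) \<le> 1/(2 * sin (pi * d A))"
    unfolding norm_mult ne G_def using norm_recip(1)[of "d A"] sA \<theta> by simp
  have n2: "norm ((1 + G K) * e (Suc K)) \<le> 1/(2 * sin (pi * d K))"
    unfolding norm_mult ne G_def using norm_recip(2)[of "d K"] sK \<theta> by simp
  have n3: "norm X \<le> (cot (pi * d A) - cot (pi * d K)) / 2"
    unfolding X_def using step[of K] K KA by simp
  have c1: "cot (pi * d A) \<le> 1 / sin (pi * d A)" unfolding cot_def using sA \<theta> by (intro divide_right_mono) auto
  have c2: "- cot (pi * d K) \<le> 1 / sin (pi * d K)" 
  proof -
    have "- cos (pi * d K) \<le> 1" using cos_ge_minus_one[of "pi * d K"] by simp
    hence "(- cos (pi * d K)) / sin (pi * d K) \<le> 1 / sin (pi * d K)" using sK \<theta> by (intro divide_right_mono) auto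
    thus ?thesis by (simp add: cot_def)
  qed
  have i1: "1 / sin (pi * d A) \<le> 1/(2*\<theta>)" using sA \<theta> by (intro divide_left_mono) auto
  have i2: "1 / sin (pi * d K) \<le> 1/(2*\<theta>)" using sK \<theta> by (intro divide_left_mono) auto
  \<comment> \<open>At either end the cotangent and the boundary term each contribute at most 1/(2
    sin); as sin \<ge> 2 \<theta> there, the four contributions add up to 1/\<theta>.\<close>
  have "norm (\<Sum>n=A..B. e n) \<le> norm X + norm ((1 + G K) * e (Suc K)) + norm (G A * e A)"
    unfolding eq by (meson norm_triangle_ineq norm_triangle_ineq4 order_trans add_right_mono)
  also have "\<dots> \<le> (1/\<theta>)" using n1 n2 n3 c1 c2 i1 i2 by (simp add: field_simps)
  finally show ?thesis unfolding e_def .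
qed

lemma kusmin_landau:
  fixes \<phi> :: "nat \<Rightarrow> real" and \<theta> :: real and \<nu> :: int
  assumes AB: "A < B" and \<theta>: "0 < \<theta>"
    and rng: "\<And>n. n \<in> {A..<B} \<Longrightarrow> real_of_int \<nu> + \<theta> \<le> \<phi> (Suc n) - \<phi> n \<and> \<phi> (Suc n) - \<phi> n \<le> real_of_int \<nu> + 1 - \<theta>"
    and mono: "\<And>n. n \<in> {A..<B} \<Longrightarrow> Suc n < B \<Longrightarrow> \<phi> (Suc n) - \<phi> n \<le> \<phi> (Suc (Suc n)) - \<phi> (Suc n)"
  shows "norm (\<Sum>n=A..B. cis (2*pi*\<phi> n)) \<le> 1 / \<theta>"
proof -
  \<comment> \<open>A linear phase of integer slope changes no exponential.\<close>
  define \<psi> where "\<psi> n = \<phi> n - \<nu> * real n" for n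
  have "cis (2*pi*\<psi> n) = cis (2*pi*\<phi> n)" for n
  proof -
    have "cis (2*pi*\<phi> n) = cis (2*pi*\<psi> n) * cis (2*pi* real_of_int (\<nu> * int n))"
      by (simp add: \<psi>_def cis_mult algebra_simps)
    also have "cis (2*pi* real_of_int (\<nu> * int n)) = 1" by (rule cis_multiple_2pi) simp
    finally show ?thesis by simp
  qed
  moreover have "norm (\<Sum>n=A..B. cis (2*pi*\<psi> n)) \<le> 1 / \<theta>"
  proof (rule kusmin_landau0[OF AB \<theta>])
    fix n assume n: "n \<in> {A..<B}"
    show "\<theta> \<le> \<psi> (Suc n) - \<psi> n \<and> \<psi> (Suc n) - \<psi> n \<le> 1 - \<theta>"
      using rng[OF n] by (simp add: \<psi>_def algebra_simps)
    show "\<psi> (Suc n) - \<psi> n \<le> \<psi> (Suc (Suc n)) - \<psi> (Suc n)" if "Suc n < B"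
      using mono[OF n that] by (simp add: \<psi>_def algebra_simps)
  qed
  ultimately show ?thesis by simp
qed

text \<open>Discrete form of van der Corput's second derivative test. Increments within q of an
  integer are few, because they grow by \<mu> at each step; the increments between two such
  neighbourhoods belong to a run of consecutive indices, to which Kusmin-Landau applies.\<close>

lemma second_difference_test:
  fixes \<phi> :: "nat \<Rightarrow> real" and \<mu> D :: real
  assumes \<mu>: "0 < \<mu>" "\<mu> \<le> 1" and D: "D \<ge> 0"
    and rng: "\<And>n. n \<in> {A..<B} \<Longrightarrow> - D \<le> \<phi> (Suc n) - \<phi> n \<and> \<phi> (Suc n) - \<phi> n \<le> 0"
    and gap: "\<And>n. n \<in> {A..<B} \<Longrightarrow> Suc n < B \<Longrightarrow> \<phi> (Suc n) - \<phi> n + \<mu> \<le> \<phi> (Suc (Suc n)) - \<phi> (Suc n)"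
  shows "norm (\<Sum>n=A..B. cis (2*pi*\<phi> n)) \<le> (D + 2) * ((22/5) / sqrt \<mu>)"
proof -
  define d where "d n = \<phi> (Suc n) - \<phi> n" for n
  define e where "e n = cis (2*pi*\<phi> n)" for n
  have ne: "norm (e n) = 1" for n by (simp add: e_def)
  \<comment> \<open>This choice equates the two costs per integer, 2q/\<mu> for the near increments
    and 1/q for the far ones.\<close>
  define q where "q = sqrt (\<mu>/2)"
  have q: "0 < q" "q < 1" using \<mu> unfolding q_def by (auto simp: real_sqrt_lt_1_iff)
  have qq: "q * q = \<mu>/2" unfolding q_def using \<mu> by simp
  have dgap: "d n + \<mu> * real (m - n) \<le> d m" if "n \<le> m" "A \<le> n" "m < B" for n m
    using that
  proof (induction m rule: dec_induct)
    case base show ?case by simp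
  next
    case (step m)
    have "d m + \<mu> \<le> d (Suc m)" using gap[of m] step by (simp add: d_def)
    moreover have "d n + \<mu> * real (m - n) \<le> d m" using step by simp
    ultimately show ?case using step(1) by (simp add: Suc_diff_le algebra_simps)
  qed
  have dmono: "d n \<le> d m" if "n \<le> m" "A \<le> n" "m < B" for n m
    using dgap[OF that] \<mu> by (smt (verit) mult_nonneg_nonneg of_nat_0_le_iff)
  \<comment> \<open>The shift by q puts the increments near \<nu> and those between \<nu> + q and
    \<nu> + 1 - q into one class; at most D + 2 classes are inhabited.\<close>
  define fl where "fl n = \<lfloor>d n + q\<rfloor>" for n
  define S where "S = {A..<B}"
  have flr: "fl n \<in> {-\<lfloor>D\<rfloor>-1..0}" if "n \<in> S" for n
  proof -
    have "- D \<le> d n" "d n \<le> 0" using rng[of n] that by (auto simp: d_def S_def)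
    moreover have "D < \<lfloor>D\<rfloor> + 1" by linarith
    ultimately have "- real_of_int \<lfloor>D\<rfloor> - 1 \<le> d n + q" "d n + q < 1" using q by linarith+
    hence "real_of_int (-\<lfloor>D\<rfloor>-1) \<le> d n + q" "d n + q < 1" by simp_all
    thus ?thesis unfolding fl_def by (simp add: le_floor_iff floor_less_iff)
  qed
  have piece: "norm (\<Sum>n\<in>{n\<in>S. fl n = \<nu>}. e n) \<le> 2*q/\<mu> + 1 + 1/q" for \<nu>
  proof -
    define Nr where "Nr = {n\<in>S. fl n = \<nu> \<and> d n < \<nu> + q}"
    define Fr where "Fr = {n\<in>S. fl n = \<nu> \<and> \<not> d n < \<nu> + q}"
    have fin: "finite Nr" "finite Fr" unfolding Nr_def Fr_def S_def by auto
    have un: "{n\<in>S. fl n = \<nu>} = Nr \<union> Fr" "Nr \<inter> Fr = {}" unfolding Nr_def Fr_def by auto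
    have "norm (\<Sum>n\<in>Nr. e n) \<le> real (card Nr)"
      using norm_sum[of e Nr] by (simp add: ne)
    also have "\<dots> \<le> 2*q/\<mu> + 1"
    proof (cases "Nr = {}")
      case True thus ?thesis using q \<mu> by simp
    next
      case False
      define l where "l = Min Nr"
      define u where "u = Max Nr"
      have lu: "l \<in> Nr" "u \<in> Nr" "l \<le> u" using False fin by (auto simp: l_def u_def)
      have "d l \<ge> \<nu> - q" using lu(1) unfolding Nr_def fl_def by (auto simp: floor_eq_iff)
      moreover have "d u < \<nu> + q" using lu(2) unfolding Nr_def by auto
      moreover have "d l + \<mu> * real (u - l) \<le> d u" using lu by (intro dgap) (auto simp: Nr_def S_def)
      ultimately have "\<mu> * real (u - l) \<le> 2 * q" by simp
      hence *: "real (u - l) \<le> 2*q/\<mu>" using \<mu> by (simp add: field_simps)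
      have "Nr \<subseteq> {l..u}" using fin by (auto simp: l_def u_def)
      hence "card Nr \<le> card {l..u}" by (intro card_mono) auto
      hence "real (card Nr) \<le> real (u - l) + 1" using lu(3) by (simp add: Suc_diff_le)
      thus ?thesis using * by simp
    qed
    finally have 1: "norm (\<Sum>n\<in>Nr. e n) \<le> 2*q/\<mu> + 1" .
    have 2: "norm (\<Sum>n\<in>Fr. e n) \<le> 1/q"
    proof (cases "Fr = {}")
      case True thus ?thesis using q by simp
    next
      case False
      define l where "l = Min Fr"
      define u where "u = Max Fr"
      have lu: "l \<in> Fr" "u \<in> Fr" "l \<le> u" using False fin by (auto simp: l_def u_def)
      have FrD: "\<nu> + q \<le> d n \<and> d n < \<nu> + 1 - q" if "n \<in> Fr" for n
        using that unfolding Fr_def fl_def by (auto simp: floor_eq_iff)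
      have inS: "n \<in> S" if "n \<in> {l..u}" for n using lu that by (auto simp: Fr_def S_def)
      have all: "\<nu> + q \<le> d n \<and> d n < \<nu> + 1 - q" if "n \<in> {l..u}" for n
      proof -
        have "d l \<le> d n" "d n \<le> d u" using that lu by (auto intro!: dmono simp: Fr_def S_def)
        thus ?thesis using FrD[OF lu(1)] FrD[OF lu(2)] by linarith
      qed
      have "Fr = {l..u}"
      proof
        show "Fr \<subseteq> {l..u}" using fin by (auto simp: l_def u_def)
        show "{l..u} \<subseteq> Fr"
        proof
          fix n assume n: "n \<in> {l..u}"
          show "n \<in> Fr" unfolding Fr_def fl_def using all[OF n] inS[OF n] q
            by (auto simp: floor_eq_iff) 
        qed
      qed
      show ?thesis
      proof (cases "l = u")
        case True
        thus ?thesis using \<open>Fr = {l..u}\<close> ne q by (simp add: field_simps)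
      next
        case False
        have "norm (\<Sum>n=l..u. e n) \<le> 1/q" unfolding e_def
        proof (rule kusmin_landau[where \<nu> = \<nu>])
          show "l < u" using False lu by simp
          show "0 < q" by (rule q)
          show "real_of_int \<nu> + q \<le> \<phi> (Suc n) - \<phi> n \<and> \<phi> (Suc n) - \<phi> n \<le> real_of_int \<nu> + 1 - q"
            if "n \<in> {l..<u}" for n using all[of n] that by (auto simp: d_def)
          show "\<phi> (Suc n) - \<phi> n \<le> \<phi> (Suc (Suc n)) - \<phi> (Suc n)" if "n \<in> {l..<u}" "Suc n < u" for n
            using dmono[of n "Suc n"] inS[of n] inS[of "Suc n"] that by (simp add: d_def S_def)
        qed
        thus ?thesis using \<open>Fr = {l..u}\<close> by simp
      qed
    qed
    have "(\<Sum>n\<in>{n\<in>S. fl n = \<nu>}. e n) = (\<Sum>n\<in>Nr. e n) + (\<Sum>n\<in>Fr. e n)"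
      unfolding un by (rule sum.union_disjoint) (use fin un in auto)
    thus ?thesis using 1 2 norm_triangle_ineq[of "\<Sum>n\<in>Nr. e n" "\<Sum>n\<in>Fr. e n"] by simp
  qed
  have pq: "2*q/\<mu> + 1 + 1/q \<ge> 0" using q \<mu> by simp
  have "(\<Sum>n\<in>S. e n) = (\<Sum>\<nu>\<in>{-\<lfloor>D\<rfloor>-1..0}. \<Sum>n\<in>{n\<in>S. fl n = \<nu>}. e n)"
    by (rule sum.group[symmetric]) (use flr in \<open>auto simp: S_def\<close>)
  hence "norm (\<Sum>n\<in>S. e n) \<le> (\<Sum>\<nu>\<in>{-\<lfloor>D\<rfloor>-1..0}. 2*q/\<mu> + 1 + 1/q)"
    using piece by (metis (no_types, lifting) norm_sum order_trans sum_mono)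
  also have "\<dots> = real (nat (\<lfloor>D\<rfloor> + 2)) * (2*q/\<mu> + 1 + 1/q)" by (simp add: add.commute)
  also have "\<dots> \<le> (D + 2) * (2*q/\<mu> + 1 + 1/q)"
    using D pq by (intro mult_right_mono) auto
  finally have main: "norm (\<Sum>n\<in>S. e n) \<le> (D + 2) * (2*q/\<mu> + 1 + 1/q)" .
  define r where "r = 1 / sqrt \<mu>"
  have r1: "1 \<le> r" unfolding r_def using \<mu> by simp
  have "q = sqrt \<mu> / sqrt 2" unfolding q_def by (simp add: real_sqrt_divide)
  hence q1: "1/q = sqrt 2 * r" by (simp add: r_def)
  have "2*q*q = \<mu>" using qq by linarith
  hence "2*q/\<mu> = 1/q" using q \<mu> by (auto simp: eq_divide_eq)
  hence q2: "2*q/\<mu> = sqrt 2 * r" using q1 by simp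
  have "sqrt 2 < (283/200)" by (rule real_less_lsqrt) (auto simp: power2_eq_square)
  hence "sqrt 2 * r \<le> (283/200) * r" using r1 by (intro mult_right_mono) auto
  hence b: "2*q/\<mu> + 1 + 1/q \<le> (77/20) * r" unfolding q1 q2 using r1 by linarith
  \<comment> \<open>\<open>S\<close> indexes increments, so the last term is missing from it. Its
    modulus 1 is at most (D + 2) r / 2, and 77/20 + 1/2 < 22/5.\<close>
  have "norm (\<Sum>n=A..B. e n) \<le> norm (\<Sum>n\<in>S. e n) + 1"
  proof (cases "A \<le> B")
    case True
    hence "(\<Sum>n=A..B. e n) = (\<Sum>n\<in>S. e n) + e B" unfolding S_def
      by (simp flip: atLeastLessThanSuc_atLeastAtMost)
    thus ?thesis using norm_triangle_ineq[of "\<Sum>n\<in>S. e n" "e B"] ne by simp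
  next
    case False thus ?thesis by simp
  qed
  also have "\<dots> \<le> (D+2) * ((77/20) * r) + (D + 2) * ((1/2) * r)"
  proof -
    have "(D + 2) * (2*q/\<mu> + 1 + 1/q) \<le> (D+2) * ((77/20) * r)" using b D by (intro mult_left_mono) auto
    moreover have "(D+2) * ((1/2) * r) \<ge> 2 * ((1/2) * 1)"
      using r1 D by (intro mult_mono) auto
    ultimately show ?thesis using main by linarith
  qed
  also have "\<dots> \<le> 22/5 * ((D+2) * r)"
  proof -
    have "(D+2) * ((77/20) * r) = 77/20 * ((D+2) * r)" "(D+2) * ((1/2) * r) = 1/2 * ((D+2) * r)"
      by (rule mult.left_commute)+
    moreover have "0 \<le> (D+2) * r" using D r1 by (intro mult_nonneg_nonneg) linarith+
    ultimately show ?thesis by linarith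
  qed
  also have "\<dots> = (D + 2) * ((22/5) / sqrt \<mu>)" unfolding r_def by simp
  finally show ?thesis unfolding e_def .
qed

section \<open>Poisson summation through powers of the cosine\<close>

text \<open>The de la Vallee Poussin kernel: nonnegative, of period 1 and mean 1, concentrated at
  the integers, and a trigonometric polynomial. Integration against it is at once an approximate sum
  over the integers and a finite combination of Fourier integrals, which is all that Poisson
  summation needs.\<close>

definition vk :: "nat \<Rightarrow> real \<Rightarrow> real" where
  "vk N v = 4 ^ N / real (2 * N choose N) * cos (pi * v) ^ (2 * N)"

text \<open>The Fourier coefficients of \<open>vk N\<close>, equal to 1 at j = 0.\<close>

definition qc :: "nat \<Rightarrow> int \<Rightarrow> real" where
  "qc N j = (if \<bar>j\<bar> \<le> int N then real (2 * N choose nat (int N + j)) / real (2 * N choose N) else 0)"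

lemma vk_nonneg: "vk N v \<ge> 0"
  unfolding vk_def by (simp add: zero_le_even_power)

lemma vk_expand: "complex_of_real (vk N v) = (\<Sum>j=-int N..int N. of_real (qc N j) * cis (2 * pi * (real_of_int j * v)))"
proof -
  have "of_real (2 * cos (pi * v)) = cis (pi * v) + cis (- (pi * v))"
    by (simp add: complex_eq_iff)
  hence "of_real ((2 * cos (pi * v)) ^ (2 * N)) = (cis (pi * v) + cis (- (pi * v))) ^ (2 * N)"
    by (simp only: of_real_power)
  also have "\<dots> = (\<Sum>k\<le>2*N. of_nat (2*N choose k) * cis (pi * v) ^ k * cis (- (pi * v)) ^ (2*N - k))"
    by (rule binomial_ring)
  also have "\<dots> = (\<Sum>k\<le>2*N. of_nat (2*N choose k) * cis (2 * pi * ((real k - real N) * v)))"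
  proof (intro sum.cong refl)
    fix k assume "k \<in> {..2*N}"
    hence "cis (pi * v) ^ k * cis (- (pi * v)) ^ (2*N - k) = cis (2 * pi * ((real k - real N) * v))"
    proof -
      have "cis (pi * v) ^ k * cis (- (pi * v)) ^ (2*N - k) = cis (real k * (pi * v) + real (2*N - k) * - (pi * v))"
        by (simp only: Complex.DeMoivre cis_mult)
      also have "real k * (pi * v) + real (2*N - k) * - (pi * v) = 2 * pi * ((real k - real N) * v)"
        using \<open>k \<in> {..2*N}\<close> by (simp add: of_nat_diff algebra_simps)
      finally show ?thesis .
    qed
    thus "of_nat (2*N choose k) * cis (pi * v) ^ k * cis (- (pi * v)) ^ (2*N - k) = of_nat (2*N choose k) * cis (2 * pi * ((real k - real N) * v))"
      by (simp add: mult.assoc)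
  qed
  also have "\<dots> = (\<Sum>j=-int N..int N. of_nat (2*N choose nat (int N + j)) * cis (2 * pi * (real_of_int j * v)))"
    by (rule sum.reindex_bij_witness[of _ "\<lambda>j. nat (int N + j)" "\<lambda>k. int k - int N"]) auto
  finally have eq: "of_real ((2 * cos (pi * v)) ^ (2 * N)) = (\<Sum>j=-int N..int N. of_nat (2*N choose nat (int N + j)) * cis (2 * pi * (real_of_int j * v)))" .
  have "vk N v = (2 * cos (pi * v)) ^ (2 * N) / real (2 * N choose N)"
    unfolding vk_def by (simp add: power_mult_distrib power_mult)
  hence "complex_of_real (vk N v) = of_real ((2 * cos (pi * v)) ^ (2 * N)) / of_nat (2 * N choose N)" by simp
  also have "\<dots> = (\<Sum>j=-int N..int N. of_real (qc N j) * cis (2 * pi * (real_of_int j * v)))"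
    unfolding eq sum_divide_distrib by (intro sum.cong) (auto simp: qc_def)
  finally show ?thesis .
qed

lemma vk_expand3:
  "vk N x * vk N y * vk N z = (\<Sum>(j,k,l)\<in>{-int N..int N} \<times> {-int N..int N} \<times> {-int N..int N}.
     qc N j * qc N k * qc N l * cos (2 * pi * (real_of_int j * x + real_of_int k * y + real_of_int l * z)))"
proof -
  define J where "J = {-int N..int N}"
  have "complex_of_real (vk N x * vk N y * vk N z) =
     (\<Sum>j\<in>J. of_real (qc N j) * cis (2 * pi * (real_of_int j * x))) * ((\<Sum>k\<in>J. of_real (qc N k) * cis (2 * pi * (real_of_int k * y))) * (\<Sum>l\<in>J. of_real (qc N l) * cis (2 * pi * (real_of_int l * z))))"
    unfolding J_def by (simp add: vk_expand)
  also have "\<dots> = (\<Sum>(j,k,l)\<in>J \<times> J \<times> J. of_real (qc N j * qc N k * qc N l) * cis (2 * pi * (real_of_int j * x + real_of_int k * y + real_of_int l * z)))"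
  proof -
    have "(\<Sum>(j,k,l)\<in>J \<times> J \<times> J. g j k l) = (\<Sum>j\<in>J. \<Sum>k\<in>J. \<Sum>l\<in>J. g j k l)" for g :: "int \<Rightarrow> int \<Rightarrow> int \<Rightarrow> complex"
      by (simp add: sum.cartesian_product)
    moreover have "cis (2 * pi * (real_of_int j * x + real_of_int k * y + real_of_int l * z)) = cis (2 * pi * (real_of_int j * x)) * (cis (2 * pi * (real_of_int k * y)) * cis (2 * pi * (real_of_int l * z)))" for j k l
      by (simp add: cis_mult algebra_simps)
    moreover have "(\<Sum>j\<in>J. f j) * ((\<Sum>k\<in>J. g k) * (\<Sum>l\<in>J. h l)) = (\<Sum>j\<in>J. \<Sum>k\<in>J. \<Sum>l\<in>J. f j * (g k * h l))" for f g h :: "int \<Rightarrow> complex"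
      unfolding sum_product by (simp only: sum_distrib_left sum_distrib_right)
    ultimately show ?thesis by (simp only: of_real_mult mult_ac)
  qed
  finally have "Re (complex_of_real (vk N x * vk N y * vk N z)) = (\<Sum>(j,k,l)\<in>J \<times> J \<times> J. qc N j * qc N k * qc N l * cos (2 * pi * (real_of_int j * x + real_of_int k * y + real_of_int l * z)))"
    by (simp add: case_prod_unfold)
  thus ?thesis unfolding J_def by simp
qed

lemma integral_cis_period:
  fixes j :: int
  assumes "j \<noteq> 0"
  shows "((\<lambda>v. cos (2 * pi * (real_of_int j * v))) has_integral 0) {-1/2..1/2}"
proof -
  have "((\<lambda>v. cos (2 * pi * (real_of_int j * v))) has_integral
     sin (2 * pi * (real_of_int j * (1/2))) / (2 * pi * j) - sin (2 * pi * (real_of_int j * (-1/2))) / (2 * pi * j)) {-1/2..1/2}"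
    by (rule fundamental_theorem_of_calculus)
       (use assms in \<open>auto intro!: derivative_eq_intros simp: has_real_derivative_iff_has_vector_derivative[symmetric]\<close>)
  moreover have "sin (pi * real_of_int j) = 0" by (simp add: sin_zero_iff_int2 mult.commute)
  ultimately show ?thesis by (simp add: mult.commute mult.left_commute)
qed

lemma vk_has_integral: "(vk N has_integral 1) {-1/2..1/2}"
proof -
  have "vk N v = (\<Sum>j=-int N..int N. qc N j * cos (2 * pi * (real_of_int j * v)))" for v
    using arg_cong[OF vk_expand[of N v], of Re] by simp
  moreover have "((\<lambda>v. \<Sum>j=-int N..int N. qc N j * cos (2 * pi * (real_of_int j * v))) has_integral
      (\<Sum>j=-int N..int N. qc N j * (if j = 0 then 1 else 0))) {-1/2..1/2}"
  proof (intro has_integral_sum has_integral_mult_right)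
    fix j :: int
    show "((\<lambda>v. cos (2 * pi * (real_of_int j * v))) has_integral (if j = 0 then 1 else 0)) {- 1 / 2..1 / 2}"
      using integral_cis_period[of j] has_integral_const_real[of "1::real" "-1/2" "1/2"] by auto
  qed auto
  moreover have "(\<Sum>j=-int N..int N. qc N j * (if j = 0 then 1 else 0)) = 1"
  proof -
    have "(\<Sum>j=-int N..int N. qc N j * (if j = 0 then 1 else 0)) = (\<Sum>j=-int N..int N. if j = 0 then qc N 0 else 0)"
      by (intro sum.cong) auto
    also have "\<dots> = qc N 0" by simp
    finally show ?thesis by (simp add: qc_def)
  qed
  ultimately show ?thesis by (metis (no_types, lifting) ext)
qed

text \<open>Writing sin^2 as 1 - cos^2 turns the integrand into \<open>vk N\<close> minus a multiple
  of \<open>vk (Suc N)\<close>, so the moment is 1 minus a ratio of normalising constants. It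
  measures how sharply the kernel concentrates at the integers.\<close>

lemma vk_sin_has_integral: "((\<lambda>v. (sin (pi * v))\<^sup>2 * vk N v) has_integral 1 / (2 * real N + 2)) {-1/2..1/2}"
proof -
  define c where "c N = 4 ^ N / real (2 * N choose N)" for N
  have c0: "c N > 0" for N by (simp add: c_def zero_less_binomial_iff)
  have rat: "c N / c (Suc N) = (2 * real N + 1) / (2 * real N + 2)"
  proof -
    have "real (2 * Suc N choose Suc N) * (real N + 1)^2 = real (2*N choose N) * (2 * real N + 2) * (2 * real N + 1)"
    proof -
      have f1: "real (2 * N choose N) = fact (2*N) / (fact N * fact N)"
        by (subst binomial_fact) auto
      have f2: "real (2 * Suc N choose Suc N) = fact (2*N+2) / (fact (Suc N) * fact (Suc N))"
        by (subst binomial_fact) auto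
      have f3: "(fact (2*N+2) :: real) = (2 * real N + 2) * ((2 * real N + 1) * fact (2*N))" by (simp add: algebra_simps)
      have f4: "(fact (Suc N) :: real) = (real N + 1) * fact N" by simp
      have *: "x * (y * F) / ((n * f) * (n * f)) * n^2 = F / (f * f) * x * y" if "n \<noteq> 0" "f \<noteq> 0" for x y F n f :: real
        using that by (simp add: power2_eq_square)
      show ?thesis unfolding f1 f2 f3 f4 by (rule *) (auto simp: add_eq_0_iff)
    qed
    note A = this
    have B: "x / y / (4 * x / z) = q / p" if "z * n^2 = y * p * q" "p = 2 * n" "y > 0" "x > 0" "z > 0" "n > 0" for x y z n p q :: real
      using that by (simp add: field_simps power2_eq_square)
    have "4 ^ N / real (2 * N choose N) / (4 * 4 ^ N / real (2 * Suc N choose Suc N)) = (2 * real N + 1) / (2 * real N + 2)"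
      by (rule B[OF A]) (simp_all add: zero_less_binomial_iff del: binomial_Suc_Suc)
    thus ?thesis unfolding c_def power_Suc .
  qed
  have "(sin (pi * v))\<^sup>2 * vk N v = vk N v - (c N / c (Suc N)) * vk (Suc N) v" for v
  proof -
    have "vk (Suc N) v = c (Suc N) * (cos (pi * v) ^ (2*N) * (cos (pi * v))\<^sup>2)"
      unfolding vk_def c_def by (simp add: power2_eq_square mult_ac)
    moreover have "vk N v = c N * cos (pi * v) ^ (2*N)" by (simp add: vk_def c_def)
    ultimately have "vk N v - (c N / c (Suc N)) * vk (Suc N) v = c N * cos (pi * v) ^ (2*N) * (1 - (cos (pi * v))\<^sup>2)"
      using c0[of "Suc N"] by (simp add: algebra_simps)
    thus ?thesis by (simp add: sin_squared_eq vk_def c_def)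
  qed
  moreover have "((\<lambda>v. vk N v - (c N / c (Suc N)) * vk (Suc N) v) has_integral (1 - (c N / c (Suc N)) * 1)) {-1/2..1/2}"
    by (intro has_integral_diff has_integral_mult_right vk_has_integral)
  moreover have "1 - (c N / c (Suc N)) * 1 = 1 / (2 * real N + 2)" unfolding rat by (simp add: field_simps)
  ultimately show ?thesis by simp
qed

lemma qc_bounds: "0 \<le> qc N j" "qc N j \<le> 1"
proof -
  show "0 \<le> qc N j" by (simp add: qc_def)
  have "2 * N choose nat (int N + j) \<le> 2 * N choose N"
    using binomial_maximum[of "2*N" "nat (int N + j)"] by simp
  thus "qc N j \<le> 1" by (simp add: qc_def divide_le_eq zero_less_binomial_iff)
qed

text \<open>Consecutive coefficients have ratio (N - k)/(N + k + 1), which tends to 1 for fixed k;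
  negative indices follow from the symmetry of the binomial coefficients.\<close>

lemma qc_tendsto: "(\<lambda>N. qc N j) \<longlonglongrightarrow> 1"
proof -
  have nat: "(\<lambda>N. real (2 * N choose (N + k)) / real (2 * N choose N)) \<longlonglongrightarrow> 1" for k
  proof (induction k)
    case 0
    show ?case by (simp add: zero_less_binomial_iff)
  next
    case (Suc k)
    have "eventually (\<lambda>N. real (2 * N choose (N + k)) / real (2 * N choose N) * ((real N - real k) / (real N + real k + 1)) = real (2 * N choose (N + Suc k)) / real (2 * N choose N)) sequentially"
    proof (rule eventually_sequentiallyI[of k])
      fix N assume N: "k \<le> N"
      have "Suc (N + k) * (2 * N choose Suc (N + k)) = (2 * N - (N + k)) * (2 * N choose (N + k))"
        using binomial_absorption[of "N+k" "2*N"] binomial_absorb_comp[of "2*N" "N+k"] by simp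
      hence "real (Suc (N + k)) * real (2 * N choose Suc (N + k)) = real (N - k) * real (2 * N choose (N + k))"
        by (metis add_diff_cancel_left mult_2 of_nat_mult)
      hence *: "(real N + real k + 1) * real (2 * N choose (N + Suc k)) = (real N - real k) * real (2 * N choose (N + k))"
        using N by (simp add: of_nat_diff add_ac)
      have "c / b * (p / q) = c' / b" if "q * c' = p * c" "q > 0" for b c c' p q :: real
      proof -
        have "c / b * (p / q) = (c' * q) / (b * q)" using that by (simp add: mult.commute)
        thus ?thesis using that(2) by simp
      qed
      from this[OF *] show "real (2 * N choose (N + k)) / real (2 * N choose N) * ((real N - real k) / (real N + real k + 1)) = real (2 * N choose (N + Suc k)) / real (2 * N choose N)"
        by simp
    qed
    note ev = this
    have "(\<lambda>N. (real N - real k) / (real N + real k + 1)) \<longlonglongrightarrow> 1" by real_asymp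
    from Lim_transform_eventually[OF tendsto_mult[OF Suc this] ev] show ?case by simp
  qed
  show ?thesis
  proof (cases "j \<ge> 0")
    case True
    have "eventually (\<lambda>N. real (2 * N choose (N + nat j)) / real (2 * N choose N) = qc N j) sequentially"
      by (rule eventually_sequentiallyI[of "nat j"]) (use True in \<open>auto simp: qc_def nat_add_distrib\<close>)
    thus ?thesis using nat[of "nat j"] by (rule Lim_transform_eventually[rotated])
  next
    case False
    have "eventually (\<lambda>N. real (2 * N choose (N + nat (-j))) / real (2 * N choose N) = qc N j) sequentially"
    proof (rule eventually_sequentiallyI[of "nat (-j)"])
      fix N assume N: "nat (-j) \<le> N"
      have "2 * N choose (N + nat (-j)) = 2 * N choose (2 * N - (N + nat (-j)))"
        using N by (intro binomial_symmetric) auto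
      also have "2 * N - (N + nat (-j)) = nat (int N + j)" using N False by auto
      finally show "real (2 * N choose (N + nat (-j))) / real (2 * N choose N) = qc N j"
        using N False by (simp add: qc_def)
    qed
    thus ?thesis using nat[of "nat (-j)"] by (rule Lim_transform_eventually[rotated])
  qed
qed

lemma vk_periodic: "vk N (v + real_of_int n) = vk N v"
proof -
  have s: "sin (pi * real_of_int n) = 0" by (simp add: sin_zero_iff_int2 mult.commute)
  have "(cos (pi * real_of_int n))\<^sup>2 = 1" using sin_cos_squared_add2[of "pi * real_of_int n"] s by simp
  hence c: "cos (pi * real_of_int n) ^ (2 * N) = 1" by (simp add: power_mult)
  have "cos (pi * (v + real_of_int n)) = cos (pi * v) * cos (pi * real_of_int n)"
    by (simp add: distrib_left cos_add s)
  thus ?thesis unfolding vk_def by (simp add: power_mult_distrib c)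
qed

lemma vk_continuous: "continuous_on S (vk N)"
  unfolding vk_def by (intro continuous_intros)

section \<open>Lipschitz functions of bounded support against the kernel, one variable\<close>

definition lip1 :: "real \<Rightarrow> real \<Rightarrow> (real \<Rightarrow> real) \<Rightarrow> bool" where
  "lip1 R \<Lambda> f \<longleftrightarrow> (\<forall>x y. \<bar>f x - f y\<bar> \<le> \<Lambda> * \<bar>x - y\<bar>) \<and> (\<forall>x. \<bar>x\<bar> > R \<longrightarrow> f x = 0)"

lemma lip1_continuous:
  assumes "lip1 R \<Lambda> f" shows "continuous_on S f"
proof -
  have "\<Lambda> \<ge> 0" using assms abs_ge_zero[of "f 1 - f 0"] unfolding lip1_def
    by (metis abs_1 diff_zero mult.right_neutral order_trans)
  hence "\<Lambda>-lipschitz_on UNIV f" using assms by (auto simp: lip1_def lipschitz_on_def dist_real_def)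
  thus ?thesis using lipschitz_on_continuous_on continuous_on_subset by blast
qed

lemma supp_integral:
  fixes f :: "real \<Rightarrow> real"
  assumes c: "continuous_on {-R..R} f" and s: "\<And>x. \<bar>x\<bar> > R \<Longrightarrow> f x = 0"
  shows "integrable lborel f" "(LBINT x. f x) = integral {-R..R} f"
proof -
  have eq: "(\<lambda>x. indicator {-R..R} x *\<^sub>R f x) = f" using s by (force simp: indicator_def)
  have si: "set_integrable lborel {-R..R} f" by (rule borel_integrable_atLeastAtMost') (rule c)
  thus "integrable lborel f" unfolding set_integrable_def eq .
  show "(LBINT x. f x) = integral {-R..R} f"
    using set_borel_integral_eq_integral(2)[OF si] unfolding set_lebesgue_integral_def eq .
qed

lemma lip1_mult_integrable:
  assumes "lip1 R \<Lambda> f" "continuous_on UNIV g"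
  shows "integrable lborel (\<lambda>x. g x * f x)"
  by (rule supp_integral(1)[of R])
     (use assms lip1_continuous[OF assms(1)] in \<open>auto intro!: continuous_intros simp: lip1_def intro: continuous_on_subset\<close>)

lemma lip1_integrable: "lip1 R \<Lambda> f \<Longrightarrow> integrable lborel f"
  using lip1_mult_integrable[of R \<Lambda> f "\<lambda>_. 1"] by simp

lemma lip1_integral_bound:
  assumes l: "lip1 R \<Lambda> f" and R: "R \<ge> 0" and S: "\<And>x. \<bar>f x\<bar> \<le> S"
  shows "\<bar>LBINT x. f x\<bar> \<le> 2 * R * S"
proof -
  have "(LBINT x. f x) = integral {-R..R} f" by (rule supp_integral(2)) (use l lip1_continuous in \<open>auto simp: lip1_def\<close>)
  moreover have "norm (integral {-R..R} f) \<le> S * (R - (- R))"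
    by (rule integral_bound) (use R S lip1_continuous[OF l] in auto)
  ultimately show ?thesis by (simp add: algebra_simps)
qed

lemma integral_unit_split:
  fixes f :: "real \<Rightarrow> real"
  assumes c: "continuous_on UNIV f"
  shows "integral {-(real R + 1/2)..real R + 1/2} f = (\<Sum>n=-int R..int R. integral {-1/2..1/2} (\<lambda>v. f (v + real_of_int n)))"
proof -
  have io: "f integrable_on {a..b}" for a b by (rule integrable_continuous_interval) (rule continuous_on_subset[OF c], simp)
  have sh: "integral {-1/2..1/2} (\<lambda>v. f (v + real_of_int n)) = integral {real_of_int n - 1/2..real_of_int n + 1/2} f" for n
    using integral_shift[of "-1/2" "real_of_int n" "1/2" f] continuous_on_subset[OF c]
    by (simp add: o_def add.commute)
  show ?thesis unfolding sh
  proof (induction R)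
    case 0 show ?case by simp
  next
    case (Suc R)
    have set: "{-int (Suc R)..int (Suc R)} = insert (int (Suc R)) (insert (- int (Suc R)) {-int R..int R})" by auto
    have "integral {-(real (Suc R) + 1/2)..real (Suc R) + 1/2} f
        = integral {-(real (Suc R) + 1/2)..-(real R + 1/2)} f + integral {-(real R + 1/2)..real (Suc R) + 1/2} f"
      by (rule Henstock_Kurzweil_Integration.integral_combine[symmetric]) (auto simp: io)
    also have "integral {-(real R + 1/2)..real (Suc R) + 1/2} f = integral {-(real R + 1/2)..real R + 1/2} f + integral {real R + 1/2..real (Suc R) + 1/2} f"
      by (rule Henstock_Kurzweil_Integration.integral_combine[symmetric]) (auto simp: io)
    finally have eq: "integral {-(real (Suc R) + 1/2)..real (Suc R) + 1/2} f
        = integral {-(real (Suc R) + 1/2)..-(real R + 1/2)} f + (integral {-(real R + 1/2)..real R + 1/2} f + integral {real R + 1/2..real (Suc R) + 1/2} f)" .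
    have a1: "real_of_int (-int (Suc R)) - 1/2 = -(real (Suc R) + 1/2)" "real_of_int (- int (Suc R)) + 1/2 = -(real R + 1/2)"
      "real_of_int (int (Suc R)) - 1/2 = real R + 1/2" "real_of_int (int (Suc R)) + 1/2 = real (Suc R) + 1/2" by simp_all
    have "(\<Sum>n=-int (Suc R)..int (Suc R). integral {real_of_int n - 1/2..real_of_int n + 1/2} f)
       = integral {real_of_int (int (Suc R)) - 1/2..real_of_int (int (Suc R)) + 1/2} f
        + (integral {real_of_int (-int (Suc R)) - 1/2..real_of_int (-int (Suc R)) + 1/2} f + (\<Sum>n=-int R..int R. integral {real_of_int n - 1/2..real_of_int n + 1/2} f))"
      unfolding set by (subst sum.insert, simp, simp, subst sum.insert) simp_all
    thus ?case unfolding eq Suc[symmetric] a1 by linarith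
  qed
qed

text \<open>For |v| \<le> 1/2 one has 2|v| \<le> |sin(pi v)|, and the arithmetic-geometric mean
  inequality gives |v| \<le> e + sin^2(pi v)/(4e). The moment of sin^2 is of order 1/N, so e =
  1/sqrt(N + 1) balances the two parts.\<close>

lemma vk_abs_moment: "integral {-1/2..1/2} (\<lambda>v. \<bar>v\<bar> * vk N v) \<le> 2 / sqrt (real N + 1)"
proof -
  define e where "e = 1 / sqrt (real N + 1)"
  have e0: "e > 0" by (simp add: e_def)
  have e2: "e * e = 1 / (real N + 1)" by (simp add: e_def)
  have "((\<lambda>v. e * vk N v + 1 / (4 * e) * ((sin (pi * v))\<^sup>2 * vk N v)) has_integral (e * 1 + 1 / (4 * e) * (1 / (2 * real N + 2)))) {-1/2..1/2}"
    by (intro has_integral_add has_integral_mult_right vk_has_integral vk_sin_has_integral)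
  hence hi: "integral {-1/2..1/2} (\<lambda>v. e * vk N v + 1 / (4 * e) * ((sin (pi * v))\<^sup>2 * vk N v)) = e * 1 + 1 / (4 * e) * (1 / (2 * real N + 2))"
    by (rule integral_unique)
  have "integral {-1/2..1/2} (\<lambda>v. \<bar>v\<bar> * vk N v) \<le> integral {-1/2..1/2} (\<lambda>v. e * vk N v + 1 / (4 * e) * ((sin (pi * v))\<^sup>2 * vk N v))"
  proof (rule integral_le)
    show "(\<lambda>v. \<bar>v\<bar> * vk N v) integrable_on {- 1 / 2..1 / 2}"
      by (intro integrable_continuous_interval continuous_intros vk_continuous)
    show "(\<lambda>v. e * vk N v + 1 / (4 * e) * ((sin (pi * v))\<^sup>2 * vk N v)) integrable_on {- 1 / 2..1 / 2}"
      by (intro integrable_continuous_interval continuous_intros vk_continuous)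
    fix v :: real assume v: "v \<in> {-1/2..1/2}"
    have "(2 * \<bar>v\<bar>)\<^sup>2 \<le> (sin (pi * v))\<^sup>2"
    proof (cases "v = 0")
      case False
      have "2 * \<bar>v\<bar> \<le> sin (pi * \<bar>v\<bar>)" using v False by (intro sin_pi_ge) auto
      hence "2 * \<bar>v\<bar> \<le> \<bar>sin (pi * v)\<bar>" by (cases "v \<ge> 0") (auto simp: abs_if)
      thus ?thesis using power_mono[of "2 * \<bar>v\<bar>" "\<bar>sin (pi * v)\<bar>" 2] by simp
    qed simp
    hence s: "4 * v\<^sup>2 \<le> (sin (pi * v))\<^sup>2" by (simp add: power_mult_distrib)
    have "0 \<le> (2 * e - 2 * \<bar>v\<bar>)\<^sup>2" by simp
    hence "8 * e * \<bar>v\<bar> \<le> 4 * (e * e) + 4 * v\<^sup>2" by (simp add: power2_eq_square algebra_simps)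
    hence "8 * e * \<bar>v\<bar> \<le> 4 * (e * e) + (sin (pi * v))\<^sup>2" using s by linarith
    hence "4 * e * \<bar>v\<bar> \<le> 4 * e * e + (sin (pi * v))\<^sup>2" using e0 mult_nonneg_nonneg[of e "\<bar>v\<bar>"] by linarith
    hence "\<bar>v\<bar> \<le> e + 1 / (4 * e) * (sin (pi * v))\<^sup>2" using e0 by (simp add: field_simps)
    hence "\<bar>v\<bar> * vk N v \<le> (e + 1 / (4 * e) * (sin (pi * v))\<^sup>2) * vk N v" by (intro mult_right_mono vk_nonneg)
    thus "\<bar>v\<bar> * vk N v \<le> e * vk N v + 1 / (4 * e) * ((sin (pi * v))\<^sup>2 * vk N v)" by (simp add: algebra_simps)
  qed
  also have "\<dots> \<le> 2 * e"
  proof -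
    have "1 / (2 * real N + 2) = e * e / 2" unfolding e2 by (simp add: field_simps)
    hence E: "e * 1 + 1 / (4 * e) * (1 / (2 * real N + 2)) = e + e / 8" using e0 by (simp only:) simp
    show ?thesis unfolding hi E using e0 by linarith
  qed
  finally show ?thesis by (simp add: e_def)
qed

text \<open>The unit cells centred at -R, ..., R cover the support, and periodicity moves the kernel
  back to the central cell.\<close>

lemma vk_integral_split:
  assumes l: "lip1 (real R) \<Lambda> f"
  shows "(LBINT x. vk N x * f x) = (\<Sum>n=-int R..int R. integral {-1/2..1/2} (\<lambda>v. vk N v * f (v + real_of_int n)))"
proof -
  have c: "continuous_on UNIV (\<lambda>x. vk N x * f x)" by (intro continuous_intros vk_continuous lip1_continuous[OF l])
  have "(LBINT x. vk N x * f x) = integral {-(real R + 1/2)..real R + 1/2} (\<lambda>x. vk N x * f x)"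
    by (rule supp_integral(2)) (use l continuous_on_subset[OF c] in \<open>auto simp: lip1_def\<close>)
  also have "\<dots> = (\<Sum>n=-int R..int R. integral {-1/2..1/2} (\<lambda>v. vk N (v + real_of_int n) * f (v + real_of_int n)))"
    by (rule integral_unit_split[OF c])
  finally show ?thesis unfolding vk_periodic .
qed

lemma vk_integral_approx:
  assumes l: "lip1 (real R) \<Lambda> f"
  shows "\<bar>(LBINT x. vk N x * f x) - (\<Sum>n=-int R..int R. f (real_of_int n))\<bar> \<le> (2 * real R + 1) * (\<Lambda> * (2 / sqrt (real N + 1)))"
proof -
  have \<Lambda>: "\<Lambda> \<ge> 0" using l abs_ge_zero[of "f 1 - f 0"] unfolding lip1_def
    by (metis abs_1 diff_zero mult.right_neutral order_trans)
  have cf: "continuous_on S (\<lambda>v. f (v + c))" for S c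
    by (rule continuous_on_compose2[OF lip1_continuous[OF l, of UNIV]]) (auto intro!: continuous_intros)
  have one: "\<bar>integral {-1/2..1/2} (\<lambda>v. vk N v * f (v + real_of_int n)) - f (real_of_int n)\<bar> \<le> \<Lambda> * (2 / sqrt (real N + 1))" for n
  proof -
    have A: "((\<lambda>v. vk N v * f (real_of_int n)) has_integral 1 * f (real_of_int n)) {-1/2..1/2}"
      by (intro has_integral_mult_left vk_has_integral)
    have B: "((\<lambda>v. vk N v * f (v + real_of_int n)) has_integral integral {-1/2..1/2} (\<lambda>v. vk N v * f (v + real_of_int n))) {-1/2..1/2}"
      by (intro integrable_integral integrable_continuous_interval continuous_intros vk_continuous cf)
    have "integral {-1/2..1/2} (\<lambda>v. vk N v * f (v + real_of_int n)) - f (real_of_int n) = integral {-1/2..1/2} (\<lambda>v. vk N v * f (v + real_of_int n) - vk N v * f (real_of_int n))"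
      by (rule integral_unique[OF has_integral_diff[OF B A[unfolded mult_1]], symmetric])
    also have "norm \<dots> \<le> integral {-1/2..1/2} (\<lambda>v. \<Lambda> * (\<bar>v\<bar> * vk N v))"
    proof (rule integral_norm_bound_integral)
      show "(\<lambda>v. vk N v * f (v + real_of_int n) - vk N v * f (real_of_int n)) integrable_on {- 1 / 2..1 / 2}"
        by (intro integrable_continuous_interval continuous_intros vk_continuous cf)
      show "(\<lambda>v. \<Lambda> * (\<bar>v\<bar> * vk N v)) integrable_on {- 1 / 2..1 / 2}"
        by (intro integrable_continuous_interval continuous_intros vk_continuous)
      fix v :: real
      have "\<bar>f (v + real_of_int n) - f (real_of_int n)\<bar> \<le> \<Lambda> * \<bar>v\<bar>" using l unfolding lip1_def by (metis add_diff_cancel_right')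
      hence "vk N v * \<bar>f (v + real_of_int n) - f (real_of_int n)\<bar> \<le> vk N v * (\<Lambda> * \<bar>v\<bar>)" by (intro mult_left_mono vk_nonneg)
      thus "norm (vk N v * f (v + real_of_int n) - vk N v * f (real_of_int n)) \<le> \<Lambda> * (\<bar>v\<bar> * vk N v)"
        by (simp add: abs_mult vk_nonneg mult_ac flip: right_diff_distrib)
    qed
    also have "\<dots> = \<Lambda> * integral {-1/2..1/2} (\<lambda>v. \<bar>v\<bar> * vk N v)" by simp
    also have "\<dots> \<le> \<Lambda> * (2 / sqrt (real N + 1))" by (intro mult_left_mono vk_abs_moment \<Lambda>)
    finally show ?thesis by simp
  qed
  have "\<bar>(LBINT x. vk N x * f x) - (\<Sum>n=-int R..int R. f (real_of_int n))\<bar> = \<bar>\<Sum>n=-int R..int R. integral {-1/2..1/2} (\<lambda>v. vk N v * f (v + real_of_int n)) - f (real_of_int n)\<bar>"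
    unfolding vk_integral_split[OF l] by (simp add: sum_subtractf)
  also have "\<dots> \<le> (\<Sum>n=-int R..int R. \<Lambda> * (2 / sqrt (real N + 1)))"
    by (rule order_trans[OF sum_abs sum_mono]) (rule one)
  also have "\<dots> = (2 * real R + 1) * (\<Lambda> * (2 / sqrt (real N + 1)))" by (simp add: add.commute)
  finally show ?thesis .
qed

text \<open>A nonnegative kernel of mean 1 costs at most the supremum in each cell. The bound is
  uniform in N, which lets the kernel be applied to one variable after another.\<close>

lemma vk_integral_bound:
  assumes l: "lip1 (real R) \<Lambda> f" and S: "\<And>x. \<bar>f x\<bar> \<le> S"
  shows "\<bar>LBINT x. vk N x * f x\<bar> \<le> (2 * real R + 1) * S"
proof -
  have cf: "continuous_on A (\<lambda>v. f (v + c))" for A c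
    by (rule continuous_on_compose2[OF lip1_continuous[OF l, of UNIV]]) (auto intro!: continuous_intros)
  have one: "\<bar>integral {-1/2..1/2} (\<lambda>v. vk N v * f (v + real_of_int n))\<bar> \<le> S" for n
  proof -
    have "norm (integral {-1/2..1/2} (\<lambda>v. vk N v * f (v + real_of_int n))) \<le> integral {-1/2..1/2} (\<lambda>v. vk N v * S)"
    proof (rule integral_norm_bound_integral)
      show "(\<lambda>v. vk N v * f (v + real_of_int n)) integrable_on {- 1 / 2..1 / 2}"
        by (intro integrable_continuous_interval continuous_intros vk_continuous cf)
      show "(\<lambda>v. vk N v * S) integrable_on {- 1 / 2..1 / 2}"
        by (intro integrable_continuous_interval continuous_intros vk_continuous)
      show "norm (vk N v * f (v + real_of_int n)) \<le> vk N v * S" for v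
        using S by (simp add: abs_mult vk_nonneg mult_left_mono)
    qed
    also have "\<dots> = 1 * S" by (rule integral_unique[OF has_integral_mult_left[OF vk_has_integral]])
    finally show ?thesis by simp
  qed
  have "\<bar>LBINT x. vk N x * f x\<bar> \<le> (\<Sum>n=-int R..int R. S)"
    unfolding vk_integral_split[OF l] by (rule order_trans[OF sum_abs sum_mono]) (rule one)
  thus ?thesis by (simp add: algebra_simps)
qed

section \<open>The kernel applied in three variables\<close>

definition lip3 :: "real \<Rightarrow> real \<Rightarrow> (real \<Rightarrow> real \<Rightarrow> real \<Rightarrow> real) \<Rightarrow> bool" where
  "lip3 R \<Lambda> f \<longleftrightarrow> (\<forall>x x' y z. \<bar>f x y z - f x' y z\<bar> \<le> \<Lambda> * \<bar>x - x'\<bar>) \<and> (\<forall>x y y' z. \<bar>f x y z - f x y' z\<bar> \<le> \<Lambda> * \<bar>y - y'\<bar>)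
     \<and> (\<forall>x y z z'. \<bar>f x y z - f x y z'\<bar> \<le> \<Lambda> * \<bar>z - z'\<bar>) \<and> (\<forall>x y z. \<bar>x\<bar> > R \<or> \<bar>y\<bar> > R \<or> \<bar>z\<bar> > R \<longrightarrow> f x y z = 0)"

text \<open>\<open>K\<close> bounds the functional that integrates against w, in the supremum norm.
  Applied to a difference in the parameter y, it transports a Lipschitz condition in y through the
  integral over x. The weight w will be the kernel on one occasion and the constant 1 on
  another.\<close>

lemma lip1_of_functional:
  assumes l: "\<And>y. lip1 R \<Lambda> (\<lambda>x. f x y)" and l': "\<And>x y y'. \<bar>f x y - f x y'\<bar> \<le> \<Lambda>' * \<bar>y - y'\<bar>"
    and s: "\<And>x y. \<bar>y\<bar> > R' \<Longrightarrow> f x y = 0"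
    and w: "continuous_on UNIV w"
    and K: "\<And>g S L. lip1 R L g \<Longrightarrow> (\<And>x. \<bar>g x\<bar> \<le> S) \<Longrightarrow> \<bar>LBINT x. w x * g x\<bar> \<le> K * S"
  shows "lip1 R' (K * \<Lambda>') (\<lambda>y. LBINT x. w x * f x y)"
  unfolding lip1_def
proof (intro conjI allI impI)
  fix y y' :: real
  have d: "lip1 R (2 * \<Lambda>) (\<lambda>x. f x y - f x y')"
    unfolding lip1_def
  proof (intro conjI allI impI)
    fix x x'
    have "\<bar>f x y - f x' y\<bar> \<le> \<Lambda> * \<bar>x - x'\<bar>" "\<bar>f x y' - f x' y'\<bar> \<le> \<Lambda> * \<bar>x - x'\<bar>" using l by (auto simp: lip1_def)
    thus "\<bar>f x y - f x y' - (f x' y - f x' y')\<bar> \<le> 2 * \<Lambda> * \<bar>x - x'\<bar>" by linarith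
  qed (use l in \<open>auto simp: lip1_def\<close>)
  have "(LBINT x. w x * f x y) - (LBINT x. w x * f x y') = (LBINT x. w x * (f x y - f x y'))"
    by (simp add: right_diff_distrib Bochner_Integration.integral_diff lip1_mult_integrable[OF l w])
  also have "\<bar>\<dots>\<bar> \<le> K * (\<Lambda>' * \<bar>y - y'\<bar>)" by (rule K[OF d]) (rule l')
  finally show "\<bar>(LBINT x. w x * f x y) - (LBINT x. w x * f x y')\<bar> \<le> K * \<Lambda>' * \<bar>y - y'\<bar>" by (simp add: mult.assoc)
next
  fix y assume "\<bar>y\<bar> > R'"
  thus "(LBINT x. w x * f x y) = 0" using s by simp
qed

text \<open>The integrals are replaced by sums one at a time, the innermost first. The error made so
  far passes through each outer integral with a factor of at most \<open>K\<close>, so the total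
  error is a constant times 1/sqrt(N + 1).\<close>

lemma vk_triple_tendsto:
  assumes l: "lip3 (real R) \<Lambda> f"
  shows "(\<lambda>N. LBINT z. vk N z * (LBINT y. vk N y * (LBINT x. vk N x * f x y z)))
    \<longlonglongrightarrow> (\<Sum>k=-int R..int R. \<Sum>j=-int R..int R. \<Sum>i=-int R..int R. f i j k)"
proof -
  define K where "K = 2 * real R + 1"
  define \<eta> where "\<eta> N = \<Lambda> * (2 / sqrt (real N + 1))" for N
  have K0: "K \<ge> 0" by (simp add: K_def)
  define I where "I = {-int R..int R}"
  have cI: "real (card I) = K" by (simp add: I_def K_def)
  have L1: "lip1 (real R) \<Lambda> (\<lambda>x. f x y z)" for y z using l by (auto simp: lip3_def lip1_def)
  have wb: "\<bar>LBINT x. vk N x * g x\<bar> \<le> K * S" if "lip1 (real R) L g" "\<And>x. \<bar>g x\<bar> \<le> S" for N g L S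
    unfolding K_def by (rule vk_integral_bound[OF that])
  have sumlip: "lip1 (real R) (K * L) (\<lambda>y. \<Sum>i\<in>I. h (real_of_int i) y)" if "\<And>i. lip1 (real R) L (h i)" for h L
    unfolding lip1_def
  proof (intro conjI allI impI)
    fix x y
    have "\<bar>(\<Sum>i\<in>I. h i x) - (\<Sum>i\<in>I. h i y)\<bar> \<le> (\<Sum>i\<in>I. L * \<bar>x - y\<bar>)"
      unfolding sum_subtractf[symmetric] by (rule order_trans[OF sum_abs sum_mono]) (use that in \<open>auto simp: lip1_def\<close>)
    thus "\<bar>(\<Sum>i\<in>I. h i x) - (\<Sum>i\<in>I. h i y)\<bar> \<le> K * L * \<bar>x - y\<bar>" by (simp add: cI mult.assoc)
  qed (use that in \<open>auto simp: lip1_def\<close>)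
  have bound: "\<bar>(LBINT z. vk N z * (LBINT y. vk N y * (LBINT x. vk N x * f x y z))) - (\<Sum>k\<in>I. \<Sum>j\<in>I. \<Sum>i\<in>I. f i j k)\<bar> \<le> 3 * K^3 * \<eta> N" for N
  proof -
    define g1 where "g1 y z = (LBINT x. vk N x * f x y z)" for y z
    define s1 where "s1 y z = (\<Sum>i\<in>I. f (real_of_int i) y z)" for y z
    define g2 where "g2 z = (LBINT y. vk N y * g1 y z)" for z
    define s2 where "s2 z = (\<Sum>j\<in>I. s1 (real_of_int j) z)" for z
    have g1y: "lip1 (real R) (K * \<Lambda>) (\<lambda>y. g1 y z)" for z unfolding g1_def
      by (rule lip1_of_functional[where R = "real R" and \<Lambda> = \<Lambda>]) (use l L1 wb vk_continuous in \<open>auto simp: lip3_def\<close>)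
    have g1z: "lip1 (real R) (K * \<Lambda>) (\<lambda>z. g1 y z)" for y unfolding g1_def
      by (rule lip1_of_functional[where R = "real R" and \<Lambda> = \<Lambda>]) (use l L1 wb vk_continuous in \<open>auto simp: lip3_def\<close>)
    have s1y: "lip1 (real R) (K * \<Lambda>) (\<lambda>y. s1 y z)" for z unfolding s1_def
      by (rule sumlip) (use l in \<open>auto simp: lip3_def lip1_def\<close>)
    have s1z: "lip1 (real R) (K * \<Lambda>) (\<lambda>z. s1 y z)" for y unfolding s1_def
      by (rule sumlip) (use l in \<open>auto simp: lip3_def lip1_def\<close>)
    have g2z: "lip1 (real R) (K * (K * \<Lambda>)) g2" unfolding g2_def
      by (rule lip1_of_functional[where R = "real R" and \<Lambda> = "K * \<Lambda>"]) (use g1y g1z wb vk_continuous in \<open>auto simp: lip1_def\<close>)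
    have s2z: "lip1 (real R) (K * (K * \<Lambda>)) s2" unfolding s2_def by (rule sumlip) (rule s1z)
    have e1: "\<bar>g1 y z - s1 y z\<bar> \<le> K * \<eta> N" for y z
      unfolding g1_def s1_def K_def \<eta>_def I_def by (rule vk_integral_approx[OF L1])
    have split: "(LBINT y. vk N y * a y) - (\<Sum>j\<in>I. b (real_of_int j)) = (LBINT y. vk N y * (a y - b y)) + ((LBINT y. vk N y * b y) - (\<Sum>j\<in>I. b (real_of_int j)))"
      if "lip1 (real R) L a" "lip1 (real R) L b" for a b L
      by (simp add: right_diff_distrib Bochner_Integration.integral_diff lip1_mult_integrable[OF that(1) vk_continuous] lip1_mult_integrable[OF that(2) vk_continuous])
    have dlip: "lip1 (real R) (2 * L) (\<lambda>y. a y - b y)" if "lip1 (real R) L a" "lip1 (real R) L b" for a b L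
      unfolding lip1_def
    proof (intro conjI allI impI)
      fix x y
      have "\<bar>a x - a y\<bar> \<le> L * \<bar>x - y\<bar>" "\<bar>b x - b y\<bar> \<le> L * \<bar>x - y\<bar>" using that by (auto simp: lip1_def)
      thus "\<bar>a x - b x - (a y - b y)\<bar> \<le> 2 * L * \<bar>x - y\<bar>" by linarith
    qed (use that in \<open>auto simp: lip1_def\<close>)
    have gen: "\<bar>(LBINT y. vk N y * a y) - (\<Sum>j\<in>I. b (real_of_int j))\<bar> \<le> K * S + K * (L * (2 / sqrt (real N + 1)))"
      if "lip1 (real R) L a" "lip1 (real R) L b" "\<And>y. \<bar>a y - b y\<bar> \<le> S" for a b L S
    proof -
      have "\<bar>LBINT y. vk N y * (a y - b y)\<bar> \<le> K * S" by (rule wb[OF dlip[OF that(1,2)] that(3)])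
      moreover have "\<bar>(LBINT y. vk N y * b y) - (\<Sum>j\<in>I. b (real_of_int j))\<bar> \<le> K * (L * (2 / sqrt (real N + 1)))"
        unfolding K_def I_def by (rule vk_integral_approx[OF that(2)])
      ultimately show ?thesis unfolding split[OF that(1,2)] by linarith
    qed
    have e2: "\<bar>g2 z - s2 z\<bar> \<le> 2 * K^2 * \<eta> N" for z
    proof -
      have "K * (K * (\<Lambda> * q)) + K * (K * \<Lambda> * q) = 2 * K^2 * (\<Lambda> * q)" for q by algebra
      thus ?thesis using gen[OF g1y s1y e1, of z] unfolding g2_def s2_def \<eta>_def by (simp only:)
    qed
    have "\<bar>(LBINT z. vk N z * g2 z) - (\<Sum>k\<in>I. s2 (real_of_int k))\<bar> \<le> 3 * K^3 * \<eta> N"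
    proof -
      have "K * (2 * K^2 * (\<Lambda> * q)) + K * (K * (K * \<Lambda>) * q) = 3 * K^3 * (\<Lambda> * q)" for q by algebra
      thus ?thesis using gen[OF g2z s2z e2] unfolding \<eta>_def by (simp only:)
    qed
    thus ?thesis unfolding g2_def s2_def g1_def s1_def .
  qed
  have "(\<lambda>N. 3 * K^3 * \<eta> N) \<longlonglongrightarrow> 3 * K^3 * (\<Lambda> * 0)" unfolding \<eta>_def
    by (intro tendsto_mult tendsto_const) real_asymp
  hence lim0: "(\<lambda>N. 3 * K^3 * \<eta> N) \<longlonglongrightarrow> 0" by (simp only: mult_zero_right)
  have le: "\<forall>N. norm ((LBINT z. vk N z * (LBINT y. vk N y * (LBINT x. vk N x * f x y z))) - (\<Sum>k\<in>I. \<Sum>j\<in>I. \<Sum>i\<in>I. f i j k)) \<le> 3 * K^3 * \<eta> N"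
    unfolding real_norm_def by (rule allI) (rule bound)
  have "(\<lambda>N. (LBINT z. vk N z * (LBINT y. vk N y * (LBINT x. vk N x * f x y z))) - (\<Sum>k\<in>I. \<Sum>j\<in>I. \<Sum>i\<in>I. f i j k)) \<longlonglongrightarrow> 0"
    by (rule Lim_null_comparison[OF always_eventually[OF le] lim0])
  thus ?thesis unfolding I_def by (rule LIM_zero_cancel)
qed

text \<open>Exchanging the finite sum with the iterated integrals needs integrability at every
  level. It comes from the fact that a cosine times a bounded Lipschitz function is again Lipschitz,
  with a constant depending on the frequency.\<close>

lemma vk_triple_expand:
  assumes l: "lip3 (real R) \<Lambda> f" and B: "\<And>x y z. \<bar>f x y z\<bar> \<le> B"
  shows "(LBINT z. vk N z * (LBINT y. vk N y * (LBINT x. vk N x * f x y z)))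
    = (\<Sum>(j,k,l)\<in>{-int N..int N} \<times> {-int N..int N} \<times> {-int N..int N}. qc N j * qc N k * qc N l *
        (LBINT z. LBINT y. LBINT x. cos (2 * pi * (real_of_int j * x + real_of_int k * y + real_of_int l * z)) * f x y z))"
proof -
  define J where "J = {-int N..int N} \<times> {-int N..int N} \<times> {-int N..int N}"
  define q where "q m = (case m of (j,k,l) \<Rightarrow> qc N j * qc N k * qc N l)" for m
  define h where "h m x y z = (case m of (j,k,l) \<Rightarrow> cos (2 * pi * (real_of_int j * x + real_of_int k * y + real_of_int l * z)) * f x y z)" for m x y z
  have B0: "B \<ge> 0" using B[of 0 0 0] by linarith
  have cosl: "\<bar>cos u - cos v\<bar> \<le> \<bar>u - v\<bar>" for u v :: real
  proof -
    have "\<bar>cos u - cos v\<bar> = 2 * \<bar>sin ((u + v) / 2)\<bar> * \<bar>sin ((v - u) / 2)\<bar>"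
      by (simp add: cos_diff_cos abs_mult)
    also have "\<dots> \<le> 2 * 1 * \<bar>(v - u) / 2\<bar>"
      by (intro mult_mono mult_left_mono abs_sin_le_one abs_sin_x_le_abs_x) auto
    finally show ?thesis by (simp add: abs_minus_commute)
  qed
  have prod: "\<bar>cos u * p - cos v * p'\<bar> \<le> (\<Lambda> + 2 * pi * D * B) * d"
    if "\<bar>p - p'\<bar> \<le> \<Lambda> * d" "\<bar>p'\<bar> \<le> B" "\<bar>u - v\<bar> \<le> 2 * pi * D * d" for u v p p' D d
  proof -
    have "cos u * p - cos v * p' = cos u * (p - p') + (cos u - cos v) * p'" by (simp add: algebra_simps)
    also have "\<bar>\<dots>\<bar> \<le> \<bar>cos u * (p - p')\<bar> + \<bar>(cos u - cos v) * p'\<bar>" by (rule abs_triangle_ineq)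
    also have "\<dots> \<le> 1 * (\<Lambda> * d) + (2 * pi * D * d) * B"
    proof (rule add_mono)
      show "\<bar>cos u * (p - p')\<bar> \<le> 1 * (\<Lambda> * d)" unfolding abs_mult by (rule mult_mono) (use that in auto)
      have "0 \<le> 2 * pi * D * d" using that(3) by (rule order_trans[OF abs_ge_zero])
      thus "\<bar>(cos u - cos v) * p'\<bar> \<le> (2 * pi * D * d) * B" unfolding abs_mult
        by (rule mult_mono[OF order_trans[OF cosl that(3)] that(2) _ abs_ge_zero])
    qed
    finally show ?thesis by (simp add: algebra_simps)
  qed
  define D where "D m = (case m of (j,k,l) \<Rightarrow> \<bar>real_of_int j\<bar> + \<bar>real_of_int k\<bar> + \<bar>real_of_int l\<bar>)" for m
  define L where "L m = \<Lambda> + 2 * pi * D m * B" for m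
  have step: "\<bar>2 * pi * s - 2 * pi * t\<bar> \<le> 2 * pi * E * d" if "\<bar>s - t\<bar> \<le> E * d" for s t E d :: real
  proof -
    have "\<bar>2 * pi * s - 2 * pi * t\<bar> = 2 * pi * \<bar>s - t\<bar>" by (simp add: abs_mult flip: right_diff_distrib)
    thus ?thesis using that by (simp add: mult.assoc)
  qed
  have lin: "\<bar>c * d\<bar> \<le> (\<bar>c\<bar> + e) * \<bar>d\<bar>" if "e \<ge> 0" for c d e :: real using that by (simp add: abs_mult distrib_right)
  have hl: "lip3 (real R) (L m) (h m)" for m
  proof -
    obtain j k l where m: "m = (j,k,l)" by (metis prod_cases3)
    have "\<bar>real_of_int j * x + real_of_int k * y + real_of_int l * z - (real_of_int j * x' + real_of_int k * y + real_of_int l * z)\<bar> \<le> D m * \<bar>x - x'\<bar>" for x x' y z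
      using lin[of "\<bar>real_of_int k\<bar> + \<bar>real_of_int l\<bar>" "real_of_int j" "x - x'"] by (simp add: m D_def algebra_simps)
    moreover have "\<bar>real_of_int j * x + real_of_int k * y + real_of_int l * z - (real_of_int j * x + real_of_int k * y' + real_of_int l * z)\<bar> \<le> D m * \<bar>y - y'\<bar>" for x y y' z
      using lin[of "\<bar>real_of_int j\<bar> + \<bar>real_of_int l\<bar>" "real_of_int k" "y - y'"] by (simp add: m D_def algebra_simps)
    moreover have "\<bar>real_of_int j * x + real_of_int k * y + real_of_int l * z - (real_of_int j * x + real_of_int k * y + real_of_int l * z')\<bar> \<le> D m * \<bar>z - z'\<bar>" for x y z z'
      using lin[of "\<bar>real_of_int j\<bar> + \<bar>real_of_int k\<bar>" "real_of_int l" "z - z'"] by (simp add: m D_def algebra_simps)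
    ultimately show ?thesis using l unfolding lip3_def L_def m h_def prod.case
      by (intro conjI allI impI prod step B) auto
  qed
  have h1: "lip1 (real R) (L m) (\<lambda>x. h m x y z)" for m y z using hl by (auto simp: lip3_def lip1_def)
  have wb: "\<bar>LBINT x. 1 * g x\<bar> \<le> (2 * real R) * S" if "lip1 (real R) L' g" "\<And>x. \<bar>g x\<bar> \<le> S" for g L' S
    using lip1_integral_bound[OF that(1) _ that(2)] by simp
  have h2y: "lip1 (real R) (2 * real R * L m) (\<lambda>y. LBINT x. 1 * h m x y z)" for m z
    by (rule lip1_of_functional[where R = "real R" and \<Lambda> = "L m"]) (use hl[of m] h1 wb in \<open>auto simp: lip3_def\<close>)
  have h2z: "lip1 (real R) (2 * real R * L m) (\<lambda>z. LBINT x. 1 * h m x y z)" for m y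
    by (rule lip1_of_functional[where R = "real R" and \<Lambda> = "L m"]) (use hl[of m] h1 wb in \<open>auto simp: lip3_def\<close>)
  have h3z: "lip1 (real R) (2 * real R * (2 * real R * L m)) (\<lambda>z. LBINT y. 1 * (LBINT x. 1 * h m x y z))" for m
    by (rule lip1_of_functional[where R = "real R" and \<Lambda> = "2 * real R * L m"]) (use h2y h2z wb in \<open>auto simp: lip1_def\<close>)
  have fJ: "finite J" by (simp add: J_def)
  have e: "vk N z * (vk N y * (vk N x * f x y z)) = (\<Sum>m\<in>J. q m * h m x y z)" for x y z
  proof -
    have "vk N z * (vk N y * (vk N x * f x y z)) = (vk N x * vk N y * vk N z) * f x y z" by simp
    also have "\<dots> = (\<Sum>m\<in>J. q m * h m x y z)"
      unfolding vk_expand3 sum_distrib_right J_def by (intro sum.cong) (auto simp: q_def h_def)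
    finally show ?thesis .
  qed
  have "(LBINT z. vk N z * (LBINT y. vk N y * (LBINT x. vk N x * f x y z))) = (LBINT z. LBINT y. LBINT x. vk N z * (vk N y * (vk N x * f x y z)))"
    by simp
  also have "\<dots> = (LBINT z. LBINT y. LBINT x. (\<Sum>m\<in>J. q m * h m x y z))" unfolding e ..
  also have "\<dots> = (LBINT z. LBINT y. (\<Sum>m\<in>J. q m * (LBINT x. h m x y z)))"
    by (subst Bochner_Integration.integral_sum) (auto intro!: integrable_mult_right lip1_integrable h1)
  also have "\<dots> = (LBINT z. (\<Sum>m\<in>J. q m * (LBINT y. LBINT x. h m x y z)))"
    using lip1_integrable[OF h2y] by (subst Bochner_Integration.integral_sum) (auto intro!: integrable_mult_right)
  also have "\<dots> = (\<Sum>m\<in>J. q m * (LBINT z. LBINT y. LBINT x. h m x y z))"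
    using lip1_integrable[OF h3z] by (subst Bochner_Integration.integral_sum) (auto intro!: integrable_mult_right)
  also have "\<dots> = (\<Sum>(j,k,l)\<in>J. qc N j * qc N k * qc N l *
        (LBINT z. LBINT y. LBINT x. cos (2 * pi * (real_of_int j * x + real_of_int k * y + real_of_int l * z)) * f x y z))"
    by (intro sum.cong refl) (auto simp: q_def h_def)
  finally show ?thesis unfolding J_def .
qed

section \<open>The Fourier transform of the Riesz kernel\<close>

text \<open>A class that is closed under shears and on which Fubini holds.\<close>

definition csupp2 :: "(real \<Rightarrow> real \<Rightarrow> real) \<Rightarrow> bool" where
  "csupp2 f \<longleftrightarrow> continuous_on UNIV (\<lambda>(x, y). f x y) \<and> (\<exists>R. \<forall>x y. \<bar>x\<bar> > R \<or> \<bar>y\<bar> > R \<longrightarrow> f x y = 0)"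

lemma csupp2_swap_integral:
  assumes "csupp2 f"
  shows "(LBINT x. LBINT y. f x y) = (LBINT y. LBINT x. f x y)"
proof -
  obtain R where R: "\<And>x y. \<bar>x\<bar> > R \<or> \<bar>y\<bar> > R \<Longrightarrow> f x y = 0" and c: "continuous_on UNIV (\<lambda>(x, y). f x y)"
    using assms by (auto simp: csupp2_def)
  have "integrable lborel (\<lambda>p. indicator ({-R..R} \<times> {-R..R}) p *\<^sub>R (case p of (x, y) \<Rightarrow> f x y))"
    by (rule borel_integrable_compact) (auto intro: compact_Times continuous_on_subset[OF c])
  also have "(\<lambda>p. indicator ({-R..R} \<times> {-R..R}) p *\<^sub>R (case p of (x, y) \<Rightarrow> f x y)) = (\<lambda>(x, y). f x y)"
    using R by (force simp: indicator_def fun_eq_iff)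
  finally have "integrable (lborel \<Otimes>\<^sub>M lborel) (\<lambda>(x, y). f x y)" by (simp add: lborel_prod)
  from lborel_pair.Fubini_integral[OF this] show ?thesis by simp
qed

lemma csupp2_shear:
  assumes "csupp2 f"
  shows "csupp2 (\<lambda>x y. f (x + \<alpha> * y) y)" "csupp2 (\<lambda>x y. f x (y + \<alpha> * x))"
proof -
  obtain R where R: "\<And>x y. \<bar>x\<bar> > R \<or> \<bar>y\<bar> > R \<Longrightarrow> f x y = 0" and c: "continuous_on UNIV (\<lambda>(x, y). f x y)"
    using assms by (auto simp: csupp2_def)
  define T where "T = \<bar>R\<bar> + \<bar>\<alpha>\<bar> * \<bar>R\<bar>"
  have TR: "T \<ge> R" unfolding T_def by (simp add: add_increasing2)
  have big: "\<bar>u + \<alpha> * v\<bar> > R" if "\<bar>u\<bar> > T" "\<bar>v\<bar> \<le> R" for u v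
  proof -
    have "\<bar>\<alpha> * v\<bar> \<le> \<bar>\<alpha>\<bar> * \<bar>R\<bar>" unfolding abs_mult using that(2) by (intro mult_left_mono) auto
    thus ?thesis using that unfolding T_def by linarith
  qed
  have c1: "continuous_on UNIV ((\<lambda>(x, y). f x y) \<circ> (\<lambda>(x, y). (x + \<alpha> * y, y)))"
    by (intro continuous_on_compose continuous_on_subset[OF c]) (auto intro!: continuous_intros simp: case_prod_unfold)
  have c2: "continuous_on UNIV ((\<lambda>(x, y). f x y) \<circ> (\<lambda>(x, y). (x, y + \<alpha> * x)))"
    by (intro continuous_on_compose continuous_on_subset[OF c]) (auto intro!: continuous_intros simp: case_prod_unfold)
  have s1: "f (x + \<alpha> * y) y = 0" if "\<bar>x\<bar> > T \<or> \<bar>y\<bar> > T" for x y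
    using that R big[of x y] TR by (cases "\<bar>y\<bar> > R") auto
  have s2: "f x (y + \<alpha> * x) = 0" if "\<bar>x\<bar> > T \<or> \<bar>y\<bar> > T" for x y
    using that R big[of y x] TR by (cases "\<bar>x\<bar> > R") auto
  show "csupp2 (\<lambda>x y. f (x + \<alpha> * y) y)" unfolding csupp2_def using c1 s1 by (auto simp: o_def case_prod_unfold)
  show "csupp2 (\<lambda>x y. f x (y + \<alpha> * x))" unfolding csupp2_def using c2 s2 by (auto simp: o_def case_prod_unfold)
qed

lemma lborel_translate: "(LBINT x. g (x + c)) = (LBINT x. g (x::real) :: real)"
  using lborel_integral_real_affine[of 1 g c] by (simp add: add.commute)

text \<open>A rotation by an angle other than the straight angle is a product of three shears.\<close>

lemma rotate_integral:
  assumes f: "csupp2 f" and cs: "c\<^sup>2 + s\<^sup>2 = 1" and c: "c \<ge> 0"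
  shows "(LBINT y. LBINT x. f (c * x - s * y) (s * x + c * y)) = (LBINT y. LBINT x. f x y)"
proof -
  \<comment> \<open>Minus the tangent of half the angle: the amount of the first and of the last
    shear, s being that of the middle one. c \<ge> 0 keeps 1 + c positive.\<close>
  define \<alpha> where "\<alpha> = - s / (1 + c)"
  have as: "\<alpha> * s = c - 1"
  proof -
    have "s\<^sup>2 = (1 - c) * (1 + c)" using cs by (simp add: algebra_simps power2_eq_square)
    thus ?thesis unfolding \<alpha>_def using c by (simp add: field_simps power2_eq_square)
  qed
  have ac: "\<alpha> * (1 + c) = - s" unfolding \<alpha>_def using c by simp
  define f1 where "f1 x y = f (x + \<alpha> * y) y" for x y
  define f2 where "f2 x y = f1 x (y + s * x)" for x y
  have cs1: "csupp2 f1" unfolding f1_def by (rule csupp2_shear(1)[OF f])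
  have cs2: "csupp2 f2" unfolding f2_def by (rule csupp2_shear(2)[OF cs1])
  have e: "f (c * x - s * y) (s * x + c * y) = f2 (x + \<alpha> * y) y" for x y
  proof -
    have "y + s * (x + \<alpha> * y) = s * x + (1 + \<alpha> * s) * y" by (simp add: algebra_simps)
    hence y: "y + s * (x + \<alpha> * y) = s * x + c * y" unfolding as by simp
    have "x + \<alpha> * y + \<alpha> * (s * x + c * y) = x * (1 + \<alpha> * s) + y * (\<alpha> * (1 + c))" by (simp add: algebra_simps)
    also have "\<dots> = c * x - s * y" unfolding as ac by simp
    finally show ?thesis unfolding f2_def f1_def y by simp
  qed
  have "(LBINT y. LBINT x. f (c * x - s * y) (s * x + c * y)) = (LBINT y. LBINT x. f2 x y)"
    unfolding e by (simp add: lborel_translate[of "\<lambda>x. f2 x _"])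
  also have "\<dots> = (LBINT x. LBINT y. f2 x y)" by (rule csupp2_swap_integral[OF cs2, symmetric])
  also have "\<dots> = (LBINT x. LBINT y. f1 x y)" unfolding f2_def by (simp add: lborel_translate[of "\<lambda>y. f1 _ y"])
  also have "\<dots> = (LBINT y. LBINT x. f1 x y)" by (rule csupp2_swap_integral[OF cs1])
  also have "\<dots> = (LBINT y. LBINT x. f x y)" unfolding f1_def by (simp add: lborel_translate[of "\<lambda>x. f x _"])
  finally show ?thesis .
qed

lemma csupp2_cos_radial:
  assumes c: "continuous_on UNIV \<Psi>" and s: "\<And>u. u > T \<Longrightarrow> \<Psi> u = 0"
  shows "csupp2 (\<lambda>x y. cos (2 * pi * (p * x + q * y + \<theta>)) * \<Psi> (x\<^sup>2 + y\<^sup>2))"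
  unfolding csupp2_def
proof (intro conjI exI[of _ "\<bar>T\<bar> + 1"] allI impI)
  have "continuous_on UNIV (\<Psi> \<circ> (\<lambda>p. (fst p)\<^sup>2 + (snd p)\<^sup>2))"
    by (intro continuous_on_compose continuous_on_subset[OF c] continuous_intros) auto
  thus "continuous_on UNIV (\<lambda>(x, y). cos (2 * pi * (p * x + q * y + \<theta>)) * \<Psi> (x\<^sup>2 + y\<^sup>2))"
    by (simp add: case_prod_unfold o_def) (intro continuous_intros)
  fix x y :: real assume *: "\<bar>x\<bar> > \<bar>T\<bar> + 1 \<or> \<bar>y\<bar> > \<bar>T\<bar> + 1"
  have sq: "w\<^sup>2 > T" if "\<bar>w\<bar> > \<bar>T\<bar> + 1" for w :: real
  proof -
    have "1 * \<bar>w\<bar> \<le> \<bar>w\<bar> * \<bar>w\<bar>" using that by (intro mult_right_mono) auto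
    thus ?thesis using that by (simp add: power2_eq_square)
  qed
  have "x\<^sup>2 + y\<^sup>2 > T" using * sq[of x] sq[of y] zero_le_power2[of x] zero_le_power2[of y] by linarith
  thus "cos (2 * pi * (p * x + q * y + \<theta>)) * \<Psi> (x\<^sup>2 + y\<^sup>2) = 0" using s by simp
qed

text \<open>The condition q c' = p s' says that the rotation turns the frequency (p, q) onto the
  first axis; the second variable leaves the phase and can be integrated out of the radial factor
  alone. \<theta> holds the phase of a third coordinate.\<close>

lemma rotate_cos_radial:
  assumes c: "continuous_on UNIV \<Psi>" and s: "\<And>u. u > T \<Longrightarrow> \<Psi> u = 0"
    and cs: "c'\<^sup>2 + s'\<^sup>2 = 1" "c' \<ge> 0" and pq: "q * c' = p * s'"
  shows "(LBINT y. LBINT x. cos (2 * pi * (p * x + q * y + \<theta>)) * \<Psi> (x\<^sup>2 + y\<^sup>2))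
    = (LBINT x. LBINT y. cos (2 * pi * ((p * c' + q * s') * x + \<theta>)) * \<Psi> (x\<^sup>2 + y\<^sup>2))"
proof -
  define f where "f x y = cos (2 * pi * (p * x + q * y + \<theta>)) * \<Psi> (x\<^sup>2 + y\<^sup>2)" for x y
  have "f (c' * x - s' * y) (s' * x + c' * y) = cos (2 * pi * ((p * c' + q * s') * x + 0 * y + \<theta>)) * \<Psi> (x\<^sup>2 + y\<^sup>2)" for x y
  proof -
    have "(c' * x - s' * y)\<^sup>2 + (s' * x + c' * y)\<^sup>2 = (c'\<^sup>2 + s'\<^sup>2) * (x\<^sup>2 + y\<^sup>2)" by algebra
    moreover have "p * (c' * x - s' * y) + q * (s' * x + c' * y) = (p * c' + q * s') * x + (q * c' - p * s') * y" by algebra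
    ultimately show ?thesis unfolding f_def using cs pq by simp
  qed
  hence "(LBINT y. LBINT x. f x y) = (LBINT y. LBINT x. cos (2 * pi * ((p * c' + q * s') * x + 0 * y + \<theta>)) * \<Psi> (x\<^sup>2 + y\<^sup>2))"
    using rotate_integral[OF _ cs, of f] csupp2_cos_radial[OF c s] by (simp add: f_def[abs_def])
  also have "\<dots> = (LBINT x. LBINT y. cos (2 * pi * ((p * c' + q * s') * x + 0 * y + \<theta>)) * \<Psi> (x\<^sup>2 + y\<^sup>2))"
    by (rule csupp2_swap_integral[OF csupp2_cos_radial[OF c s], symmetric])
  finally show ?thesis unfolding f_def by simp
qed

text \<open>Forcing c \<ge> 0 may turn the frequency onto the negative half-axis, so only its square
  is fixed. This suffices, since the transforms are even.\<close>

lemma rotation_exists: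
  fixes p q :: real
  shows "\<exists>c s. c\<^sup>2 + s\<^sup>2 = 1 \<and> c \<ge> 0 \<and> q * c = p * s \<and> (p * c + q * s)\<^sup>2 = p\<^sup>2 + q\<^sup>2"
proof (cases "p = 0 \<and> q = 0")
  case True thus ?thesis by (intro exI[of _ 1] exI[of _ 0]) auto
next
  case False
  define P where "P = sqrt (p\<^sup>2 + q\<^sup>2)"
  have P2: "P\<^sup>2 = p\<^sup>2 + q\<^sup>2" unfolding P_def by simp
  have P0: "P > 0" unfolding P_def using False by (simp add: sum_power2_gt_zero_iff)
  define e where "e = (if p \<ge> 0 then 1 else -1 :: real)"
  have e2: "e * e = 1" "e * p \<ge> 0" by (auto simp: e_def)
  have 1: "(e * p / P)\<^sup>2 + (e * q / P)\<^sup>2 = 1"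
  proof -
    have "(e * p / P)\<^sup>2 + (e * q / P)\<^sup>2 = (e * e) * (p\<^sup>2 + q\<^sup>2) / P\<^sup>2" by (simp add: power2_eq_square add_divide_distrib algebra_simps)
    thus ?thesis using P0 by (simp add: e2 P2[symmetric])
  qed
  have "p * (e * p / P) + q * (e * q / P) = e * (p\<^sup>2 + q\<^sup>2) / P" by (simp add: power2_eq_square add_divide_distrib algebra_simps)
  also have "\<dots> = e * P" unfolding P2[symmetric] using P0 by (simp add: power2_eq_square)
  finally have "(p * (e * p / P) + q * (e * q / P))\<^sup>2 = (e * e) * P\<^sup>2" by (simp add: power2_eq_square)
  hence "(p * (e * p / P) + q * (e * q / P))\<^sup>2 = p\<^sup>2 + q\<^sup>2" unfolding e2 P2 by simp
  thus ?thesis using 1 e2 P0 by (intro exI[of _ "e * p / P"] exI[of _ "e * q / P"]) auto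
qed

section \<open>The Riesz kernel, its integrals and its Fourier transform\<close>

definition psi :: "real \<Rightarrow> real" where "psi s = (max s 0)\<^sup>2 / 2"
text \<open>What remains of \<open>psi\<close> after one variable y is integrated out of psi(s -
  y^2): a multiple of the power 5/2.\<close>

definition phi :: "real \<Rightarrow> real" where "phi s = 8 / 15 * ((max s 0)\<^sup>2 * sqrt (max s 0))"

lemma LBINT_symmetric_support:
  fixes f g :: "real \<Rightarrow> real"
  assumes A: "A > 0" and f: "\<And>y. y\<^sup>2 \<le> A \<Longrightarrow> f y = g y" and f0: "\<And>y. y\<^sup>2 > A \<Longrightarrow> f y = 0"
    and cg: "continuous_on {-sqrt A..sqrt A} g" and I: "(g has_integral I) {-sqrt A..sqrt A}"
  shows "(LBINT y. f y) = I"
proof -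
  have iff: "y \<in> {-sqrt A..sqrt A} \<longleftrightarrow> y\<^sup>2 \<le> A" for y
    using A by (metis abs_le_iff atLeastAtMost_iff minus_le_iff real_sqrt_abs real_sqrt_le_iff)
  have eq: "f = (\<lambda>y. indicator {-sqrt A..sqrt A} y *\<^sub>R g y)"
    using f f0 iff by (auto simp: fun_eq_iff indicator_def not_le)
  have si: "set_integrable lborel {-sqrt A..sqrt A} g" by (rule borel_integrable_atLeastAtMost'[OF cg])
  show ?thesis unfolding eq using set_borel_integral_eq_integral(2)[OF si] I
    by (simp add: set_lebesgue_integral_def integral_unique)
qed

lemma integral_psi: "(LBINT y. psi (A - y\<^sup>2)) = phi A"
proof (cases "A > 0")
  case False
  hence "A - y\<^sup>2 \<le> 0" for y using zero_le_power2[of y] by linarith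
  hence "psi (A - y\<^sup>2) = 0" for y by (simp add: psi_def max_absorb2)
  thus ?thesis using False by (simp add: phi_def max_def)
next
  case True
  have s: "sqrt A * sqrt A = A" using True by simp
  have p3: "sqrt A ^ 3 = A * sqrt A" "sqrt A ^ 5 = A * A * sqrt A" using s by (simp_all add: eval_nat_numeral)
  define F where "F y = A\<^sup>2 / 2 * y - A / 3 * y ^ 3 + 1 / 10 * y ^ 5" for y
  have dF: "(F has_real_derivative (A - y\<^sup>2)\<^sup>2 / 2) (at y within X)" for y X
  proof -
    have "(F has_real_derivative A\<^sup>2 / 2 - A / 3 * (3 * y\<^sup>2) + 1 / 10 * (5 * y ^ 4)) (at y within X)"
      unfolding F_def by (auto intro!: derivative_eq_intros)
    also have "A\<^sup>2 / 2 - A / 3 * (3 * y\<^sup>2) + 1 / 10 * (5 * y ^ 4) = (A - y\<^sup>2)\<^sup>2 / 2"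
      by (simp add: power2_eq_square eval_nat_numeral field_simps)
    finally show ?thesis .
  qed
  have "((\<lambda>y. (A - y\<^sup>2)\<^sup>2 / 2) has_integral F (sqrt A) - F (- sqrt A)) {-sqrt A..sqrt A}"
    by (rule fundamental_theorem_of_calculus)
       (use True dF in \<open>auto simp: has_real_derivative_iff_has_vector_derivative[symmetric]\<close>)
  also have "F (sqrt A) - F (- sqrt A) = phi A"
  proof -
    have "F (sqrt A) = 4 / 15 * (A * A * sqrt A)" unfolding F_def p3 by (simp add: power2_eq_square)
    moreover have "F (- sqrt A) = - F (sqrt A)" by (simp add: F_def)
    ultimately show ?thesis using True by (simp add: phi_def max_def power2_eq_square)
  qed
  finally show ?thesis
    by (intro LBINT_symmetric_support[OF True]) (auto simp: psi_def max_def intro!: continuous_intros)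
qed

text \<open>The antiderivative of (A - y^2)^(5/2) comes from the reduction formula for odd powers of
  the root and ends in an arcsine. That arcsine is not differentiable at the endpoints, hence the
  form of the fundamental theorem that asks for derivatives in the interior only.\<close>

lemma integral_phi: "(LBINT y. phi (A - y\<^sup>2)) = pi / 6 * (max A 0) ^ 3"
proof (cases "A > 0")
  case False
  hence "A - y\<^sup>2 \<le> 0" for y using zero_le_power2[of y] by linarith
  hence "phi (A - y\<^sup>2) = 0" for y by (simp add: phi_def max_absorb2)
  thus ?thesis using False by (simp add: max_def)
next
  case True
  define S where "S y = sqrt (A - y\<^sup>2)" for y
  define G where "G y = y * S y ^ 5 / 6 + 5 * A * (y * S y ^ 3) / 24 + 5 * A\<^sup>2 / 16 * (y * S y) + 5 * A ^ 3 / 16 * arcsin (y / sqrt A)" for y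
  have cS: "continuous_on {-sqrt A..sqrt A} S" unfolding S_def by (intro continuous_intros)
  have cG: "continuous_on {-sqrt A..sqrt A} G" unfolding G_def
    using True by (intro continuous_intros cS continuous_on_arcsin) (auto simp: pos_le_divide_eq pos_divide_le_eq)
  have der: "(G has_real_derivative S y ^ 5) (at y)" if y: "y \<in> {-sqrt A<..<sqrt A}" for y
  proof -
    have y2: "y\<^sup>2 < A" using y True by (metis abs_less_iff greaterThanLessThan_iff minus_less_iff real_sqrt_abs real_sqrt_less_iff)
    define T where "T = S y"
    have T0: "T > 0" unfolding T_def S_def using y2 by simp
    have TT: "T\<^sup>2 = A - y\<^sup>2" unfolding T_def S_def using y2 by simp
    have dS: "(S has_real_derivative - y / T) (at y)"
      unfolding S_def T_def using y2 by (auto intro!: derivative_eq_intros simp: field_simps)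
    have dA: "((\<lambda>y. arcsin (y / sqrt A)) has_real_derivative 1 / T) (at y)"
    proof -
      have rng: "-1 < y / sqrt A" "y / sqrt A < 1" using y True by (auto simp: pos_less_divide_eq pos_divide_less_eq)
      have "((\<lambda>y. arcsin (y / sqrt A)) has_real_derivative inverse (sqrt (1 - (y / sqrt A)\<^sup>2)) * (1 / sqrt A)) (at y)"
        by (rule DERIV_chain2[where f = arcsin and g = "\<lambda>y. y / sqrt A", OF DERIV_arcsin[OF rng]]) (rule DERIV_cdivide[OF DERIV_ident])
      moreover have "sqrt (1 - (y / sqrt A)\<^sup>2) = T / sqrt A"
      proof -
        have "1 - (y / sqrt A)\<^sup>2 = (A - y\<^sup>2) / A" using True by (simp add: power_divide diff_divide_distrib)
        thus ?thesis by (simp add: real_sqrt_divide T_def S_def)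
      qed
      moreover have "inverse (T / sqrt A) * (1 / sqrt A) = 1 / T" using True by (simp add: field_simps)
      ultimately show ?thesis by (simp only:)
    qed
    have "(G has_real_derivative (1 * T ^ 5 + y * (5 * T ^ 4 * (- y / T))) / 6 + 5 * A * (1 * T ^ 3 + y * (3 * T\<^sup>2 * (- y / T))) / 24
        + 5 * A\<^sup>2 / 16 * (1 * T + y * (- y / T)) + 5 * A ^ 3 / 16 * (1 / T)) (at y)"
    proof -
      have "(G has_real_derivative (1 * S y ^ 5 + (5 * S y ^ 4 * (- y / T)) * y) / 6 + 5 * A * (1 * S y ^ 3 + (3 * (S y)\<^sup>2 * (- y / T)) * y) / 24
        + 5 * A\<^sup>2 / 16 * (1 * S y + (- y / T) * y) + 5 * A ^ 3 / 16 * (1 / T)) (at y)"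
        unfolding G_def
      proof (intro DERIV_add DERIV_cdivide DERIV_cmult DERIV_mult DERIV_ident dA dS)
        show "((\<lambda>y. S y ^ 5) has_real_derivative 5 * S y ^ 4 * (- y / T)) (at y)"
          using DERIV_power[OF dS, of 5] by (simp add: mult_ac)
        show "((\<lambda>y. S y ^ 3) has_real_derivative 3 * (S y)\<^sup>2 * (- y / T)) (at y)"
          using DERIV_power[OF dS, of 3] by (simp add: mult_ac)
      qed
      thus ?thesis unfolding T_def[symmetric] by (simp only: mult_ac)
    qed
    also have "(1 * T ^ 5 + y * (5 * T ^ 4 * (- y / T))) / 6 + 5 * A * (1 * T ^ 3 + y * (3 * T\<^sup>2 * (- y / T))) / 24
        + 5 * A\<^sup>2 / 16 * (1 * T + y * (- y / T)) + 5 * A ^ 3 / 16 * (1 / T) = T ^ 5"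
    proof -
      define Y where "Y = y\<^sup>2"
      have A: "A = T\<^sup>2 + Y" using TT by (simp add: Y_def)
      have a1: "y * (5 * T ^ 4 * (- y / T)) = - (5 * T^3 * Y)" "y * (3 * T\<^sup>2 * (- y / T)) = - (3 * T * Y)" "y * (- y / T) = - (Y / T)"
        using T0 by (simp_all add: Y_def power2_eq_square eval_nat_numeral)
      \<comment> \<open>With the reciprocal as a variable subject to T i = 1, the claim is a
        polynomial identity.\<close>
      define i where "i = 1 / T"
      have Ti: "T * i = 1" using T0 by (simp add: i_def)
      have E0: "8 * (T ^ 5 - 5 * T^3 * Y) + 10 * A * (T ^ 3 - 3 * T * Y) + 15 * A\<^sup>2 * (T - Y * i) + 15 * A ^ 3 * i = 48 * T ^ 5"
        using A Ti by algebra
      have E: "8 * (T ^ 5 - 5 * T^3 * Y) / 48 + 10 * A * (T ^ 3 - 3 * T * Y) / 48 + 15 * A\<^sup>2 * (T - Y * i) / 48 + 15 * A ^ 3 * i / 48 = T ^ 5"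
      proof -
        have "p / 48 + q / 48 + r / 48 + s / 48 = t" if "p + q + r + s = 48 * t" for p q r s t :: real using that by linarith
        from this[OF E0] show ?thesis .
      qed
      have "(1 * T ^ 5 + - (5 * T^3 * Y)) / 6 = 8 * (T ^ 5 - 5 * T^3 * Y) / 48"
        "5 * A * (1 * T ^ 3 + - (3 * T * Y)) / 24 = 10 * A * (T ^ 3 - 3 * T * Y) / 48"
        "5 * A\<^sup>2 / 16 * (1 * T + - (Y / T)) = 15 * A\<^sup>2 * (T - Y * i) / 48"
        "5 * A ^ 3 / 16 * (1 / T) = 15 * A ^ 3 * i / 48"
        by (simp_all add: i_def)
      thus ?thesis unfolding a1 using E by (simp only:)
    qed
    finally show ?thesis unfolding T_def .
  qed
  have "((\<lambda>y. S y ^ 5) has_integral (G (sqrt A) - G (- sqrt A))) {-sqrt A..sqrt A}"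
    by (rule fundamental_theorem_of_calculus_interior)
       (use True cG der in \<open>auto simp: has_real_derivative_iff_has_vector_derivative[symmetric]\<close>)
  also have "G (sqrt A) - G (- sqrt A) = 5 * A ^ 3 / 16 * pi"
    using True by (simp add: G_def S_def arcsin_minus field_simps)
  finally have "((\<lambda>y. 8 / 15 * S y ^ 5) has_integral 8 / 15 * (5 * A ^ 3 / 16 * pi)) {-sqrt A..sqrt A}"
    by (rule has_integral_mult_right)
  also have "8 / 15 * (5 * A ^ 3 / 16 * pi) = pi / 6 * (max A 0) ^ 3" using True by (simp add: max_def)
  finally have I: "((\<lambda>y. 8 / 15 * S y ^ 5) has_integral pi / 6 * (max A 0) ^ 3) {-sqrt A..sqrt A}" .
  show ?thesis
  proof (rule LBINT_symmetric_support[OF True _ _ _ I])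
    show "phi (A - y\<^sup>2) = 8 / 15 * S y ^ 5" if "y\<^sup>2 \<le> A" for y
    proof -
      have "S y ^ 5 = (S y)\<^sup>2 * (S y)\<^sup>2 * S y" by (simp add: eval_nat_numeral)
      also have "(S y)\<^sup>2 = A - y\<^sup>2" using that by (simp add: S_def)
      finally show ?thesis using that by (simp add: phi_def max_def S_def power2_eq_square)
    qed
    show "phi (A - y\<^sup>2) = 0" if "y\<^sup>2 > A" for y using that by (simp add: phi_def max_def)
    show "continuous_on {- sqrt A..sqrt A} (\<lambda>y. 8 / 15 * S y ^ 5)" by (intro continuous_intros cS)
  qed
qed

text \<open>The cosine transform of (pi/6) (t - x^2)^3 over x^2 \<le> t at angular frequency
  \<omega>. It is also the three-dimensional transform of psi(t - |u|^2), that is, the Bessel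
  function of order 7/2 in elementary form.\<close>

definition gf :: "real \<Rightarrow> real \<Rightarrow> real" where
  "gf \<omega> t = 16 * pi * ((15 / \<omega> ^ 7 - 6 * t / \<omega> ^ 5) * sin (\<omega> * sqrt t) - (15 * sqrt t / \<omega> ^ 6 - t * sqrt t / \<omega> ^ 4) * cos (\<omega> * sqrt t))"

text \<open>At \<kappa> = 0 the formula for \<open>gf\<close> degenerates; the value is the integral
  of the kernel itself, whose second derivative in t is the volume.\<close>

definition gg :: "real \<Rightarrow> real \<Rightarrow> real" where
  "gg \<kappa> t = (if \<kappa> = 0 then 16 * pi / 105 * (t ^ 3 * sqrt t) else gf (2 * pi * \<kappa>) t)"

lemma integral_cube_cos:
  assumes t: "t > 0"
  shows "(LBINT x. cos (2 * pi * (\<kappa> * x)) * (pi / 6 * (max (t - x\<^sup>2) 0) ^ 3)) = gg \<bar>\<kappa>\<bar> t"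
proof -
  define \<rho> where "\<rho> = sqrt t"
  have \<rho>: "\<rho> > 0" "\<rho> * \<rho> = t" unfolding \<rho>_def using t by auto
  have "((\<lambda>x. cos (2 * pi * (\<kappa> * x)) * (pi / 6 * (t - x\<^sup>2) ^ 3)) has_integral gg \<bar>\<kappa>\<bar> t) {-sqrt t..sqrt t}"
  proof (cases "\<kappa> = 0")
    case True
    define F where "F x = pi / 6 * (t^3 * x - t\<^sup>2 * x^3 + 3 * t * x^5 / 5 - x^7 / 7)" for x
    have "((\<lambda>x. pi / 6 * (t - x\<^sup>2) ^ 3) has_integral F \<rho> - F (- \<rho>)) {-\<rho>..\<rho>}"
      by (rule fundamental_theorem_of_calculus)
         (use \<rho> in \<open>auto intro!: derivative_eq_intros simp: F_def has_real_derivative_iff_has_vector_derivative[symmetric] power2_eq_square eval_nat_numeral algebra_simps\<close>)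
    also have "F \<rho> - F (- \<rho>) = gg \<bar>\<kappa>\<bar> t"
    proof -
      have p: "\<rho>^3 = t * \<rho>" "\<rho>^5 = t^2 * \<rho>" "\<rho>^7 = t^3 * \<rho>" by (simp_all add: \<rho>(2)[symmetric] eval_nat_numeral)
      have "F \<rho> = pi / 6 * (16 / 35 * (t^3 * \<rho>))"
        unfolding F_def p by (simp add: field_simps power2_eq_square power3_eq_cube)
      moreover have "F (- \<rho>) = - F \<rho>" by (simp add: F_def algebra_simps)
      ultimately show ?thesis by (simp add: gg_def True \<rho>_def[symmetric])
    qed
    finally show ?thesis unfolding True \<rho>_def by simp
  next
    case False
    define w where "w = 2 * pi * \<kappa>"
    have w0: "w \<noteq> 0" using False by (simp add: w_def)
    define j where "j = 1 / w"
    have jw: "w * j = 1" using w0 by (simp add: j_def)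
    \<comment> \<open>Repeated integration by parts of a polynomial of degree six against the
      cosine, with j for 1/w so that the verification is polynomial.\<close>
    define F where "F x = (t^3 - 3*t^2*x^2 + 3*t*x^4 - x^6) * sin (w*x) * j + (-6*t^2*x + 12*t*x^3 - 6*x^5) * cos (w*x) * j^2
       - (-6*t^2 + 36*t*x^2 - 30*x^4) * sin (w*x) * j^3 - (72*t*x - 120*x^3) * cos (w*x) * j^4
       + (72*t - 360*x^2) * sin (w*x) * j^5 + (-720*x) * cos (w*x) * j^6 + 720 * sin (w*x) * j^7" for x
    have der: "(F has_real_derivative (t - x\<^sup>2)^3 * cos (w*x)) (at x)" for x
    proof -
      define s where "s = sin (w*x)"
      define c where "c = cos (w*x)"
      have "(F has_real_derivative
         ((- 6*t^2*x + 12*t*x^3 - 6*x^5) * s + (t^3 - 3*t^2*x^2 + 3*t*x^4 - x^6) * (c * w)) * j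
         + ((-6*t^2 + 36*t*x^2 - 30*x^4) * c + (-6*t^2*x + 12*t*x^3 - 6*x^5) * (- s * w)) * j^2
         - ((72*t*x - 120*x^3) * s + (-6*t^2 + 36*t*x^2 - 30*x^4) * (c * w)) * j^3
         - ((72*t - 360*x^2) * c + (72*t*x - 120*x^3) * (- s * w)) * j^4
         + ((-720*x) * s + (72*t - 360*x^2) * (c * w)) * j^5
         + ((-720) * c + (-720*x) * (- s * w)) * j^6 + 720 * (c * w) * j^7) (at x)"
        unfolding F_def s_def c_def
        by (auto intro!: derivative_eq_intros simp: algebra_simps eval_nat_numeral)
      also have "((- 6*t^2*x + 12*t*x^3 - 6*x^5) * s + (t^3 - 3*t^2*x^2 + 3*t*x^4 - x^6) * (c * w)) * j
         + ((-6*t^2 + 36*t*x^2 - 30*x^4) * c + (-6*t^2*x + 12*t*x^3 - 6*x^5) * (- s * w)) * j^2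
         - ((72*t*x - 120*x^3) * s + (-6*t^2 + 36*t*x^2 - 30*x^4) * (c * w)) * j^3
         - ((72*t - 360*x^2) * c + (72*t*x - 120*x^3) * (- s * w)) * j^4
         + ((-720*x) * s + (72*t - 360*x^2) * (c * w)) * j^5
         + ((-720) * c + (-720*x) * (- s * w)) * j^6 + 720 * (c * w) * j^7 = (t - x\<^sup>2)^3 * c"
        using jw by algebra
      finally show ?thesis by (simp add: c_def)
    qed
    have "((\<lambda>x. (t - x\<^sup>2)^3 * cos (w*x)) has_integral F \<rho> - F (- \<rho>)) {-\<rho>..\<rho>}"
      by (rule fundamental_theorem_of_calculus)
         (use \<rho> der in \<open>auto simp: has_real_derivative_iff_has_vector_derivative[symmetric] intro: DERIV_subset\<close>)
    hence "((\<lambda>x. pi / 6 * ((t - x\<^sup>2)^3 * cos (w*x))) has_integral pi / 6 * (F \<rho> - F (- \<rho>))) {-\<rho>..\<rho>}"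
      by (rule has_integral_mult_right)
    also have "pi / 6 * (F \<rho> - F (- \<rho>)) = gf w t"
    proof -
      define s where "s = sin (w*\<rho>)"
      define c where "c = cos (w*\<rho>)"
      have F2: "F \<rho> - F (- \<rho>) = 2 * F \<rho>" by (simp add: F_def algebra_simps)
      have F1: "F \<rho> = 48 * ((15 * j^7 - 6 * t * j^5) * s - (15 * \<rho> * j^6 - t * \<rho> * j^4) * c)"
        unfolding F_def s_def[symmetric] c_def[symmetric] \<rho>(2)[symmetric] by (simp add: algebra_simps eval_nat_numeral)
      have Fd: "F \<rho> - F (- \<rho>) = 2 * (48 * ((15 * j^7 - 6 * t * j^5) * s - (15 * \<rho> * j^6 - t * \<rho> * j^4) * c))"
        by (rule trans[OF F2]) (rule arg_cong[OF F1])
      have "15 / w ^ 7 = 15 * j^7" "6 * t / w ^ 5 = 6 * t * j^5" "15 * \<rho> / w ^ 6 = 15 * \<rho> * j^6" "t * \<rho> / w ^ 4 = t * \<rho> * j^4"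
        by (simp_all add: j_def power_one_over)
      thus ?thesis unfolding gf_def \<rho>_def[symmetric] s_def[symmetric] c_def[symmetric] Fd by simp
    qed
    also have "gf w t = gg \<bar>\<kappa>\<bar> t"
    proof (cases "\<kappa> > 0")
      case True thus ?thesis by (simp add: gg_def w_def)
    next
      case False
      hence "gf w t = gf (- w) t" by (simp add: gf_def algebra_simps)
      thus ?thesis using False \<open>\<kappa> \<noteq> 0\<close> by (simp add: gg_def w_def)
    qed
    finally show ?thesis unfolding \<rho>_def w_def by (simp add: mult_ac)
  qed
  thus ?thesis
    by (intro LBINT_symmetric_support[OF t]) (auto simp: max_def intro!: continuous_intros)
qed

text \<open>Two plane rotations, in (x, y) and then in (x, z), bring the frequency onto one axis.
  After each of them the freed variable is integrated out, from \<open>psi\<close> to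
  \<open>phi\<close> and from \<open>phi\<close> to a cube, and a one-dimensional cosine transform
  remains.\<close>

lemma fourier_radial3:
  assumes t: "t > 0"
  shows "(LBINT z. LBINT y. LBINT x. cos (2 * pi * (p * x + q * y + r * z)) * psi (t - (x\<^sup>2 + y\<^sup>2 + z\<^sup>2))) = gg (sqrt (p\<^sup>2 + q\<^sup>2 + r\<^sup>2)) t"
proof -
  obtain c s where cs: "c\<^sup>2 + s\<^sup>2 = 1" "c \<ge> 0" "q * c = p * s" "(p * c + q * s)\<^sup>2 = p\<^sup>2 + q\<^sup>2"
    using rotation_exists by blast
  define P where "P = p * c + q * s"
  obtain c' s' where cs': "c'\<^sup>2 + s'\<^sup>2 = 1" "c' \<ge> 0" "r * c' = P * s'" "(P * c' + r * s')\<^sup>2 = P\<^sup>2 + r\<^sup>2"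
    using rotation_exists by blast
  define K where "K = P * c' + r * s'"
  have K: "\<bar>K\<bar> = sqrt (p\<^sup>2 + q\<^sup>2 + r\<^sup>2)"
    using cs'(4) cs(4) unfolding K_def P_def by (metis real_sqrt_abs)
  have cpsi: "continuous_on UNIV (\<lambda>u. psi (A - u))" for A unfolding psi_def by (intro continuous_intros) auto
  have cphi: "continuous_on UNIV (\<lambda>u. phi (A - u))" for A unfolding phi_def by (intro continuous_intros)
  have psi0: "psi (A - u) = 0" if "u > A" for A u using that by (simp add: psi_def)
  have phi0: "phi (A - u) = 0" if "u > A" for A u using that by (simp add: phi_def)
  have "(LBINT y. LBINT x. cos (2 * pi * (p * x + q * y + r * z)) * psi (t - (x\<^sup>2 + y\<^sup>2 + z\<^sup>2)))
      = (LBINT x. cos (2 * pi * (P * x + r * z)) * phi (t - (x\<^sup>2 + z\<^sup>2)))" for z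
  proof -
    have "(LBINT y. LBINT x. cos (2 * pi * (p * x + q * y + r * z)) * psi (t - (x\<^sup>2 + y\<^sup>2 + z\<^sup>2)))
      = (LBINT y. LBINT x. cos (2 * pi * (p * x + q * y + r * z)) * psi ((t - z\<^sup>2) - (x\<^sup>2 + y\<^sup>2)))"
      by (simp add: algebra_simps)
    also have "\<dots> = (LBINT x. LBINT y. cos (2 * pi * (P * x + r * z)) * psi ((t - z\<^sup>2) - (x\<^sup>2 + y\<^sup>2)))"
      unfolding P_def by (rule rotate_cos_radial[where \<Psi> = "\<lambda>u. psi ((t - z\<^sup>2) - u)" and T = "t - z\<^sup>2"]) (use cs cpsi psi0 in auto)
    also have "\<dots> = (LBINT x. cos (2 * pi * (P * x + r * z)) * (LBINT y. psi ((t - x\<^sup>2 - z\<^sup>2) - y\<^sup>2)))"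
      by (simp add: algebra_simps)
    also have "\<dots> = (LBINT x. cos (2 * pi * (P * x + r * z)) * phi (t - (x\<^sup>2 + z\<^sup>2)))"
      unfolding integral_psi by (simp add: algebra_simps)
    finally show ?thesis .
  qed
  hence "(LBINT z. LBINT y. LBINT x. cos (2 * pi * (p * x + q * y + r * z)) * psi (t - (x\<^sup>2 + y\<^sup>2 + z\<^sup>2)))
    = (LBINT z. LBINT x. cos (2 * pi * (P * x + r * z + 0)) * phi (t - (x\<^sup>2 + z\<^sup>2)))" by simp
  also have "\<dots> = (LBINT x. LBINT z. cos (2 * pi * (K * x + 0)) * phi (t - (x\<^sup>2 + z\<^sup>2)))"
    unfolding K_def by (rule rotate_cos_radial[where \<Psi> = "\<lambda>u. phi (t - u)" and T = t]) (use cs' cphi phi0 in auto)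
  also have "\<dots> = (LBINT x. cos (2 * pi * (K * x)) * (LBINT z. phi ((t - x\<^sup>2) - z\<^sup>2)))" by (simp add: algebra_simps)
  also have "\<dots> = (LBINT x. cos (2 * pi * (K * x)) * (pi / 6 * (max (t - x\<^sup>2) 0) ^ 3))" unfolding integral_phi ..
  also have "\<dots> = gg \<bar>K\<bar> t" by (rule integral_cube_cos[OF t])
  finally show ?thesis unfolding K .
qed

lemma lborel_scale: "c > 0 \<Longrightarrow> (LBINT x. g x) = c * (LBINT x. g (c * x) :: real)"
  using lborel_integral_real_affine[of c g 0] by simp

text \<open>Scaling the variables by sqrt a, sqrt a and 1/a has determinant 1 and turns the
  ellipsoid into a ball; the same factors pass to the frequencies.\<close>

lemma fourier_ellipsoid:
  assumes a: "a > 0" and t: "t > 0"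
  shows "(LBINT z. LBINT y. LBINT x. cos (2 * pi * (j * x + k * y + l * z)) * psi (t - ((x\<^sup>2 + y\<^sup>2) / a + a\<^sup>2 * z\<^sup>2)))
    = gg (sqrt (a * (j\<^sup>2 + k\<^sup>2) + (l / a)\<^sup>2)) t"
proof -
  define s where "s = sqrt a"
  have s: "s > 0" "s\<^sup>2 = a" using a by (auto simp: s_def)
  define b where "b = 1 / a"
  have b: "b > 0" using a by (simp add: b_def)
  have "(LBINT z. LBINT y. LBINT x. cos (2 * pi * (j * x + k * y + l * z)) * psi (t - ((x\<^sup>2 + y\<^sup>2) / a + a\<^sup>2 * z\<^sup>2)))
    = b * (LBINT z. s * (LBINT y. s * (LBINT x. cos (2 * pi * (j * (s * x) + k * (s * y) + l * (b * z))) * psi (t - (((s * x)\<^sup>2 + (s * y)\<^sup>2) / a + a\<^sup>2 * (b * z)\<^sup>2)))))"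
    by (subst lborel_scale[OF b], subst (2) lborel_scale[OF s(1)], subst (3) lborel_scale[OF s(1)]) simp
  also have "\<dots> = (b * s * s) * (LBINT z. LBINT y. LBINT x. cos (2 * pi * ((j * s) * x + (k * s) * y + (l / a) * z)) * psi (t - (x\<^sup>2 + y\<^sup>2 + z\<^sup>2)))"
  proof -
    have e1: "((s * x)\<^sup>2 + (s * y)\<^sup>2) / a + a\<^sup>2 * (b * z)\<^sup>2 = x\<^sup>2 + y\<^sup>2 + z\<^sup>2" for x y z
      using a by (simp add: power_mult_distrib s b_def power_divide add_divide_distrib)
    have e2: "j * (s * x) + k * (s * y) + l * (b * z) = (j * s) * x + (k * s) * y + (l / a) * z" for x y z
      by (simp add: b_def)
    show ?thesis unfolding e1 e2 by simp
  qed
  also have "b * s * s = 1" using s a by (simp add: b_def power2_eq_square)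
  also have "(j * s)\<^sup>2 + (k * s)\<^sup>2 + (l / a)\<^sup>2 = a * (j\<^sup>2 + k\<^sup>2) + (l / a)\<^sup>2"
    by (simp add: power_mult_distrib s algebra_simps)
  with fourier_radial3[OF t, of "j * s" "k * s" "l / a"]
  have "(LBINT z. LBINT y. LBINT x. cos (2 * pi * ((j * s) * x + (k * s) * y + (l / a) * z)) * psi (t - (x\<^sup>2 + y\<^sup>2 + z\<^sup>2))) = gg (sqrt (a * (j\<^sup>2 + k\<^sup>2) + (l / a)\<^sup>2)) t"
    by (simp only:)
  finally show ?thesis by simp
qed

text \<open>Dominated convergence for counting measure: multipliers bounded by 1 and tending to 1
  pointwise recover an absolutely convergent sum.\<close>

lemma sum_dominated_tendsto:
  fixes c :: "'a \<Rightarrow> real" and q :: "nat \<Rightarrow> 'a \<Rightarrow> real"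
  assumes s: "(\<lambda>m. \<bar>c m\<bar>) summable_on UNIV" and fin: "\<And>N. finite (B N)"
    and q0: "\<And>N m. m \<notin> B N \<Longrightarrow> q N m = 0" and q1: "\<And>N m. \<bar>q N m\<bar> \<le> 1" and ql: "\<And>m. (\<lambda>N. q N m) \<longlonglongrightarrow> 1"
  shows "(\<lambda>N. \<Sum>m\<in>B N. q N m * c m) \<longlonglongrightarrow> infsum c UNIV"
proof -
  have abs: "Infinite_Set_Sum.abs_summable_on c UNIV"
    using s by (simp add: abs_summable_equivalent[symmetric])
  hence int: "integrable (count_space UNIV) c" by (simp add: Infinite_Set_Sum.abs_summable_on_def)
  have "(\<lambda>N. integral\<^sup>L (count_space UNIV) (\<lambda>m. q N m * c m)) \<longlonglongrightarrow> integral\<^sup>L (count_space UNIV) c"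
  proof (rule integral_dominated_convergence[where w = "\<lambda>m. \<bar>c m\<bar>"])
    show "integrable (count_space UNIV) (\<lambda>m. \<bar>c m\<bar>)" using int by simp
    show "AE m in count_space UNIV. (\<lambda>N. q N m * c m) \<longlonglongrightarrow> c m"
      using tendsto_mult[OF ql tendsto_const] by (intro AE_I2) fastforce
    show "AE m in count_space UNIV. norm (q N m * c m) \<le> \<bar>c m\<bar>" for N
      using q1 by (intro AE_I2) (simp add: abs_mult mult_left_le_one_le)
  qed auto
  moreover have "integral\<^sup>L (count_space UNIV) (\<lambda>m. q N m * c m) = (\<Sum>m\<in>B N. q N m * c m)" for N
  proof -
    have sub: "{m. q N m * c m \<noteq> 0} \<subseteq> B N" using q0 by auto
    have "integral\<^sup>L (count_space UNIV) (\<lambda>m. q N m * c m) = (\<Sum>m | q N m * c m \<noteq> 0. q N m * c m)"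
      using lebesgue_integral_count_space_finite_support[of UNIV "\<lambda>m. q N m * c m"] finite_subset[OF sub fin] by simp
    also have "\<dots> = (\<Sum>m\<in>B N. q N m * c m)" by (rule sum.mono_neutral_left[OF fin sub]) auto
    finally show ?thesis .
  qed
  moreover have "integral\<^sup>L (count_space UNIV) c = infsum c UNIV"
    using infsetsum_infsum[OF abs] by (simp add: infsetsum_def)
  ultimately show ?thesis by simp
qed

section \<open>Regularity, summability and the summation formula for the ellipsoid\<close>

lemma psi_lipschitz: "s \<le> t \<Longrightarrow> s' \<le> t \<Longrightarrow> t \<ge> 0 \<Longrightarrow> \<bar>psi s - psi s'\<bar> \<le> t * \<bar>s - s'\<bar>"
proof -
  assume a: "s \<le> t" "s' \<le> t" "t \<ge> 0"
  define p where "p = max s 0"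
  define p' where "p' = max s' 0"
  have "psi s - psi s' = (p - p') * ((p + p') / 2)" unfolding psi_def p_def p'_def by (simp add: power2_eq_square field_simps)
  moreover have "\<bar>(p + p') / 2\<bar> = (p + p') / 2" by (simp add: p_def p'_def)
  ultimately have "\<bar>psi s - psi s'\<bar> = \<bar>p - p'\<bar> * ((p + p') / 2)" by (simp only: abs_mult)
  also have "\<dots> \<le> \<bar>s - s'\<bar> * t" using a by (intro mult_mono) (auto simp: p_def p'_def)
  finally show ?thesis by (simp add: mult.commute)
qed

text \<open>A quadratic is not Lipschitz on all reals, but the kernel vanishes for |v| \<ge> R.
  Clamping v to [-R, R] therefore changes nothing, and it bounds |v + v'| by 2R.\<close>

lemma psi_quadratic_lipschitz:
  assumes c: "c > 0" and R: "R \<ge> 0" "c * R\<^sup>2 \<ge> t" and t: "t \<ge> 0" and A: "A \<le> t"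
  shows "\<bar>psi (A - c * v\<^sup>2) - psi (A - c * v'\<^sup>2)\<bar> \<le> (2 * t * c * R) * \<bar>v - v'\<bar>"
    and "\<bar>v\<bar> > R \<Longrightarrow> psi (A - c * v\<^sup>2) = 0"
proof -
  define cl where "cl v = max (- R) (min R v)" for v
  have neg: "A - c * v\<^sup>2 \<le> 0" if "\<bar>v\<bar> \<ge> R" for v
  proof -
    have "R\<^sup>2 \<le> v\<^sup>2" using that R(1) power_mono[of R "\<bar>v\<bar>" 2] by simp
    hence "c * R\<^sup>2 \<le> c * v\<^sup>2" using c by simp
    thus ?thesis using R(2) A by linarith
  qed
  show "psi (A - c * v\<^sup>2) = 0" if "\<bar>v\<bar> > R" using neg[of v] that by (simp add: psi_def max_absorb2)
  have cl: "psi (A - c * v\<^sup>2) = psi (A - c * (cl v)\<^sup>2)" for v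
  proof (cases "\<bar>v\<bar> \<ge> R")
    case True
    have "\<bar>cl v\<bar> \<ge> R" using True R(1) by (auto simp: cl_def)
    thus ?thesis using neg[OF True] neg[of "cl v"] by (simp add: psi_def max_absorb2)
  next
    case False
    hence "cl v = v" by (auto simp: cl_def)
    thus ?thesis by simp
  qed
  have lt: "A - c * u\<^sup>2 \<le> t" for u
  proof -
    have "0 \<le> c * u\<^sup>2" using c by simp
    thus ?thesis using A by linarith
  qed
  have "\<bar>psi (A - c * v\<^sup>2) - psi (A - c * v'\<^sup>2)\<bar> \<le> t * \<bar>(A - c * (cl v)\<^sup>2) - (A - c * (cl v')\<^sup>2)\<bar>"
    unfolding cl[of v] cl[of v'] by (rule psi_lipschitz[OF lt lt t])
  also have "(A - c * (cl v)\<^sup>2) - (A - c * (cl v')\<^sup>2) = c * ((cl v' - cl v) * (cl v' + cl v))"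
    by (simp add: power2_eq_square algebra_simps)
  also have "\<bar>\<dots>\<bar> = c * (\<bar>cl v' - cl v\<bar> * \<bar>cl v' + cl v\<bar>)" using c by (simp add: abs_mult)
  also have "t * \<dots> \<le> t * (c * (\<bar>v - v'\<bar> * (2 * R)))"
    using t c R(1) by (intro mult_left_mono mult_mono) (auto simp: cl_def)
  finally show "\<bar>psi (A - c * v\<^sup>2) - psi (A - c * v'\<^sup>2)\<bar> \<le> (2 * t * c * R) * \<bar>v - v'\<bar>" by (simp add: mult_ac)
qed

lemma ellipsoid_lip3:
  assumes a: "a > 0" and t: "t > 0" and R: "(1 / a) * (real R)\<^sup>2 \<ge> t" "a\<^sup>2 * (real R)\<^sup>2 \<ge> t"
  shows "lip3 (real R) (2 * t * (1 / a) * R + 2 * t * a\<^sup>2 * R) (\<lambda>x y z. psi (t - ((x\<^sup>2 + y\<^sup>2) / a + a\<^sup>2 * z\<^sup>2)))"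
proof -
  define L1 where "L1 = 2 * t * (1 / a) * R"
  define L2 where "L2 = 2 * t * a\<^sup>2 * R"
  have L: "L1 \<ge> 0" "L2 \<ge> 0" using a t by (auto simp: L1_def L2_def)
  have ap: "1 / a > 0" "a\<^sup>2 > 0" using a by auto
  have ax: "t - ((x\<^sup>2 + y\<^sup>2) / a + a\<^sup>2 * z\<^sup>2) = (t - (1 / a * y\<^sup>2 + a\<^sup>2 * z\<^sup>2)) - 1 / a * x\<^sup>2" for x y z by (simp add: add_divide_distrib)
  have ay: "t - ((x\<^sup>2 + y\<^sup>2) / a + a\<^sup>2 * z\<^sup>2) = (t - (1 / a * x\<^sup>2 + a\<^sup>2 * z\<^sup>2)) - 1 / a * y\<^sup>2" for x y z by (simp add: add_divide_distrib)
  have az: "t - ((x\<^sup>2 + y\<^sup>2) / a + a\<^sup>2 * z\<^sup>2) = (t - (1 / a * x\<^sup>2 + 1 / a * y\<^sup>2)) - a\<^sup>2 * z\<^sup>2" for x y z by (simp add: add_divide_distrib)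
  have le: "t - (c * x\<^sup>2 + d * y\<^sup>2) \<le> t" if "c > 0" "d > 0" for c d x y :: real
  proof -
    have "0 \<le> c * x\<^sup>2" "0 \<le> d * y\<^sup>2" using that by auto
    thus ?thesis by linarith
  qed
  note le1 = le[OF ap(1) ap(2)] and le2 = le[OF ap(1) ap(1)]
  have t0: "t \<ge> 0" using t by simp
  have w: "L1 * \<bar>d\<bar> \<le> (L1 + L2) * \<bar>d\<bar>" "L2 * \<bar>d\<bar> \<le> (L1 + L2) * \<bar>d\<bar>" for d using L by (auto intro!: mult_right_mono)
  show ?thesis unfolding L1_def[symmetric] L2_def[symmetric] lip3_def
  proof (intro conjI allI impI)
    fix x x' y z
    show "\<bar>psi (t - ((x\<^sup>2 + y\<^sup>2) / a + a\<^sup>2 * z\<^sup>2)) - psi (t - ((x'\<^sup>2 + y\<^sup>2) / a + a\<^sup>2 * z\<^sup>2))\<bar> \<le> (L1 + L2) * \<bar>x - x'\<bar>"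
      unfolding ax using psi_quadratic_lipschitz(1)[OF ap(1) of_nat_0_le_iff R(1) t0 le1, of y z x x'] w(1)[of "x - x'"] unfolding L1_def by linarith
    fix y' z'
    show "\<bar>psi (t - ((x\<^sup>2 + y\<^sup>2) / a + a\<^sup>2 * z\<^sup>2)) - psi (t - ((x\<^sup>2 + y'\<^sup>2) / a + a\<^sup>2 * z\<^sup>2))\<bar> \<le> (L1 + L2) * \<bar>y - y'\<bar>"
      unfolding ay using psi_quadratic_lipschitz(1)[OF ap(1) of_nat_0_le_iff R(1) t0 le1, of x z y y'] w(1)[of "y - y'"] unfolding L1_def by linarith
    show "\<bar>psi (t - ((x\<^sup>2 + y\<^sup>2) / a + a\<^sup>2 * z\<^sup>2)) - psi (t - ((x\<^sup>2 + y\<^sup>2) / a + a\<^sup>2 * z'\<^sup>2))\<bar> \<le> (L1 + L2) * \<bar>z - z'\<bar>"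
      unfolding az using psi_quadratic_lipschitz(1)[OF ap(2) of_nat_0_le_iff R(2) t0 le2, of x y z z'] w(2)[of "z - z'"] unfolding L2_def by linarith
    assume "\<bar>x\<bar> > real R \<or> \<bar>y\<bar> > real R \<or> \<bar>z\<bar> > real R"
    thus "psi (t - ((x\<^sup>2 + y\<^sup>2) / a + a\<^sup>2 * z\<^sup>2)) = 0"
      using psi_quadratic_lipschitz(2)[OF ap(1) of_nat_0_le_iff R(1) t0 le1, of x y z, folded ax]
        psi_quadratic_lipschitz(2)[OF ap(1) of_nat_0_le_iff R(1) t0 le1, of y x z, folded ay]
        psi_quadratic_lipschitz(2)[OF ap(2) of_nat_0_le_iff R(2) t0 le2, of z x y, folded az] by blast
  qed
qed

lemma gf_bound:
  assumes w: "\<omega> > 0" and t: "t \<ge> 0"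
  shows "\<bar>gf \<omega> t\<bar> \<le> 16 * pi * (15 / \<omega> ^ 7 + 6 * t / \<omega> ^ 5 + 15 * sqrt t / \<omega> ^ 6 + t * sqrt t / \<omega> ^ 4)"
proof -
  have m: "\<bar>p * s\<bar> \<le> q" if "\<bar>p\<bar> \<le> q" "\<bar>s\<bar> \<le> 1" for p q s :: real
    using mult_mono[OF that] that by (simp add: abs_mult)
  have "\<bar>gf \<omega> t\<bar> = 16 * pi * \<bar>(15 / \<omega> ^ 7 - 6 * t / \<omega> ^ 5) * sin (\<omega> * sqrt t) - (15 * sqrt t / \<omega> ^ 6 - t * sqrt t / \<omega> ^ 4) * cos (\<omega> * sqrt t)\<bar>"
    unfolding gf_def by (simp add: abs_mult)
  also have "\<dots> \<le> 16 * pi * ((15 / \<omega> ^ 7 + 6 * t / \<omega> ^ 5) + (15 * sqrt t / \<omega> ^ 6 + t * sqrt t / \<omega> ^ 4))"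
    by (intro mult_left_mono order_trans[OF abs_triangle_ineq4] add_mono m abs_sin_le_one abs_cos_le_one) (use w t in auto)
  finally show ?thesis by (simp add: add.assoc)
qed

lemma sum_int_powr_bounded: "\<exists>G. \<forall>B. (\<Sum>j=-int B..int B. (1 + \<bar>real_of_int j\<bar>) powr (-4/3)) \<le> G"
proof -
  have "summable (\<lambda>n. real n powr (-4/3))" by (subst summable_real_powr_iff) simp
  hence "summable (\<lambda>n. real (Suc n) powr (-4/3))" by (subst summable_Suc_iff)
  then obtain s where s: "\<And>n. (\<Sum>k<n. real (Suc k) powr (-4/3)) \<le> s"
    by (metis sum_le_suminf[OF _ finite_lessThan] powr_ge_zero)
  have "(\<Sum>j=-int B..int B. (1 + \<bar>real_of_int j\<bar>) powr (-4/3)) \<le> 2 * s" for B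
  proof -
    have "{-int B..int B} \<subseteq> {0..int B} \<union> (\<lambda>j. - j) ` {0..int B}"
    proof
      fix j assume "j \<in> {-int B..int B}"
      thus "j \<in> {0..int B} \<union> (\<lambda>j. - j) ` {0..int B}" by (cases "j \<ge> 0") (auto intro!: image_eqI[of _ _ "-j"])
    qed
    hence "(\<Sum>j=-int B..int B. (1 + \<bar>real_of_int j\<bar>) powr (-4/3)) \<le> (\<Sum>j\<in>{0..int B} \<union> (\<lambda>j. - j) ` {0..int B}. (1 + \<bar>real_of_int j\<bar>) powr (-4/3))"
      by (intro sum_mono2) auto
    also have "\<dots> \<le> (\<Sum>j\<in>{0..int B}. (1 + \<bar>real_of_int j\<bar>) powr (-4/3)) + (\<Sum>j\<in>(\<lambda>j. - j) ` {0..int B}. (1 + \<bar>real_of_int j\<bar>) powr (-4/3))"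
      by (subst sum.union_inter[symmetric]) (auto intro!: sum_nonneg)
    also have "(\<Sum>j\<in>(\<lambda>j. - j) ` {0..int B}. (1 + \<bar>real_of_int j\<bar>) powr (-4/3)) = (\<Sum>j\<in>{0..int B}. (1 + \<bar>real_of_int j\<bar>) powr (-4/3))"
      by (subst sum.reindex) (auto simp: inj_on_def)
    also have "(\<Sum>j\<in>{0..int B}. (1 + \<bar>real_of_int j\<bar>) powr (-4/3)) = (\<Sum>k<Suc B. real (Suc k) powr (-4/3))"
      by (rule sum.reindex_bij_witness[of _ int nat]) (auto simp: add.commute)
    finally show ?thesis using s[of "Suc B"] by linarith
  qed
  thus ?thesis by blast
qed

text \<open>Off the origin the terms are O(\<kappa>^(-4)), and \<kappa> is at least a constant times
  the largest of |j|, |k|, |l|. Splitting the exponent 4 as 3 * 4/3 bounds each term by a product of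
  three powers (1 + |.|)^(-4/3), one for each index, each of them summable.\<close>

lemma gg_summable:
  assumes a: "a > 0" and t: "t > 0"
  shows "(\<lambda>(j::int,k::int,l::int). \<bar>gg (sqrt (a * ((real_of_int j)\<^sup>2 + (real_of_int k)\<^sup>2) + (real_of_int l / a)\<^sup>2)) t\<bar>) summable_on UNIV"
proof -
  define kp where "kp = (\<lambda>(j::int,k::int,l::int). sqrt (a * ((real_of_int j)\<^sup>2 + (real_of_int k)\<^sup>2) + (real_of_int l / a)\<^sup>2))"
  define k0 where "k0 = min (sqrt a) (1 / a)"
  have k0: "k0 > 0" using a by (simp add: k0_def)
  define P where "P = (\<lambda>(j::int,k::int,l::int). (1 + \<bar>real_of_int j\<bar>) powr (-4/3) * ((1 + \<bar>real_of_int k\<bar>) powr (-4/3) * (1 + \<bar>real_of_int l\<bar>) powr (-4/3)))"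
  define w0 where "w0 = 2 * pi * k0"
  have w0: "w0 > 0" using k0 by (simp add: w0_def)
  \<comment> \<open>Off the origin 2 pi \<kappa> \<ge> \<open>w0\<close>, so powers of 1/w beyond
    the fourth are paid with \<open>w0\<close>.\<close>
  define C where "C = 16 * pi * (15 / w0 ^ 3 + 6 * t / w0 + 15 * sqrt t / w0\<^sup>2 + t * sqrt t)"
  have C0: "C \<ge> 0" unfolding C_def using w0 t by simp
  have low: "k0 * max (max \<bar>real_of_int j\<bar> \<bar>real_of_int k\<bar>) \<bar>real_of_int l\<bar> \<le> kp (j,k,l)" for j k l
  proof -
    have 1: "k0 * \<bar>u\<bar> \<le> sqrt (a * (u\<^sup>2 + v\<^sup>2) + w\<^sup>2)" for u v w
    proof -
      have "k0 * \<bar>u\<bar> \<le> sqrt a * \<bar>u\<bar>" by (intro mult_right_mono) (auto simp: k0_def)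
      also have "\<dots> = sqrt (a * u\<^sup>2)" by (simp add: real_sqrt_mult)
      also have "\<dots> \<le> sqrt (a * (u\<^sup>2 + v\<^sup>2) + w\<^sup>2)" using a by (intro real_sqrt_le_mono) (simp add: distrib_left)
      finally show ?thesis .
    qed
    have 2: "k0 * \<bar>w\<bar> \<le> sqrt (a * (u\<^sup>2 + v\<^sup>2) + (w / a)\<^sup>2)" for u v w
    proof -
      have "k0 * \<bar>w\<bar> \<le> 1 / a * \<bar>w\<bar>" by (intro mult_right_mono) (auto simp: k0_def)
      also have "\<dots> = sqrt ((w / a)\<^sup>2)" using a by simp
      also have "\<dots> \<le> sqrt (a * (u\<^sup>2 + v\<^sup>2) + (w / a)\<^sup>2)" using a by (intro real_sqrt_le_mono) simp
      finally show ?thesis .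
    qed
    show ?thesis using 1[of "real_of_int j" "real_of_int k" "real_of_int l / a"] 1[of "real_of_int k" "real_of_int j" "real_of_int l / a"] 2[of "real_of_int l" "real_of_int j" "real_of_int k"]
      by (auto simp: kp_def max_def add.commute)
  qed
  have bound: "\<bar>gg (kp m) t\<bar> \<le> (C * (1 / pi) ^ 4 / k0 ^ 4) * P m" if m: "m \<noteq> (0,0,0)" for m
  proof -
    obtain j k l where mm: "m = (j,k,l)" by (metis prod_cases3)
    define M where "M = max (max \<bar>real_of_int j\<bar> \<bar>real_of_int k\<bar>) \<bar>real_of_int l\<bar>"
    have M1: "M \<ge> 1"
    proof -
      have "j \<noteq> 0 \<or> k \<noteq> 0 \<or> l \<noteq> 0" using m mm by auto
      moreover have "\<bar>real_of_int i\<bar> \<ge> 1" if "i \<noteq> 0" for i using that by (metis of_int_1_le_iff of_int_abs int_one_le_iff_zero_less zero_less_abs_iff)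
      ultimately show ?thesis unfolding M_def by (metis le_max_iff_disj)
    qed
    have kM: "k0 * M \<le> kp m" using low unfolding M_def mm .
    have "k0 * 1 \<le> k0 * M" using M1 k0 by (intro mult_left_mono) auto
    hence kk: "k0 \<le> kp m" using kM by linarith
    hence kpos: "kp m > 0" using k0 by linarith
    define w where "w = 2 * pi * kp m"
    have w: "w \<ge> w0" "w > 0" using kk kpos by (auto simp: w_def w0_def)
    have "\<bar>gg (kp m) t\<bar> = \<bar>gf w t\<bar>" using kpos by (simp add: gg_def w_def)
    also have "\<dots> \<le> 16 * pi * (15 / w ^ 7 + 6 * t / w ^ 5 + 15 * sqrt t / w ^ 6 + t * sqrt t / w ^ 4)"
      by (rule gf_bound) (use w t in auto)
    also have "\<dots> \<le> 16 * pi * ((15 / w0 ^ 3) / w ^ 4 + (6 * t / w0) / w ^ 4 + (15 * sqrt t / w0\<^sup>2) / w ^ 4 + t * sqrt t / w ^ 4)"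
    proof -
      have p: "w0 ^ 3 * w ^ 4 \<le> w ^ 7" "w0 * w ^ 4 \<le> w ^ 5" "w0\<^sup>2 * w ^ 4 \<le> w ^ 6"
      proof -
        have e: "w ^ 7 = w ^ 3 * w ^ 4" "w ^ 5 = w * w ^ 4" "w ^ 6 = w\<^sup>2 * w ^ 4" by (simp_all add: eval_nat_numeral)
        show "w0 ^ 3 * w ^ 4 \<le> w ^ 7" "w0 * w ^ 4 \<le> w ^ 5" "w0\<^sup>2 * w ^ 4 \<le> w ^ 6"
          unfolding e using w w0 by (intro mult_right_mono power_mono; simp)+
      qed
      have "15 / w ^ 7 \<le> 15 / (w0 ^ 3 * w ^ 4)" "6 * t / w ^ 5 \<le> 6 * t / (w0 * w ^ 4)" "15 * sqrt t / w ^ 6 \<le> 15 * sqrt t / (w0\<^sup>2 * w ^ 4)"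
        using p w w0 t by (auto intro!: divide_left_mono mult_pos_pos)
      thus ?thesis by (intro mult_left_mono add_mono) auto
    qed
    also have "\<dots> = C / w ^ 4" by (simp only: C_def add_divide_distrib[symmetric] times_divide_eq_right)
    also have "\<dots> = C * (1 / pi) ^ 4 * (1 / (2 * kp m) ^ 4)" by (simp add: w_def power_mult_distrib power_one_over field_simps)
    also have "\<dots> \<le> C * (1 / pi) ^ 4 * (P m / k0 ^ 4)"
    proof (intro mult_left_mono)
      have e: "(1 + \<bar>real_of_int i\<bar>) powr (-4/3) \<ge> (2 * kp m / k0) powr (-4/3)" if "\<bar>real_of_int i\<bar> \<le> M" for i
      proof (rule powr_mono2')
        have "1 + \<bar>real_of_int i\<bar> \<le> 2 * M" using that M1 by linarith
        also have "\<dots> \<le> 2 * kp m / k0" using kM k0 by (simp add: pos_le_divide_eq mult_ac)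
        finally show "1 + \<bar>real_of_int i\<bar> \<le> 2 * kp m / k0" .
      qed auto
      define u where "u = (2 * kp m / k0) powr (-4/3)"
      have u0: "u \<ge> 0" by (simp add: u_def)
      have b: "2 * kp m / k0 > 0" using kpos k0 by simp
      have "u * (u * u) = (2 * kp m / k0) powr (-4)" unfolding u_def by (simp flip: powr_add)
      also have "\<dots> = 1 / (2 * kp m / k0) ^ 4" using b by (simp add: powr_minus_divide)
      finally have uu: "1 / (2 * kp m / k0) ^ 4 = u * (u * u)" ..
      have "u * (u * u) \<le> P m" unfolding P_def mm prod.case u_def
        by (intro mult_mono e[unfolded mm]) (auto simp: M_def)
      hence "1 / (2 * kp m / k0) ^ 4 \<le> P m" unfolding uu .
      thus "1 / (2 * kp m) ^ 4 \<le> P m / k0 ^ 4" using k0 by (simp add: power_divide pos_le_divide_eq)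
    qed (use C0 in auto)
    finally show ?thesis by (simp add: mult_ac)
  qed
  obtain G where G: "\<And>B. (\<Sum>j=-int B..int B. (1 + \<bar>real_of_int j\<bar>) powr (-4/3)) \<le> G" using sum_int_powr_bounded by blast
  have P0: "P m \<ge> 0" for m by (auto simp: P_def split: prod.split)
  have "P summable_on UNIV"
  proof (rule nonneg_bdd_above_summable_on)
    show "bdd_above (sum P ` {F. F \<subseteq> UNIV \<and> finite F})"
    proof (rule bdd_aboveI2[where M = "G * (G * G)"])
      fix F :: "(int \<times> int \<times> int) set" assume "F \<in> {F. F \<subseteq> UNIV \<and> finite F}"
      hence fF: "finite F" by simp
      define B where "B = nat (Max (insert 0 ((\<lambda>(j,k,l). max (max \<bar>j\<bar> \<bar>k\<bar>) \<bar>l\<bar>) ` F)))"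
      define I where "I = {-int B..int B}"
      have FB: "F \<subseteq> I \<times> I \<times> I"
      proof
        fix m assume m: "m \<in> F"
        obtain j k l where mm: "m = (j,k,l)" by (metis prod_cases3)
        have "max (max \<bar>j\<bar> \<bar>k\<bar>) \<bar>l\<bar> \<le> Max (insert 0 ((\<lambda>(j,k,l). max (max \<bar>j\<bar> \<bar>k\<bar>) \<bar>l\<bar>) ` F))"
          using m mm fF by (intro Max_ge) force+
        hence "max (max \<bar>j\<bar> \<bar>k\<bar>) \<bar>l\<bar> \<le> int B" unfolding B_def by linarith
        thus "m \<in> I \<times> I \<times> I" unfolding mm I_def by auto
      qed
      have "sum P F \<le> sum P (I \<times> I \<times> I)" by (rule sum_mono2) (use FB P0 in \<open>auto simp: I_def\<close>)
      also have "\<dots> = (\<Sum>j\<in>I. (1 + \<bar>real_of_int j\<bar>) powr (-4/3)) * ((\<Sum>j\<in>I. (1 + \<bar>real_of_int j\<bar>) powr (-4/3)) * (\<Sum>j\<in>I. (1 + \<bar>real_of_int j\<bar>) powr (-4/3)))"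
      proof -
        define g where "g j = (1 + \<bar>real_of_int j\<bar>) powr (-4/3)" for j
        have "(\<Sum>j\<in>I. g j) * ((\<Sum>k\<in>I. g k) * (\<Sum>l\<in>I. g l)) = (\<Sum>j\<in>I. \<Sum>k\<in>I. \<Sum>l\<in>I. g j * (g k * g l))"
          unfolding sum_product by (simp only: sum_distrib_left sum_distrib_right)
        also have "\<dots> = (\<Sum>(j,k,l)\<in>I \<times> I \<times> I. g j * (g k * g l))" by (simp add: sum.cartesian_product)
        finally show ?thesis unfolding P_def g_def ..
      qed
      also have "\<dots> \<le> G * (G * G)"
      proof -
        have s0: "0 \<le> (\<Sum>j\<in>I. (1 + \<bar>real_of_int j\<bar>) powr (-4/3))" by (intro sum_nonneg) auto
        have sG: "(\<Sum>j\<in>I. (1 + \<bar>real_of_int j\<bar>) powr (-4/3)) \<le> G" using G unfolding I_def .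
        show ?thesis by (intro mult_mono sG s0 mult_nonneg_nonneg order_trans[OF s0 sG])
      qed
      finally show "sum P F \<le> G * (G * G)" .
    qed
  qed (use P0 in auto)
  hence "(\<lambda>m. (C * (1 / pi) ^ 4 / k0 ^ 4) * P m) summable_on (UNIV - {(0,0,0)})"
    by (intro summable_on_cmult_right) (rule summable_on_subset_banach, auto)
  hence "(\<lambda>m. \<bar>gg (kp m) t\<bar>) summable_on (UNIV - {(0,0,0)})"
    by (rule summable_on_comparison_test) (use bound in auto)
  hence "(\<lambda>m. \<bar>gg (kp m) t\<bar>) summable_on insert (0,0,0) (UNIV - {(0,0,0)})"
    by (subst summable_on_insert_iff)
  also have "insert (0,0,0) (UNIV - {(0,0,0)}) = (UNIV :: (int \<times> int \<times> int) set)" by auto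
  finally show ?thesis by (simp add: kp_def case_prod_unfold)
qed

text \<open>Both sides are limits of one integral against the kernel: its concentration at the
  integers yields the lattice sum, and dominated convergence with the multipliers \<open>qc\<close>
  yields the series of transforms.\<close>

theorem ellipsoid_poisson:
  assumes a: "a > 0" and t: "t > 0" and R: "(1 / a) * (real R)\<^sup>2 \<ge> t" "a\<^sup>2 * (real R)\<^sup>2 \<ge> t"
  shows "((\<lambda>(j::int,k::int,l::int). gg (sqrt (a * ((real_of_int j)\<^sup>2 + (real_of_int k)\<^sup>2) + (real_of_int l / a)\<^sup>2)) t) has_sum
     (\<Sum>k=-int R..int R. \<Sum>j=-int R..int R. \<Sum>i=-int R..int R. psi (t - (((real_of_int i)\<^sup>2 + (real_of_int j)\<^sup>2) / a + a\<^sup>2 * (real_of_int k)\<^sup>2)))) UNIV"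
proof -
  define c where "c = (\<lambda>(j::int,k::int,l::int). gg (sqrt (a * ((real_of_int j)\<^sup>2 + (real_of_int k)\<^sup>2) + (real_of_int l / a)\<^sup>2)) t)"
  define f where "f x y z = psi (t - ((x\<^sup>2 + y\<^sup>2) / a + a\<^sup>2 * z\<^sup>2))" for x y z :: real
  define q where "q N = (\<lambda>(j,k,l). qc N j * qc N k * qc N l)" for N
  define B where "B N = {-int N..int N} \<times> {-int N..int N} \<times> {-int N..int N}" for N
  have lip: "lip3 (real R) (2 * t * (1 / a) * R + 2 * t * a\<^sup>2 * R) f"
    unfolding f_def by (rule ellipsoid_lip3[OF a t R])
  have fb: "\<bar>f x y z\<bar> \<le> t\<^sup>2 / 2" for x y z
  proof -
    have "(x\<^sup>2 + y\<^sup>2) / a + a\<^sup>2 * z\<^sup>2 \<ge> 0" using a by simp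
    hence "max (t - ((x\<^sup>2 + y\<^sup>2) / a + a\<^sup>2 * z\<^sup>2)) 0 \<le> t" using t by simp
    hence "(max (t - ((x\<^sup>2 + y\<^sup>2) / a + a\<^sup>2 * z\<^sup>2)) 0)\<^sup>2 \<le> t\<^sup>2" by (intro power_mono) auto
    thus ?thesis by (simp add: f_def psi_def)
  qed
  have cs: "(\<lambda>m. \<bar>c m\<bar>) summable_on UNIV" using gg_summable[OF a t] by (simp add: c_def case_prod_unfold)
  have "(\<lambda>N. \<Sum>m\<in>B N. q N m * c m) \<longlonglongrightarrow> infsum c UNIV"
  proof (rule sum_dominated_tendsto[OF cs])
    show "finite (B N)" for N by (simp add: B_def)
    show "q N m = 0" if "m \<notin> B N" for N m using that by (auto simp: q_def B_def qc_def split: prod.split)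
    show "\<bar>q N m\<bar> \<le> 1" for N m
    proof -
      obtain j k l where mm: "m = (j,k,l)" by (metis prod_cases3)
      have "qc N j * qc N k * qc N l \<le> 1 * 1 * 1" by (intro mult_mono qc_bounds mult_nonneg_nonneg) auto
      thus ?thesis using qc_bounds(1)[of N] by (simp add: mm q_def abs_mult)
    qed
    show "(\<lambda>N. q N m) \<longlonglongrightarrow> 1" for m
    proof -
      obtain j k l where mm: "m = (j,k,l)" by (metis prod_cases3)
      have "(\<lambda>N. qc N j * qc N k * qc N l) \<longlonglongrightarrow> 1 * 1 * 1" by (intro tendsto_mult qc_tendsto)
      thus ?thesis by (simp add: mm q_def)
    qed
  qed
  moreover have "(\<Sum>m\<in>B N. q N m * c m) = (LBINT z. vk N z * (LBINT y. vk N y * (LBINT x. vk N x * f x y z)))" for N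
    unfolding vk_triple_expand[OF lip fb] B_def
  proof (intro sum.cong refl)
    fix m assume "m \<in> {-int N..int N} \<times> {-int N..int N} \<times> {-int N..int N}"
    obtain j k l where mm: "m = (j,k,l)" by (metis prod_cases3)
    show "q N m * c m = (case m of (j, k, l) \<Rightarrow> qc N j * qc N k * qc N l *
        (LBINT z. LBINT y. LBINT x. cos (2 * pi * (real_of_int j * x + real_of_int k * y + real_of_int l * z)) * f x y z))"
      unfolding mm q_def c_def prod.case f_def fourier_ellipsoid[OF a t] ..
  qed
  ultimately have "(\<lambda>N. LBINT z. vk N z * (LBINT y. vk N y * (LBINT x. vk N x * f x y z))) \<longlonglongrightarrow> infsum c UNIV" by simp
  hence "infsum c UNIV = (\<Sum>k=-int R..int R. \<Sum>j=-int R..int R. \<Sum>i=-int R..int R. f i j k)"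
    using vk_triple_tendsto[OF lip] by (rule LIMSEQ_unique)
  moreover have "c summable_on UNIV" using cs abs_summable_summable[of c UNIV] by simp
  ultimately show ?thesis unfolding c_def[symmetric] f_def using has_sum_infsum by fastforce
qed

section \<open>The mean square of the number of representations as a sum of two squares\<close>

definition r2 :: "nat \<Rightarrow> nat" where
  "r2 n = card {(i::int, j::int). i\<^sup>2 + j\<^sup>2 = int n}"

lemma sq_le_imp_abs_le: 
  fixes i :: int assumes "i\<^sup>2 \<le> int n" shows "i \<in> {- int n..int n}"
proof -
  have "\<bar>i\<bar> \<le> i\<^sup>2" by (metis abs_ge_zero abs_le_square_iff abs_mult_self_eq int_one_le_iff_zero_less mult.right_neutral mult_left_mono power2_abs power2_eq_square zero_less_abs_iff abs_0 order_refl mult_zero_left)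
  thus ?thesis using assms by auto
qed

lemma finite_r2: "finite {(i::int, j::int). i\<^sup>2 + j\<^sup>2 = int n}"
proof (rule finite_subset)
  show "{(i::int, j::int). i\<^sup>2 + j\<^sup>2 = int n} \<subseteq> {- int n..int n} \<times> {- int n..int n}"
    by (auto simp del: atLeastAtMost_iff intro!: sq_le_imp_abs_le) (metis add.commute le_add_same_cancel2 zero_le_power2)+
qed auto

text \<open>Passing from K to K + 1 adds 2K + 1 terms equal to 1/(K + 1), together less than
  2.\<close>

lemma sum_inv_max_le: "(\<Sum>p=1..K. \<Sum>s=1..K. 1 / real (max p s)) \<le> 2 * real K"
proof (induction K)
  case (Suc K)
  define f where "f p s = 1 / real (max p s)" for p s :: nat
  have a: "(\<Sum>p=1..K. f p (Suc K)) = (\<Sum>p=1..K. 1 / real (Suc K))"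
    by (intro sum.cong) (auto simp: max_def f_def)
  have b: "(\<Sum>s=1..Suc K. f (Suc K) s) = (\<Sum>s=1..Suc K. 1 / real (Suc K))"
    by (intro sum.cong) (auto simp: max_def f_def)
  have c: "(\<Sum>s=1..Suc K. f p s) = (\<Sum>s=1..K. f p s) + f p (Suc K)" for p by simp
  have "(\<Sum>p=1..Suc K. \<Sum>s=1..Suc K. f p s) = (\<Sum>p=1..K. \<Sum>s=1..Suc K. f p s) + (\<Sum>s=1..Suc K. f (Suc K) s)"
    by (rule sum.cl_ivl_Suc[THEN trans]) simp
  also have "(\<Sum>p=1..K. \<Sum>s=1..Suc K. f p s) = (\<Sum>p=1..K. \<Sum>s=1..K. f p s) + (\<Sum>p=1..K. f p (Suc K))"
    unfolding c by (rule sum.distrib)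
  finally have "(\<Sum>p=1..Suc K. \<Sum>s=1..Suc K. f p s) = (\<Sum>p=1..K. \<Sum>s=1..K. f p s) + real K * (1 / real (Suc K)) + real (Suc K) * (1 / real (Suc K))"
    unfolding a b by (simp only: sum_constant card_atLeastAtMost diff_Suc_1)
  moreover have "real K * (1 / real (Suc K)) \<le> 1" "real (Suc K) * (1 / real (Suc K)) = 1" by simp_all
  ultimately have "(\<Sum>p=1..Suc K. \<Sum>s=1..Suc K. f p s) \<le> 2 * real K + 1 + 1" using Suc unfolding f_def by linarith
  thus ?case unfolding f_def by simp
qed simp

lemma harm_le_one_plus_ln: "n \<ge> 1 \<Longrightarrow> harm n \<le> 1 + ln (real n)"
proof -
  assume n: "n \<ge> 1"
  have "harm (Suc (n - 1)) - ln (real (Suc (n - 1))) \<le> harm (Suc 0) - ln (real (Suc 0))"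
    using decseq_harm_diff_ln unfolding decseq_def by blast
  thus ?thesis using n by (simp add: harm_def)
qed

text \<open>With g = gcd p s, the numbers q and t must be the same multiple \<delta> of s/g and p/g,
  and \<delta> is limited by the larger of these two.\<close>

lemma card_fixed_ratio_le:
  fixes p s B :: nat
  assumes p: "p \<ge> 1" and s: "s \<ge> 1"
  shows "real (card {(q, t). q \<in> {1..B} \<and> t \<in> {1..B} \<and> p * q = s * t}) \<le> real B * real (gcd p s) / real (max p s)"
proof -
  define g where "g = gcd p s"
  have g0: "g > 0" using p by (simp add: g_def)
  have "gcd p s \<noteq> 0" using p by simp
  from gcd_coprime_exists[OF this] obtain p' s' where *: "p = p' * gcd p s" "s = s' * gcd p s" "coprime p' s'" by blast
  have ps: "p = p' * g" "s = s' * g" "coprime p' s'" unfolding g_def by (fact *)+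
  have pos: "p' > 0" "s' > 0" using ps(1,2) p s by (cases "p' = 0"; cases "s' = 0"; simp)+
  define m where "m = max p' s'"
  have m0: "m > 0" using pos by (simp add: m_def)
  define S where "S = {(q, t). q \<in> {1..B} \<and> t \<in> {1..B} \<and> p * q = s * t}"
  have form: "\<exists>\<delta>\<in>{1..B div m}. q = s' * \<delta> \<and> t = p' * \<delta>" if "(q, t) \<in> S" for q t
  proof -
    have e: "p' * q = s' * t" using that g0 by (auto simp: S_def ps)
    have "s' dvd p' * q" using e by simp
    hence "s' dvd q" using ps(3) by (simp add: coprime_dvd_mult_right_iff coprime_commute)
    then obtain \<delta> where d: "q = s' * \<delta>" by auto
    have "s' * (p' * \<delta>) = s' * t" using e d by (simp add: mult_ac)
    hence t: "t = p' * \<delta>" using pos by simp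
    have "\<delta> \<ge> 1" using that d by (auto simp: S_def intro: Nat.gr0I)
    moreover have "m * \<delta> \<le> B" using that d t by (auto simp: S_def m_def max_def)
    hence "\<delta> \<le> B div m" using m0 by (simp add: less_eq_div_iff_mult_less_eq mult.commute)
    ultimately show ?thesis using d t by auto
  qed
  have "S \<subseteq> (\<lambda>\<delta>. (s' * \<delta>, p' * \<delta>)) ` {1..B div m}" using form by fast
  hence "card S \<le> card {1..B div m}"
    by (meson card_image_le card_mono finite_atLeastAtMost finite_imageI order_trans)
  hence "real (card S) \<le> real (B div m)" by simp
  also have "\<dots> \<le> real B / real m" by (rule of_nat_div_le_of_nat)
  also have "\<dots> = real B * real g / real (max p s)"
  proof -
    have "max p s = m * g" unfolding ps m_def by (simp add: nat_mult_max_left)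
    thus ?thesis using g0 by simp
  qed
  finally show ?thesis by (simp add: S_def g_def)
qed

text \<open>The gcd is majorised by the sum of all common divisors, which decouples p from s: for
  each divisor d both run over multiples of d. The harmonic sum over d produces the
  logarithm.\<close>

lemma card_prod_eq_prod_le:
  fixes B :: nat
  assumes B: "B \<ge> 1"
  shows "real (card {(p, q, s, t). p \<in> {1..B} \<and> q \<in> {1..B} \<and> s \<in> {1..B} \<and> t \<in> {1..B} \<and> p * q = s * t}) \<le> 2 * (real B)\<^sup>2 * (1 + ln (real B))"
proof -
  define F where "F p s = {(q, t). q \<in> {1..B} \<and> t \<in> {1..B} \<and> p * q = s * t}" for p s
  have finF: "finite (F p s)" for p s unfolding F_def by (rule finite_subset[of _ "{1..B} \<times> {1..B}"]) auto
  define S where "S = (SIGMA ps:{1..B} \<times> {1..B}. F (fst ps) (snd ps))"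
  have "bij_betw (\<lambda>((p, s), (q, t)). (p, q, s, t)) S {(p, q, s, t). p \<in> {1..B} \<and> q \<in> {1..B} \<and> s \<in> {1..B} \<and> t \<in> {1..B} \<and> p * q = s * t}"
    by (rule bij_betwI[where g = "\<lambda>(p, q, s, t). ((p, s), (q, t))"]) (auto simp: S_def F_def)
  hence "card {(p, q, s, t). p \<in> {1..B} \<and> q \<in> {1..B} \<and> s \<in> {1..B} \<and> t \<in> {1..B} \<and> p * q = s * t} = card S"
    by (simp add: bij_betw_same_card)
  also have "card S = (\<Sum>ps\<in>{1..B} \<times> {1..B}. card (F (fst ps) (snd ps)))"
    unfolding S_def by (rule card_SigmaI) (auto simp: finF)
  also have "\<dots> = (\<Sum>p=1..B. \<Sum>s=1..B. card (F p s))" by (simp add: sum.cartesian_product case_prod_unfold)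
  finally have "real (card {(p, q, s, t). p \<in> {1..B} \<and> q \<in> {1..B} \<and> s \<in> {1..B} \<and> t \<in> {1..B} \<and> p * q = s * t}) = (\<Sum>p=1..B. \<Sum>s=1..B. real (card (F p s)))"
    by simp
  also have "\<dots> \<le> (\<Sum>p=1..B. \<Sum>s=1..B. \<Sum>d=1..B. if d dvd p \<and> d dvd s then real B * real d / real (max p s) else 0)"
  proof (intro sum_mono)
    fix p s assume ps: "p \<in> {1..B}" "s \<in> {1..B}"
    have "gcd p s \<in> {1..B}" using ps by (auto intro: order_trans[OF gcd_le1_nat] simp: Suc_le_eq)
    hence "real B * real (gcd p s) / real (max p s) \<le> (\<Sum>d=1..B. if d dvd p \<and> d dvd s then real B * real d / real (max p s) else 0)"
      by (intro order_trans[OF _ member_le_sum[of "gcd p s"]]) auto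
    thus "real (card (F p s)) \<le> (\<Sum>d=1..B. if d dvd p \<and> d dvd s then real B * real d / real (max p s) else 0)"
      using card_fixed_ratio_le[of p s B] ps unfolding F_def by auto
  qed
  also have "\<dots> = (\<Sum>p=1..B. \<Sum>d=1..B. \<Sum>s=1..B. if d dvd p \<and> d dvd s then real B * real d / real (max p s) else 0)"
    by (intro sum.cong refl sum.swap)
  also have "\<dots> = (\<Sum>d=1..B. \<Sum>p=1..B. \<Sum>s=1..B. if d dvd p \<and> d dvd s then real B * real d / real (max p s) else 0)"
    by (rule sum.swap)
  also have "\<dots> \<le> (\<Sum>d=1..B. 2 * (real B)\<^sup>2 * (1 / real d))"
  proof (intro sum_mono)
    fix d assume d: "d \<in> {1..B}"
    have d0: "d > 0" using d by simp
    define K where "K = B div d"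
    have im: "{p\<in>{1..B}. d dvd p} = (\<lambda>k. d * k) ` {1..K}"
    proof (intro set_eqI iffI)
      fix p assume "p \<in> {p\<in>{1..B}. d dvd p}"
      then obtain k where "p = d * k" "1 \<le> d * k" "d * k \<le> B" by auto
      moreover have "k \<ge> 1" using calculation(2) by (cases k) auto
      moreover have "k \<le> K" using calculation(3) d0 by (simp add: K_def less_eq_div_iff_mult_less_eq mult.commute)
      ultimately show "p \<in> (\<lambda>k. d * k) ` {1..K}" by auto
    next
      fix p assume "p \<in> (\<lambda>k. d * k) ` {1..K}"
      then obtain k where k0: "p = d * k" "k \<in> {1..K}" by blast
      hence k: "p = d * k" "1 \<le> k" "k \<le> K" by simp_all
      have "d * k \<le> B" using k(3) d0 by (simp add: K_def less_eq_div_iff_mult_less_eq mult.commute)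
      thus "p \<in> {p\<in>{1..B}. d dvd p}" using k d0 by (auto simp: Suc_le_eq)
    qed
    have red: "(\<Sum>p=1..B. if d dvd p then f p else 0) = (\<Sum>k=1..K. f (d * k))" for f :: "nat \<Rightarrow> real"
    proof -
      have "(\<Sum>p=1..B. if d dvd p then f p else 0) = (\<Sum>p\<in>{p\<in>{1..B}. d dvd p}. f p)"
        by (rule sum.inter_filter[symmetric]) simp
      also have "\<dots> = (\<Sum>k=1..K. f (d * k))" unfolding im
        using d0 by (subst sum.reindex) (auto simp: inj_on_def)
      finally show ?thesis .
    qed
    have "(\<Sum>p=1..B. \<Sum>s=1..B. if d dvd p \<and> d dvd s then real B * real d / real (max p s) else 0)
        = (\<Sum>p=1..B. if d dvd p then (\<Sum>s=1..B. if d dvd s then real B * real d / real (max p s) else 0) else 0)"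
      by (intro sum.cong) auto
    also have "\<dots> = (\<Sum>k=1..K. \<Sum>l=1..K. real B * real d / real (max (d * k) (d * l)))"
      unfolding red ..
    also have "\<dots> = (\<Sum>k=1..K. \<Sum>l=1..K. real B * (1 / real (max k l)))"
      using d0 by (intro sum.cong refl) (simp flip: nat_mult_max_right)
    also have "\<dots> = real B * (\<Sum>k=1..K. \<Sum>l=1..K. 1 / real (max k l))" by (simp add: sum_distrib_left)
    also have "\<dots> \<le> real B * (2 * real K)" by (intro mult_left_mono sum_inv_max_le) auto
    also have "\<dots> \<le> real B * (2 * (real B / real d))" unfolding K_def by (intro mult_left_mono of_nat_div_le_of_nat) auto
    also have "\<dots> = 2 * (real B)\<^sup>2 * (1 / real d)" by (simp add: power2_eq_square)
    finally show "(\<Sum>p=1..B. \<Sum>s=1..B. if d dvd p \<and> d dvd s then real B * real d / real (max p s) else 0) \<le> 2 * (real B)\<^sup>2 * (1 / real d)" .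
  qed
  also have "\<dots> = 2 * (real B)\<^sup>2 * harm B" by (simp add: sum_distrib_left harm_def divide_inverse)
  also have "\<dots> \<le> 2 * (real B)\<^sup>2 * (1 + ln (real B))"
    using harm_le_one_plus_ln[of B] B by (intro mult_left_mono) auto
  finally show ?thesis .
qed

text \<open>Solutions with vanishing products are counted trivially. For the others the signs of p,
  q, s determine that of t, whence 8 copies of the positive count.\<close>

lemma card_signed_prod_eq_prod_le:
  fixes B :: nat
  assumes B: "B \<ge> 1"
  shows "real (card {(p::int, q::int, s::int, t::int). {p,q,s,t} \<subseteq> {-int B..int B} \<and> p * q = s * t}) \<le> (4 * real B + 1)\<^sup>2 + 16 * (real B)\<^sup>2 * (1 + ln (real B))"
proof -
  define I where "I = {-int B..int B}"
  define Z0 where "Z0 = {(p::int, q::int). p \<in> I \<and> q \<in> I \<and> p * q = 0}"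
  define P where "P = {(p::nat, q::nat, s::nat, t::nat). p \<in> {1..B} \<and> q \<in> {1..B} \<and> s \<in> {1..B} \<and> t \<in> {1..B} \<and> p * q = s * t}"
  define N1 where "N1 = {(p::int, q::int, s::int, t::int). {p,q,s,t} \<subseteq> I \<and> p * q = s * t \<and> p * q \<noteq> 0}"
  define N0 where "N0 = {(p::int, q::int, s::int, t::int). {p,q,s,t} \<subseteq> I \<and> p * q = 0 \<and> s * t = 0}"
  have finP: "finite P" unfolding P_def by (rule finite_subset[of _ "{1..B} \<times> {1..B} \<times> {1..B} \<times> {1..B}"]) auto
  have finZ0: "finite Z0" unfolding Z0_def I_def by (rule finite_subset[of _ "{-int B..int B} \<times> {-int B..int B}"]) auto
  have "Z0 \<subseteq> ({0} \<times> I) \<union> ((I - {0}) \<times> {0})" by (auto simp: Z0_def)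
  hence "card Z0 \<le> card (({0::int} \<times> I) \<union> ((I - {0}) \<times> {0::int}))" by (intro card_mono) (auto simp: I_def)
  also have "\<dots> \<le> card ({0::int} \<times> I) + card ((I - {0}) \<times> {0::int})" by (rule card_Un_le)
  also have "\<dots> = 4 * B + 1"
  proof -
    have "card I = 2 * B + 1" by (simp add: I_def)
    moreover have "card (I - {0}) = 2 * B" using \<open>card I = _\<close> by (subst card_Diff_singleton) (auto simp: I_def)
    ultimately show ?thesis by (simp add: card_cartesian_product)
  qed
  finally have cZ0: "card Z0 \<le> 4 * B + 1" .
  have "N0 \<subseteq> (\<lambda>((p,q),(s,t)). (p,q,s,t)) ` (Z0 \<times> Z0)"
    by (auto simp: N0_def Z0_def image_iff)
  hence "card N0 \<le> card (Z0 \<times> Z0)"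
    by (meson card_image_le card_mono finZ0 finite_SigmaI finite_imageI order_trans)
  also have "\<dots> \<le> (4 * B + 1) * (4 * B + 1)" unfolding card_cartesian_product by (rule mult_le_mono[OF cZ0 cZ0])
  finally have c0: "real (card N0) \<le> (4 * real B + 1)\<^sup>2"
    by (metis (mono_tags, opaque_lifting) of_nat_1 of_nat_add of_nat_le_iff of_nat_mult of_nat_numeral power2_eq_square)
  define f where "f = (\<lambda>(p::int, q::int, s::int, t::int). ((sgn p, sgn q, sgn s), (nat \<bar>p\<bar>, nat \<bar>q\<bar>, nat \<bar>s\<bar>, nat \<bar>t\<bar>)))"
  have inj: "inj_on f N1"
  proof (rule inj_onI)
    fix x y assume xy: "x \<in> N1" "y \<in> N1" "f x = f y"
    obtain p q s t where x: "x = (p, q, s, t)" by (metis prod_cases4)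
    obtain p' q' s' t' where y: "y = (p', q', s', t')" by (metis prod_cases4)
    have abs: "\<bar>p\<bar> = \<bar>p'\<bar>" "\<bar>q\<bar> = \<bar>q'\<bar>" "\<bar>s\<bar> = \<bar>s'\<bar>" and sg: "sgn p = sgn p'" "sgn q = sgn q'" "sgn s = sgn s'"
      using xy(3) by (auto simp: x y f_def eq_nat_nat_iff)
    have e: "p = p'" "q = q'" "s = s'" using abs sg by (metis mult_sgn_abs)+
    have "s * t = s * t'" using xy(1,2) e by (auto simp: x y N1_def)
    moreover have "s \<noteq> 0" using xy(1) by (auto simp: x N1_def)
    ultimately show "x = y" using e by (simp add: x y)
  qed
  have img: "f ` N1 \<subseteq> ({-1,1} \<times> {-1,1} \<times> {-1,1}) \<times> P"
  proof
    fix y assume "y \<in> f ` N1"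
    then obtain p q s t where pq: "(p,q,s,t) \<in> N1" "y = f (p,q,s,t)" by auto
    have nz: "p \<noteq> 0" "q \<noteq> 0" "s \<noteq> 0" "t \<noteq> 0" using pq by (auto simp: N1_def)
    have "nat \<bar>p\<bar> * nat \<bar>q\<bar> = nat \<bar>p * q\<bar>" by (simp add: nat_mult_distrib abs_mult)
    also have "\<dots> = nat \<bar>s * t\<bar>" using pq by (simp add: N1_def)
    also have "\<dots> = nat \<bar>s\<bar> * nat \<bar>t\<bar>" by (simp add: nat_mult_distrib abs_mult)
    finally have e: "nat \<bar>p\<bar> * nat \<bar>q\<bar> = nat \<bar>s\<bar> * nat \<bar>t\<bar>" .
    have sg: "sgn w \<in> {-1, 1}" if "w \<noteq> 0" for w :: int using that by (simp add: sgn_if)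
    have rg: "nat \<bar>w\<bar> \<in> {1..B}" if "w \<noteq> 0" "w \<in> I" for w 
    proof -
      have "\<bar>w\<bar> \<le> int B" "\<bar>w\<bar> > 0" using that by (auto simp: I_def)
      thus ?thesis by (simp add: nat_le_iff Suc_le_eq)
    qed
    have "p \<in> I" "q \<in> I" "s \<in> I" "t \<in> I" using pq(1) by (simp_all add: N1_def)
    hence "(nat \<bar>p\<bar>, nat \<bar>q\<bar>, nat \<bar>s\<bar>, nat \<bar>t\<bar>) \<in> P" unfolding P_def using e rg[OF nz(1)] rg[OF nz(2)] rg[OF nz(3)] rg[OF nz(4)] by simp
    thus "y \<in> ({-1,1} \<times> {-1,1} \<times> {-1,1}) \<times> P"
      unfolding pq(2) f_def using sg[OF nz(1)] sg[OF nz(2)] sg[OF nz(3)] by (simp only: prod.case mem_Sigma_iff)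
  qed
  have "card N1 = card (f ` N1)" by (rule card_image[OF inj, symmetric])
  also have "\<dots> \<le> card ((({-1,1}::int set) \<times> ({-1,1}::int set) \<times> ({-1,1}::int set)) \<times> P)"
    by (rule card_mono[OF _ img]) (auto simp: finP)
  also have "\<dots> = 8 * card P" by (simp add: card_cartesian_product)
  finally have "real (card N1) \<le> 8 * real (card P)" by (metis of_nat_le_iff of_nat_mult of_nat_numeral)
  also have "\<dots> \<le> 8 * (2 * (real B)\<^sup>2 * (1 + ln (real B)))"
    using card_prod_eq_prod_le[OF B] unfolding P_def by (intro mult_left_mono) auto
  finally have c1: "real (card N1) \<le> 16 * (real B)\<^sup>2 * (1 + ln (real B))" by simp
  have fin4: "finite (I \<times> I \<times> I \<times> I)" by (simp add: I_def)
  have "N0 \<subseteq> I \<times> I \<times> I \<times> I" "N1 \<subseteq> I \<times> I \<times> I \<times> I"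
    unfolding N0_def N1_def by (simp_all only: subset_iff mem_Collect_eq split_paired_All prod.case mem_Sigma_iff insert_iff empty_iff) blast+
  hence fin: "finite (N0 \<union> N1)" using fin4 by (meson finite_UnI finite_subset)
  have "{(p::int, q::int, s::int, t::int). {p,q,s,t} \<subseteq> I \<and> p * q = s * t} \<subseteq> N0 \<union> N1"
    unfolding N0_def N1_def by (simp only: subset_iff mem_Collect_eq split_paired_All prod.case Un_iff) (simp, blast)
  hence "card {(p::int, q::int, s::int, t::int). {p,q,s,t} \<subseteq> I \<and> p * q = s * t} \<le> card N0 + card N1"
    by (rule order_trans[OF card_mono[OF fin] card_Un_le])
  from of_nat_mono[OF this, where ?'a = real] show ?thesis unfolding I_def[symmetric] of_nat_add using c0 c1 by linarith
qed

text \<open>A pair of representations of the same number, u1^2 + u2^2 = v1^2 + v2^2, factors as (u1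
  - v1)(u1 + v1) = (v2 - u2)(v2 + u2). The map to the four factors is injective, and the factors are
  at most 2 sqrt X in size.\<close>

lemma sum_r2_sq_le:
  fixes X :: real
  assumes X: "X \<ge> 1"
  shows "(\<Sum>n=1..nat \<lfloor>X\<rfloor>. (real (r2 n))\<^sup>2) \<le> 32 * X * (ln X + 6)"
proof -
  define N where "N = nat \<lfloor>X\<rfloor>"
  have NX: "real N \<le> X" using X by (simp add: N_def)
  define R where "R n = {(i::int, j::int). i\<^sup>2 + j\<^sup>2 = int n}" for n
  have fR: "finite (R n)" for n unfolding R_def by (rule finite_r2)
  define B where "B = nat \<lfloor>2 * sqrt X\<rfloor>"
  have B2: "B \<ge> 2" using X by (simp add: B_def le_nat_iff le_floor_iff)
  have BX: "real B \<le> 2 * sqrt X" using X by (simp add: B_def)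
  define Q where "Q = {(p::int, q::int, s::int, t::int). {p,q,s,t} \<subseteq> {-int B..int B} \<and> p * q = s * t}"
  have fQ: "finite Q" unfolding Q_def
    by (rule finite_subset[of _ "{-int B..int B} \<times> {-int B..int B} \<times> {-int B..int B} \<times> {-int B..int B}"]) auto
  define S where "S = (\<Union>n\<in>{1..N}. R n \<times> R n)"
  have "card S = (\<Sum>n=1..N. card (R n \<times> R n))" unfolding S_def
    by (rule card_UN_disjoint) (auto simp: fR, auto simp: R_def)
  also have "\<dots> = (\<Sum>n=1..N. (r2 n)\<^sup>2)"
    by (simp add: card_cartesian_product r2_def R_def power2_eq_square)
  finally have cS: "card S = (\<Sum>n=1..N. (r2 n)\<^sup>2)" .
  define f where "f = (\<lambda>((u1::int, u2::int), (v1::int, v2::int)). (u1 - v1, u1 + v1, v2 - u2, v2 + u2))"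
  have "inj f" by (auto simp: inj_def f_def)
  hence inj: "inj_on f S" by (rule inj_on_subset) simp
  have bnd: "\<bar>x\<bar> + \<bar>y\<bar> \<le> int B" if "x\<^sup>2 \<le> int N" "y\<^sup>2 \<le> int N" for x y :: int
  proof -
    have *: "real_of_int \<bar>w\<bar> \<le> sqrt X" if "w\<^sup>2 \<le> int N" for w :: int
    proof (rule real_le_rsqrt)
      have "real_of_int (w\<^sup>2) \<le> real_of_int (int N)" using that by (simp only: of_int_le_iff)
      thus "(real_of_int \<bar>w\<bar>)\<^sup>2 \<le> X" using NX by simp
    qed
    have "real_of_int (\<bar>x\<bar> + \<bar>y\<bar>) \<le> 2 * sqrt X" using *[OF that(1)] *[OF that(2)] by simp
    hence "\<bar>x\<bar> + \<bar>y\<bar> \<le> \<lfloor>2 * sqrt X\<rfloor>" by (simp only: le_floor_iff)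
    thus ?thesis using X by (simp add: B_def)
  qed
  have "f ` S \<subseteq> Q"
  proof
    fix y assume "y \<in> f ` S"
    then obtain u1 u2 v1 v2 n where n: "n \<in> {1..N}" "u1\<^sup>2 + u2\<^sup>2 = int n" "v1\<^sup>2 + v2\<^sup>2 = int n" and y: "y = (u1 - v1, u1 + v1, v2 - u2, v2 + u2)"
      by (auto simp: S_def R_def f_def)
    have sqs: "u1\<^sup>2 \<le> int N" "u2\<^sup>2 \<le> int N" "v1\<^sup>2 \<le> int N" "v2\<^sup>2 \<le> int N"
    proof -
      have "int n \<le> int N" using n(1) by simp
      thus "u1\<^sup>2 \<le> int N" "u2\<^sup>2 \<le> int N" "v1\<^sup>2 \<le> int N" "v2\<^sup>2 \<le> int N"
        using n(2,3) zero_le_power2[of u1] zero_le_power2[of u2] zero_le_power2[of v1] zero_le_power2[of v2] by linarith+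
    qed
    have "(u1 - v1) * (u1 + v1) = (v2 - u2) * (v2 + u2)" using n by (simp add: algebra_simps power2_eq_square)
    moreover have "\<bar>u1\<bar> + \<bar>v1\<bar> \<le> int B" "\<bar>v2\<bar> + \<bar>u2\<bar> \<le> int B" using sqs by (auto intro!: bnd)
    hence "{u1 - v1, u1 + v1, v2 - u2, v2 + u2} \<subseteq> {-int B..int B}" by auto
    ultimately show "y \<in> Q" unfolding Q_def y by blast
  qed
  hence "card S \<le> card Q" using card_inj_on_le[OF inj] fQ by blast
  hence "(\<Sum>n=1..N. (real (r2 n))\<^sup>2) \<le> real (card Q)" unfolding cS
    by (metis (mono_tags, lifting) of_nat_le_iff of_nat_power of_nat_sum sum.cong)
  also have "\<dots> \<le> (4 * real B + 1)\<^sup>2 + 16 * (real B)\<^sup>2 * (1 + ln (real B))"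
    unfolding Q_def by (rule card_signed_prod_eq_prod_le) (use B2 in simp)
  also have "\<dots> \<le> (9/2 * real B)\<^sup>2 + 16 * (real B)\<^sup>2 * (1 + ln (real B))"
    using B2 by (intro add_right_mono power_mono) auto
  also have "\<dots> = (real B)\<^sup>2 * (145/4 + 16 * ln (real B))" by (simp add: power2_eq_square algebra_simps)
  also have "\<dots> \<le> (2 * sqrt X)\<^sup>2 * (145/4 + 16 * ln (2 * sqrt X))"
    using BX B2 X by (intro mult_mono power_mono add_left_mono mult_left_mono) (auto simp: ln_ge_zero)
  also have "\<dots> = 4 * X * (145/4 + 16 * ln 2 + 8 * ln X)"
    using X by (simp add: ln_mult ln_sqrt power_mult_distrib)
  \<comment> \<open>145/4 + 16 * 0.7 < 48, and 48/8 is the 6 next to the logarithm.\<close>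
  also have "\<dots> \<le> 4 * X * (48 + 8 * ln X)"
  proof -
    have "ln 2 < (0.7::real)" using ln2_le_25_over_36 by simp
    thus ?thesis using X by (intro mult_left_mono) auto
  qed
  also have "\<dots> = 32 * X * (ln X + 6)" by (simp add: algebra_simps)
  finally show ?thesis unfolding N_def .
qed

section \<open>Oscillating sums over boundary layers of frequencies\<close>

text \<open>A single intermediate point serves a whole finite sum of functions at once, which
  matters when that sum oscillates. The mean value theorem is applied to the first difference of f
  and then to f'.\<close>

lemma second_difference_mvt:
  fixes f f' f'' :: "real \<Rightarrow> real"
  assumes h: "0 < h"
    and d1: "\<And>t. x \<le> t \<Longrightarrow> t \<le> x + 2 * h \<Longrightarrow> (f has_real_derivative f' t) (at t)"
    and d2: "\<And>t. x \<le> t \<Longrightarrow> t \<le> x + 2 * h \<Longrightarrow> (f' has_real_derivative f'' t) (at t)"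
  shows "\<exists>\<xi>. x < \<xi> \<and> \<xi> < x + 2 * h \<and> f (x + 2 * h) - 2 * f (x + h) + f x = h\<^sup>2 * f'' \<xi>"
proof -
  define g where "g s = f (s + h) - f s" for s
  have "\<exists>z>x. z < x + h \<and> g (x + h) - g x = (x + h - x) * (f' (z + h) - f' z)"
  proof (rule MVT2)
    show "x < x + h" using h by simp
    fix t assume t: "x \<le> t" "t \<le> x + h"
    have "((\<lambda>s. f (s + h)) has_real_derivative f' (t + h)) (at t)"
      using DERIV_shift[of f "f' (t+h)" t h] d1[of "t+h"] t by (simp add: add.commute)
    thus "(g has_real_derivative f' (t + h) - f' t) (at t)"
      unfolding g_def using d1[of t] t h by (intro DERIV_diff) auto
  qed
  then obtain z where z: "x < z" "z < x + h" "g (x + h) - g x = h * (f' (z + h) - f' z)" by auto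
  have "\<exists>\<xi>>z. \<xi> < z + h \<and> f' (z + h) - f' z = (z + h - z) * f'' \<xi>"
    by (rule MVT2) (use h z d2 in auto)
  then obtain \<xi> where \<xi>: "z < \<xi>" "\<xi> < z + h" "f' (z + h) - f' z = h * f'' \<xi>" by auto
  have "f (x + 2 * h) - 2 * f (x + h) + f x = g (x + h) - g x"
    by (simp add: g_def algebra_simps)
  also have "\<dots> = h\<^sup>2 * f'' \<xi>" unfolding z(3) \<xi>(3) by (simp add: power2_eq_square)
  finally show ?thesis using z \<xi> by (intro exI[of _ \<xi>]) auto
qed

lemma abel_antimono:
  fixes w :: "nat \<Rightarrow> real" and e :: "nat \<Rightarrow> complex"
  assumes AB: "A \<le> B" and w0: "\<And>n. n \<in> {A..B} \<Longrightarrow> w n \<ge> 0"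
    and wm: "\<And>n. n \<in> {A..<B} \<Longrightarrow> w (Suc n) \<le> w n"
    and E: "\<And>K. K \<in> {A..B} \<Longrightarrow> norm (\<Sum>n=A..K. e n) \<le> V"
  shows "norm (\<Sum>n=A..B. of_real (w n) * e n) \<le> w A * V"
proof -
  have "norm ((\<Sum>n=A..K. of_real (w n) * e n) - of_real (w K) * (\<Sum>n=A..K. e n)) \<le> (w A - w K) * V"
    if "A \<le> K" "K \<le> B" for K
    using that
  proof (induction K rule: dec_induct)
    case base show ?case by simp
  next
    case (step K)
    have eq: "(\<Sum>n=A..Suc K. of_real (w n) * e n) - of_real (w (Suc K)) * (\<Sum>n=A..Suc K. e n)
      = ((\<Sum>n=A..K. of_real (w n) * e n) - of_real (w K) * (\<Sum>n=A..K. e n)) + of_real (w K - w (Suc K)) * (\<Sum>n=A..K. e n)"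
      using step by (simp add: algebra_simps)
    have "norm (of_real (w K - w (Suc K)) * (\<Sum>n=A..K. e n)) \<le> (w K - w (Suc K)) * V"
    proof -
      have "norm (of_real (w K - w (Suc K)) :: complex) = w K - w (Suc K)"
        using wm[of K] step by (simp only: norm_of_real) simp
      thus ?thesis unfolding norm_mult using wm[of K] E[of K] step by (metis atLeastAtMost_iff atLeastLessThan_iff diff_ge_0_iff_ge less_imp_le mult_left_mono Suc_le_lessD order_less_imp_le)
    qed
    hence "norm ((\<Sum>n=A..Suc K. of_real (w n) * e n) - of_real (w (Suc K)) * (\<Sum>n=A..Suc K. e n))
        \<le> (w A - w K) * V + (w K - w (Suc K)) * V"
      unfolding eq using step by (intro norm_triangle_mono) auto
    thus ?case by (simp add: algebra_simps)
  qed
  from this[of B] AB have 1: "norm ((\<Sum>n=A..B. of_real (w n) * e n) - of_real (w B) * (\<Sum>n=A..B. e n)) \<le> (w A - w B) * V" by simp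
  have 2: "norm (of_real (w B) * (\<Sum>n=A..B. e n)) \<le> w B * V"
    unfolding norm_mult using w0[of B] E[of B] AB by (intro mult_mono) auto
  have "(\<Sum>n=A..B. of_real (w n) * e n) = ((\<Sum>n=A..B. of_real (w n) * e n) - of_real (w B) * (\<Sum>n=A..B. e n)) + of_real (w B) * (\<Sum>n=A..B. e n)" by simp
  also have "norm \<dots> \<le> (w A - w B) * V + w B * V" by (rule norm_triangle_mono[OF 1 2])
  finally show ?thesis by (simp add: algebra_simps)
qed

text \<open>The inequality is averaged over n before correlations are bounded, so \<open>C\<close>
  concerns a sum over n and m together. As z vanishes outside {1..M}, each of H shifts reproduces
  the inner sum; Cauchy-Schwarz over at most M + H positions and grouping by the difference of two
  shifts do the rest.\<close>

lemma weyl_van_der_corput: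
  fixes z :: "nat \<Rightarrow> int \<Rightarrow> complex" and C :: "nat \<Rightarrow> real" and M H :: nat
  assumes H: "H \<ge> 1" and supp: "\<And>n m. m \<notin> {1..int M} \<Longrightarrow> z n m = 0"
    and C: "\<And>\<Delta>. \<Delta> < H \<Longrightarrow> norm (\<Sum>n\<in>I. \<Sum>m=1..int M. z n (m + int \<Delta>) * cnj (z n m)) \<le> C \<Delta>"
  shows "(\<Sum>n\<in>I. (norm (\<Sum>m=1..int M. z n m))\<^sup>2) \<le> (real M + real H) / real H * (C 0 + 2 * (\<Sum>\<Delta>=1..<H. C \<Delta>))"
proof -
  define K where "K = {1..int M + int H - 1}"
  have fK: "finite K" "card K \<le> M + H" unfolding K_def by auto
  have shift: "(\<Sum>k\<in>K. f (k - int j) ) = (\<Sum>m=1..int M. f m)"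
    if "j < H" "\<And>m. m \<notin> {1..int M} \<Longrightarrow> f m = 0" for j and f :: "int \<Rightarrow> complex"
  proof -
    have "(\<Sum>k\<in>K. f (k - int j)) = (\<Sum>m\<in>(\<lambda>k. k - int j) ` K. f m)"
      by (subst sum.reindex) (auto simp: inj_on_def)
    also have "\<dots> = (\<Sum>m=1..int M. f m)"
    proof (rule sum.mono_neutral_right)
      show "finite ((\<lambda>k. k - int j) ` K)" using fK by simp
      show "{1..int M} \<subseteq> (\<lambda>k. k - int j) ` K"
      proof
        fix m assume "m \<in> {1..int M}"
        thus "m \<in> (\<lambda>k. k - int j) ` K" unfolding K_def using that(1)
          by (intro image_eqI[of _ _ "m + int j"]) auto
      qed
      show "\<forall>i\<in>(\<lambda>k. k - int j) ` K - {1..int M}. f i = 0" using that(2) by auto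
    qed
    finally show ?thesis .
  qed
  define P where "P j j' = (\<Sum>n\<in>I. \<Sum>k\<in>K. z n (k - int j) * cnj (z n (k - int j')))" for j j'
  have Ple: "norm (P j j') \<le> C (j' - j)" if "j \<le> j'" "j' < H" for j j'
  proof -
    have "(\<Sum>k\<in>K. z n (k - int j) * cnj (z n (k - int j'))) = (\<Sum>m=1..int M. z n (m + int (j' - j)) * cnj (z n m))" for n
    proof -
      have "(\<Sum>k\<in>K. z n (k - int j) * cnj (z n (k - int j'))) = (\<Sum>k\<in>K. (\<lambda>m. z n (m + int (j' - j)) * cnj (z n m)) (k - int j'))"
        using that by (intro sum.cong) (auto simp: of_nat_diff algebra_simps)
      also have "\<dots> = (\<Sum>m=1..int M. z n (m + int (j' - j)) * cnj (z n m))"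
        by (rule shift) (use that supp in auto)
      finally show ?thesis .
    qed
    thus ?thesis unfolding P_def using C[of "j'-j"] that by simp
  qed
  have Psym: "norm (P j j') = norm (P j' j)" for j j'
  proof -
    have "P j j' = cnj (P j' j)" unfolding P_def by (simp add: cnj_sum mult.commute)
    thus ?thesis by simp
  qed
  have C0: "C \<Delta> \<ge> 0" if "\<Delta> < H" for \<Delta> using C[OF that] norm_ge_zero order_trans by blast
  have one: "(real H * norm (\<Sum>m=1..int M. z n m))\<^sup>2 \<le> (real M + real H) * (\<Sum>k\<in>K. (norm (\<Sum>j<H. z n (k - int j)))\<^sup>2)" for n
  proof -
    have "of_nat H * (\<Sum>m=1..int M. z n m) = (\<Sum>j<H. \<Sum>k\<in>K. z n (k - int j))"
      using shift[of _ "z n"] supp by simp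
    also have "\<dots> = (\<Sum>k\<in>K. \<Sum>j<H. z n (k - int j))" by (rule sum.swap)
    finally have "real H * norm (\<Sum>m=1..int M. z n m) = norm (\<Sum>k\<in>K. \<Sum>j<H. z n (k - int j))"
      by (metis norm_mult norm_of_nat)
    also have "\<dots> \<le> (\<Sum>k\<in>K. norm (\<Sum>j<H. z n (k - int j)) * 1)" using norm_sum by auto
    finally have "(real H * norm (\<Sum>m=1..int M. z n m))\<^sup>2 \<le> (\<Sum>k\<in>K. norm (\<Sum>j<H. z n (k - int j)) * 1)\<^sup>2"
      by (intro power_mono) auto
    also have "\<dots> \<le> (\<Sum>k\<in>K. (norm (\<Sum>j<H. z n (k - int j)))\<^sup>2) * (\<Sum>k\<in>K. 1\<^sup>2)"
      by (rule Cauchy_Schwarz_ineq_sum)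
    also have "\<dots> \<le> (\<Sum>k\<in>K. (norm (\<Sum>j<H. z n (k - int j)))\<^sup>2) * (real M + real H)"
      using fK by (intro mult_left_mono sum_nonneg) auto
    finally show ?thesis by (simp add: mult.commute)
  qed
  have sq: "(\<Sum>n\<in>I. \<Sum>k\<in>K. (norm (\<Sum>j<H. z n (k - int j)))\<^sup>2) \<le> (\<Sum>j<H. \<Sum>j'<H. norm (P j j'))"
  proof -
    have "complex_of_real (\<Sum>n\<in>I. \<Sum>k\<in>K. (norm (\<Sum>j<H. z n (k - int j)))\<^sup>2)
        = (\<Sum>n\<in>I. \<Sum>k\<in>K. (\<Sum>j<H. z n (k - int j)) * cnj (\<Sum>j<H. z n (k - int j)))"
      by (simp add: complex_norm_square del: of_real_power cnj_sum)
    also have "\<dots> = (\<Sum>n\<in>I. \<Sum>k\<in>K. \<Sum>j<H. \<Sum>j'<H. z n (k - int j) * cnj (z n (k - int j')))"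
      by (simp add: sum_product)
    also have "\<dots> = (\<Sum>n\<in>I. \<Sum>j<H. \<Sum>k\<in>K. \<Sum>j'<H. z n (k - int j) * cnj (z n (k - int j')))"
      by (intro sum.cong refl sum.swap)
    also have "\<dots> = (\<Sum>n\<in>I. \<Sum>j<H. \<Sum>j'<H. \<Sum>k\<in>K. z n (k - int j) * cnj (z n (k - int j')))"
      by (intro sum.cong refl sum.swap)
    also have "\<dots> = (\<Sum>j<H. \<Sum>n\<in>I. \<Sum>j'<H. \<Sum>k\<in>K. z n (k - int j) * cnj (z n (k - int j')))"
      by (rule sum.swap)
    also have "\<dots> = (\<Sum>j<H. \<Sum>j'<H. P j j')"
      unfolding P_def by (intro sum.cong refl sum.swap)
    finally have "norm (complex_of_real (\<Sum>n\<in>I. \<Sum>k\<in>K. (norm (\<Sum>j<H. z n (k - int j)))\<^sup>2)) \<le> (\<Sum>j<H. \<Sum>j'<H. norm (P j j'))"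
      by (simp only:) (intro order_trans[OF norm_sum] sum_mono norm_sum)
    hence "\<bar>\<Sum>n\<in>I. \<Sum>k\<in>K. (norm (\<Sum>j<H. z n (k - int j)))\<^sup>2\<bar> \<le> (\<Sum>j<H. \<Sum>j'<H. norm (P j j'))"
      by (simp only: norm_of_real)
    thus ?thesis by (rule order_trans[OF abs_ge_self])
  qed
  \<comment> \<open>For fixed j, each shift difference occurs at most once on either side of the
    diagonal.\<close>
  have row: "(\<Sum>j'<H. norm (P j j')) \<le> C 0 + 2 * (\<Sum>\<Delta>=1..<H. C \<Delta>)" if j: "j < H" for j
  proof -
    have "{..<H} = {..<j} \<union> {j} \<union> {Suc j..<H}" "{..<j} \<inter> {Suc j..<H} = {}" using j by auto
    hence "(\<Sum>j'<H. norm (P j j')) = (\<Sum>j'\<in>{..<j}. norm (P j j')) + norm (P j j) + (\<Sum>j'\<in>{Suc j..<H}. norm (P j j'))"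
      by (simp add: sum.union_disjoint)
    also have "(\<Sum>j'\<in>{..<j}. norm (P j j')) \<le> (\<Sum>j'\<in>{..<j}. C (j - j'))"
      using Ple Psym j by (intro sum_mono) (metis lessThan_iff less_imp_le)
    also have "(\<Sum>j'\<in>{..<j}. C (j - j')) = (\<Sum>\<Delta>\<in>(\<lambda>j'. j - j') ` {..<j}. C \<Delta>)"
      by (subst sum.reindex) (auto simp: inj_on_def)
    also have "\<dots> \<le> (\<Sum>\<Delta>=1..<H. C \<Delta>)"
      by (rule sum_mono2) (use j C0 in auto)
    also have "(\<Sum>j'\<in>{Suc j..<H}. norm (P j j')) \<le> (\<Sum>j'\<in>{Suc j..<H}. C (j' - j))"
      using Ple by (intro sum_mono) auto
    also have "(\<Sum>j'\<in>{Suc j..<H}. C (j' - j)) = (\<Sum>\<Delta>\<in>(\<lambda>j'. j' - j) ` {Suc j..<H}. C \<Delta>)"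
      by (subst sum.reindex) (auto simp: inj_on_def)
    also have "\<dots> \<le> (\<Sum>\<Delta>=1..<H. C \<Delta>)"
      by (rule sum_mono2) (use j C0 in auto)
    also have "norm (P j j) \<le> C 0" using Ple[of j j] j by simp
    finally show ?thesis by simp
  qed
  have "(real H)\<^sup>2 * (\<Sum>n\<in>I. (norm (\<Sum>m=1..int M. z n m))\<^sup>2) \<le> (real M + real H) * (\<Sum>n\<in>I. \<Sum>k\<in>K. (norm (\<Sum>j<H. z n (k - int j)))\<^sup>2)"
    unfolding sum_distrib_left using one by (intro sum_mono) (simp add: power_mult_distrib sum_distrib_left)
  also have "\<dots> \<le> (real M + real H) * (\<Sum>j<H. \<Sum>j'<H. norm (P j j'))"
    using sq by (intro mult_left_mono) auto
  also have "\<dots> \<le> (real M + real H) * (\<Sum>j<H. C 0 + 2 * (\<Sum>\<Delta>=1..<H. C \<Delta>))"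
    using row by (intro mult_left_mono sum_mono) auto
  also have "\<dots> = (real M + real H) * (real H * (C 0 + 2 * (\<Sum>\<Delta>=1..<H. C \<Delta>)))" by simp
  finally have "real H * (real H * (\<Sum>n\<in>I. (norm (\<Sum>m=1..int M. z n m))\<^sup>2)) \<le> real H * ((real M + real H) * (C 0 + 2 * (\<Sum>\<Delta>=1..<H. C \<Delta>)))"
    by (simp only: power2_eq_square mult.assoc mult.left_commute)
  hence "real H * (\<Sum>n\<in>I. (norm (\<Sum>m=1..int M. z n m))\<^sup>2) \<le> (real M + real H) * (C 0 + 2 * (\<Sum>\<Delta>=1..<H. C \<Delta>))"
    using H by (subst (asm) mult_le_cancel_left_pos) auto
  thus ?thesis using H by (simp add: pos_le_divide_eq mult.commute)
qed

section \<open>The frequencies as functions of a real variable, and their correlations\<close>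

definition kap :: "real \<Rightarrow> real \<Rightarrow> real \<Rightarrow> real" where
  "kap a s m = sqrt (a * s + (m / a)\<^sup>2)"

text \<open>The right side is the integral of (3/2) u^(-5/2) over [p^2, q^2], at least the length of
  the interval times the value at its right end. The proof is the polynomial form of this in x =
  p/q.\<close>

lemma inv_cube_diff_ge:
  fixes p q :: real
  assumes "0 < p" "p \<le> q"
  shows "3 / 2 * (q\<^sup>2 - p\<^sup>2) / q ^ 5 \<le> 1 / p ^ 3 - 1 / q ^ 3"
proof -
  have q: "q > 0" using assms by simp
  define x where "x = p / q"
  have x: "0 < x" "x \<le> 1" unfolding x_def using assms by auto
  have p: "p = x * q" unfolding x_def using q by simp
  have le: "x^3 * (3 * (1 - x\<^sup>2)) \<le> 2 * (1 - x^3)"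
  proof -
    have "x^3 \<le> 1" "x^4 \<le> 1" "x^3 \<le> x^2" using x by (auto intro!: power_le_one power_decreasing)
    moreover have "x^4 \<le> x" using x power_decreasing[of 1 4 x] by simp
    ultimately have "0 \<le> 2 + 2 * x + 2 * x\<^sup>2 - 3 * x^3 - 3 * x^4" using x by linarith
    hence "0 \<le> (1 - x) * (2 + 2 * x + 2 * x\<^sup>2 - 3 * x^3 - 3 * x^4)" using x by (intro mult_nonneg_nonneg) auto
    also have "\<dots> = 2 * (1 - x^3) - x^3 * (3 * (1 - x\<^sup>2))" by (simp add: algebra_simps power2_eq_square power3_eq_cube power4_eq_xxxx)
    finally show ?thesis by simp
  qed
  have "3 / 2 * (q\<^sup>2 - p\<^sup>2) / q ^ 5 = (3 * (1 - x\<^sup>2)) / 2 / q^3"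
    unfolding p using q by (simp add: field_simps power2_eq_square power3_eq_cube eval_nat_numeral)
  also have "\<dots> \<le> ((1 - x^3) / x^3) / q^3"
    using le x q by (intro divide_right_mono) (auto simp: pos_le_divide_eq mult.commute)
  also have "\<dots> = 1 / p ^ 3 - 1 / q ^ 3"
    unfolding p using q x by (simp add: field_simps power_mult_distrib)
  finally show ?thesis .
qed

text \<open>The left side is the integral of (1/2) u^(-3/2) over [p^2, q^2], at most the length of
  the interval times the value at its left end.\<close>

lemma inv_diff_le:
  fixes p q :: real
  assumes "0 < p" "p \<le> q"
  shows "1 / p - 1 / q \<le> (q\<^sup>2 - p\<^sup>2) / (2 * p ^ 3)"
proof -
  have q: "q > 0" using assms by simp
  have "p * p \<le> p * q" "p * p \<le> q * q" using assms by (auto intro: mult_mono)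
  hence "2 * p\<^sup>2 \<le> (q + p) * q" unfolding power2_eq_square distrib_right by linarith
  hence "0 \<le> (q - p) * ((q + p) * q - 2 * p\<^sup>2)" using assms by (intro mult_nonneg_nonneg) auto
  hence "(q - p) * (2 * p\<^sup>2) \<le> (q\<^sup>2 - p\<^sup>2) * q" by (simp add: algebra_simps power2_eq_square)
  hence "(q - p) * (2 * p ^ 3) \<le> (q\<^sup>2 - p\<^sup>2) * (p * q)" using assms
    mult_left_mono[of "(q - p) * (2 * p\<^sup>2)" "(q\<^sup>2 - p\<^sup>2) * q" p] by (simp add: power2_eq_square power3_eq_cube algebra_simps)
  hence "(q - p) / (p * q) \<le> (q\<^sup>2 - p\<^sup>2) / (2 * p ^ 3)"
    using assms q by (subst frac_le_eq) (auto simp: divide_le_0_iff mult.commute algebra_simps)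
  moreover have "1 / p - 1 / q = (q - p) / (p * q)" using assms q by (simp add: field_simps)
  ultimately show ?thesis by simp
qed

lemma kap_sq: "a > 0 \<Longrightarrow> s \<ge> 0 \<Longrightarrow> (kap a s m)\<^sup>2 = a * s + (m / a)\<^sup>2"
  unfolding kap_def by (subst real_sqrt_pow2) auto

lemma kap_pos: "a > 0 \<Longrightarrow> s > 0 \<Longrightarrow> kap a s m > 0"
  unfolding kap_def by (intro real_sqrt_gt_zero add_pos_nonneg) auto

lemma kap_mono: "a > 0 \<Longrightarrow> s \<le> s' \<Longrightarrow> 0 \<le> m \<Longrightarrow> m \<le> m' \<Longrightarrow> kap a s m \<le> kap a s' m'"
  unfolding kap_def by (intro real_sqrt_le_mono add_mono power_mono mult_left_mono divide_right_mono) auto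

lemma kap_deriv:
  assumes "a > 0" "s > 0"
  shows "((\<lambda>s. kap a s m) has_real_derivative a / (2 * kap a s m)) (at s)"
proof -
  have "a * s + (m/a)\<^sup>2 > 0" using assms by (intro add_pos_nonneg) auto
  thus ?thesis unfolding kap_def
    by (auto intro!: derivative_eq_intros simp: field_simps)
qed

lemma kap_inv_deriv:
  assumes "a > 0" "s > 0"
  shows "((\<lambda>s. 1 / kap a s m) has_real_derivative - a / (2 * kap a s m ^ 3)) (at s)"
proof -
  have k: "kap a s m > 0" by (rule kap_pos[OF assms])
  have "((\<lambda>s. 1 / kap a s m) has_real_derivative (0 * kap a s m - 1 * (a / (2 * kap a s m))) / (kap a s m * kap a s m)) (at s)"
    by (rule DERIV_divide[OF DERIV_const kap_deriv[OF assms]]) (use k in auto)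
  moreover have "(0 * kap a s m - 1 * (a / (2 * kap a s m))) / (kap a s m * kap a s m) = - a / (2 * kap a s m ^ 3)"
    using k by (simp add: power3_eq_cube)
  ultimately show ?thesis by metis
qed

text \<open>The derivatives of the phase in n are differences of 1/\<kappa> and of 1/\<kappa>^3 at
  two frequencies whose squares differ by a constant: the first derivative lies in [-D, 0] and the
  second is at least \<mu>. The result is the second difference test rewritten with g = 4 Z^2 sqrt
  \<mu>.\<close>

lemma correlation_bound:
  fixes a \<rho> Z m \<Delta> g :: real and A B :: nat
  assumes a: "a > 0" and \<rho>: "\<rho> > 0" and Z: "Z > 0" and m: "m > 0" and \<Delta>: "\<Delta> > 0"
    and mD: "m + \<Delta> \<le> a * Z" and A: "A \<ge> 1" and B: "real B \<le> Z\<^sup>2 / a"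
    and low: "kap a A m \<ge> Z / 2" and g: "g = sqrt (\<rho> * \<Delta> * (2 * m + \<Delta>) / Z)"
  shows "norm (\<Sum>n=A..B. cis (2 * pi * (\<rho> * (kap a n (m + \<Delta>) - kap a n m)))) \<le> 176 / 5 * (g / a + Z\<^sup>2 / g)"
proof -
  define U where "U = \<rho> * \<Delta> * (2 * m + \<Delta>)"
  have U: "U > 0" unfolding U_def using \<rho> \<Delta> m by (intro mult_pos_pos add_pos_pos) auto
  have g0: "g > 0" unfolding g using U Z by (simp add: U_def)
  have g2: "g\<^sup>2 = U / Z" unfolding g U_def[symmetric] using U Z by simp
  have Ug: "U = Z * g\<^sup>2" using g2 Z by simp
  \<comment> \<open>\<open>\<mu>\<close> comes from \<kappa>^2 \<le> 2 Z^2, hence \<kappa>^5 \<le> 6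
    Z^5 as 2^(5/2) < 6; \<open>D\<close> comes from \<kappa> \<ge> Z/2.\<close>
  define \<mu> where "\<mu> = U / (16 * Z ^ 5)"
  define D where "D = 2 * U / (a * Z ^ 3)"
  define \<phi> where "\<phi> s = \<rho> * (kap a s (m + \<Delta>) - kap a s m)" for s
  define \<phi>1 where "\<phi>1 s = \<rho> * (a / (2 * kap a s (m + \<Delta>)) - a / (2 * kap a s m))" for s
  define \<phi>2 where "\<phi>2 s = \<rho> * (a / 2 * (- a / (2 * kap a s (m + \<Delta>) ^ 3) - (- a / (2 * kap a s m ^ 3))))" for s
  have d1: "(\<phi> has_real_derivative \<phi>1 s) (at s)" if "s > 0" for s
    unfolding \<phi>_def \<phi>1_def by (intro DERIV_cmult DERIV_diff kap_deriv a that)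
  have d2: "(\<phi>1 has_real_derivative \<phi>2 s) (at s)" if "s > 0" for s
  proof -
    have "\<phi>1 = (\<lambda>s. \<rho> * (a / 2 * (1 / kap a s (m + \<Delta>) - 1 / kap a s m)))"
      by (auto simp: \<phi>1_def right_diff_distrib)
    thus ?thesis unfolding \<phi>2_def by (simp only:) (intro DERIV_cmult DERIV_diff kap_inv_deriv a that)
  qed
  have \<delta>: "(kap a s (m + \<Delta>))\<^sup>2 - (kap a s m)\<^sup>2 = U / (\<rho> * a\<^sup>2)" if "s > 0" for s
  proof -
    have "(kap a s (m + \<Delta>))\<^sup>2 - (kap a s m)\<^sup>2 = ((m + \<Delta>) / a)\<^sup>2 - (m / a)\<^sup>2"
      using kap_sq[OF a] that by simp
    also have "\<dots> = \<Delta> * (2 * m + \<Delta>) / a\<^sup>2" using a by (simp add: field_simps power2_eq_square)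
    also have "\<dots> = U / (\<rho> * a\<^sup>2)" using \<rho> by (simp add: U_def)
    finally show ?thesis .
  qed
  have kle: "kap a s m \<le> kap a s (m + \<Delta>)" for s by (rule kap_mono) (use a m \<Delta> in auto)
  have klow: "kap a s m \<ge> Z / 2" if "real A \<le> s" for s
    using low kap_mono[of a A s m m] that a m by linarith
  have kup: "kap a s (m + \<Delta>) ^ 5 \<le> 6 * Z ^ 5" if "0 < s" "s \<le> real B" for s
  proof -
    have "a * s \<le> a * (Z\<^sup>2 / a)" using that B a by (intro mult_left_mono) auto
    hence 1: "a * s \<le> Z\<^sup>2" using a by simp
    have "(m + \<Delta>) / a \<le> Z" using mD a by (simp add: pos_divide_le_eq mult.commute)
    hence "((m + \<Delta>) / a)\<^sup>2 \<le> Z\<^sup>2" using m \<Delta> a by (intro power_mono) auto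
    hence "(kap a s (m + \<Delta>))\<^sup>2 \<le> 2 * Z\<^sup>2" using 1 kap_sq[OF a, of s "m+\<Delta>"] that by simp
    hence "((kap a s (m + \<Delta>))\<^sup>2) ^ 5 \<le> (2 * Z\<^sup>2) ^ 5" by (intro power_mono) auto
    also have "\<dots> \<le> (6 * Z ^ 5)\<^sup>2" by (simp add: power_mult_distrib flip: power_mult)
    finally have "(kap a s (m + \<Delta>) ^ 5)\<^sup>2 \<le> (6 * Z ^ 5)\<^sup>2" by (simp flip: power_mult)
    thus ?thesis by (rule power2_le_imp_le) (use Z in auto)
  qed
  have \<phi>1_rng: "- D \<le> \<phi>1 s \<and> \<phi>1 s \<le> 0" if s: "real A \<le> s" for s
  proof -
    have s0: "s > 0" using s A by linarith
    have k0: "kap a s m > 0" by (rule kap_pos[OF a s0])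
    have e: "\<phi>1 s = - (\<rho> * a / 2 * (1 / kap a s m - 1 / kap a s (m + \<Delta>)))"
      by (simp add: \<phi>1_def right_diff_distrib)
    have "1 / kap a s m - 1 / kap a s (m + \<Delta>) \<le> U / (\<rho> * a\<^sup>2) / (2 * kap a s m ^ 3)"
      using inv_diff_le[OF k0 kle] \<delta>[OF s0] by simp
    also have "\<dots> \<le> U / (\<rho> * a\<^sup>2) / (2 * (Z/2) ^ 3)"
      using klow[OF s] Z U \<rho> a by (intro divide_left_mono mult_left_mono power_mono mult_pos_pos zero_less_power divide_nonneg_nonneg) auto
    finally have "\<rho> * a / 2 * (1 / kap a s m - 1 / kap a s (m + \<Delta>)) \<le> \<rho> * a / 2 * (U / (\<rho> * a\<^sup>2) / (2 * (Z/2) ^ 3))"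
      using \<rho> a by (intro mult_left_mono) auto
    also have "\<dots> = D" using \<rho> a Z by (simp add: D_def field_simps power2_eq_square power3_eq_cube)
    finally have "- D \<le> \<phi>1 s" using e by linarith
    moreover have "0 \<le> 1 / kap a s m - 1 / kap a s (m + \<Delta>)" using kle[of s] k0 by (simp add: frac_le)
    hence "0 \<le> \<rho> * a / 2 * (1 / kap a s m - 1 / kap a s (m + \<Delta>))" using \<rho> a by (intro mult_nonneg_nonneg) auto
    ultimately show ?thesis using e by linarith
  qed
  have \<phi>2_low: "\<mu> \<le> \<phi>2 s" if s: "real A \<le> s" "s \<le> real B" for s
  proof -
    have s0: "s > 0" using s A by linarith
    have k0: "kap a s m > 0" by (rule kap_pos[OF a s0])
    have k1: "kap a s (m + \<Delta>) > 0" by (rule kap_pos[OF a s0])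
    have "3 / 2 * (U / (\<rho> * a\<^sup>2)) / (6 * Z ^ 5) \<le> 3 / 2 * (U / (\<rho> * a\<^sup>2)) / kap a s (m + \<Delta>) ^ 5"
      using kup[OF s0 s(2)] U \<rho> a Z k1 by (intro divide_left_mono mult_pos_pos mult_nonneg_nonneg divide_nonneg_nonneg) auto
    also have "\<dots> \<le> 1 / kap a s m ^ 3 - 1 / kap a s (m + \<Delta>) ^ 3"
      using inv_cube_diff_ge[OF k0 kle] \<delta>[OF s0] by simp
    finally have "\<rho> * a\<^sup>2 / 4 * (3 / 2 * (U / (\<rho> * a\<^sup>2)) / (6 * Z ^ 5)) \<le> \<rho> * a\<^sup>2 / 4 * (1 / kap a s m ^ 3 - 1 / kap a s (m + \<Delta>) ^ 3)"
      using \<rho> by (intro mult_left_mono) auto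
    also have "\<dots> = \<phi>2 s" by (simp add: \<phi>2_def right_diff_distrib power2_eq_square)
    finally show ?thesis using \<rho> a by (simp add: \<mu>_def)
  qed
  have \<mu>0: "\<mu> > 0" unfolding \<mu>_def using U Z by simp
  have s\<mu>: "sqrt \<mu> = g / (4 * Z\<^sup>2)"
  proof (rule real_sqrt_unique)
    have "(g / (4 * Z\<^sup>2))\<^sup>2 = U / Z / (16 * Z^4)" using g2 by (simp add: power_divide power_mult_distrib flip: power_mult)
    thus "(g / (4 * Z\<^sup>2))\<^sup>2 = \<mu>" unfolding \<mu>_def using Z by (simp add: eval_nat_numeral)
  qed (use g0 in auto)
  show ?thesis
  proof (cases "\<mu> \<le> 1")
    case True
    have "norm (\<Sum>n=A..B. cis (2 * pi * \<phi> (real n))) \<le> (D + 2) * ((22/5) / sqrt \<mu>)"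
    proof (rule second_difference_test[OF \<mu>0 True])
      show "D \<ge> 0" unfolding D_def using U a Z by simp
      fix n assume n: "n \<in> {A..<B}"
      have "\<exists>z>real n. z < real n + 1 \<and> \<phi> (real n + 1) - \<phi> (real n) = (real n + 1 - real n) * \<phi>1 z"
        by (rule MVT2) (use d1 n A in auto)
      then obtain z where "z > real n" "\<phi> (real n + 1) - \<phi> (real n) = \<phi>1 z" by auto
      thus "- D \<le> \<phi> (real (Suc n)) - \<phi> (real n) \<and> \<phi> (real (Suc n)) - \<phi> (real n) \<le> 0"
        using \<phi>1_rng[of z] n by (simp add: add.commute)
      assume n2: "Suc n < B"
      have "\<exists>\<xi>. real n < \<xi> \<and> \<xi> < real n + 2 * 1 \<and> \<phi> (real n + 2 * 1) - 2 * \<phi> (real n + 1) + \<phi> (real n) = 1\<^sup>2 * \<phi>2 \<xi>"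
        by (rule second_difference_mvt[where f' = \<phi>1]) (use d1 d2 n A in auto)
      then obtain \<xi> where \<xi>: "real n < \<xi>" "\<xi> < real n + 2" "\<phi> (real n + 2) - 2 * \<phi> (real n + 1) + \<phi> (real n) = \<phi>2 \<xi>" by auto
      have "\<mu> \<le> \<phi>2 \<xi>" by (rule \<phi>2_low) (use \<xi> n n2 in auto)
      thus "\<phi> (real (Suc n)) - \<phi> (real n) + \<mu> \<le> \<phi> (real (Suc (Suc n))) - \<phi> (real (Suc n))"
        using \<xi>(3) by (simp add: add.commute)
    qed
    also have "(D + 2) * ((22/5) / sqrt \<mu>) = 176 / 5 * (g / a + Z\<^sup>2 / g)"
      unfolding s\<mu> D_def Ug using a Z g0 by (simp add: field_simps power2_eq_square power3_eq_cube)
    finally show ?thesis by (simp add: \<phi>_def)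
  next
    \<comment> \<open>For \<mu> > 1 counting the terms is enough: then g \<ge> 4 Z^2, so their
      number Z^2/a is at most g/a.\<close>
    case False
    hence "1 \<le> sqrt \<mu>" by simp
    hence g4: "4 * Z\<^sup>2 \<le> g" unfolding s\<mu> using Z by (simp add: pos_le_divide_eq)
    have "norm (\<Sum>n=A..B. cis (2 * pi * (\<rho> * (kap a n (m + \<Delta>) - kap a n m)))) \<le> (\<Sum>n=A..B. 1)"
      by (intro order_trans[OF norm_sum] sum_mono) simp
    also have "\<dots> \<le> real B" using A by simp
    also have "\<dots> \<le> Z\<^sup>2 / a" by (rule B)
    also have "Z\<^sup>2 / a \<le> g / a"
    proof -
      have "Z\<^sup>2 \<le> g" using g4 zero_le_power2[of Z] by linarith
      thus ?thesis using a by (intro divide_right_mono) auto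
    qed
    also have "\<dots> \<le> 176 / 5 * (g / a + Z\<^sup>2 / g)"
    proof -
      have *: "x \<le> 176 / 5 * (x + y)" if "x \<ge> 0" "y \<ge> 0" for x y :: real using that by (simp add: algebra_simps)
      show ?thesis by (rule *) (use a g0 in auto)
    qed
    finally show ?thesis .
  qed
qed

lemma sum_inv_sqrt_le: "(\<Sum>k=1..n. 1 / sqrt (real k)) \<le> 2 * sqrt (real n)"
proof (induction n)
  case (Suc n)
  have "1 / sqrt (real (Suc n)) \<le> 2 * (sqrt (real (Suc n)) - sqrt (real n))"
  proof -
    define p where "p = sqrt (real (Suc n))"
    define q where "q = sqrt (real n)"
    have pq: "p > 0" "q \<ge> 0" "p\<^sup>2 = q\<^sup>2 + 1" unfolding p_def q_def by auto
    have "0 \<le> (p - q)\<^sup>2" by simp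
    hence "1 \<le> 2 * (p - q) * p" using pq(3) by (simp add: power2_eq_square algebra_simps)
    thus ?thesis using pq by (simp add: pos_divide_le_eq p_def q_def)
  qed
  thus ?case using Suc by simp
qed simp

section \<open>One dyadic layer: correlations, mean square, and the sum weighted by r_2\<close>

definition in_ring :: "real \<Rightarrow> real \<Rightarrow> nat \<Rightarrow> real \<Rightarrow> bool" where
  "in_ring a Z n m \<longleftrightarrow> \<not> (real n \<le> (Z/2)\<^sup>2 / a \<and> m \<le> a * (Z/2))"

lemma in_ring_kap:
  assumes "a > 0" "Z > 0" "m \<ge> 0" "in_ring a Z n m"
  shows "kap a n m \<ge> Z / 2"
proof -
  have "(Z/2)\<^sup>2 \<le> a * real n + (m / a)\<^sup>2"
  proof (cases "real n \<le> (Z/2)\<^sup>2 / a")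
    case True
    hence "a * (Z/2) < m" using assms by (simp add: in_ring_def)
    hence "Z / 2 \<le> m / a" using assms by (simp add: pos_le_divide_eq mult.commute)
    hence "(Z/2)\<^sup>2 \<le> (m / a)\<^sup>2" using assms by (intro power_mono) auto
    thus ?thesis using assms by (simp add: add_increasing)
  next
    case False
    hence "(Z/2)\<^sup>2 \<le> a * real n" using assms by (simp add: pos_divide_less_eq not_le mult.commute)
    thus ?thesis by (simp add: add_increasing2)
  qed
  hence "sqrt ((Z/2)\<^sup>2) \<le> kap a n m" unfolding kap_def by (intro real_sqrt_le_mono)
  thus ?thesis using assms by (simp add: real_sqrt_abs)
qed

text \<open>For fixed m the layer means n \<ge> A, so the sum runs over an interval. The weights
  decrease in n and are removed by partial summation; their largest value is at most that at
  Z/2.\<close>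

lemma ring_correlation:
  fixes a \<rho> Z :: real and w :: "real \<Rightarrow> real" and N :: nat and m \<Delta> :: real
  assumes a: "a > 0" and \<rho>: "\<rho> > 0" and Z: "Z > 0" and m: "m > 0" and \<Delta>: "\<Delta> > 0"
    and mD: "m + \<Delta> \<le> a * Z" and N: "real N \<le> Z\<^sup>2 / a"
    and w0: "\<And>x. x > 0 \<Longrightarrow> w x \<ge> 0" and wm: "\<And>x y. 0 < x \<Longrightarrow> x \<le> y \<Longrightarrow> w y \<le> w x"
  defines "g \<equiv> sqrt (\<rho> * \<Delta> * (2 * m + \<Delta>) / Z)"
  shows "norm (\<Sum>n=1..N. if in_ring a Z n m then of_real (w (kap a n m) * w (kap a n (m + \<Delta>))) * cis (2 * pi * (\<rho> * (kap a n (m + \<Delta>) - kap a n m))) else 0)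
     \<le> (w (Z/2))\<^sup>2 * (176 / 5 * (g / a + Z\<^sup>2 / g))"
proof -
  have g0: "g \<ge> 0" unfolding g_def using \<rho> \<Delta> m Z by simp
  define V where "V = 176 / 5 * (g / a + Z\<^sup>2 / g)"
  have V0: "V \<ge> 0" unfolding V_def using g0 a by simp
  \<comment> \<open>The first n outside the half-size box. If m alone lies outside it, every n \<ge>
    1 qualifies.\<close>
  define A where "A = (if m \<le> a * (Z/2) then Suc (nat \<lfloor>(Z/2)\<^sup>2 / a\<rfloor>) else 1)"
  have A1: "A \<ge> 1" by (simp add: A_def)
  have ring: "in_ring a Z n m \<longleftrightarrow> n \<ge> A" if "n \<ge> 1" for n
  proof -
    have "(Z/2)\<^sup>2 / a \<ge> 0" using a by simp
    hence "real n \<le> (Z/2)\<^sup>2 / a \<longleftrightarrow> n \<le> nat \<lfloor>(Z/2)\<^sup>2 / a\<rfloor>" using le_nat_floor[of n] 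
      by (metis le_nat_floor of_nat_floor of_nat_le_iff order_trans)
    thus ?thesis using that by (auto simp: in_ring_def A_def)
  qed
  define f where "f n = of_real (w (kap a n m) * w (kap a n (m + \<Delta>))) * cis (2 * pi * (\<rho> * (kap a n (m + \<Delta>) - kap a n m)))" for n :: nat
  have "(\<Sum>n=1..N. if in_ring a Z n m then f n else 0) = (\<Sum>n\<in>{n\<in>{1..N}. in_ring a Z n m}. f n)"
    by (rule sum.inter_filter[symmetric]) simp
  also have "{n\<in>{1..N}. in_ring a Z n m} = {A..N}" using ring A1 by auto
  finally have eq: "(\<Sum>n=1..N. if in_ring a Z n m then f n else 0) = (\<Sum>n=A..N. f n)" .
  have "norm (\<Sum>n=A..N. f n) \<le> (w (Z/2))\<^sup>2 * V"
  proof (cases "A \<le> N")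
    case False thus ?thesis using V0 by simp
  next
    case True
    have kA: "kap a A m \<ge> Z/2" by (rule in_ring_kap) (use a Z m ring[of A] A1 in auto)
    have kp: "kap a n m' > 0" if "n \<in> {A..N}" for n :: nat and m' by (rule kap_pos) (use a that A1 in auto)
    have "norm (\<Sum>n=A..N. f n) \<le> (w (kap a A m) * w (kap a A (m + \<Delta>))) * V"
      unfolding f_def
    proof (rule abel_antimono[OF True])
      fix n assume n: "n \<in> {A..N}"
      show "0 \<le> w (kap a n m) * w (kap a n (m + \<Delta>))" using w0 kp[OF n] by simp
      show "norm (\<Sum>n=A..n. cis (2 * pi * (\<rho> * (kap a n (m + \<Delta>) - kap a n m)))) \<le> V" unfolding V_def
        by (rule correlation_bound) (use a \<rho> Z m \<Delta> mD A1 n N kA in \<open>auto simp: g_def\<close>)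
    next
      fix n assume n: "n \<in> {A..<N}"
      have "w (kap a (Suc n) m') \<le> w (kap a n m')" if "m' \<ge> 0" for m'
        by (rule wm[OF kp kap_mono]) (use n a that in auto)
      thus "w (kap a (Suc n) m) * w (kap a (Suc n) (m + \<Delta>)) \<le> w (kap a n m) * w (kap a n (m + \<Delta>))"
        using m \<Delta> n by (intro mult_mono w0 kp) auto
    qed
    also have "\<dots> \<le> (w (Z/2) * w (Z/2)) * V"
    proof (intro mult_right_mono mult_mono V0)
      show "w (kap a A m) \<le> w (Z/2)" using kA Z by (intro wm) auto
      have "kap a A m \<le> kap a A (m + \<Delta>)" using a m \<Delta> by (intro kap_mono) auto
      thus "w (kap a A (m + \<Delta>)) \<le> w (Z/2)" using kA Z by (intro wm) auto
      show "0 \<le> w (Z/2)" using Z by (intro w0) auto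
      show "0 \<le> w (kap a A (m + \<Delta>))" using kp[of A] True by (intro w0) auto
    qed
    finally show ?thesis by (simp add: power2_eq_square)
  qed
  thus ?thesis unfolding eq[unfolded f_def] f_def V_def .
qed

text \<open>Weyl-van der Corput with about h shifts. The diagonal gives the terms in 1/h and 1/(aZ).
  Off the diagonal each correlation bound has a part growing like the root of the shift, which gives
  sqrt h, and a part decaying like its inverse, which gives the 1/sqrt h and 1/sqrt(aZ)
  terms.\<close>

lemma ring_mean_square:
  fixes a \<rho> Z h :: real and w :: "real \<Rightarrow> real"
  assumes a: "a > 0" and \<rho>: "\<rho> > 0" and Z: "Z > 0" and h: "h > 0"
    and w0: "\<And>x. x > 0 \<Longrightarrow> w x \<ge> 0" and wm: "\<And>x y. 0 < x \<Longrightarrow> x \<le> y \<Longrightarrow> w y \<le> w x"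
  shows "(\<Sum>n=1..nat \<lfloor>Z\<^sup>2/a\<rfloor>. (norm (\<Sum>m=1..int (nat \<lfloor>a*Z\<rfloor>). if in_ring a Z n m then of_real (w (kap a n m)) * cis (2*pi*\<rho>*kap a n m) else 0))\<^sup>2)
    \<le> (w (Z/2))\<^sup>2 * (a*Z)\<^sup>2 * (Z\<^sup>2 / a / h + Z\<^sup>2 / a / (a*Z) + 200 * sqrt (2 * \<rho> * h / a) + 400 * Z\<^sup>2 / sqrt (a * \<rho>) * (1 / sqrt h + 1 / sqrt (a*Z)))"
proof -
  define X where "X = Z\<^sup>2 / a"
  define Y where "Y = a * Z"
  define N where "N = nat \<lfloor>X\<rfloor>"
  define M where "M = nat \<lfloor>Y\<rfloor>"
  define W where "W = w (Z/2)"
  have X0: "X > 0" and Y0: "Y > 0" using a Z by (auto simp: X_def Y_def)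
  have NX: "real N \<le> X" and MY: "real M \<le> Y" using X0 Y0 by (auto simp: N_def M_def)
  define z where "z n m = (if m \<in> {1..int M} \<and> in_ring a Z n m then of_real (w (kap a n m)) * cis (2*pi*\<rho>*kap a n m) else 0)" for n :: nat and m :: int
  define E where "E = X / h + X / Y + 200 * sqrt (2 * \<rho> * h / a) + 400 * Z\<^sup>2 / sqrt (a * \<rho>) * (1 / sqrt h + 1 / sqrt Y)"
  \<comment> \<open>The correlation bound summed over m, without the weight; 50 exceeds (176/5) sqrt
    2.\<close>
  define b where "b \<Delta> = 50 * Y * (sqrt (\<rho>/a) * sqrt \<Delta> + Z\<^sup>2 / sqrt (a*\<rho>) * (1 / sqrt \<Delta>))" for \<Delta> :: real
  have b0: "b \<Delta> \<ge> 0" if "\<Delta> \<ge> 0" for \<Delta> unfolding b_def using Y0 a \<rho> that by simp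
  \<comment> \<open>A shift by M or more moves {1..M} off itself, so its correlation is 0 and only
    the shifts below min(H, M) count.\<close>
  define C where "C \<Delta> = (if \<Delta> = 0 then W\<^sup>2 * (X * M) else if \<Delta> < M then W\<^sup>2 * b (real \<Delta>) else 0)" for \<Delta> :: nat
  define H where "H = nat \<lceil>h\<rceil>"
  have H1: "H \<ge> 1" unfolding H_def using h by (simp add: Suc_le_eq)
  have Hh: "h \<le> real H" unfolding H_def using h by linarith
  have kp: "kap a n m > 0" if "n \<ge> 1" for n :: nat and m by (rule kap_pos) (use a that in auto)
  have ring_up: "in_ring a Z n m'" if "in_ring a Z n m" "m \<le> m'" for n m m' using that by (auto simp: in_ring_def)
  have C0: "norm (\<Sum>n=1..N. \<Sum>m=1..int M. z n (m + int 0) * cnj (z n m)) \<le> C 0"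
  proof -
    have "norm (z n m * cnj (z n m)) \<le> W\<^sup>2" if "n \<in> {1..N}" "m \<in> {1..int M}" for n m
    proof (cases "in_ring a Z n m")
      case True
      have k: "kap a n m \<ge> Z/2" by (rule in_ring_kap) (use a Z that True in auto)
      have "w (kap a n m) \<le> W" "w (kap a n m) \<ge> 0" unfolding W_def using k Z by (auto intro!: wm w0)
      hence "w (kap a n m) * w (kap a n m) \<le> W * W" by (intro mult_mono) auto
      thus ?thesis using \<open>w (kap a n m) \<ge> 0\<close> True that by (simp add: z_def norm_mult power2_eq_square)
    qed (auto simp: z_def)
    hence "norm (\<Sum>n=1..N. \<Sum>m=1..int M. z n m * cnj (z n m)) \<le> (\<Sum>n=1..N. \<Sum>m=1..int M. W\<^sup>2)"
      by (intro order_trans[OF norm_sum] sum_mono) auto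
    also have "\<dots> = W\<^sup>2 * (real N * M)" by simp
    also have "\<dots> \<le> W\<^sup>2 * (X * M)" using NX by (intro mult_left_mono mult_right_mono) auto
    finally show ?thesis by (simp add: C_def)
  qed
  have Cpos: "norm (\<Sum>n=1..N. \<Sum>m=1..int M. z n (m + int \<Delta>) * cnj (z n m)) \<le> C \<Delta>" if D: "\<Delta> \<ge> 1" for \<Delta>
  proof -
    define T where "T m = (\<Sum>n=1..N. z n (m + int \<Delta>) * cnj (z n m))" for m
    have sw: "(\<Sum>n=1..N. \<Sum>m=1..int M. z n (m + int \<Delta>) * cnj (z n m)) = (\<Sum>m=1..int M. T m)"
      unfolding T_def by (rule sum.swap)
    show ?thesis
    proof (cases "\<Delta> < M")
      case False
      have "T m = 0" if "m \<in> {1..int M}" for m unfolding T_def z_def using False that by auto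
      thus ?thesis unfolding sw using False D by (simp add: C_def)
    next
      case True
      have Tb: "norm (T m) \<le> W\<^sup>2 * (176/5 * (sqrt (2 * \<rho> * \<Delta> / a) + Z\<^sup>2 * sqrt (Z / (2 * \<rho> * \<Delta>)) * (1 / sqrt m)))"
        if m: "m \<in> {1..int M}" for m
      proof (cases "m + int \<Delta> \<le> int M")
        case False
        hence "T m = 0" unfolding T_def z_def by auto
        thus ?thesis using \<rho> a Z m by simp
      next
        case le: True
        define g where "g = sqrt (\<rho> * real \<Delta> * (2 * real_of_int m + real \<Delta>) / Z)"
        have mY: "real_of_int m + real \<Delta> \<le> a * Z" using le MY unfolding Y_def
          by (metis (mono_tags, lifting) of_int_add of_int_le_iff of_int_of_nat_eq order_trans)
        have Teq: "T m = (\<Sum>n=1..N. if in_ring a Z n m then of_real (w (kap a n m) * w (kap a n (real_of_int m + real \<Delta>))) * cis (2 * pi * (\<rho> * (kap a n (real_of_int m + real \<Delta>) - kap a n m))) else 0)"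
          unfolding T_def
        proof (intro sum.cong refl)
          fix n
          show "z n (m + int \<Delta>) * cnj (z n m) = (if in_ring a Z n m then of_real (w (kap a n m) * w (kap a n (real_of_int m + real \<Delta>))) * cis (2 * pi * (\<rho> * (kap a n (real_of_int m + real \<Delta>) - kap a n m))) else 0)"
          proof (cases "in_ring a Z n m")
            case True
            hence "in_ring a Z n (real_of_int m + real \<Delta>)" by (rule ring_up) simp
            thus ?thesis using True le m D
              by (simp add: z_def cis_mult cis_cnj algebra_simps)
          qed (simp add: z_def)
        qed
        have "norm (T m) \<le> W\<^sup>2 * (176 / 5 * (g / a + Z\<^sup>2 / g))"
          unfolding Teq W_def g_def by (rule ring_correlation) (use a \<rho> Z m D mY NX w0 wm in \<open>auto simp: X_def\<close>)
        \<comment> \<open>2m + \<Delta> \<le> 2aZ bounds g from above and 2m + \<Delta> \<ge> 2m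
          bounds it from below; the latter leaves 1/sqrt m, whose sum is at most 2 sqrt(aZ).\<close>
        also have "\<dots> \<le> W\<^sup>2 * (176/5 * (sqrt (2 * \<rho> * \<Delta> / a) + Z\<^sup>2 * sqrt (Z / (2 * \<rho> * \<Delta>)) * (1 / sqrt m)))"
        proof (intro mult_left_mono add_mono)
          have "\<rho> * real \<Delta> * (2 * real_of_int m + real \<Delta>) / Z \<le> \<rho> * real \<Delta> * (2 * (a * Z)) / Z"
            using mY \<rho> Z by (intro divide_right_mono mult_left_mono) auto
          hence "g \<le> sqrt (\<rho> * real \<Delta> * (2 * (a * Z)) / Z)" unfolding g_def by (rule real_sqrt_le_mono)
          also have "\<rho> * real \<Delta> * (2 * (a * Z)) / Z = 2 * \<rho> * \<Delta> / a * a\<^sup>2" using Z a by (simp add: power2_eq_square)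
          also have "sqrt \<dots> = sqrt (2 * \<rho> * \<Delta> / a) * a" using a by (subst real_sqrt_mult) simp
          finally show "g / a \<le> sqrt (2 * \<rho> * \<Delta> / a)" using a by (simp add: pos_divide_le_eq)
          have "2 * \<rho> * \<Delta> / Z * real_of_int m \<le> \<rho> * real \<Delta> * (2 * real_of_int m + real \<Delta>) / Z"
            using \<rho> Z by (simp add: field_simps)
          hence "sqrt (2 * \<rho> * \<Delta> / Z * real_of_int m) \<le> g" unfolding g_def by (rule real_sqrt_le_mono)
          moreover have "0 < sqrt (2 * \<rho> * \<Delta> / Z * real_of_int m)" using \<rho> Z m D by simp
          ultimately have "1 / g \<le> 1 / sqrt (2 * \<rho> * \<Delta> / Z * real_of_int m)" by (intro frac_le) simp_all
          also have "\<dots> = sqrt (Z / (2 * \<rho> * \<Delta>)) * (1 / sqrt m)" by (simp add: real_sqrt_mult real_sqrt_divide)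
          finally have "Z\<^sup>2 * (1 / g) \<le> Z\<^sup>2 * (sqrt (Z / (2 * \<rho> * \<Delta>)) * (1 / sqrt m))" by (intro mult_left_mono) auto
          thus "Z\<^sup>2 / g \<le> Z\<^sup>2 * sqrt (Z / (2 * \<rho> * \<Delta>)) * (1 / sqrt m)" by simp
        qed auto
        finally show ?thesis .
      qed
      have "norm (\<Sum>m=1..int M. T m) \<le> (\<Sum>m=1..int M. W\<^sup>2 * (176/5 * (sqrt (2 * \<rho> * \<Delta> / a) + Z\<^sup>2 * sqrt (Z / (2 * \<rho> * \<Delta>)) * (1 / sqrt m))))"
        using Tb by (intro order_trans[OF norm_sum] sum_mono)
      also have "\<dots> = W\<^sup>2 * (176/5 * (real M * sqrt (2 * \<rho> * \<Delta> / a) + Z\<^sup>2 * sqrt (Z / (2 * \<rho> * \<Delta>)) * (\<Sum>m=1..int M. 1 / sqrt m)))"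
        by (simp only: sum_distrib_left[symmetric] sum.distrib) simp
      also have "(\<Sum>m=1..int M. 1 / sqrt m) = (\<Sum>k=1..M. 1 / sqrt (real k))"
        by (rule sum.reindex_bij_witness[of _ int nat]) auto
      also have "W\<^sup>2 * (176/5 * (real M * sqrt (2 * \<rho> * \<Delta> / a) + Z\<^sup>2 * sqrt (Z / (2 * \<rho> * \<Delta>)) * (\<Sum>k=1..M. 1 / sqrt (real k))))
         \<le> W\<^sup>2 * (176/5 * (Y * sqrt (2 * \<rho> * \<Delta> / a) + Z\<^sup>2 * sqrt (Z / (2 * \<rho> * \<Delta>)) * (2 * sqrt Y)))"
      proof (intro mult_left_mono add_mono mult_right_mono MY)
        have "2 * sqrt (real M) \<le> 2 * sqrt Y" using MY by simp
        thus "(\<Sum>k=1..M. 1 / sqrt (real k)) \<le> 2 * sqrt Y" using sum_inv_sqrt_le[of M] by linarith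
      qed (use \<rho> a Z in auto)
      also have "\<dots> = W\<^sup>2 * (176/5 * sqrt 2 * Y * (sqrt (\<rho>/a) * sqrt \<Delta> + Z\<^sup>2 / sqrt (a*\<rho>) * (1 / sqrt \<Delta>)))"
      proof -
        have 1: "sqrt (2 * \<rho> * \<Delta> / a) = sqrt 2 * (sqrt (\<rho>/a) * sqrt \<Delta>)" by (simp add: real_sqrt_mult real_sqrt_divide)
        have za: "sqrt Z * sqrt Z = Z" "sqrt a * sqrt a = a" using a Z by auto
        have 2: "sqrt (Z / (2 * \<rho> * \<Delta>)) * (2 * sqrt Y) = sqrt 2 * Y * (1 / sqrt (a*\<rho>) * (1 / sqrt \<Delta>))"
        proof -
          have "2 / sqrt 2 = sqrt 2" by (simp add: real_div_sqrt)
          hence s2: "inverse (sqrt 2) * 2 = sqrt 2" by (simp add: divide_inverse mult.commute)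
          have sa: "a * inverse (sqrt a) = sqrt a" using a by (simp add: real_div_sqrt flip: divide_inverse)
          have "sqrt (Z / (2 * \<rho> * \<Delta>)) * (2 * sqrt Y) = (inverse (sqrt 2) * 2) * (sqrt Z * sqrt Z) * sqrt a * inverse (sqrt \<rho>) * inverse (sqrt \<Delta>)"
            unfolding Y_def by (simp only: real_sqrt_mult real_sqrt_divide divide_inverse inverse_mult_distrib real_sqrt_inverse mult_ac)
          also have "\<dots> = sqrt 2 * Z * (a * inverse (sqrt a)) * inverse (sqrt \<rho>) * inverse (sqrt \<Delta>)"
            unfolding s2 za sa ..
          also have "\<dots> = sqrt 2 * Y * (1 / sqrt (a*\<rho>) * (1 / sqrt \<Delta>))"
            unfolding Y_def by (simp only: real_sqrt_mult divide_inverse inverse_mult_distrib mult_ac mult_1_left mult_1_right)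
          finally show ?thesis .
        qed
        have "Z\<^sup>2 * sqrt (Z / (2 * \<rho> * \<Delta>)) * (2 * sqrt Y) = Z\<^sup>2 * (sqrt 2 * Y * (1 / sqrt (a*\<rho>) * (1 / sqrt \<Delta>)))"
          using 2 by (simp only: mult.assoc)
        thus ?thesis unfolding 1 by (simp add: algebra_simps)
      qed
      also have "\<dots> \<le> W\<^sup>2 * b (real \<Delta>)"
      proof -
        have "sqrt 2 < 283/200" by (rule real_less_lsqrt) (auto simp: power2_eq_square)
        hence "176/5 * sqrt 2 \<le> 50" by simp
        thus ?thesis unfolding b_def using Y0 a \<rho> by (intro mult_left_mono mult_right_mono) auto
      qed
      finally show ?thesis unfolding sw using True D by (simp add: C_def)
    qed
  qed
  have "(\<Sum>n=1..N. (norm (\<Sum>m=1..int M. z n m))\<^sup>2) \<le> (real M + real H) / real H * (C 0 + 2 * (\<Sum>\<Delta>=1..<H. C \<Delta>))"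
  proof (rule weyl_van_der_corput[OF H1])
    show "z n m = 0" if "m \<notin> {1..int M}" for n m using that by (auto simp: z_def)
    show "norm (\<Sum>n=1..N. \<Sum>m=1..int M. z n (m + int \<Delta>) * cnj (z n m)) \<le> C \<Delta>" for \<Delta>
      using C0 Cpos[of \<Delta>] by (cases "\<Delta> = 0") auto
  qed
  also have "\<dots> \<le> W\<^sup>2 * (Y\<^sup>2 * E)"
  proof (cases "M = 0")
    case True
    hence "C \<Delta> = 0" for \<Delta> by (simp add: C_def)
    moreover have "E \<ge> 0" unfolding E_def using X0 Y0 h a \<rho> by simp
    ultimately show ?thesis by simp
  next
    case M0: False
    define K where "K = min H M"
    have K1: "K \<ge> 1" unfolding K_def using H1 M0 by simp
    have Csum: "(\<Sum>\<Delta>=1..<H. C \<Delta>) = W\<^sup>2 * (\<Sum>\<Delta>=1..<K. b (real \<Delta>))"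
    proof -
      have "(\<Sum>\<Delta>=1..<H. C \<Delta>) = (\<Sum>\<Delta>=1..<K. C \<Delta>)"
        by (rule sum.mono_neutral_right) (auto simp: K_def C_def)
      also have "\<dots> = (\<Sum>\<Delta>=1..<K. W\<^sup>2 * b (real \<Delta>))"
        by (intro sum.cong) (auto simp: K_def C_def)
      finally show ?thesis by (simp add: sum_distrib_left)
    qed
    have s1: "(\<Sum>\<Delta>=1..<K. sqrt (real \<Delta>)) \<le> real K * sqrt K"
    proof -
      have "(\<Sum>\<Delta>=1..<K. sqrt (real \<Delta>)) \<le> (\<Sum>\<Delta>=1..<K. sqrt (real K))" by (intro sum_mono) auto
      also have "\<dots> = real (K - 1) * sqrt K" by simp
      also have "\<dots> \<le> real K * sqrt K" by (intro mult_right_mono) auto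
      finally show ?thesis .
    qed
    have s2: "(\<Sum>\<Delta>=1..<K. 1 / sqrt (real \<Delta>)) \<le> 2 * sqrt K"
    proof -
      have "(\<Sum>\<Delta>=1..<K. 1 / sqrt (real \<Delta>)) \<le> (\<Sum>\<Delta>=1..K. 1 / sqrt (real \<Delta>))" by (intro sum_mono2) auto
      thus ?thesis using sum_inv_sqrt_le[of K] by linarith
    qed
    define p where "p = sqrt (\<rho>/a)"
    define q where "q = Z\<^sup>2 / sqrt (a*\<rho>)"
    have pq: "p \<ge> 0" "q \<ge> 0" unfolding p_def q_def using a \<rho> by auto
    have bs: "(\<Sum>\<Delta>=1..<K. b (real \<Delta>)) \<le> 50 * Y * (p * (real K * sqrt K) + q * (2 * sqrt K))"
    proof -
      have "(\<Sum>\<Delta>=1..<K. b (real \<Delta>)) = 50 * Y * (p * (\<Sum>\<Delta>=1..<K. sqrt (real \<Delta>)) + q * (\<Sum>\<Delta>=1..<K. 1 / sqrt (real \<Delta>)))"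
        unfolding b_def p_def q_def by (simp only: sum.distrib flip: sum_distrib_left)
      also have "\<dots> \<le> 50 * Y * (p * (real K * sqrt K) + q * (2 * sqrt K))"
        using s1 s2 pq Y0 by (intro mult_left_mono add_mono) auto
      finally show ?thesis .
    qed
    \<comment> \<open>M + H is at most twice the larger of M and H, and the larger one equals MH/K
      because K is the smaller.\<close>
    have f1: "(real M + real H) / real H \<le> real M * (2 / real K)"
    proof -
      have "real M + real H \<le> real M * 2 * real H / real K"
        by (cases "H \<le> M") (use H1 M0 in \<open>auto simp: K_def min_def field_simps\<close>)
      thus ?thesis using H1 K1 by (simp add: divide_le_eq mult_ac)
    qed
    have diag: "(real M + real H) / real H * (X * M) \<le> Y\<^sup>2 * (X / h + X / Y)"
    proof -
      have "(real M + real H) / real H = real M / H + 1" using H1 by (simp add: field_simps)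
      also have "\<dots> \<le> Y / h + 1" using MY Hh h Y0 by (intro add_mono frac_le) auto
      finally have "(real M + real H) / real H * (X * M) \<le> (Y / h + 1) * (X * Y)"
        using MY X0 Y0 h by (intro mult_mono mult_left_mono) auto
      also have "\<dots> = Y\<^sup>2 * (X / h + X / Y)" using Y0 h by (simp add: field_simps power2_eq_square)
      finally show ?thesis .
    qed
    have off: "(real M + real H) / real H * (2 * (\<Sum>\<Delta>=1..<K. b (real \<Delta>))) \<le> Y\<^sup>2 * (200 * sqrt (2 * \<rho> * h / a) + 400 * Z\<^sup>2 / sqrt (a * \<rho>) * (1 / sqrt h + 1 / sqrt Y))"
    proof (cases "h \<le> 1")
      \<comment> \<open>The ceiling of h is at most 2h only for h > 1. For h \<le> 1 it is 1, and no
        off-diagonal shift remains.\<close>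
      case True
      hence "\<lceil>h\<rceil> = 1" using h by (simp add: ceiling_eq_iff)
      hence "H = 1" by (simp add: H_def)
      hence "(\<Sum>\<Delta>=1..<K. b (real \<Delta>)) = 0" by (simp add: K_def)
      moreover have "0 \<le> Y\<^sup>2 * (200 * sqrt (2 * \<rho> * h / a) + 400 * Z\<^sup>2 / sqrt (a * \<rho>) * (1 / sqrt h + 1 / sqrt Y))" using \<rho> h a Y0 by simp
      ultimately show ?thesis by simp
    next
      case False
      have H2: "real H \<le> 2 * h" using False unfolding H_def by linarith
      have sK: "sqrt K > 0" using K1 by simp
      have KK: "real K = sqrt K * sqrt K" by simp
      have i1: "1 / sqrt K \<le> 1 / sqrt h + 1 / sqrt M"
      proof -
        have "1 / sqrt H \<le> 1 / sqrt h" using Hh h by (intro divide_left_mono) auto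
        moreover have "1 / sqrt K \<le> 1 / sqrt H + 1 / sqrt M" by (auto simp: K_def min_def)
        ultimately show ?thesis by linarith
      qed
      have "(real M + real H) / real H * (2 * (\<Sum>\<Delta>=1..<K. b (real \<Delta>))) \<le> real M * (2 / real K) * (2 * (50 * Y * (p * (real K * sqrt K) + q * (2 * sqrt K))))"
        using f1 bs b0 by (intro mult_mono mult_left_mono mult_nonneg_nonneg sum_nonneg) auto
      also have "\<dots> = 200 * Y * (p * (real M * sqrt K) + 2 * q * (real M * (1 / sqrt K)))"
      proof -
        define i where "i = 1 / real K"
        have i1: "real K * i = 1" using K1 by (simp add: i_def)
        have i2: "1 / sqrt K = i * sqrt K" by (simp add: i_def sqrt_divide_self_eq inverse_eq_divide)
        have "real M * (2 * i) * (2 * (50 * Y * (p * (real K * sqrt K) + q * (2 * sqrt K))))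
            = 200 * Y * (p * (real M * (sqrt K * (real K * i))) + 2 * q * (real M * (i * sqrt K)))"
          by (simp add: algebra_simps)
        thus ?thesis unfolding i1 i2[symmetric] by (simp add: i_def)
      qed
      also have "\<dots> \<le> 200 * Y * (p * (Y * sqrt (2 * h)) + 2 * q * (Y * (1 / sqrt h + 1 / sqrt Y)))"
      proof (intro mult_left_mono add_mono)
        have "real K \<le> 2 * h" using H2 by (simp add: K_def)
        thus "real M * sqrt K \<le> Y * sqrt (2 * h)" using MY Y0 by (intro mult_mono) auto
        have "real M * (1 / sqrt M) = sqrt M" by (simp add: real_div_sqrt)
        also have "\<dots> \<le> sqrt Y" using MY by simp
        also have "\<dots> = Y * (1 / sqrt Y)" using Y0 by (simp add: real_div_sqrt)
        finally have "real M * (1 / sqrt M) \<le> Y * (1 / sqrt Y)" .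
        moreover have "real M * (1 / sqrt h) \<le> Y * (1 / sqrt h)" using MY h by (intro mult_right_mono) auto
        moreover have "real M * (1 / sqrt K) \<le> real M * (1 / sqrt h + 1 / sqrt M)" using i1 by (intro mult_left_mono) auto
        ultimately show "real M * (1 / sqrt K) \<le> Y * (1 / sqrt h + 1 / sqrt Y)" unfolding distrib_left by linarith
      qed (use pq Y0 in auto)
      also have "\<dots> = Y\<^sup>2 * (200 * (p * sqrt (2 * h)) + 400 * q * (1 / sqrt h + 1 / sqrt Y))"
        by (simp add: algebra_simps power2_eq_square)
      also have "p * sqrt (2 * h) = sqrt (2 * \<rho> * h / a)" unfolding p_def by (simp add: mult.commute flip: real_sqrt_mult)
      finally show ?thesis by (simp add: q_def)
    qed
    have "(real M + real H) / real H * (C 0 + 2 * (\<Sum>\<Delta>=1..<H. C \<Delta>)) = W\<^sup>2 * ((real M + real H) / real H * (X * M) + (real M + real H) / real H * (2 * (\<Sum>\<Delta>=1..<K. b (real \<Delta>))))"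
    proof -
      have *: "c * (v * x + 2 * (v * y)) = v * (c * x + c * (2 * y))" for c v x y :: real by (simp add: algebra_simps)
      show ?thesis unfolding Csum by (subst *[symmetric]) (simp add: C_def)
    qed
    also have "\<dots> \<le> W\<^sup>2 * (Y\<^sup>2 * (X / h + X / Y) + Y\<^sup>2 * (200 * sqrt (2 * \<rho> * h / a) + 400 * Z\<^sup>2 / sqrt (a * \<rho>) * (1 / sqrt h + 1 / sqrt Y)))"
      by (intro mult_left_mono add_mono diag off) auto
    also have "\<dots> = W\<^sup>2 * (Y\<^sup>2 * E)" by (simp add: E_def distrib_left)
    finally show ?thesis .
  qed
  finally have "(\<Sum>n=1..N. (norm (\<Sum>m=1..int M. z n m))\<^sup>2) \<le> W\<^sup>2 * Y\<^sup>2 * E" by (simp only: mult.assoc)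
  moreover have "(\<Sum>m=1..int M. z n m) = (\<Sum>m=1..int M. if in_ring a Z n m then of_real (w (kap a n m)) * cis (2*pi*\<rho>*kap a n m) else 0)" for n
    by (intro sum.cong) (auto simp: z_def)
  ultimately show ?thesis unfolding W_def X_def Y_def E_def N_def M_def by simp
qed

text \<open>Bound for a layer of size Z with the factor w(Z/2) sqrt l Z^2 taken out, r being the
  order of sqrt t. The first term comes from the balanced shift length h, the second from the 1/sqrt
  h part, the third from the diagonal when m takes few values, the fourth from the 1/sqrt(aZ)
  part.\<close>

definition Bz :: "real \<Rightarrow> real \<Rightarrow> real \<Rightarrow> real" where
  "Bz a r Z = 52 * (Z\<^sup>2 * r * a) powr (1/6) + 266 * (Z ^ 4 * a\<^sup>2 / r) powr (1/6) + 6 * (Z / a) powr (1/2) + 117 * (Z ^ 3 / r) powr (1/4)"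

lemma sqrt_exp: "sqrt (exp u) = exp (u / 2)"
  by (rule real_sqrt_unique) (simp_all flip: exp_double)

text \<open>The length h equates Z^2/(ah) and sqrt(rh/a) up to a constant, and 27 nearly minimises
  their weighted sum. The pieces may be rooted separately, since the root of a sum of squares is at
  most the sum. Writing all quantities as exponentials makes the identities between powers
  linear.\<close>

lemma ring_constant:
  fixes a r \<rho> Z :: real
  assumes a: "a > 0" and r: "r > 0" and Z: "Z > 0" and \<rho>: "9/10 * r \<le> \<rho>" "\<rho> \<le> 11/10 * r"
  defines "h \<equiv> (Z ^ 4 / (a * r)) powr (1/3) / 27"
  shows "sqrt (32 * a * (Z\<^sup>2 / a / h + Z\<^sup>2 / a / (a*Z) + 200 * sqrt (2 * \<rho> * h / a) + 400 * Z\<^sup>2 / sqrt (a * \<rho>) * (1 / sqrt h + 1 / sqrt (a*Z)))) \<le> Bz a r Z"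
proof -
  define \<alpha> where "\<alpha> = ln a"
  define z where "z = ln Z"
  define \<sigma> where "\<sigma> = ln r"
  have ea: "a = exp \<alpha>" and eZ: "Z = exp z" and er: "r = exp \<sigma>" using a r Z by (simp_all add: \<alpha>_def z_def \<sigma>_def)
  define v1 where "v1 = exp ((2*z + \<sigma> + \<alpha>)/6)"
  define v2 where "v2 = exp ((4*z + 2*\<alpha> - \<sigma>)/6)"
  define v3 where "v3 = exp ((z - \<alpha>)/2)"
  define v4 where "v4 = exp ((3*z - \<sigma>)/4)"
  have vs: "v1 > 0" "v2 > 0" "v3 > 0" "v4 > 0" by (simp_all add: v1_def v2_def v3_def v4_def)
  have \<rho>0: "\<rho> > 0" using \<rho>(1) r by linarith
  have hh: "h = exp ((4*z - \<alpha> - \<sigma>)/3) / 27"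
    unfolding h_def ea eZ er by (simp add: powr_def flip: exp_of_nat_mult exp_add exp_diff)
  have h0: "h > 0" unfolding hh by simp
  have v1s: "v1\<^sup>2 = exp ((2*z + \<sigma> + \<alpha>)/3)" and v2s: "v2\<^sup>2 = exp ((4*z + 2*\<alpha> - \<sigma>)/3)" and v3s: "v3\<^sup>2 = exp (z - \<alpha>)" and v4s: "v4\<^sup>2 = exp ((3*z - \<sigma>)/2)"
    unfolding v1_def v2_def v3_def v4_def by (simp_all flip: exp_double)
  have t1: "32 * a * (Z\<^sup>2 / a / h) = 864 * v1\<^sup>2"
  proof -
    have "32 * a * (Z\<^sup>2 / a / h) = 864 * (exp (2*z) / exp ((4*z - \<alpha> - \<sigma>)/3))" unfolding hh eZ ea by (simp flip: exp_double)
    also have "exp (2*z) / exp ((4*z - \<alpha> - \<sigma>)/3) = exp ((2*z + \<sigma> + \<alpha>)/3)" unfolding exp_diff[symmetric] by (rule arg_cong[where f = exp]) (simp add: field_simps)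
    finally show ?thesis by (simp add: v1s)
  qed
  have t1': "32 * a * (200 * sqrt (2 * \<rho> * h / a)) \<le> 1840 * v1\<^sup>2"
  proof -
    have "2 * \<rho> * h / a \<le> 2 * (11/10 * r) * h / a" using \<rho> a h0 by (intro divide_right_mono mult_right_mono mult_left_mono) auto
    also have "\<dots> = 11/135 * (exp \<sigma> * exp ((4*z - \<alpha> - \<sigma>)/3) / exp \<alpha>)" unfolding hh er ea by simp
    also have "exp \<sigma> * exp ((4*z - \<alpha> - \<sigma>)/3) / exp \<alpha> = exp ((4*z + 2*\<sigma> - 4*\<alpha>)/3)" unfolding exp_diff[symmetric] exp_add[symmetric] by (rule arg_cong[where f = exp]) (simp add: field_simps)
    also have "11/135 * exp ((4*z + 2*\<sigma> - 4*\<alpha>)/3) \<le> (23/80)\<^sup>2 * exp ((4*z + 2*\<sigma> - 4*\<alpha>)/3)" by (intro mult_right_mono) (auto simp: power2_eq_square)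
    finally have "sqrt (2 * \<rho> * h / a) \<le> sqrt ((23/80)\<^sup>2 * exp ((4*z + 2*\<sigma> - 4*\<alpha>)/3))" by (rule real_sqrt_le_mono)
    also have "\<dots> = 23/80 * exp ((4*z + 2*\<sigma> - 4*\<alpha>)/3/2)" by (simp add: real_sqrt_mult sqrt_exp)
    finally have "32 * a * (200 * sqrt (2 * \<rho> * h / a)) \<le> 32 * a * (200 * (23/80 * exp ((4*z + 2*\<sigma> - 4*\<alpha>)/3/2)))" using a by (intro mult_left_mono) auto
    also have "\<dots> = 1840 * (exp \<alpha> * exp ((4*z + 2*\<sigma> - 4*\<alpha>)/3/2))" unfolding ea by simp
    also have "exp \<alpha> * exp ((4*z + 2*\<sigma> - 4*\<alpha>)/3/2) = v1\<^sup>2" unfolding v1s exp_add[symmetric] by (rule arg_cong[where f = exp]) (simp add: field_simps)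
    finally show ?thesis .
  qed
  have ar: "Z\<^sup>2 / sqrt (a * \<rho>) \<le> Z\<^sup>2 / sqrt (9/10 * (a * r))"
    using \<rho> a r by (intro divide_left_mono real_sqrt_le_mono mult_pos_pos) (auto simp: mult.left_commute)
  have ar': "Z\<^sup>2 / sqrt (9/10 * (a * r)) = sqrt (10/9) * exp (2*z - (\<alpha> + \<sigma>)/2)"
  proof -
    have "sqrt (9/10 * (a * r)) = sqrt (9/10) * exp ((\<alpha> + \<sigma>)/2)" unfolding ea er exp_add[symmetric] by (simp only: real_sqrt_mult sqrt_exp)
    moreover have "1 / sqrt (9/10) = sqrt (10/9::real)" by (simp add: real_sqrt_divide)
    ultimately show ?thesis unfolding eZ exp_diff by (simp add: field_simps flip: exp_double)
  qed
  have t2: "32 * a * (400 * Z\<^sup>2 / sqrt (a * \<rho>) * (1 / sqrt h)) \<le> 266\<^sup>2 * v2\<^sup>2"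
  proof -
    have sh: "1 / sqrt h = sqrt 27 * exp (- ((4*z - \<alpha> - \<sigma>)/6))" unfolding hh by (simp add: real_sqrt_divide sqrt_exp exp_minus field_simps)
    have "400 * Z\<^sup>2 / sqrt (a * \<rho>) * (1 / sqrt h) \<le> 400 * (sqrt (10/9) * exp (2*z - (\<alpha> + \<sigma>)/2)) * (sqrt 27 * exp (- ((4*z - \<alpha> - \<sigma>)/6)))"
      using ar unfolding ar' sh by (intro mult_right_mono) auto
    also have "\<dots> = 400 * (sqrt (10/9) * sqrt 27) * (exp (2*z - (\<alpha> + \<sigma>)/2) * exp (- ((4*z - \<alpha> - \<sigma>)/6)))" by simp
    also have "sqrt (10/9) * sqrt 27 = sqrt 30" by (simp flip: real_sqrt_mult)
    also have "400 * sqrt 30 * (exp (2*z - (\<alpha> + \<sigma>)/2) * exp (- ((4*z - \<alpha> - \<sigma>)/6))) \<le> 400 * (11/2) * (exp (2*z - (\<alpha> + \<sigma>)/2) * exp (- ((4*z - \<alpha> - \<sigma>)/6)))"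
      by (intro mult_right_mono mult_left_mono real_le_lsqrt) (auto simp: power2_eq_square)
    finally have "32 * a * (400 * Z\<^sup>2 / sqrt (a * \<rho>) * (1 / sqrt h)) \<le> 32 * a * (400 * (11/2) * (exp (2*z - (\<alpha> + \<sigma>)/2) * exp (- ((4*z - \<alpha> - \<sigma>)/6))))"
      using a by (intro mult_left_mono) auto
    also have "\<dots> = 70400 * (exp \<alpha> * exp (2*z - (\<alpha> + \<sigma>)/2) * exp (- ((4*z - \<alpha> - \<sigma>)/6)))" unfolding ea by simp
    also have "exp \<alpha> * exp (2*z - (\<alpha> + \<sigma>)/2) * exp (- ((4*z - \<alpha> - \<sigma>)/6)) = v2\<^sup>2" unfolding v2s exp_add[symmetric] by (rule arg_cong[where f = exp]) (simp add: field_simps)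
    also have "70400 * v2\<^sup>2 \<le> 266\<^sup>2 * v2\<^sup>2" by (intro mult_right_mono) auto
    finally show ?thesis .
  qed
  have t3: "32 * a * (Z\<^sup>2 / a / (a*Z)) \<le> 6\<^sup>2 * v3\<^sup>2"
  proof -
    have "32 * a * (Z\<^sup>2 / a / (a*Z)) = 32 * (Z / a)" using a Z by (simp add: power2_eq_square)
    also have "Z / a = v3\<^sup>2" unfolding v3s eZ ea by (simp add: exp_diff)
    also have "32 * v3\<^sup>2 \<le> 6\<^sup>2 * v3\<^sup>2" by (intro mult_right_mono) auto
    finally show ?thesis .
  qed
  have t4: "32 * a * (400 * Z\<^sup>2 / sqrt (a * \<rho>) * (1 / sqrt (a*Z))) \<le> 117\<^sup>2 * v4\<^sup>2"
  proof -
    have sh: "1 / sqrt (a*Z) = exp (- ((\<alpha> + z)/2))" unfolding ea eZ by (simp add: sqrt_exp exp_minus field_simps flip: exp_add)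
    have "400 * Z\<^sup>2 / sqrt (a * \<rho>) * (1 / sqrt (a*Z)) \<le> 400 * (sqrt (10/9) * exp (2*z - (\<alpha> + \<sigma>)/2)) * exp (- ((\<alpha> + z)/2))"
      using ar unfolding ar' sh by (intro mult_right_mono) auto
    also have "\<dots> \<le> 400 * (53/50 * exp (2*z - (\<alpha> + \<sigma>)/2)) * exp (- ((\<alpha> + z)/2))"
      by (intro mult_right_mono mult_left_mono real_le_lsqrt) (auto simp: power2_eq_square)
    finally have "32 * a * (400 * Z\<^sup>2 / sqrt (a * \<rho>) * (1 / sqrt (a*Z))) \<le> 32 * a * (400 * (53/50 * exp (2*z - (\<alpha> + \<sigma>)/2)) * exp (- ((\<alpha> + z)/2)))"
      using a by (intro mult_left_mono) auto
    also have "\<dots> = 13568 * (exp \<alpha> * exp (2*z - (\<alpha> + \<sigma>)/2) * exp (- ((\<alpha> + z)/2)))" unfolding ea by simp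
    also have "exp \<alpha> * exp (2*z - (\<alpha> + \<sigma>)/2) * exp (- ((\<alpha> + z)/2)) = v4\<^sup>2" unfolding v4s exp_add[symmetric] by (rule arg_cong[where f = exp]) (simp add: field_simps)
    also have "13568 * v4\<^sup>2 \<le> 117\<^sup>2 * v4\<^sup>2" by (intro mult_right_mono) auto
    finally show ?thesis .
  qed
  have B: "Bz a r Z = 52 * v1 + 266 * v2 + 6 * v3 + 117 * v4"
  proof -
    have "(Z\<^sup>2 * r * a) powr (1/6) = v1" unfolding v1_def ea eZ er by (simp add: powr_def field_simps flip: exp_of_nat_mult exp_add exp_double)
    moreover have "(Z ^ 4 * a\<^sup>2 / r) powr (1/6) = v2" unfolding v2_def ea eZ er by (simp add: powr_def flip: exp_of_nat_mult exp_add exp_diff exp_double)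
    moreover have "(Z / a) powr (1/2) = v3" unfolding v3_def ea eZ er by (simp add: powr_def flip: exp_diff)
    moreover have "(Z ^ 3 / r) powr (1/4) = v4" unfolding v4_def ea eZ er by (simp add: powr_def flip: exp_of_nat_mult exp_diff)
    ultimately show ?thesis by (simp add: Bz_def)
  qed
  have "32 * a * (Z\<^sup>2 / a / h + Z\<^sup>2 / a / (a*Z) + 200 * sqrt (2 * \<rho> * h / a) + 400 * Z\<^sup>2 / sqrt (a * \<rho>) * (1 / sqrt h + 1 / sqrt (a*Z)))
     = 32 * a * (Z\<^sup>2 / a / h) + 32 * a * (Z\<^sup>2 / a / (a*Z)) + 32 * a * (200 * sqrt (2 * \<rho> * h / a)) + (32 * a * (400 * Z\<^sup>2 / sqrt (a * \<rho>) * (1 / sqrt h)) + 32 * a * (400 * Z\<^sup>2 / sqrt (a * \<rho>) * (1 / sqrt (a*Z))))"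
    by (simp only: distrib_left)
  \<comment> \<open>864 + 1840 = 2704 = 52^2 collects the two balanced terms.\<close>
  also have "\<dots> \<le> 2704 * v1\<^sup>2 + 6\<^sup>2 * v3\<^sup>2 + (266\<^sup>2 * v2\<^sup>2 + 117\<^sup>2 * v4\<^sup>2)" using t1 t1' t2 t3 t4 by linarith
  also have "\<dots> \<le> (52 * v1 + 266 * v2 + 6 * v3 + 117 * v4)\<^sup>2"
  proof -
    have "(p + q + u + v)\<^sup>2 \<ge> p\<^sup>2 + q\<^sup>2 + u\<^sup>2 + v\<^sup>2" if "p \<ge> 0" "q \<ge> 0" "u \<ge> 0" "v \<ge> 0" for p q u v :: real
    proof -
      define K where "K = p * q + p * u + p * v + q * u + q * v + u * v"
      have e: "(p + q + u + v)\<^sup>2 = p\<^sup>2 + q\<^sup>2 + u\<^sup>2 + v\<^sup>2 + 2 * K" unfolding K_def by algebra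
      have "0 \<le> K" unfolding K_def using that by simp
      thus ?thesis unfolding e by simp
    qed
    from this[of "52 * v1" "266 * v2" "6 * v3" "117 * v4"] vs show ?thesis by (simp add: power_mult_distrib)
  qed
  finally show ?thesis unfolding B using vs by (intro real_le_lsqrt) auto
qed

text \<open>Cauchy-Schwarz over n separates \<open>r2\<close> from the oscillating inner sums.
  \<open>l\<close> may be any nonnegative majorant of the logarithm, so that different layers can
  use a convenient one.\<close>

lemma ring_trig_bound:
  fixes a r \<rho> Z l :: real and w :: "real \<Rightarrow> real"
  assumes a: "a > 0" and r: "r > 0" and Z: "Z > 0" and \<rho>: "9/10 * r \<le> \<rho>" "\<rho> \<le> 11/10 * r"
    and l: "ln (Z\<^sup>2 / a) + 6 \<le> l" "l \<ge> 0"
    and w0: "\<And>x. x > 0 \<Longrightarrow> w x \<ge> 0" and wm: "\<And>x y. 0 < x \<Longrightarrow> x \<le> y \<Longrightarrow> w y \<le> w x"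
  shows "norm (\<Sum>n=1..nat \<lfloor>Z\<^sup>2/a\<rfloor>. of_real (real (r2 n)) * (\<Sum>m=1..int (nat \<lfloor>a*Z\<rfloor>). if in_ring a Z n m then of_real (w (kap a n m)) * cis (2*pi*\<rho>*kap a n m) else 0))
    \<le> w (Z/2) * (sqrt l * Z\<^sup>2 * Bz a r Z)"
proof -
  define X where "X = Z\<^sup>2 / a"
  define S where "S n = (\<Sum>m=1..int (nat \<lfloor>a*Z\<rfloor>). if in_ring a Z n m then of_real (w (kap a n m)) * cis (2*pi*\<rho>*kap a n m) else 0)" for n :: nat
  define h where "h = (Z ^ 4 / (a * r)) powr (1/3) / 27"
  have h0: "h > 0" unfolding h_def using a r Z by simp
  define E where "E = Z\<^sup>2 / a / h + Z\<^sup>2 / a / (a*Z) + 200 * sqrt (2 * \<rho> * h / a) + 400 * Z\<^sup>2 / sqrt (a * \<rho>) * (1 / sqrt h + 1 / sqrt (a*Z))"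
  have \<rho>0: "\<rho> > 0" using \<rho>(1) r by linarith
  have E0: "E \<ge> 0" unfolding E_def using a Z h0 \<rho>0 by simp
  have W0: "w (Z/2) \<ge> 0" using w0 Z by simp
  have SE: "sqrt (32 * a * E) \<le> Bz a r Z" unfolding E_def h_def by (rule ring_constant) (use assms in auto)
  have "norm (\<Sum>n=1..nat \<lfloor>X\<rfloor>. of_real (real (r2 n)) * S n) \<le> w (Z/2) * (sqrt l * Z\<^sup>2 * Bz a r Z)"
  proof (cases "X \<ge> 1")
    case False
    hence "nat \<lfloor>X\<rfloor> = 0" by (simp add: floor_le_iff not_le)
    moreover have "Bz a r Z \<ge> 0" by (simp add: Bz_def)
    ultimately show ?thesis using W0 l by simp
  next
    case True
    have "norm (\<Sum>n=1..nat \<lfloor>X\<rfloor>. of_real (real (r2 n)) * S n) \<le> (\<Sum>n=1..nat \<lfloor>X\<rfloor>. real (r2 n) * norm (S n))"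
      by (rule order_trans[OF norm_sum]) (simp add: norm_mult)
    hence "(norm (\<Sum>n=1..nat \<lfloor>X\<rfloor>. of_real (real (r2 n)) * S n))\<^sup>2 \<le> (\<Sum>n=1..nat \<lfloor>X\<rfloor>. real (r2 n) * norm (S n))\<^sup>2"
      by (intro power_mono) auto
    also have "\<dots> \<le> (\<Sum>n=1..nat \<lfloor>X\<rfloor>. (real (r2 n))\<^sup>2) * (\<Sum>n=1..nat \<lfloor>X\<rfloor>. (norm (S n))\<^sup>2)"
      by (rule Cauchy_Schwarz_ineq_sum)
    also have "\<dots> \<le> (32 * X * l) * ((w (Z/2))\<^sup>2 * (a*Z)\<^sup>2 * E)"
    proof (intro mult_mono)
      have "(\<Sum>n=1..nat \<lfloor>X\<rfloor>. (real (r2 n))\<^sup>2) \<le> 32 * X * (ln X + 6)" by (rule sum_r2_sq_le[OF True])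
      also have "\<dots> \<le> 32 * X * l" using l True unfolding X_def by (intro mult_left_mono) auto
      finally show "(\<Sum>n=1..nat \<lfloor>X\<rfloor>. (real (r2 n))\<^sup>2) \<le> 32 * X * l" .
      show "(\<Sum>n=1..nat \<lfloor>X\<rfloor>. (norm (S n))\<^sup>2) \<le> (w (Z/2))\<^sup>2 * (a*Z)\<^sup>2 * E"
        unfolding S_def E_def X_def by (rule ring_mean_square[OF a \<rho>0 Z h0 w0 wm])
    qed (use True l in \<open>auto intro!: sum_nonneg\<close>)
    also have "\<dots> = (w (Z/2))\<^sup>2 * l * (Z\<^sup>2)\<^sup>2 * (32 * a * E)"
      unfolding X_def using a by (simp add: power2_eq_square)
    also have "\<dots> = (w (Z/2) * (sqrt l * Z\<^sup>2 * sqrt (32 * a * E)))\<^sup>2"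
      using l(2) a E0 by (simp add: power_mult_distrib)
    finally have "norm (\<Sum>n=1..nat \<lfloor>X\<rfloor>. of_real (real (r2 n)) * S n) \<le> w (Z/2) * (sqrt l * Z\<^sup>2 * sqrt (32 * a * E))"
      by (rule power2_le_imp_le) (use W0 l a E0 in auto)
    also have "\<dots> \<le> w (Z/2) * (sqrt l * Z\<^sup>2 * Bz a r Z)" using SE W0 l by (intro mult_left_mono) auto
    finally show ?thesis .
  qed
  thus ?thesis unfolding S_def X_def .
qed

section \<open>The second difference of the Riesz mean\<close>

definition sdiff :: "real \<Rightarrow> real \<Rightarrow> (real \<Rightarrow> real) \<Rightarrow> real" where
  "sdiff h x f = f (x + 2 * h) - 2 * f (x + h) + f x"

text \<open>The t-derivative of \<open>gf \<omega>\<close>, as \<open>gf2\<close> is that of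
  \<open>gf1 \<omega>\<close>. Each differentiation costs one power of \<omega> in the decay, from
  \<omega>^(-4) to \<omega>^(-2).\<close>

definition gf1 :: "real \<Rightarrow> real \<Rightarrow> real" where
  "gf1 \<omega> t = 8 * pi * ((3 / \<omega> ^ 5 - t / \<omega> ^ 3) * sin (\<omega> * sqrt t) - 3 * sqrt t / \<omega> ^ 4 * cos (\<omega> * sqrt t))"

definition gf2 :: "real \<Rightarrow> real \<Rightarrow> real" where
  "gf2 \<omega> t = 4 * pi / \<omega> ^ 3 * sin (\<omega> * sqrt t) - 4 * pi * sqrt t / \<omega>\<^sup>2 * cos (\<omega> * sqrt t)"

lemma gf_derivs:
  assumes w: "\<omega> > 0" and t: "t > 0"
  shows "(gf \<omega> has_real_derivative gf1 \<omega> t) (at t)" "(gf1 \<omega> has_real_derivative gf2 \<omega> t) (at t)"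
proof -
  define q where "q = sqrt t"
  define i where "i = inverse q / 2"
  define j where "j = 1 / \<omega>"
  have q: "q > 0" "t = q * q" unfolding q_def using t by auto
  have qi: "2 * (q * i) = 1" using q by (simp add: i_def)
  have jw: "\<omega> * j = 1" using w by (simp add: j_def)
  define s where "s = sin (\<omega> * q)"
  define c where "c = cos (\<omega> * q)"
  have dq: "(sqrt has_real_derivative i) (at t)" unfolding i_def q_def using DERIV_real_sqrt[OF t] by simp
  have ds: "((\<lambda>t. sin (\<omega> * sqrt t)) has_real_derivative c * (\<omega> * i)) (at t)"
    unfolding c_def q_def by (rule DERIV_chain2[OF DERIV_sin DERIV_cmult[OF dq]])
  have dc: "((\<lambda>t. cos (\<omega> * sqrt t)) has_real_derivative - s * (\<omega> * i)) (at t)"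
    unfolding s_def q_def by (rule DERIV_chain2[OF DERIV_cos DERIV_cmult[OF dq]])
  have dt: "((\<lambda>t. t) has_real_derivative 1) (at t)" by (rule DERIV_ident)
  have gfj: "gf \<omega> = (\<lambda>t. 16 * pi * ((15 * j ^ 7 - 6 * j ^ 5 * t) * sin (\<omega> * sqrt t) - (15 * j ^ 6 * sqrt t - j ^ 4 * (t * sqrt t)) * cos (\<omega> * sqrt t)))"
    unfolding gf_def j_def by (auto simp: power_one_over fun_eq_iff)
  have gf1j: "gf1 \<omega> = (\<lambda>t. 8 * pi * ((3 * j ^ 5 - j ^ 3 * t) * sin (\<omega> * sqrt t) - 3 * j ^ 4 * sqrt t * cos (\<omega> * sqrt t)))"
    unfolding gf1_def j_def by (auto simp: power_one_over fun_eq_iff)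
  have gf2j: "gf2 \<omega> t = 4 * pi * (j ^ 3 * s - q * j\<^sup>2 * c)"
    unfolding gf2_def j_def s_def c_def q_def by (simp add: power_one_over right_diff_distrib)
  have "(gf \<omega> has_real_derivative 16 * pi * (((0 - 6 * j ^ 5 * 1) * sin (\<omega> * sqrt t) + c * (\<omega> * i) * (15 * j ^ 7 - 6 * j ^ 5 * t))
      - ((15 * j ^ 6 * i - j ^ 4 * (1 * sqrt t + i * t)) * cos (\<omega> * sqrt t) + - s * (\<omega> * i) * (15 * j ^ 6 * sqrt t - j ^ 4 * (t * sqrt t))))) (at t)"
    unfolding gfj by (intro DERIV_cmult DERIV_diff DERIV_mult DERIV_const dt dq ds dc)
  also have "16 * pi * (((0 - 6 * j ^ 5 * 1) * sin (\<omega> * sqrt t) + c * (\<omega> * i) * (15 * j ^ 7 - 6 * j ^ 5 * t))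
      - ((15 * j ^ 6 * i - j ^ 4 * (1 * sqrt t + i * t)) * cos (\<omega> * sqrt t) + - s * (\<omega> * i) * (15 * j ^ 6 * sqrt t - j ^ 4 * (t * sqrt t)))) = gf1 \<omega> t"
    unfolding gf1j q_def[symmetric] s_def[symmetric] c_def[symmetric] using q(2) qi jw by algebra
  finally show "(gf \<omega> has_real_derivative gf1 \<omega> t) (at t)" .
  have "(gf1 \<omega> has_real_derivative 8 * pi * (((0 - j ^ 3 * 1) * sin (\<omega> * sqrt t) + c * (\<omega> * i) * (3 * j ^ 5 - j ^ 3 * t))
      - (3 * j ^ 4 * i * cos (\<omega> * sqrt t) + - s * (\<omega> * i) * (3 * j ^ 4 * sqrt t)))) (at t)"
    unfolding gf1j by (intro DERIV_cmult DERIV_diff DERIV_mult DERIV_const dt dq ds dc)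
  also have "8 * pi * (((0 - j ^ 3 * 1) * sin (\<omega> * sqrt t) + c * (\<omega> * i) * (3 * j ^ 5 - j ^ 3 * t))
      - (3 * j ^ 4 * i * cos (\<omega> * sqrt t) + - s * (\<omega> * i) * (3 * j ^ 4 * sqrt t))) = gf2 \<omega> t"
    unfolding gf2j q_def[symmetric] s_def[symmetric] c_def[symmetric] using q(2) qi jw by algebra
  finally show "(gf1 \<omega> has_real_derivative gf2 \<omega> t) (at t)" .
qed

section \<open>Sums over boxes and layers, and their dyadic summation\<close>

definition tsum :: "real \<Rightarrow> real \<Rightarrow> (real \<Rightarrow> real) \<Rightarrow> real" where
  "tsum a Z F = (\<Sum>n=1..nat \<lfloor>Z\<^sup>2/a\<rfloor>. real (r2 n) * (\<Sum>m=1..int (nat \<lfloor>a*Z\<rfloor>). F (kap a n m)))"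

definition ringsum :: "real \<Rightarrow> real \<Rightarrow> (real \<Rightarrow> real) \<Rightarrow> real" where
  "ringsum a Z F = (\<Sum>n=1..nat \<lfloor>Z\<^sup>2/a\<rfloor>. real (r2 n) * (\<Sum>m=1..int (nat \<lfloor>a*Z\<rfloor>). if in_ring a Z n m then F (kap a n m) else 0))"

lemma ringsum_diff: "ringsum a Z (\<lambda>\<kappa>. F \<kappa> - G \<kappa>) = ringsum a Z F - ringsum a Z G"
  unfolding ringsum_def by (simp add: sum_subtractf[symmetric] right_diff_distrib[symmetric] if_distrib cong: if_cong)

lemma ringsum_cmult: "ringsum a Z (\<lambda>\<kappa>. c * F \<kappa>) = c * ringsum a Z F"
proof -
  have "(if P then c * y else 0) = c * (if P then y else 0)" for P and y :: real by simp
  thus ?thesis unfolding ringsum_def by (simp only: sum_distrib_left[symmetric] mult.left_commute[of _ c])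
qed

lemma ringsum_deriv:
  assumes "\<And>\<kappa>. \<kappa> > 0 \<Longrightarrow> (f \<kappa> has_real_derivative f' \<kappa>) (at t)" and a: "a > 0"
  shows "((\<lambda>t. ringsum a Z (\<lambda>\<kappa>. f \<kappa> t)) has_real_derivative ringsum a Z f') (at t)"
  unfolding ringsum_def
proof (intro DERIV_sum DERIV_cmult)
  fix n :: nat and m :: int assume "n \<in> {1..nat \<lfloor>Z\<^sup>2/a\<rfloor>}"
  hence "kap a n m > 0" using a by (intro kap_pos) auto
  thus "((\<lambda>t. if in_ring a Z n m then f (kap a n m) t else 0) has_real_derivative (if in_ring a Z n m then f' (kap a n m) else 0)) (at t)"
    using assms(1) by auto
qed

text \<open>A point of the box needs a \<le> Z^2 and 1 \<le> aZ, hence Z^3 \<ge> 1. This is what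
  ends the downward dyadic iteration.\<close>

lemma small_box_empty:
  assumes "a > 0" "Z > 0" "Z < 1"
  shows "tsum a Z F = 0" "ringsum a Z F = 0"
proof -
  have "nat \<lfloor>Z\<^sup>2/a\<rfloor> = 0 \<or> nat \<lfloor>a*Z\<rfloor> = 0"
  proof (rule ccontr)
    assume "\<not> ?thesis"
    hence "1 \<le> \<lfloor>Z\<^sup>2/a\<rfloor>" "1 \<le> \<lfloor>a*Z\<rfloor>" by linarith+
    hence "a \<le> Z\<^sup>2" "1 \<le> a * Z" using assms by (auto simp: le_floor_iff pos_le_divide_eq)
    hence "1 \<le> Z\<^sup>2 * Z" using assms by (meson less_imp_le mult_right_mono order_trans)
    moreover have "Z\<^sup>2 * Z < 1" using power_Suc_less_one[of Z 2] assms by (simp add: power2_eq_square power3_eq_cube mult_ac)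
    ultimately show False by simp
  qed
  thus "tsum a Z F = 0" "ringsum a Z F = 0" unfolding tsum_def ringsum_def by auto
qed

lemma tsum_halve:
  assumes a: "a > 0" and Z: "Z > 0"
  shows "tsum a Z F = tsum a (Z/2) F + ringsum a Z F"
proof -
  define N where "N = nat \<lfloor>Z\<^sup>2/a\<rfloor>"
  define N' where "N' = nat \<lfloor>(Z/2)\<^sup>2/a\<rfloor>"
  define M where "M = int (nat \<lfloor>a*Z\<rfloor>)"
  define M' where "M' = int (nat \<lfloor>a*(Z/2)\<rfloor>)"
  have NN: "N' \<le> N" unfolding N_def N'_def using a by (intro nat_mono floor_mono divide_right_mono) (auto simp: power_divide)
  have MM: "M' \<le> M" unfolding M_def M'_def using a Z by (simp, intro nat_mono floor_mono) auto
  have X0: "(Z/2)\<^sup>2/a \<ge> 0" "a*(Z/2) \<ge> 0" using a Z by auto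
  have inN: "real n \<le> (Z/2)\<^sup>2/a \<longleftrightarrow> n \<le> N'" for n using X0(1) unfolding N'_def
    by (metis le_nat_floor of_nat_floor of_nat_le_iff order_trans)
  have inM: "real_of_int m \<le> a*(Z/2) \<longleftrightarrow> m \<le> M'" if "m \<ge> 1" for m
    unfolding M'_def using X0(2) by (simp add: le_floor_iff)
  have "tsum a (Z/2) F = (\<Sum>n=1..N'. real (r2 n) * (\<Sum>m=1..M'. F (kap a n m)))" unfolding tsum_def N'_def M'_def ..
  also have "\<dots> = (\<Sum>n=1..N. if n \<le> N' then real (r2 n) * (\<Sum>m=1..M'. F (kap a n m)) else 0)"
    by (rule sum.mono_neutral_cong_left) (use NN in auto)
  also have "\<dots> = (\<Sum>n=1..N. real (r2 n) * (\<Sum>m=1..M. if n \<le> N' \<and> m \<le> M' then F (kap a n m) else 0))"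
  proof (intro sum.cong refl)
    fix n :: nat
    have "(\<Sum>m=1..M'. F (kap a n m)) = (\<Sum>m=1..M. if m \<le> M' then F (kap a n m) else 0)"
      by (rule sum.mono_neutral_cong_left) (use MM in auto)
    thus "(if n \<le> N' then real (r2 n) * (\<Sum>m=1..M'. F (kap a n m)) else 0) = real (r2 n) * (\<Sum>m=1..M. if n \<le> N' \<and> m \<le> M' then F (kap a n m) else 0)"
      by simp
  qed
  finally have e: "tsum a (Z/2) F = (\<Sum>n=1..N. real (r2 n) * (\<Sum>m=1..M. if n \<le> N' \<and> m \<le> M' then F (kap a n m) else 0))" .
  have "tsum a (Z/2) F + ringsum a Z F = (\<Sum>n=1..N. real (r2 n) * (\<Sum>m=1..M. (if n \<le> N' \<and> m \<le> M' then F (kap a n m) else 0) + (if in_ring a Z n m then F (kap a n m) else 0)))"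
    unfolding e ringsum_def N_def[symmetric] M_def[symmetric] by (simp only: sum.distrib distrib_left)
  also have "\<dots> = tsum a Z F" unfolding tsum_def N_def[symmetric] M_def[symmetric]
  proof (intro sum.cong refl arg_cong2[where f = "(*)"])
    fix n m assume "m \<in> {1..M}"
    hence "in_ring a Z n m \<longleftrightarrow> \<not> (n \<le> N' \<and> m \<le> M')" by (simp only: in_ring_def inN inM atLeastAtMost_iff)
    thus "(if n \<le> N' \<and> m \<le> M' then F (kap a n m) else 0) + (if in_ring a Z n m then F (kap a n m) else 0) = F (kap a n m)" by simp
  qed
  finally show ?thesis ..
qed

lemma ringsum_trig_bound:
  fixes a r \<rho> Z l :: real and w :: "real \<Rightarrow> real"
  assumes a: "a > 0" and r: "r > 0" and Z: "Z > 0" and \<rho>: "9/10 * r \<le> \<rho>" "\<rho> \<le> 11/10 * r"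
    and l: "ln (Z\<^sup>2 / a) + 6 \<le> l" "l \<ge> 0"
    and w0: "\<And>x. x > 0 \<Longrightarrow> w x \<ge> 0" and wm: "\<And>x y. 0 < x \<Longrightarrow> x \<le> y \<Longrightarrow> w y \<le> w x"
  shows "\<bar>ringsum a Z (\<lambda>\<kappa>. w \<kappa> * cos (2 * pi * \<kappa> * \<rho>))\<bar> \<le> w (Z/2) * (sqrt l * Z\<^sup>2 * Bz a r Z)"
    and "\<bar>ringsum a Z (\<lambda>\<kappa>. w \<kappa> * sin (2 * pi * \<kappa> * \<rho>))\<bar> \<le> w (Z/2) * (sqrt l * Z\<^sup>2 * Bz a r Z)"
proof -
  define T where "T = (\<Sum>n=1..nat \<lfloor>Z\<^sup>2/a\<rfloor>. of_real (real (r2 n)) * (\<Sum>m=1..int (nat \<lfloor>a*Z\<rfloor>). if in_ring a Z n m then of_real (w (kap a n m)) * cis (2*pi*\<rho>*kap a n m) else 0))"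
  have b: "norm T \<le> w (Z/2) * (sqrt l * Z\<^sup>2 * Bz a r Z)" unfolding T_def by (rule ring_trig_bound) (use assms in auto)
  have ReT: "Re T = ringsum a Z (\<lambda>\<kappa>. w \<kappa> * cos (2 * pi * \<kappa> * \<rho>))"
    unfolding T_def ringsum_def Re_sum by (intro sum.cong refl) (simp add: if_distrib[of Re] mult_ac cong: if_cong)
  have ImT: "Im T = ringsum a Z (\<lambda>\<kappa>. w \<kappa> * sin (2 * pi * \<kappa> * \<rho>))"
    unfolding T_def ringsum_def Im_sum by (intro sum.cong refl) (simp add: if_distrib[of Im] mult_ac cong: if_cong)
  show "\<bar>ringsum a Z (\<lambda>\<kappa>. w \<kappa> * cos (2 * pi * \<kappa> * \<rho>))\<bar> \<le> w (Z/2) * (sqrt l * Z\<^sup>2 * Bz a r Z)"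
    using b abs_Re_le_cmod[of T] unfolding ReT by linarith
  show "\<bar>ringsum a Z (\<lambda>\<kappa>. w \<kappa> * sin (2 * pi * \<kappa> * \<rho>))\<bar> \<le> w (Z/2) * (sqrt l * Z\<^sup>2 * Bz a r Z)"
    using b abs_Im_le_cmod[of T] unfolding ImT by linarith
qed

lemma inverse_power_weight:
  fixes c :: real assumes "c \<ge> 0"
  shows "x > 0 \<Longrightarrow> c / (2 * pi * x) ^ k \<ge> 0" "0 < x \<Longrightarrow> x \<le> y \<Longrightarrow> c / (2 * pi * y) ^ k \<le> c / (2 * pi * x) ^ k"
  using assms by (auto intro!: divide_left_mono power_mono)

lemma sqrt_range:
  assumes r: "r > 0" and t: "81/100 * r\<^sup>2 \<le> t" "t \<le> 121/100 * r\<^sup>2"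
  shows "9/10 * r \<le> sqrt t" "sqrt t \<le> 11/10 * r" "t > 0"
proof -
  show "9/10 * r \<le> sqrt t" by (rule real_le_rsqrt) (use t in \<open>simp add: power2_eq_square\<close>)
  show "sqrt t \<le> 11/10 * r" by (rule real_le_lsqrt) (use t r in \<open>auto simp: power2_eq_square intro: order_trans[OF _ t(1)]\<close>)
  have "81/100 * r\<^sup>2 > 0" using r by simp
  thus "t > 0" using t(1) by linarith
qed

text \<open>The layer sum is differentiated as a whole, so the second difference is h^2 times an
  oscillating sum of \<open>gf2\<close> at one point. Its main weight, sqrt t times 1/\<omega>^2,
  taken at Z/2 cancels the factor Z^2 of the layer bound.\<close>

lemma ringsum_low:
  fixes a r x h Z l :: real
  assumes a: "a > 0" and r: "r \<ge> 14" and Z: "Z > 0" and h: "h > 0" and x: "81/100 * r\<^sup>2 \<le> x" "x + 2 * h \<le> 121/100 * r\<^sup>2"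
    and l: "ln (Z\<^sup>2 / a) + 6 \<le> l" "l \<ge> 0"
  shows "\<bar>ringsum a Z (\<lambda>\<kappa>. sdiff h x (gf (2 * pi * \<kappa>)))\<bar> \<le> h\<^sup>2 * (3/2 * r * sqrt l * Bz a r Z)"
proof (cases "Z < 1")
  case True
  have "Bz a r Z \<ge> 0" by (simp add: Bz_def)
  thus ?thesis using small_box_empty(2)[OF a Z True] r l by simp
next
  case False
  define \<Phi> where "\<Phi> t = ringsum a Z (\<lambda>\<kappa>. gf (2 * pi * \<kappa>) t)" for t
  define \<Phi>1 where "\<Phi>1 t = ringsum a Z (\<lambda>\<kappa>. gf1 (2 * pi * \<kappa>) t)" for t
  define \<Phi>2 where "\<Phi>2 t = ringsum a Z (\<lambda>\<kappa>. gf2 (2 * pi * \<kappa>) t)" for t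
  have r0: "r > 0" using r by simp
  have tr: "81/100 * r\<^sup>2 \<le> t" "t \<le> 121/100 * r\<^sup>2" if "x \<le> t" "t \<le> x + 2 * h" for t using that x by linarith+
  have "\<exists>\<xi>. x < \<xi> \<and> \<xi> < x + 2 * h \<and> \<Phi> (x + 2 * h) - 2 * \<Phi> (x + h) + \<Phi> x = h\<^sup>2 * \<Phi>2 \<xi>"
  proof (rule second_difference_mvt[where f' = \<Phi>1, OF h])
    fix t assume "x \<le> t" "t \<le> x + 2 * h"
    hence t0: "t > 0" using sqrt_range(3)[OF r0 tr] by blast
    show "(\<Phi> has_real_derivative \<Phi>1 t) (at t)" unfolding \<Phi>_def[abs_def] \<Phi>1_def
      by (rule ringsum_deriv[OF _ a]) (use gf_derivs(1) t0 in auto)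
    show "(\<Phi>1 has_real_derivative \<Phi>2 t) (at t)" unfolding \<Phi>1_def[abs_def] \<Phi>2_def
      by (rule ringsum_deriv[OF _ a]) (use gf_derivs(2) t0 in auto)
  qed
  then obtain \<xi> where \<xi>: "x < \<xi>" "\<xi> < x + 2 * h" "\<Phi> (x + 2 * h) - 2 * \<Phi> (x + h) + \<Phi> x = h\<^sup>2 * \<Phi>2 \<xi>" by blast
  have lin: "ringsum a Z (\<lambda>\<kappa>. sdiff h x (gf (2 * pi * \<kappa>))) = \<Phi> (x + 2 * h) - 2 * \<Phi> (x + h) + \<Phi> x"
  proof -
    have "ringsum a Z (\<lambda>\<kappa>. sdiff h x (gf (2 * pi * \<kappa>))) = ringsum a Z (\<lambda>\<kappa>. gf (2 * pi * \<kappa>) (x + 2 * h) - (2 * gf (2 * pi * \<kappa>) (x + h) - gf (2 * pi * \<kappa>) x))"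
      by (simp add: sdiff_def algebra_simps)
    thus ?thesis unfolding ringsum_diff ringsum_cmult \<Phi>_def by simp
  qed
  define \<rho> where "\<rho> = sqrt \<xi>"
  have \<rho>: "9/10 * r \<le> \<rho>" "\<rho> \<le> 11/10 * r" unfolding \<rho>_def using sqrt_range[OF r0 tr[of \<xi>]] \<xi> by auto
  have \<rho>0: "\<rho> > 0" using \<rho>(1) r0 by linarith
  define Q where "Q = sqrt l * Z\<^sup>2 * Bz a r Z"
  have Q0: "Q \<ge> 0" unfolding Q_def using l by (simp add: Bz_def)
  have "\<Phi>2 \<xi> = ringsum a Z (\<lambda>\<kappa>. 4 * pi / (2 * pi * \<kappa>) ^ 3 * sin (2 * pi * \<kappa> * \<rho>)) - ringsum a Z (\<lambda>\<kappa>. 4 * pi * \<rho> / (2 * pi * \<kappa>)\<^sup>2 * cos (2 * pi * \<kappa> * \<rho>))"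
    unfolding \<Phi>2_def gf2_def \<rho>_def ringsum_diff ..
  hence "\<bar>\<Phi>2 \<xi>\<bar> \<le> \<bar>ringsum a Z (\<lambda>\<kappa>. 4 * pi / (2 * pi * \<kappa>) ^ 3 * sin (2 * pi * \<kappa> * \<rho>))\<bar> + \<bar>ringsum a Z (\<lambda>\<kappa>. 4 * pi * \<rho> / (2 * pi * \<kappa>)\<^sup>2 * cos (2 * pi * \<kappa> * \<rho>))\<bar>"
    by linarith
  also have "\<dots> \<le> 4 * pi / (2 * pi * (Z/2)) ^ 3 * Q + 4 * pi * \<rho> / (2 * pi * (Z/2))\<^sup>2 * Q"
    unfolding Q_def
    by (intro add_mono ringsum_trig_bound[where w = "\<lambda>\<kappa>. 4 * pi / (2 * pi * \<kappa>) ^ 3"] ringsum_trig_bound[where w = "\<lambda>\<kappa>. 4 * pi * \<rho> / (2 * pi * \<kappa>)\<^sup>2"] inverse_power_weight)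
       (use a r0 Z \<rho> \<rho>0 l in auto)
  also have "\<dots> = (4 * pi / (pi * Z) ^ 3 + 4 * pi * \<rho> / (pi * Z)\<^sup>2) * Q" by (simp add: distrib_right)
  also have "\<dots> \<le> (3/2 * r / Z\<^sup>2) * Q"
  proof (intro mult_right_mono Q0)
    have pi3: "pi \<ge> 3" using pi_gt3 by simp
    have "4 * pi / (pi * Z) ^ 3 = 4 / (pi * pi * Z) / Z\<^sup>2" using Z by (simp add: field_simps power2_eq_square power3_eq_cube)
    also have "\<dots> \<le> (4/9) / Z\<^sup>2"
    proof (rule divide_right_mono)
      have "(3 * 3) * 1 \<le> pi * pi * Z" using pi3 False by (intro mult_mono) auto
      hence "4 / (pi * pi * Z) \<le> 4 / 9" by (intro divide_left_mono) auto
      thus "4 / (pi * pi * Z) \<le> 4/9" .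
    qed auto
    finally have 1: "4 * pi / (pi * Z) ^ 3 \<le> (4/9) / Z\<^sup>2" .
    have "4 * pi * \<rho> / (pi * Z)\<^sup>2 = (4 * \<rho> / pi) / Z\<^sup>2" by (simp add: power2_eq_square)
    also have "\<dots> \<le> (4 * (11/10 * r) / 3) / Z\<^sup>2"
      using \<rho> \<rho>0 pi3 by (intro divide_right_mono frac_le) auto
    finally have 2: "4 * pi * \<rho> / (pi * Z)\<^sup>2 \<le> (4 * (11/10 * r) / 3) / Z\<^sup>2" .
    have "(4/9) / Z\<^sup>2 + (4 * (11/10 * r) / 3) / Z\<^sup>2 = (4/9 + 4 * (11/10 * r) / 3) / Z\<^sup>2" by (simp add: add_divide_distrib)
    \<comment> \<open>This is where r \<ge> 14 matters: 4/9 has to fit into (3/2 - 22/15) r =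
      r/30.\<close>
    also have "\<dots> \<le> (3/2 * r) / Z\<^sup>2" using r by (intro divide_right_mono) auto
    finally show "4 * pi / (pi * Z) ^ 3 + 4 * pi * \<rho> / (pi * Z)\<^sup>2 \<le> 3/2 * r / Z\<^sup>2" using 1 2 by linarith
  qed
  also have "\<dots> = 3/2 * r * sqrt l * Bz a r Z" using Z by (simp add: Q_def)
  finally have "h\<^sup>2 * \<bar>\<Phi>2 \<xi>\<bar> \<le> h\<^sup>2 * (3/2 * r * sqrt l * Bz a r Z)" by (rule mult_left_mono) simp
  thus ?thesis unfolding lin \<xi>(3) abs_mult by simp
qed

text \<open>Here h is too long for differentiation to help, so the three values of the layer sum are
  bounded separately; 4 = 1 + 2 + 1 is the total weight of a second difference. The decay
  \<omega>^(-4) leaves the factor Z^(-2) that makes the upward dyadic sum converge.\<close>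

lemma ringsum_high:
  fixes a r x h Z l :: real
  assumes a: "a > 0" and r: "r \<ge> 14" and Z: "Z > 0" and h: "h > 0" and x: "81/100 * r\<^sup>2 \<le> x" "x + 2 * h \<le> 121/100 * r\<^sup>2"
    and l: "ln (Z\<^sup>2 / a) + 6 \<le> l" "l \<ge> 0"
  shows "\<bar>ringsum a Z (\<lambda>\<kappa>. sdiff h x (gf (2 * pi * \<kappa>)))\<bar> \<le> 4 * r ^ 3 / Z\<^sup>2 * (sqrt l * Bz a r Z)"
proof (cases "Z < 1")
  case True
  have "Bz a r Z \<ge> 0" by (simp add: Bz_def)
  thus ?thesis using small_box_empty(2)[OF a Z True] r l by simp
next
  case False
  define \<Phi> where "\<Phi> t = ringsum a Z (\<lambda>\<kappa>. gf (2 * pi * \<kappa>) t)" for t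
  have r0: "r > 0" using r by simp
  have pi3: "pi \<ge> 3" using pi_gt3 by simp
  define Q where "Q = sqrt l * Z\<^sup>2 * Bz a r Z"
  have Q0: "Q \<ge> 0" unfolding Q_def using l by (simp add: Bz_def)
  have b: "\<bar>\<Phi> t\<bar> \<le> r ^ 3 / Z ^ 4 * Q" if t: "81/100 * r\<^sup>2 \<le> t" "t \<le> 121/100 * r\<^sup>2" for t
  proof -
    define \<rho> where "\<rho> = sqrt t"
    note sr = sqrt_range[OF r0 t]
    have \<rho>: "9/10 * r \<le> \<rho>" "\<rho> \<le> 11/10 * r" unfolding \<rho>_def using sr by auto
    have \<rho>0: "\<rho> > 0" using \<rho>(1) r0 by linarith
    have t0: "t > 0" by (rule sr(3))
    define A where "A = ringsum a Z (\<lambda>\<kappa>. 240 * pi / (2 * pi * \<kappa>) ^ 7 * sin (2 * pi * \<kappa> * \<rho>))"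
    define B where "B = ringsum a Z (\<lambda>\<kappa>. 96 * pi * t / (2 * pi * \<kappa>) ^ 5 * sin (2 * pi * \<kappa> * \<rho>))"
    define C where "C = ringsum a Z (\<lambda>\<kappa>. 240 * pi * \<rho> / (2 * pi * \<kappa>) ^ 6 * cos (2 * pi * \<kappa> * \<rho>))"
    define D where "D = ringsum a Z (\<lambda>\<kappa>. 16 * pi * (t * \<rho>) / (2 * pi * \<kappa>) ^ 4 * cos (2 * pi * \<kappa> * \<rho>))"
    have "\<Phi> t = (A - B) - (C - D)"
      unfolding \<Phi>_def A_def B_def C_def D_def ringsum_diff[symmetric] gf_def \<rho>_def[symmetric]
      by (simp add: algebra_simps)
    hence "\<bar>\<Phi> t\<bar> \<le> \<bar>A\<bar> + \<bar>B\<bar> + \<bar>C\<bar> + \<bar>D\<bar>" by linarith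
    also have "\<dots> \<le> 240 * pi / (2 * pi * (Z/2)) ^ 7 * Q + 96 * pi * t / (2 * pi * (Z/2)) ^ 5 * Q + 240 * pi * \<rho> / (2 * pi * (Z/2)) ^ 6 * Q + 16 * pi * (t * \<rho>) / (2 * pi * (Z/2)) ^ 4 * Q"
      unfolding Q_def A_def B_def C_def D_def
      by (intro add_mono ringsum_trig_bound[where w = "\<lambda>\<kappa>. 240 * pi / (2 * pi * \<kappa>) ^ 7"] ringsum_trig_bound[where w = "\<lambda>\<kappa>. 96 * pi * t / (2 * pi * \<kappa>) ^ 5"]
          ringsum_trig_bound[where w = "\<lambda>\<kappa>. 240 * pi * \<rho> / (2 * pi * \<kappa>) ^ 6"] ringsum_trig_bound[where w = "\<lambda>\<kappa>. 16 * pi * (t * \<rho>) / (2 * pi * \<kappa>) ^ 4"] inverse_power_weight)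
         (use a r0 Z \<rho> \<rho>0 t0 l in auto)
    also have "\<dots> = (240 * pi / (pi * Z) ^ 7 + 96 * pi * t / (pi * Z) ^ 5 + 240 * pi * \<rho> / (pi * Z) ^ 6 + 16 * pi * (t * \<rho>) / (pi * Z) ^ 4) * Q"
      by (simp add: distrib_right)
    also have "\<dots> \<le> (r ^ 3 / Z ^ 4) * Q"
    proof (intro mult_right_mono Q0)
      have Z1: "Z \<ge> 1" using False by simp
      \<comment> \<open>One factor pi cancels; the remaining ones are bounded below by 3, and Z^k by
        1.\<close>
      have gen: "c * pi * u / (pi * Z) ^ (4 + k) \<le> c * v / 3 ^ (3 + k) / Z ^ 4" if "0 \<le> c" "0 \<le> u" "u \<le> v" for c u v :: real and k
      proof -
        have "3 ^ (3 + k) * 1 \<le> pi ^ (3 + k) * Z ^ k" using pi3 Z1 by (intro mult_mono power_mono one_le_power) auto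
        hence "c * u / (pi ^ (3 + k) * Z ^ k) \<le> c * v / 3 ^ (3 + k)" using that by (intro frac_le mult_left_mono mult_nonneg_nonneg) auto
        hence "c * u / (pi ^ (3 + k) * Z ^ k) / Z ^ 4 \<le> c * v / 3 ^ (3 + k) / Z ^ 4" using Z by (intro divide_right_mono) auto
        moreover have "c * pi * u / (pi * Z) ^ (4 + k) = c * u / (pi ^ (3 + k) * Z ^ k) / Z ^ 4"
        proof -
          have "(pi * Z) ^ (4 + k) = pi * (pi ^ (3 + k) * Z ^ k * Z ^ 4)" by (simp add: power_mult_distrib power_add eval_nat_numeral)
          thus ?thesis by simp
        qed
        ultimately show ?thesis by simp
      qed
      have r2: "1 \<le> r ^ 3 / 2744" "r \<le> r ^ 3 / 196" "r\<^sup>2 \<le> r ^ 3 / 14"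
      proof -
        have "14 * r\<^sup>2 \<le> r * r\<^sup>2" using r by (intro mult_right_mono) auto
        thus c: "r\<^sup>2 \<le> r ^ 3 / 14" by (simp add: power2_eq_square power3_eq_cube)
        have "14 * r \<le> r * r" using r by (intro mult_right_mono) auto
        thus "r \<le> r ^ 3 / 196" using c by (simp add: power2_eq_square)
        thus "1 \<le> r ^ 3 / 2744" using r by simp
      qed
      have trho: "t * \<rho> \<le> (121/100 * r\<^sup>2) * (11/10 * r)" using t \<rho> \<rho>0 t0 by (intro mult_mono) auto
      hence trho: "t * \<rho> \<le> 1331/1000 * r ^ 3" by (simp add: power2_eq_square power3_eq_cube)
      have b1: "240 * pi * 1 / (pi * Z) ^ (4 + 3) \<le> 240 * (r ^ 3 / 2744) / 3 ^ (3 + 3) / Z ^ 4" by (rule gen) (use r2 in auto)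
      have b2: "96 * pi * t / (pi * Z) ^ (4 + 1) \<le> 96 * (121/100 * (r ^ 3 / 14)) / 3 ^ (3 + 1) / Z ^ 4"
        by (rule gen) (use r2 t t0 in auto)
      have b3: "240 * pi * \<rho> / (pi * Z) ^ (4 + 2) \<le> 240 * (11/10 * (r ^ 3 / 196)) / 3 ^ (3 + 2) / Z ^ 4"
        by (rule gen) (use r2 \<rho> \<rho>0 in auto)
      have b4: "16 * pi * (t * \<rho>) / (pi * Z) ^ (4 + 0) \<le> 16 * (1331/1000 * r ^ 3) / 3 ^ (3 + 0) / Z ^ 4"
        by (rule gen) (use trho \<rho>0 t0 in auto)
      define u where "u = r ^ 3 / Z ^ 4"
      have u0: "u \<ge> 0" using r0 Z by (simp add: u_def)
      have "240 * pi / (pi * Z) ^ 7 \<le> 240 / 2744 / 729 * u" using b1 by (simp add: u_def)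
      moreover have "96 * pi * t / (pi * Z) ^ 5 \<le> 96 * 121 / 1400 / 81 * u" using b2 by (simp add: u_def)
      moreover have "240 * pi * \<rho> / (pi * Z) ^ 6 \<le> 240 * 11 / 1960 / 243 * u" using b3 by (simp add: u_def)
      moreover have "16 * pi * (t * \<rho>) / (pi * Z) ^ 4 \<le> 16 * 1331 / 1000 / 27 * u" using b4 by (simp add: u_def)
      ultimately show "240 * pi / (pi * Z) ^ 7 + 96 * pi * t / (pi * Z) ^ 5 + 240 * pi * \<rho> / (pi * Z) ^ 6 + 16 * pi * (t * \<rho>) / (pi * Z) ^ 4 \<le> r ^ 3 / Z ^ 4"
        using u0 unfolding u_def[symmetric] by linarith
    qed
    finally show ?thesis .
  qed
  have lin: "ringsum a Z (\<lambda>\<kappa>. sdiff h x (gf (2 * pi * \<kappa>))) = \<Phi> (x + 2 * h) - 2 * \<Phi> (x + h) + \<Phi> x"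
  proof -
    have "ringsum a Z (\<lambda>\<kappa>. sdiff h x (gf (2 * pi * \<kappa>))) = ringsum a Z (\<lambda>\<kappa>. gf (2 * pi * \<kappa>) (x + 2 * h) - (2 * gf (2 * pi * \<kappa>) (x + h) - gf (2 * pi * \<kappa>) x))"
      by (simp add: sdiff_def algebra_simps)
    thus ?thesis unfolding ringsum_diff ringsum_cmult \<Phi>_def by simp
  qed
  have "\<bar>\<Phi> (x + 2 * h)\<bar> \<le> r ^ 3 / Z ^ 4 * Q" "\<bar>\<Phi> (x + h)\<bar> \<le> r ^ 3 / Z ^ 4 * Q" "\<bar>\<Phi> x\<bar> \<le> r ^ 3 / Z ^ 4 * Q"
    by (rule b; use x h in linarith)+
  hence "\<bar>\<Phi> (x + 2 * h) - 2 * \<Phi> (x + h) + \<Phi> x\<bar> \<le> 4 * (r ^ 3 / Z ^ 4 * Q)" by linarith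
  also have "\<dots> = 4 * r ^ 3 / Z\<^sup>2 * (sqrt l * Bz a r Z)" using Z by (simp add: Q_def eval_nat_numeral)
  finally show ?thesis unfolding lin .
qed

lemma powr_inverse_scale:
  fixes u k c :: real
  assumes "u \<ge> 0" "0 \<le> k" "c > 0" "n > 0" "k \<le> c ^ n"
  shows "(k * u) powr (1 / real n) \<le> c * u powr (1 / real n)"
proof -
  have "k powr (1 / real n) \<le> (c ^ n) powr (1 / real n)" using assms by (intro powr_mono2) auto
  also have "\<dots> = c" using assms by (simp add: powr_powr flip: powr_realpow)
  finally show ?thesis using assms by (simp add: powr_mult mult_right_mono)
qed

lemma Bz_nonneg: "Bz a r Z \<ge> 0" by (simp add: Bz_def)

text \<open>The four terms are homogeneous in Z of degrees 1/3, 2/3, 1/2 and 3/4, which gives the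
  four conditions on k and c.\<close>

lemma Bz_scale:
  assumes a: "a > 0" and r: "r > 0" and Z: "Z > 0" and k: "k > 0" and c: "c > 0"
    and "k ^ 2 \<le> c ^ 6" "k ^ 4 \<le> c ^ 6" "k \<le> c ^ 2" "k ^ 3 \<le> c ^ 4"
  shows "Bz a r (k * Z) \<le> c * Bz a r Z"
proof -
  have "((k * Z)\<^sup>2 * r * a) powr (1/6) \<le> c * (Z\<^sup>2 * r * a) powr (1/6)"
    using powr_inverse_scale[of "Z\<^sup>2 * r * a" "k\<^sup>2" c 6] assms by (simp add: power_mult_distrib mult.assoc)
  moreover have "((k * Z) ^ 4 * a\<^sup>2 / r) powr (1/6) \<le> c * (Z ^ 4 * a\<^sup>2 / r) powr (1/6)"
    using powr_inverse_scale[of "Z ^ 4 * a\<^sup>2 / r" "k ^ 4" c 6] assms by (simp add: power_mult_distrib mult.assoc)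
  moreover have "((k * Z) / a) powr (1/2) \<le> c * (Z / a) powr (1/2)"
    using powr_inverse_scale[of "Z / a" k c 2] assms by simp
  moreover have "((k * Z) ^ 3 / r) powr (1/4) \<le> c * (Z ^ 3 / r) powr (1/4)"
    using powr_inverse_scale[of "Z ^ 3 / r" "k ^ 3" c 4] assms by (simp add: power_mult_distrib)
  ultimately show ?thesis unfolding Bz_def distrib_left by linarith
qed

text \<open>Both directions from Z0 = r/h converge geometrically. Below, halving Z multiplies the
  low bound by at most 4/5. Above, doubling Z multiplies the high bound by 1/4 from Z^(-2), 17/10
  from \<open>Bz\<close> and 28/25 from the root of the logarithm, altogether less than 1/2.\<close>

lemma tsum_bound:
  fixes a r x h Z0 L :: real
  assumes a: "a > 0" and r: "r \<ge> 14" and Z: "Z0 > 0" and h: "h > 0" and hZ: "h * Z0 = r"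
    and x: "81/100 * r\<^sup>2 \<le> x" "x + 2 * h \<le> 121/100 * r\<^sup>2"
    and L: "ln (Z0\<^sup>2 / a) + 6 \<le> L" "L \<ge> 10"
  shows "\<bar>tsum a (Z0 * 2 ^ J) (\<lambda>\<kappa>. sdiff h x (gf (2 * pi * \<kappa>)))\<bar> \<le> h\<^sup>2 * (12 * r * sqrt L * Bz a r Z0)"
proof -
  define F where "F \<kappa> = sdiff h x (gf (2 * pi * \<kappa>))" for \<kappa>
  have r0: "r > 0" using r by simp
  define c where "c = h\<^sup>2 * (r * sqrt L * Bz a r Z0)"
  have c0: "c \<ge> 0" unfolding c_def using r0 L Bz_nonneg by simp
  \<comment> \<open>2^(-1/3) < 4/5 is the slowest decay among the four terms; for
    \<open>Bup\<close>, 2^(3/4) < 17/10 is the fastest growth.\<close>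
  have Bdown: "Bz a r (Z0 / 2 ^ i) \<le> (4/5) ^ i * Bz a r Z0" for i
  proof (induction i)
    case (Suc i)
    have "Bz a r (1/2 * (Z0 / 2 ^ i)) \<le> 4/5 * Bz a r (Z0 / 2 ^ i)"
      by (rule Bz_scale) (use a r0 Z in \<open>auto simp: power_divide\<close>)
    thus ?case using Suc by (simp add: mult.commute)
  qed simp
  have Bup: "Bz a r (Z0 * 2 ^ i) \<le> (17/10) ^ i * Bz a r Z0" for i
  proof (induction i)
    case (Suc i)
    have "Bz a r (2 * (Z0 * 2 ^ i)) \<le> 17/10 * Bz a r (Z0 * 2 ^ i)"
      by (rule Bz_scale) (use a r0 Z in \<open>auto simp: power_divide\<close>)
    thus ?case using Suc by (simp add: mult_ac)
  qed simp
  have low: "\<bar>tsum a Z0 F\<bar> \<le> \<bar>tsum a (Z0 / 2 ^ I) F\<bar> + 3/2 * c * (\<Sum>i<I. (4/5) ^ i)" for I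
  proof (induction I)
    case (Suc I)
    define Y where "Y = Z0 / 2 ^ I"
    have Y: "Y > 0" "Y \<le> Z0" using Z by (auto simp: Y_def divide_le_eq mult_le_cancel_left1)
    have "Y\<^sup>2 / a \<le> Z0\<^sup>2 / a" using Y a by (intro divide_right_mono power_mono) auto
    hence "ln (Y\<^sup>2 / a) \<le> ln (Z0\<^sup>2 / a)" using Y a by (subst ln_le_cancel_iff) auto
    hence lY: "ln (Y\<^sup>2 / a) + 6 \<le> L" using L by linarith
    have "\<bar>ringsum a Y F\<bar> \<le> h\<^sup>2 * (3/2 * r * sqrt L * Bz a r Y)"
      unfolding F_def by (rule ringsum_low[OF a r Y(1) h x lY]) (use L in simp)
    also have "\<dots> \<le> h\<^sup>2 * (3/2 * r * sqrt L * ((4/5) ^ I * Bz a r Z0))"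
      using Bdown[of I] r0 L unfolding Y_def by (intro mult_left_mono) auto
    also have "\<dots> = 3/2 * c * (4/5) ^ I" by (simp add: c_def)
    finally have 1: "\<bar>ringsum a Y F\<bar> \<le> 3/2 * c * (4/5) ^ I" .
    have 2: "tsum a Y F = tsum a (Z0 / 2 ^ Suc I) F + ringsum a Y F"
      using tsum_halve[OF a Y(1), of F] by (simp add: Y_def mult.commute)
    have "3/2 * c * (\<Sum>i<Suc I. (4/5) ^ i) = 3/2 * c * (\<Sum>i<I. (4/5) ^ i) + 3/2 * c * (4/5) ^ I" by (simp add: distrib_left)
    thus ?case using Suc 1 2 unfolding Y_def by linarith
  qed simp
  \<comment> \<open>After enough halvings the box is empty; 5 is the sum of the geometric series of
    ratio 4/5.\<close>
  have base: "\<bar>tsum a Z0 F\<bar> \<le> 15/2 * c"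
  proof -
    obtain I :: nat where I: "Z0 < 2 ^ I" using real_arch_pow[of 2 Z0] by auto
    have "tsum a (Z0 / 2 ^ I) F = 0" by (rule small_box_empty) (use a Z I in auto)
    moreover have "(\<Sum>i<I. (4/5::real) ^ i) \<le> 5"
    proof -
      have "(\<Sum>i<I. (4/5::real) ^ i) = 5 * (1 - (4/5) ^ I)" by (simp add: sum_gp_strict)
      thus ?thesis by simp
    qed
    hence "3/2 * c * (\<Sum>i<I. (4/5) ^ i) \<le> 3/2 * c * 5" using c0 by (intro mult_left_mono) auto
    ultimately show ?thesis using low[of I] by simp
  qed
  have "\<bar>tsum a (Z0 * 2 ^ J) F\<bar> \<le> 15/2 * c + 4 * c * (1 - (1/2) ^ J)"
  proof (induction J)
    case 0 show ?case using base by simp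
  next
    case (Suc J)
    define j where "j = Suc J"
    define Y where "Y = Z0 * 2 ^ j"
    have Y: "Y > 0" using Z by (simp add: Y_def)
    define l where "l = L * (5/4) ^ j"
    have l0: "l \<ge> 0" using L by (simp add: l_def)
    \<comment> \<open>Each doubling adds 2 ln 2 < 2 to the logarithm, which is at most L/4;
      Bernoulli's inequality turns this linear growth into the factor (5/4)^j.\<close>
    have ll: "ln (Y\<^sup>2 / a) + 6 \<le> l"
    proof -
      have "Y\<^sup>2 / a = Z0\<^sup>2 / a * 2 ^ (2 * j)" by (simp add: Y_def power_mult_distrib power_mult mult.commute)
      moreover have "ln (Z0\<^sup>2 / a * 2 ^ (2 * j)) = ln (Z0\<^sup>2 / a) + ln (2 ^ (2 * j))" using Z a by (subst ln_mult) auto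
      moreover have "ln ((2::real) ^ (2 * j)) = real (2 * j) * ln 2" by (subst ln_realpow) auto
      ultimately have "ln (Y\<^sup>2 / a) = ln (Z0\<^sup>2 / a) + real (2 * j) * ln 2" by (simp only:)
      also have "\<dots> \<le> ln (Z0\<^sup>2 / a) + real (2 * j) * 1" using ln_2_less_1 by (intro add_left_mono mult_left_mono) auto
      finally have "ln (Y\<^sup>2 / a) + 6 \<le> L + 2 * real j" using L by simp
      also have "\<dots> \<le> L * (1 + real j * (1/4))" using L mult_right_mono[of 10 L "real j"] by (simp add: distrib_left)
      also have "\<dots> \<le> L * (1 + 1/4) ^ j" using L by (intro mult_left_mono Bernoulli_inequality) auto
      finally show ?thesis by (simp add: l_def)
    qed
    have sl: "sqrt l \<le> sqrt L * (28/25) ^ j"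
    proof -
      have "sqrt l = sqrt L * sqrt ((5/4) ^ j)" by (simp add: l_def real_sqrt_mult)
      also have "sqrt ((5/4) ^ j) = sqrt (5/4) ^ j" by (rule real_sqrt_power)
      also have "sqrt (5/4) ^ j \<le> (28/25) ^ j" by (intro power_mono real_le_lsqrt) (auto simp: power2_eq_square)
      finally show ?thesis using L by (simp add: mult_left_mono)
    qed
    have "\<bar>ringsum a Y F\<bar> \<le> 4 * r ^ 3 / Y\<^sup>2 * (sqrt l * Bz a r Y)"
      unfolding F_def by (intro ringsum_high) (use a r Y h x ll l0 in auto)
    also have "\<dots> \<le> 4 * r ^ 3 / Y\<^sup>2 * ((sqrt L * (28/25) ^ j) * ((17/10) ^ j * Bz a r Z0))"
      using sl Bup[of j] r0 L Bz_nonneg l0 unfolding Y_def[symmetric]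
      by (intro mult_left_mono mult_mono) auto
    also have "4 * r ^ 3 / Y\<^sup>2 = 4 * h\<^sup>2 * r * (1/4) ^ j"
    proof -
      have "r ^ 3 = h\<^sup>2 * r * Z0\<^sup>2" unfolding hZ[symmetric] by (simp add: power2_eq_square power3_eq_cube)
      moreover have "Y\<^sup>2 = Z0\<^sup>2 * 4 ^ j" by (simp add: Y_def power_mult_distrib power2_eq_square flip: power_mult_distrib)
      ultimately show ?thesis using Z by (simp add: power_one_over)
    qed
    also have "4 * h\<^sup>2 * r * (1/4) ^ j * ((sqrt L * (28/25) ^ j) * ((17/10) ^ j * Bz a r Z0)) = 4 * c * ((1/4) ^ j * (28/25) ^ j * (17/10) ^ j)"
      by (simp add: c_def)
    also have "(1/4) ^ j * (28/25) ^ j * (17/10) ^ j = (119/250 :: real) ^ j" by (simp flip: power_mult_distrib)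
    also have "4 * c * (119/250) ^ j \<le> 4 * c * (1/2) ^ j" using c0 by (intro mult_left_mono power_mono) auto
    finally have 1: "\<bar>ringsum a Y F\<bar> \<le> 4 * c * (1/2) ^ j" .
    have 2: "tsum a Y F = tsum a (Z0 * 2 ^ J) F + ringsum a Y F"
      using tsum_halve[OF a Y, of F] by (simp add: Y_def j_def)
    have "4 * c * (1 - (1/2) ^ J) + 4 * c * (1/2) ^ j = 4 * c * (1 - (1/2) ^ j)" by (simp add: j_def algebra_simps)
    thus ?case using Suc 1 2 unfolding Y_def j_def by linarith
  qed
  \<comment> \<open>15/2 from the layers below Z0 and 4 from those above.\<close>
  also have "\<dots> \<le> 12 * c"
  proof -
    have "4 * c * (1 - (1/2) ^ J) \<le> 4 * c * 1" using c0 by (intro mult_left_mono) auto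
    thus ?thesis using c0 by linarith
  qed
  finally show ?thesis unfolding F_def c_def by (simp add: mult_ac)
qed

section \<open>Decomposition of all frequencies; the plane and the axis\<close>

lemma sum_even_int:
  fixes f :: "int \<Rightarrow> real"
  assumes "\<And>l. f (- l) = f l"
  shows "(\<Sum>l=-int M..int M. f l) = f 0 + 2 * (\<Sum>l=1..int M. f l)"
proof -
  have s: "{-int M..int M} = insert 0 ({1..int M} \<union> uminus ` {1..int M})"
    by (auto simp: image_iff intro: exI[of _ "- x" for x])
  have "(\<Sum>l=-int M..int M. f l) = f 0 + ((\<Sum>l=1..int M. f l) + (\<Sum>l\<in>uminus ` {1..int M}. f l))"
    unfolding s by (subst sum.insert, simp, force, subst sum.union_disjoint) auto
  also have "(\<Sum>l\<in>uminus ` {1..int M}. f l) = (\<Sum>l=1..int M. f l)"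
    using assms by (subst sum.reindex) (auto simp: inj_on_def)
  finally show ?thesis by simp
qed

lemma r2_0: "r2 0 = 1"
proof -
  have "{(i::int, j::int). i\<^sup>2 + j\<^sup>2 = int 0} = {(0,0)}" by (auto simp: sum_power2_eq_zero_iff)
  thus ?thesis unfolding r2_def by simp
qed

lemma finite_disc: "finite {(i::int, j::int). i\<^sup>2 + j\<^sup>2 \<le> int N}"
proof -
  have "{(i::int, j::int). i\<^sup>2 + j\<^sup>2 \<le> int N} \<subseteq> (\<Union>n\<in>{0..N}. {(i::int, j::int). i\<^sup>2 + j\<^sup>2 = int n})"
  proof clarify
    fix i j :: int assume *: "i\<^sup>2 + j\<^sup>2 \<le> int N"
    have "i\<^sup>2 + j\<^sup>2 = int (nat (i\<^sup>2 + j\<^sup>2))" by simp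
    moreover have "nat (i\<^sup>2 + j\<^sup>2) \<in> {0..N}" using * by simp
    ultimately show "(i, j) \<in> (\<Union>n\<in>{0..N}. {(i::int, j::int). i\<^sup>2 + j\<^sup>2 = int n})" by blast
  qed
  thus ?thesis by (rule finite_subset) (auto simp: finite_r2)
qed

lemma sum_disc:
  fixes f :: "nat \<Rightarrow> real"
  shows "(\<Sum>(i::int,j::int) | i\<^sup>2 + j\<^sup>2 \<le> int N. f (nat (i\<^sup>2 + j\<^sup>2))) = (\<Sum>n=0..N. real (r2 n) * f n)"
proof -
  define D where "D = {(i::int, j::int). i\<^sup>2 + j\<^sup>2 \<le> int N}"
  define g where "g = (\<lambda>(i::int, j::int). nat (i\<^sup>2 + j\<^sup>2))"
  have "(\<Sum>p\<in>D. f (g p)) = (\<Sum>n\<in>{0..N}. \<Sum>p\<in>{p\<in>D. g p = n}. f (g p))"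
    by (rule sum.group[symmetric]) (use finite_disc in \<open>auto simp: D_def g_def\<close>)
  also have "\<dots> = (\<Sum>n=0..N. real (r2 n) * f n)"
  proof (intro sum.cong refl)
    fix n assume n: "n \<in> {0..N}"
    have "{p\<in>D. g p = n} = {(i::int, j::int). i\<^sup>2 + j\<^sup>2 = int n}" using n by (auto simp: D_def g_def)
    moreover have "(\<Sum>p\<in>{p\<in>D. g p = n}. f (g p)) = (\<Sum>p\<in>{p\<in>D. g p = n}. f n)" by (intro sum.cong) auto
    ultimately show "(\<Sum>p\<in>{p\<in>D. g p = n}. f (g p)) = real (r2 n) * f n" by (simp add: r2_def)
  qed
  finally show ?thesis by (simp add: D_def g_def case_prod_unfold)
qed

text \<open>(j, k) runs over a disc rather than a square, so that grouping by n = j^2 + k^2 collects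
  complete representation numbers.\<close>

definition box3 :: "nat \<Rightarrow> nat \<Rightarrow> (int \<times> int \<times> int) set" where
  "box3 N M = {(j, k, l). j\<^sup>2 + k\<^sup>2 \<le> int N \<and> l \<in> {-int M..int M}}"

lemma finite_box3: "finite (box3 N M)"
proof -
  have "box3 N M \<subseteq> (\<lambda>((j,k),l). (j,k,l)) ` ({(i::int, j::int). i\<^sup>2 + j\<^sup>2 \<le> int N} \<times> {-int M..int M})"
    by (force simp: box3_def)
  thus ?thesis by (rule finite_subset) (use finite_disc in auto)
qed

text \<open>Grouping by n leaves the single pair (0, 0) for n = 0, which separates the origin and
  the vertical axis. Evenness in l gives the factors 2, and the last double sum is of the form
  \<open>tsum\<close>.\<close>

lemma sum_box3:
  fixes G :: "real \<Rightarrow> real"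
  assumes a: "a > 0"
  shows "(\<Sum>(j,k,l)\<in>box3 N M. G (sqrt (a * ((real_of_int j)\<^sup>2 + (real_of_int k)\<^sup>2) + (real_of_int l / a)\<^sup>2)))
    = G 0 + 2 * (\<Sum>l=1..int M. G (real_of_int l / a)) + (\<Sum>n=1..N. real (r2 n) * G (sqrt (a * real n)))
      + 2 * (\<Sum>n=1..N. real (r2 n) * (\<Sum>m=1..int M. G (kap a n m)))"
proof -
  define D where "D = {(i::int, j::int). i\<^sup>2 + j\<^sup>2 \<le> int N}"
  define f where "f n = (\<Sum>l=-int M..int M. G (kap a (real n) (real_of_int l)))" for n :: nat
  have f: "f n = G (sqrt (a * real n)) + 2 * (\<Sum>m=1..int M. G (kap a n m))" for n
    unfolding f_def by (subst sum_even_int) (auto simp: kap_def)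
  have "(\<Sum>(j,k,l)\<in>box3 N M. G (sqrt (a * ((real_of_int j)\<^sup>2 + (real_of_int k)\<^sup>2) + (real_of_int l / a)\<^sup>2)))
     = (\<Sum>((j,k),l)\<in>D \<times> {-int M..int M}. G (sqrt (a * ((real_of_int j)\<^sup>2 + (real_of_int k)\<^sup>2) + (real_of_int l / a)\<^sup>2)))"
    by (rule sum.reindex_bij_witness[of _ "\<lambda>((j,k),l). (j,k,l)" "\<lambda>(j,k,l). ((j,k),l)"]) (auto simp: box3_def D_def)
  also have "\<dots> = (\<Sum>p\<in>D. \<Sum>l\<in>{-int M..int M}. G (sqrt (a * ((real_of_int (fst p))\<^sup>2 + (real_of_int (snd p))\<^sup>2) + (real_of_int l / a)\<^sup>2)))"
    by (simp add: sum.cartesian_product case_prod_unfold)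
  also have "\<dots> = (\<Sum>(j,k)\<in>D. f (nat (j\<^sup>2 + k\<^sup>2)))"
    unfolding f_def kap_def case_prod_unfold by (intro sum.cong refl) simp
  also have "\<dots> = (\<Sum>n=0..N. real (r2 n) * f n)" unfolding D_def by (rule sum_disc)
  also have "\<dots> = f 0 + (\<Sum>n=1..N. real (r2 n) * f n)" by (simp add: sum.atLeast_Suc_atMost r2_0)
  also have "f 0 = G 0 + 2 * (\<Sum>l=1..int M. G (real_of_int l / a))"
  proof -
    have "(\<Sum>l=1..int M. G (kap a (real 0) (real_of_int l))) = (\<Sum>l=1..int M. G (real_of_int l / a))"
      using a by (intro sum.cong refl) (simp add: kap_def)
    thus ?thesis unfolding f by simp
  qed
  also have "(\<Sum>n=1..N. real (r2 n) * f n) = (\<Sum>n=1..N. real (r2 n) * G (sqrt (a * real n))) + 2 * (\<Sum>n=1..N. real (r2 n) * (\<Sum>m=1..int M. G (kap a n m)))"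
    unfolding f by (simp add: distrib_left sum.distrib sum_distrib_left mult.left_commute)
  finally show ?thesis by simp
qed

text \<open>The points lie in a square with 2s + 1 \<le> 3s points on each side, where s is the
  integer part of sqrt N.\<close>

lemma sum_r2_le: "(\<Sum>n=1..N. real (r2 n)) \<le> 9 * real N"
proof (cases "N = 0")
  case False
  define s where "s = nat \<lfloor>sqrt (real N)\<rfloor>"
  have s1: "s \<ge> 1" using False by (simp add: s_def le_nat_iff le_floor_iff)
  have sN: "real s \<le> sqrt (real N)" by (simp add: s_def)
  hence sN2: "(real s)\<^sup>2 \<le> real N" by (metis of_nat_0_le_iff power_mono real_sqrt_pow2)
  have sub: "{(i::int, j::int). i\<^sup>2 + j\<^sup>2 \<le> int N} \<subseteq> {-int s..int s} \<times> {-int s..int s}"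
  proof clarify
    fix i j :: int assume *: "i\<^sup>2 + j\<^sup>2 \<le> int N"
    have le: "\<bar>u\<bar> \<le> int s" if "u\<^sup>2 \<le> int N" for u :: int
    proof -
      have "real_of_int (u\<^sup>2) \<le> real_of_int (int N)" using that by (simp only: of_int_le_iff)
      hence "real_of_int \<bar>u\<bar> \<le> sqrt (real N)" by (intro real_le_rsqrt) simp
      hence "\<bar>u\<bar> \<le> \<lfloor>sqrt (real N)\<rfloor>" by (simp only: le_floor_iff)
      thus ?thesis by (simp add: s_def)
    qed
    have "i\<^sup>2 \<le> int N" "j\<^sup>2 \<le> int N" using * zero_le_power2[of i] zero_le_power2[of j] by linarith+
    from le[OF this(1)] le[OF this(2)] show "i \<in> {-int s..int s} \<and> j \<in> {-int s..int s}" by auto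
  qed
  have "(\<Sum>n=1..N. real (r2 n)) \<le> (\<Sum>n=0..N. real (r2 n) * 1)" by (simp add: sum_mono2)
  also have "\<dots> = real (card {(i::int, j::int). i\<^sup>2 + j\<^sup>2 \<le> int N})"
    using sum_disc[of "\<lambda>_. 1" N] by (simp add: case_prod_unfold)
  also have "\<dots> \<le> real (card ({-int s..int s} \<times> {-int s..int s}))"
    by (intro of_nat_mono card_mono sub) auto
  also have "\<dots> = (2 * real s + 1)\<^sup>2" by (simp add: card_cartesian_product power2_eq_square algebra_simps)
  also have "\<dots> \<le> (3 * real s)\<^sup>2" using s1 by (intro power_mono) auto
  also have "\<dots> \<le> 9 * real N" using sN2 by (simp add: power_mult_distrib)
  finally show ?thesis .
qed simp

text \<open>Partial summation: the partial sums of r_2(n) - 9 are never positive, and decreasing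
  nonnegative weights preserve this.\<close>

lemma sum_r2_antimono_le:
  fixes v :: "nat \<Rightarrow> real"
  assumes v0: "\<And>n. n \<ge> 1 \<Longrightarrow> v n \<ge> 0" and vm: "\<And>n. n \<ge> 1 \<Longrightarrow> v (Suc n) \<le> v n"
  shows "(\<Sum>n=1..N. real (r2 n) * v n) \<le> 9 * (\<Sum>n=1..N. v n)"
proof -
  define R where "R n = (\<Sum>k=1..n. real (r2 k) - 9)" for n
  have R: "R n \<le> 0" for n unfolding R_def using sum_r2_le[of n] by (simp add: sum_subtractf)
  have "(\<Sum>n=1..N. (real (r2 n) - 9) * v n) \<le> R N * v (max 1 N)"
  proof (induction N)
    case (Suc N)
    show ?case
    proof (cases "N = 0")
      case True thus ?thesis by (simp add: R_def)
    next
      case False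
      hence "(\<Sum>n=1..Suc N. (real (r2 n) - 9) * v n) \<le> R N * v N + (real (r2 (Suc N)) - 9) * v (Suc N)"
        using Suc by (simp add: max_def split: if_splits)
      also have "R N * v N \<le> R N * v (Suc N)" using R[of N] vm[of N] False by (intro mult_left_mono_neg) auto
      also have "R N * v (Suc N) + (real (r2 (Suc N)) - 9) * v (Suc N) = R (Suc N) * v (max 1 (Suc N))"
        by (simp add: R_def algebra_simps)
      finally show ?thesis by simp
    qed
  qed (simp add: R_def)
  also have "\<dots> \<le> 0" using R[of N] v0[of "max 1 N"] by (intro mult_nonpos_nonneg) auto
  finally show ?thesis by (simp add: left_diff_distrib sum_subtractf sum_distrib_left)
qed

lemma sum_inv_sq_tail:
  assumes "K \<ge> 1" "K \<le> N"
  shows "(\<Sum>n=Suc K..N. 1 / (real n)\<^sup>2) \<le> 1 / real K - 1 / real N"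
  using assms(2)
proof (induction N rule: dec_induct)
  case (step N)
  have N: "real N > 0" using step assms(1) by simp
  have "1 / (real (Suc N))\<^sup>2 \<le> 1 / real N - 1 / real (Suc N)"
  proof -
    have "1 / real N - 1 / real (Suc N) = 1 / (real N * real (Suc N))" using N by (simp add: field_simps)
    moreover have "1 / (real (Suc N))\<^sup>2 \<le> 1 / (real N * real (Suc N))"
      using N by (intro divide_left_mono) (auto simp: power2_eq_square intro!: mult_right_mono)
    ultimately show ?thesis by simp
  qed
  moreover have "(\<Sum>n=Suc K..Suc N. 1 / (real n)\<^sup>2) = (\<Sum>n=Suc K..N. 1 / (real n)\<^sup>2) + 1 / (real (Suc N))\<^sup>2"
    using step by simp
  moreover have "(\<Sum>n=Suc K..N. 1 / (real n)\<^sup>2) \<le> 1 / real K - 1 / real N" using step by blast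
  ultimately show ?case by linarith
qed simp

text \<open>The two bounds cross at n = X. Before it the harmonic sum gives the logarithm; beyond it
  X times the tail of 1/n^2 is at most 1.\<close>

lemma sum_min_bound:
  fixes X L :: real
  assumes X: "X > 0" and L: "L \<ge> 0" "X \<ge> 1 \<Longrightarrow> ln X + 1 \<le> L"
  shows "(\<Sum>n=1..N. min (1 / real n) (X / (real n)\<^sup>2)) \<le> 2 + L"
proof -
  define K where "K = max 1 (nat \<lceil>X\<rceil>)"
  have K1: "K \<ge> 1" by (simp add: K_def)
  have KX: "X \<le> real K" unfolding K_def by linarith
  have lnK: "ln (real K) \<le> L"
  proof (cases "X \<ge> 1")
    case False
    hence "\<lceil>X\<rceil> \<le> 1" by (simp add: ceiling_le_iff)
    hence "K = 1" by (simp add: K_def)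
    thus ?thesis using L by simp
  next
    case True
    have "real K \<le> 2 * X" unfolding K_def using True by linarith
    hence "ln (real K) \<le> ln (2 * X)" using K1 X by (subst ln_le_cancel_iff) auto
    also have "\<dots> = ln 2 + ln X" using X by (simp add: ln_mult)
    finally show ?thesis using L(2)[OF True] ln_2_less_1 by linarith
  qed
  define m where "m n = min (1 / real n) (X / (real n)\<^sup>2)" for n
  have m0: "m n \<ge> 0" for n unfolding m_def using X by simp
  have "(\<Sum>n=1..N. m n) \<le> (\<Sum>n\<in>{1..K} \<union> {Suc K..max K N}. m n)" by (rule sum_mono2) (use m0 in auto)
  also have "\<dots> = (\<Sum>n=1..K. m n) + (\<Sum>n=Suc K..max K N. m n)" by (rule sum.union_disjoint) auto
  also have "(\<Sum>n=1..K. m n) \<le> (\<Sum>n=1..K. 1 / real n)" unfolding m_def by (intro sum_mono) auto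
  also have "\<dots> = harm K" by (simp add: harm_def divide_inverse)
  also have "\<dots> \<le> 1 + ln (real K)" by (rule harm_le_one_plus_ln[OF K1])
  also have "(\<Sum>n=Suc K..max K N. m n) \<le> (\<Sum>n=Suc K..max K N. X * (1 / (real n)\<^sup>2))" unfolding m_def by (intro sum_mono) auto
  also have "\<dots> = X * (\<Sum>n=Suc K..max K N. 1 / (real n)\<^sup>2)" by (rule sum_distrib_left[symmetric])
  also have "\<dots> \<le> X * (1 / real K)"
  proof (rule mult_left_mono)
    have "(\<Sum>n=Suc K..max K N. 1 / (real n)\<^sup>2) \<le> 1 / real K - 1 / real (max K N)" by (rule sum_inv_sq_tail) (use K1 in auto)
    also have "\<dots> \<le> 1 / real K" by simp
    finally show "(\<Sum>n=Suc K..max K N. 1 / (real n)\<^sup>2) \<le> 1 / real K" .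
  qed (use X in simp)
  also have "\<dots> \<le> 1" using KX K1 by (simp add: divide_le_eq)
  finally show ?thesis using lnK unfolding m_def by linarith
qed

text \<open>Termwise bound for the frequencies that are summed without cancellation. pi \<ge> 3
  produces 18 = 2 * 9 and 11/30 = (11/10)/3.\<close>

lemma sdiff_gf_derivative_bound:
  fixes \<kappa> r h x :: real
  assumes k: "\<kappa> > 0" and r: "r > 0" and h: "h > 0"
    and x: "81/100 * r\<^sup>2 \<le> x" "x + 2 * h \<le> 121/100 * r\<^sup>2"
  shows "\<bar>sdiff h x (gf (2 * pi * \<kappa>))\<bar> \<le> h\<^sup>2 * (1 / (18 * \<kappa> ^ 3) + 11/30 * r / \<kappa>\<^sup>2)"
proof -
  define w where "w = 2 * pi * \<kappa>"
  have w: "w > 0" using k by (simp add: w_def)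
  have pi3: "pi \<ge> 3" using pi_gt3 by simp
  have tp: "t > 0" if "x \<le> t" for t
  proof -
    have "0 < 81/100 * r\<^sup>2" using r by simp
    thus ?thesis using x(1) that by linarith
  qed
  obtain \<xi> where xi: "x < \<xi>" "\<xi> < x + 2 * h" and e: "sdiff h x (gf w) = h\<^sup>2 * gf2 w \<xi>"
    using second_difference_mvt[OF h, of x "gf w" "gf1 w" "gf2 w"] gf_derivs[OF w tp] unfolding sdiff_def by blast
  have s: "0 \<le> sqrt \<xi>" "sqrt \<xi> \<le> 11/10 * r" using sqrt_range[OF r, of \<xi>] xi x tp[of \<xi>] by auto
  have "\<bar>gf2 w \<xi>\<bar> \<le> \<bar>4 * pi / w ^ 3 * sin (w * sqrt \<xi>)\<bar> + \<bar>4 * pi * sqrt \<xi> / w\<^sup>2 * cos (w * sqrt \<xi>)\<bar>"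
    unfolding gf2_def by (rule abs_triangle_ineq4)
  also have "\<dots> \<le> 4 * pi / w ^ 3 + 4 * pi * sqrt \<xi> / w\<^sup>2"
    unfolding abs_mult using w s by (intro add_mono mult_left_le[THEN order_trans]) (auto simp: abs_mult)
  also have "4 * pi / w ^ 3 \<le> 1 / (18 * \<kappa> ^ 3)"
  proof -
    have "4 * pi / w ^ 3 = 1 / (2 * pi\<^sup>2 * \<kappa> ^ 3)" using k by (simp add: w_def field_simps power2_eq_square power3_eq_cube)
    also have "\<dots> \<le> 1 / (18 * \<kappa> ^ 3)"
    proof -
      have "9 \<le> pi\<^sup>2" using power_mono[OF pi3, of 2] by simp
      thus ?thesis using k by (intro divide_left_mono mult_right_mono) auto
    qed
    finally show ?thesis .
  qed
  also have "4 * pi * sqrt \<xi> / w\<^sup>2 \<le> 11/30 * r / \<kappa>\<^sup>2"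
  proof -
    have "4 * pi * sqrt \<xi> / w\<^sup>2 = sqrt \<xi> / pi / \<kappa>\<^sup>2" using k by (simp add: w_def field_simps power2_eq_square)
    also have "sqrt \<xi> / pi \<le> (11/10 * r) / 3" using s pi3 r by (intro frac_le) auto
    finally show ?thesis by (simp add: divide_right_mono)
  qed
  finally have "\<bar>gf2 w \<xi>\<bar> \<le> 1 / (18 * \<kappa> ^ 3) + 11/30 * r / \<kappa>\<^sup>2" by simp
  thus ?thesis using e by (simp add: w_def abs_mult mult_left_mono)
qed

text \<open>The companion bound, better once \<kappa> exceeds the order of r/h. From r \<kappa>
  \<ge> 1 follows 1/\<omega> \<le> r/6, so the lower-order terms of \<open>gf\<close> are absorbed
  into r^3/\<omega>^4.\<close>

lemma sdiff_gf_trivial_bound: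
  fixes \<kappa> r h x :: real
  assumes k: "\<kappa> > 0" "r * \<kappa> \<ge> 1" and r: "r > 0" and h: "h > 0"
    and x: "81/100 * r\<^sup>2 \<le> x" "x + 2 * h \<le> 121/100 * r\<^sup>2"
  shows "\<bar>sdiff h x (gf (2 * pi * \<kappa>))\<bar> \<le> r ^ 3 / (2 * \<kappa> ^ 4)"
proof -
  define w where "w = 2 * pi * \<kappa>"
  have w: "w > 0" using k by (simp add: w_def)
  have pi3: "pi \<ge> 3" using pi_gt3 by simp
  have "6 \<le> 6 * (r * \<kappa>)" using k by simp
  also have "\<dots> \<le> 2 * pi * (r * \<kappa>)" using pi3 k by (intro mult_right_mono) auto
  finally have iw: "1 / w \<le> r / 6" using w by (simp add: w_def field_simps)
  have iw0: "0 \<le> 1 / w" using w by simp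
  have b: "\<bar>gf w t\<bar> \<le> r ^ 3 / (8 * \<kappa> ^ 4)" if t: "x \<le> t" "t \<le> x + 2 * h" for t
  proof -
    define s where "s = sqrt t"
    have t0: "t > 0" and s: "0 \<le> s" "s \<le> 11/10 * r" and ts: "t = s\<^sup>2"
      using sqrt_range[OF r, of t] t x by (auto simp: s_def)
    have "15 / w ^ 7 + 6 * t / w ^ 5 + 15 * sqrt t / w ^ 6 + t * sqrt t / w ^ 4
       = (15 * (1 / w) ^ 3 + 6 * (s ^ 2 * (1 / w)) + 15 * (s * (1 / w) ^ 2) + s ^ 3) / w ^ 4"
      using w s(1) unfolding s_def[symmetric] ts by (simp add: field_simps eval_nat_numeral)
    also have "\<dots> \<le> (15 * (r / 6) ^ 3 + 6 * ((11/10 * r) ^ 2 * (r / 6)) + 15 * ((11/10 * r) * (r / 6) ^ 2) + (11/10 * r) ^ 3) / w ^ 4"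
      using w iw iw0 s r by (intro divide_right_mono add_mono mult_left_mono mult_mono power_mono) auto
    \<comment> \<open>The four terms add up to about 3.07 r^3; 27/8 is taken because its 27 cancels
      against pi^3 \<ge> 27.\<close>
    also have "\<dots> \<le> (27/8 * r ^ 3) / w ^ 4"
      using w r by (intro divide_right_mono) (auto simp: power2_eq_square power3_eq_cube)
    finally have B: "15 / w ^ 7 + 6 * t / w ^ 5 + 15 * sqrt t / w ^ 6 + t * sqrt t / w ^ 4 \<le> (27/8 * r ^ 3) / w ^ 4" .
    have "\<bar>gf w t\<bar> \<le> 16 * pi * ((27/8 * r ^ 3) / w ^ 4)"
      using gf_bound[OF w, of t] mult_left_mono[OF B, of "16 * pi"] t0 by simp
    also have "\<dots> = (27/8 * r ^ 3) / (pi ^ 3 * \<kappa> ^ 4)"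
      using k by (simp add: w_def field_simps power2_eq_square power3_eq_cube eval_nat_numeral)
    also have "\<dots> \<le> (27/8 * r ^ 3) / (27 * \<kappa> ^ 4)"
    proof -
      have "27 \<le> pi ^ 3" using power_mono[OF pi3, of 3] by simp
      thus ?thesis using k r by (intro divide_left_mono mult_right_mono) auto
    qed
    finally show ?thesis by simp
  qed
  have "\<bar>sdiff h x (gf w)\<bar> \<le> 4 * (r ^ 3 / (8 * \<kappa> ^ 4))"
    using b[of x] b[of "x + h"] b[of "x + 2 * h"] h unfolding sdiff_def by linarith
  thus ?thesis by (simp add: w_def)
qed

lemma sum_int_atLeast1_atMost: "(\<Sum>l=1..int M. f (real_of_int l)) = (\<Sum>n=1..M. f (real n))"
  by (rule sum.reindex_bij_witness[of _ int nat]) auto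

lemma sum_inv_sq_le: "(\<Sum>n=1..M. 1 / (real n)\<^sup>2) \<le> 2"
proof (cases "M = 0")
  case False
  hence "(\<Sum>n=1..M. 1 / (real n)\<^sup>2) = 1 + (\<Sum>n=Suc 1..M. 1 / (real n)\<^sup>2)"
    by (subst sum.atLeast_Suc_atMost) auto
  also have "(\<Sum>n=Suc 1..M. 1 / (real n)\<^sup>2) \<le> 1 / real 1 - 1 / real M"
    using False by (intro sum_inv_sq_tail) auto
  finally show ?thesis by (simp add: order_trans[of _ "2 - 1 / real M"])
qed simp

text \<open>The dyadic boxes eventually contain every finite set of frequencies, so an unconditional
  sum is the limit of its sums over them.\<close>

lemma filterlim_box3:
  assumes a: "a > 0" and Z0: "Z0 > (0::real)"
  shows "filterlim (\<lambda>J::nat. box3 (nat \<lfloor>(Z0 * 2 ^ J)\<^sup>2 / a\<rfloor>) (nat \<lfloor>a * (Z0 * 2 ^ J)\<rfloor>)) (finite_subsets_at_top UNIV) sequentially"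
  unfolding filterlim_finite_subsets_at_top
proof (intro allI impI)
  fix X :: "(int \<times> int \<times> int) set" assume "finite X \<and> X \<subseteq> UNIV"
  hence X: "finite X" by simp
  have t1: "filterlim (\<lambda>J::nat. (Z0 * 2 ^ J)\<^sup>2 / a) at_top sequentially" using a Z0 by real_asymp
  have t2: "filterlim (\<lambda>J::nat. a * (Z0 * 2 ^ J)) at_top sequentially" using a Z0 by real_asymp
  have "\<forall>p\<in>X. \<forall>\<^sub>F J::nat in sequentially. p \<in> box3 (nat \<lfloor>(Z0 * 2 ^ J)\<^sup>2 / a\<rfloor>) (nat \<lfloor>a * (Z0 * 2 ^ J)\<rfloor>)"
  proof
    fix p :: "int \<times> int \<times> int" assume "p \<in> X"
    obtain j k l where p: "p = (j,k,l)" by (metis prod_cases3)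
    have "\<forall>\<^sub>F J::nat in sequentially. real_of_int (j\<^sup>2 + k\<^sup>2) \<le> (Z0 * 2 ^ J)\<^sup>2 / a"
      using t1 unfolding filterlim_at_top by blast
    moreover have "\<forall>\<^sub>F J::nat in sequentially. real_of_int \<bar>l\<bar> \<le> a * (Z0 * 2 ^ J)"
      using t2 unfolding filterlim_at_top by blast
    ultimately show "\<forall>\<^sub>F J::nat in sequentially. p \<in> box3 (nat \<lfloor>(Z0 * 2 ^ J)\<^sup>2 / a\<rfloor>) (nat \<lfloor>a * (Z0 * 2 ^ J)\<rfloor>)"
    proof eventually_elim
      case (elim J)
      have "j\<^sup>2 + k\<^sup>2 \<le> \<lfloor>(Z0 * 2 ^ J)\<^sup>2 / a\<rfloor>" "\<bar>l\<bar> \<le> \<lfloor>a * (Z0 * 2 ^ J)\<rfloor>"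
        using elim unfolding le_floor_iff by auto
      moreover have "0 \<le> (Z0 * 2 ^ J)\<^sup>2 / a" "0 \<le> a * (Z0 * 2 ^ J)" using a Z0 by auto
      ultimately show ?case unfolding p box3_def by auto
    qed
  qed
  hence "\<forall>\<^sub>F J::nat in sequentially. \<forall>p\<in>X. p \<in> box3 (nat \<lfloor>(Z0 * 2 ^ J)\<^sup>2 / a\<rfloor>) (nat \<lfloor>a * (Z0 * 2 ^ J)\<rfloor>)"
    using X by (simp add: eventually_ball_finite)
  thus "\<forall>\<^sub>F J::nat in sequentially. finite (box3 (nat \<lfloor>(Z0 * 2 ^ J)\<^sup>2 / a\<rfloor>) (nat \<lfloor>a * (Z0 * 2 ^ J)\<rfloor>)) \<and>
      X \<subseteq> box3 (nat \<lfloor>(Z0 * 2 ^ J)\<^sup>2 / a\<rfloor>) (nat \<lfloor>a * (Z0 * 2 ^ J)\<rfloor>) \<and> box3 (nat \<lfloor>(Z0 * 2 ^ J)\<^sup>2 / a\<rfloor>) (nat \<lfloor>a * (Z0 * 2 ^ J)\<rfloor>) \<subseteq> UNIV"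
    by eventually_elim (auto simp: finite_box3)
qed

text \<open>For l = 0 one has \<kappa>^2 = a n, and the two termwise bounds combine to a multiple of
  min(1/n, X/n^2), where X = Z0^2/a is the n with \<kappa> = r/h. Only a logarithm is lost. a r^2
  \<ge> 1 provides r \<kappa> \<ge> 1.\<close>

lemma planar_axis_bound:
  fixes a r h x Z0 L :: real
  assumes a: "a > 0" and r: "r > 0" "a * r\<^sup>2 \<ge> 1" and h: "h > 0" and Z0: "Z0 > 0" and hZ: "h * Z0 = r"
    and x: "81/100 * r\<^sup>2 \<le> x" "x + 2 * h \<le> 121/100 * r\<^sup>2"
    and L: "L \<ge> 10" "ln (Z0\<^sup>2 / a) + 6 \<le> L"
  shows "\<bar>\<Sum>n=1..N. real (r2 n) * sdiff h x (gf (2 * pi * sqrt (a * real n)))\<bar> \<le> h\<^sup>2 * (6 * L * r / a)"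
proof -
  define X where "X = Z0\<^sup>2 / a"
  define v where "v n = min (1 / real n) (X / (real n)\<^sup>2)" for n :: nat
  have X0: "X > 0" using a Z0 by (simp add: X_def)
  have pt: "\<bar>sdiff h x (gf (2 * pi * sqrt (a * real n)))\<bar> \<le> h\<^sup>2 * (r / (2 * a)) * v n" if n: "n \<ge> 1" for n :: nat
  proof -
    define k where "k = sqrt (a * real n)"
    have k: "k > 0" "k\<^sup>2 = a * real n" using a n by (auto simp: k_def)
    have "1 \<le> (r * k)\<^sup>2"
    proof -
      have "1 \<le> a * r\<^sup>2 * real n" using mult_mono[OF r(2), of 1 "real n"] n a by simp
      thus ?thesis by (simp add: power_mult_distrib k(2) algebra_simps)
    qed
    hence rk: "1 \<le> r * k" using k r abs_le_square_iff[of 1 "r * k"] by simp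
    have "1 / (18 * k ^ 3) \<le> r / (18 * k\<^sup>2)"
      using mult_left_mono[OF rk, of "k\<^sup>2"] k(1) by (simp add: field_simps power2_eq_square power3_eq_cube)
    hence "1 / (18 * k ^ 3) + 11/30 * r / k\<^sup>2 \<le> (r / k\<^sup>2) * (38/90)" by (simp add: field_simps)
    also have "\<dots> \<le> (r / k\<^sup>2) * (1/2)" using r by (intro mult_left_mono) auto
    finally have "h\<^sup>2 * (1 / (18 * k ^ 3) + 11/30 * r / k\<^sup>2) \<le> h\<^sup>2 * ((r / k\<^sup>2) * (1/2))" by (intro mult_left_mono) auto
    also have "\<dots> = h\<^sup>2 * (r / (2 * a)) * (1 / real n)" unfolding k(2) by simp
    finally have 1: "\<bar>sdiff h x (gf (2 * pi * k))\<bar> \<le> h\<^sup>2 * (r / (2 * a)) * (1 / real n)"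
      using sdiff_gf_derivative_bound[OF k(1) r(1) h x] by linarith
    have "r ^ 3 / (2 * k ^ 4) = r * r\<^sup>2 / (2 * (k\<^sup>2)\<^sup>2)" by (simp add: eval_nat_numeral)
    also have "\<dots> = h\<^sup>2 * (r / (2 * a)) * (X / (real n)\<^sup>2)"
      unfolding k(2) hZ[symmetric] X_def by (simp add: field_simps power2_eq_square)
    finally have 2: "\<bar>sdiff h x (gf (2 * pi * k))\<bar> \<le> h\<^sup>2 * (r / (2 * a)) * (X / (real n)\<^sup>2)"
      using sdiff_gf_trivial_bound[OF k(1) rk r(1) h x] by linarith
    show ?thesis using 1 2 unfolding k_def v_def min_def
      by (cases "1 / real n \<le> X / (real n)\<^sup>2") (simp_all only: if_True if_False)
  qed
  have v0: "v n \<ge> 0" for n using X0 by (simp add: v_def)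
  have vm: "v (Suc n) \<le> v n" if "n \<ge> 1" for n
    unfolding v_def using that X0 by (intro min.mono divide_left_mono power_mono) auto
  have "\<bar>\<Sum>n=1..N. real (r2 n) * sdiff h x (gf (2 * pi * sqrt (a * real n)))\<bar> \<le> (\<Sum>n=1..N. real (r2 n) * (h\<^sup>2 * (r / (2 * a)) * v n))"
  proof (rule order_trans[OF sum_abs], rule sum_mono)
    fix n assume n: "n \<in> {1..N}"
    show "\<bar>real (r2 n) * sdiff h x (gf (2 * pi * sqrt (a * real n)))\<bar> \<le> real (r2 n) * (h\<^sup>2 * (r / (2 * a)) * v n)"
      unfolding abs_mult abs_of_nat by (intro mult_left_mono pt of_nat_0_le_iff) (use n in simp)
  qed
  also have "\<dots> = h\<^sup>2 * (r / (2 * a)) * (\<Sum>n=1..N. real (r2 n) * v n)"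
    unfolding sum_distrib_left by (intro sum.cong) auto
  also have "\<dots> \<le> h\<^sup>2 * (r / (2 * a)) * (9 * (\<Sum>n=1..N. v n))"
    using a r by (intro mult_left_mono sum_r2_antimono_le v0 vm) auto
  also have "\<dots> \<le> h\<^sup>2 * (r / (2 * a)) * (9 * (2 + (L - 5)))"
    unfolding v_def using a r X0 L by (intro mult_left_mono sum_min_bound) (auto simp: X_def)
  also have "\<dots> \<le> h\<^sup>2 * (r / (2 * a)) * (12 * L)" using a r L by (intro mult_left_mono) auto
  also have "\<dots> = h\<^sup>2 * (6 * L * r / a)" by simp
  finally show ?thesis .
qed

text \<open>Here \<kappa> = l/a, and the derivative bound alone suffices because the sum of 1/l^2
  converges.\<close>

lemma vertical_axis_bound:
  fixes a r h x :: real
  assumes a: "a > 0" and r: "r > 0" and h: "h > 0"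
    and x: "81/100 * r\<^sup>2 \<le> x" "x + 2 * h \<le> 121/100 * r\<^sup>2"
  shows "\<bar>\<Sum>l=1..int M. sdiff h x (gf (2 * pi * (real_of_int l / a)))\<bar> \<le> h\<^sup>2 * (a ^ 3 / 2 + r * a\<^sup>2)"
proof -
  have "\<bar>\<Sum>l=1..int M. sdiff h x (gf (2 * pi * (real_of_int l / a)))\<bar> = \<bar>\<Sum>n=1..M. sdiff h x (gf (2 * pi * (real n / a)))\<bar>"
    by (subst sum_int_atLeast1_atMost[where f = "\<lambda>l. sdiff h x (gf (2 * pi * (l / a)))"]) simp
  also have "\<dots> \<le> (\<Sum>n=1..M. h\<^sup>2 * (a ^ 3 / 18 + 11/30 * r * a\<^sup>2) * (1 / (real n)\<^sup>2))"
  proof (rule order_trans[OF sum_abs], rule sum_mono)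
    fix n assume "n \<in> {1..M}"
    hence n: "real n \<ge> 1" by simp
    hence k: "real n / a > 0" using a by simp
    have 1: "1 / (18 * (real n / a) ^ 3) \<le> a ^ 3 / 18 * (1 / (real n)\<^sup>2)"
    proof -
      have "(real n)\<^sup>2 * 1 \<le> (real n)\<^sup>2 * real n" using n by (intro mult_left_mono) auto
      thus ?thesis using n a by (simp add: field_simps power2_eq_square power3_eq_cube)
    qed
    have 2: "11/30 * r / (real n / a)\<^sup>2 = 11/30 * r * a\<^sup>2 * (1 / (real n)\<^sup>2)"
      using n a by (simp add: field_simps)
    have "1 / (18 * (real n / a) ^ 3) + 11/30 * r / (real n / a)\<^sup>2 \<le> (a ^ 3 / 18 + 11/30 * r * a\<^sup>2) * (1 / (real n)\<^sup>2)"
      unfolding distrib_right 2 using 1 by (rule add_right_mono)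
    from mult_left_mono[OF this, of "h\<^sup>2"]
    show "\<bar>sdiff h x (gf (2 * pi * (real n / a)))\<bar> \<le> h\<^sup>2 * (a ^ 3 / 18 + 11/30 * r * a\<^sup>2) * (1 / (real n)\<^sup>2)"
      using sdiff_gf_derivative_bound[OF k r h x] by simp
  qed
  also have "\<dots> = h\<^sup>2 * (a ^ 3 / 18 + 11/30 * r * a\<^sup>2) * (\<Sum>n=1..M. 1 / (real n)\<^sup>2)" by (simp add: sum_distrib_left)
  also have "\<dots> \<le> h\<^sup>2 * (a ^ 3 / 18 + 11/30 * r * a\<^sup>2) * 2"
    using a r by (intro mult_left_mono sum_inv_sq_le) auto
  also have "\<dots> = h\<^sup>2 * (a ^ 3 / 9 + 11/15 * (r * a\<^sup>2))" by simp
  also have "\<dots> \<le> h\<^sup>2 * (a ^ 3 / 2 + r * a\<^sup>2)"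
    using a r by (intro mult_left_mono add_mono) auto
  finally show ?thesis .
qed

text \<open>The mean of order two cut to a cube. Its value is the full lattice sum as soon as the
  cube contains the ellipsoid of parameter t.\<close>

definition riesz_sum :: "real \<Rightarrow> nat \<Rightarrow> real \<Rightarrow> real" where
  "riesz_sum a R t = (\<Sum>k=-int R..int R. \<Sum>j=-int R..int R. \<Sum>i=-int R..int R.
     psi (t - (((real_of_int i)\<^sup>2 + (real_of_int j)\<^sup>2) / a + a\<^sup>2 * (real_of_int k)\<^sup>2)))"

text \<open>Poisson summation at the three values of t makes the left side an unconditional sum over
  nonzero frequencies. The bound holds on every dyadic box with the same constant and passes to the
  limit; 24 = 2 * 12 accounts for l > 0 and l < 0.\<close>

theorem riesz_sum_second_difference:
  fixes a r h x Z0 L :: real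
  assumes a: "a > 0" and r: "r \<ge> 14" "a * r\<^sup>2 \<ge> 1" and h: "h > 0" and Z0: "Z0 > 0" and hZ: "h * Z0 = r"
    and x: "81/100 * r\<^sup>2 \<le> x" "x + 2 * h \<le> 121/100 * r\<^sup>2"
    and L: "L \<ge> 10" "ln (Z0\<^sup>2 / a) + 6 \<le> L"
    and R: "(1 / a) * (real R)\<^sup>2 \<ge> x + 2 * h" "a\<^sup>2 * (real R)\<^sup>2 \<ge> x + 2 * h"
  shows "\<bar>sdiff h x (riesz_sum a R) - sdiff h x (gg 0)\<bar>
    \<le> h\<^sup>2 * (24 * r * sqrt L * Bz a r Z0 + 6 * L * r / a + a ^ 3 + 2 * r * a\<^sup>2)"
proof -
  define G where "G \<kappa> = sdiff h x (gg \<kappa>)" for \<kappa>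
  define q where "q = (\<lambda>(j::int,k::int,l::int). sqrt (a * ((real_of_int j)\<^sup>2 + (real_of_int k)\<^sup>2) + (real_of_int l / a)\<^sup>2))"
  define B where "B J = box3 (nat \<lfloor>(Z0 * 2 ^ J)\<^sup>2 / a\<rfloor>) (nat \<lfloor>a * (Z0 * 2 ^ J)\<rfloor>)" for J :: nat
  have r0: "r > 0" using r by simp
  have "0 < 81/100 * r\<^sup>2" using r0 by simp
  hence x0: "x > 0" using x(1) by linarith
  have P: "((\<lambda>p. gg (q p) t) has_sum riesz_sum a R t) UNIV" if "0 < t" "t \<le> x + 2 * h" for t
    using ellipsoid_poisson[OF a that(1), of R] R that unfolding riesz_sum_def q_def by (simp add: case_prod_unfold)
  have "((\<lambda>p. (gg (q p) (x + 2 * h) + (- 2) * gg (q p) (x + h)) + gg (q p) x) has_sum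
      ((riesz_sum a R (x + 2 * h) + (- 2) * riesz_sum a R (x + h)) + riesz_sum a R x)) UNIV"
    using x0 h by (intro has_sum_add has_sum_cmult_right P) auto
  hence hs: "((\<lambda>p. G (q p)) has_sum sdiff h x (riesz_sum a R)) UNIV" by (simp add: G_def sdiff_def)
  have lim: "(\<lambda>J. \<Sum>p\<in>B J. G (q p)) \<longlonglongrightarrow> sdiff h x (riesz_sum a R)"
    using hs filterlim_box3[OF a Z0] unfolding has_sum_def B_def by (rule filterlim_compose)
  have Gpos: "G \<kappa> = sdiff h x (gf (2 * pi * \<kappa>))" if "\<kappa> > 0" for \<kappa>
    using that by (simp add: G_def sdiff_def gg_def)
  have bound: "\<bar>(\<Sum>p\<in>B J. G (q p)) - G 0\<bar> \<le> h\<^sup>2 * (24 * r * sqrt L * Bz a r Z0 + 6 * L * r / a + a ^ 3 + 2 * r * a\<^sup>2)" for J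
  proof -
    define N where "N = nat \<lfloor>(Z0 * 2 ^ J)\<^sup>2 / a\<rfloor>"
    define M where "M = nat \<lfloor>a * (Z0 * 2 ^ J)\<rfloor>"
    define V where "V = (\<Sum>l=1..int M. sdiff h x (gf (2 * pi * (real_of_int l / a))))"
    define H where "H = (\<Sum>n=1..N. real (r2 n) * sdiff h x (gf (2 * pi * sqrt (a * real n))))"
    define T where "T = tsum a (Z0 * 2 ^ J) (\<lambda>\<kappa>. sdiff h x (gf (2 * pi * \<kappa>)))"
    have "(\<Sum>p\<in>B J. G (q p)) = G 0 + 2 * (\<Sum>l=1..int M. G (real_of_int l / a)) + (\<Sum>n=1..N. real (r2 n) * G (sqrt (a * real n)))
      + 2 * (\<Sum>n=1..N. real (r2 n) * (\<Sum>m=1..int M. G (kap a n m)))"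
      unfolding sum_box3[OF a, symmetric] B_def N_def M_def q_def by (intro sum.cong) auto
    also have "(\<Sum>l=1..int M. G (real_of_int l / a)) = V"
      unfolding V_def using a by (intro sum.cong refl Gpos) auto
    also have "(\<Sum>n=1..N. real (r2 n) * G (sqrt (a * real n))) = H"
      unfolding H_def using a by (intro sum.cong refl arg_cong2[where f = "(*)"] Gpos) auto
    also have "(\<Sum>n=1..N. real (r2 n) * (\<Sum>m=1..int M. G (kap a n m))) = T"
      unfolding T_def tsum_def N_def M_def using a by (intro sum.cong refl arg_cong2[where f = "(*)"] Gpos kap_pos) auto
    finally have e: "(\<Sum>p\<in>B J. G (q p)) - G 0 = 2 * V + H + 2 * T" by simp
    have b: "\<bar>V\<bar> \<le> h\<^sup>2 * (a ^ 3 / 2 + r * a\<^sup>2)" "\<bar>H\<bar> \<le> h\<^sup>2 * (6 * L * r / a)" "\<bar>T\<bar> \<le> h\<^sup>2 * (12 * r * sqrt L * Bz a r Z0)"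
      unfolding V_def H_def T_def
      by (rule vertical_axis_bound[OF a r0 h x] planar_axis_bound[OF a r0 r(2) h Z0 hZ x L] tsum_bound[OF a r(1) Z0 h hZ x L(2,1)])+
    have "\<bar>2 * V + H + 2 * T\<bar> \<le> 2 * (h\<^sup>2 * (a ^ 3 / 2 + r * a\<^sup>2)) + h\<^sup>2 * (6 * L * r / a) + 2 * (h\<^sup>2 * (12 * r * sqrt L * Bz a r Z0))"
      using b by linarith
    also have "\<dots> = h\<^sup>2 * (24 * r * sqrt L * Bz a r Z0 + 6 * L * r / a + a ^ 3 + 2 * r * a\<^sup>2)"
      by (simp add: distrib_left mult.assoc)
    finally show ?thesis unfolding e .
  qed
  have "(\<lambda>J. \<bar>(\<Sum>p\<in>B J. G (q p)) - G 0\<bar>) \<longlonglongrightarrow> \<bar>sdiff h x (riesz_sum a R) - G 0\<bar>"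
    by (intro tendsto_rabs tendsto_diff lim tendsto_const)
  from LIMSEQ_le_const2[OF this] bound show ?thesis unfolding G_def by blast
qed

section \<open>From the Riesz mean to the lattice discrepancy\<close>

text \<open>Divided by h^2, the second difference is a smoothed indicator of s \<ge> 0 that rises
  from 0 to 1 between -2h and 0.\<close>

lemma psi_second_difference:
  assumes h: "h > 0"
  shows "s \<ge> 0 \<Longrightarrow> psi (s + 2 * h) - 2 * psi (s + h) + psi s = h\<^sup>2"
    and "s + 2 * h \<le> 0 \<Longrightarrow> psi (s + 2 * h) - 2 * psi (s + h) + psi s = 0"
    and "0 \<le> psi (s + 2 * h) - 2 * psi (s + h) + psi s"
    and "psi (s + 2 * h) - 2 * psi (s + h) + psi s \<le> h\<^sup>2"
proof -
  show 1: "psi (s + 2 * h) - 2 * psi (s + h) + psi s = h\<^sup>2" if "s \<ge> 0"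
    using that h by (simp add: psi_def max_def power2_eq_square field_simps)
  show 2: "psi (s + 2 * h) - 2 * psi (s + h) + psi s = 0" if "s + 2 * h \<le> 0"
    using that h by (simp add: psi_def max_def)
  have 3: "0 \<le> psi (s + 2 * h) - 2 * psi (s + h) + psi s \<and> psi (s + 2 * h) - 2 * psi (s + h) + psi s \<le> h\<^sup>2"
    if "s < 0" "s + 2 * h > 0"
  proof (cases "s + h \<le> 0")
    case True
    have "(s + 2 * h)\<^sup>2 \<le> h\<^sup>2" using True that by (intro power_mono) auto
    moreover have "psi (s + 2 * h) - 2 * psi (s + h) + psi s = (s + 2 * h)\<^sup>2 / 2"
      using True that by (simp add: psi_def max_def)
    moreover have "0 \<le> (s + 2 * h)\<^sup>2" by simp
    ultimately show ?thesis by linarith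
  next
    case False
    have "(- s)\<^sup>2 \<le> h\<^sup>2" using False that by (intro power_mono) auto
    moreover have "psi (s + 2 * h) - 2 * psi (s + h) + psi s = h\<^sup>2 - (- s)\<^sup>2 / 2"
      using False that by (simp add: psi_def max_def power2_eq_square field_simps)
    moreover have "0 \<le> (- s)\<^sup>2" by simp
    ultimately show ?thesis by linarith
  qed
  show "0 \<le> psi (s + 2 * h) - 2 * psi (s + h) + psi s" "psi (s + 2 * h) - 2 * psi (s + h) + psi s \<le> h\<^sup>2"
    using 1 2 3 h zero_le_power2[of h] by linarith+
qed

context
  fixes a :: real and R :: nat
  assumes a: "a > 0"
begin

definition quad :: "int \<Rightarrow> int \<Rightarrow> int \<Rightarrow> real" where
  "quad i j k = ((real_of_int i)\<^sup>2 + (real_of_int j)\<^sup>2) / a + a\<^sup>2 * (real_of_int k)\<^sup>2"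

lemma sdiff_riesz_sum:
  "sdiff h x (riesz_sum a R) = (\<Sum>k=-int R..int R. \<Sum>j=-int R..int R. \<Sum>i=-int R..int R.
     psi ((x - quad i j k) + 2 * h) - 2 * psi ((x - quad i j k) + h) + psi (x - quad i j k))"
  unfolding sdiff_def riesz_sum_def quad_def[symmetric]
  by (simp add: sum_subtractf sum.distrib sum_distrib_left algebra_simps)

lemma quad_bounded:
  assumes R: "(1 / a) * (real R)\<^sup>2 \<ge> x" "a\<^sup>2 * (real R)\<^sup>2 \<ge> x" and q: "quad i j k \<le> x"
  shows "\<bar>i\<bar> \<le> int R" "\<bar>j\<bar> \<le> int R" "\<bar>k\<bar> \<le> int R"
proof -
  have aux: "\<bar>u\<bar> \<le> int R" if "(real_of_int u)\<^sup>2 \<le> (real R)\<^sup>2" for u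
    using that by (simp add: abs_le_square_iff[symmetric])
  have n: "0 \<le> (real_of_int i)\<^sup>2 / a" "0 \<le> (real_of_int j)\<^sup>2 / a" "0 \<le> a\<^sup>2 * (real_of_int k)\<^sup>2" using a by auto
  have R': "x \<le> (real R)\<^sup>2 / a" using R(1) by simp
  have q': "(real_of_int i)\<^sup>2 / a + (real_of_int j)\<^sup>2 / a + a\<^sup>2 * (real_of_int k)\<^sup>2 \<le> x"
    using q by (simp add: quad_def add_divide_distrib)
  have "(real_of_int i)\<^sup>2 / a \<le> (real R)\<^sup>2 / a" "(real_of_int j)\<^sup>2 / a \<le> (real R)\<^sup>2 / a"
    "a\<^sup>2 * (real_of_int k)\<^sup>2 \<le> a\<^sup>2 * (real R)\<^sup>2" using q' n R(2) R' by linarith+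
  thus "\<bar>i\<bar> \<le> int R" "\<bar>j\<bar> \<le> int R" "\<bar>k\<bar> \<le> int R" using a by (auto intro!: aux simp: divide_le_cancel)
qed

lemma card_lattice_points_sum:
  assumes R: "(1 / a) * (real R)\<^sup>2 \<ge> x" "a\<^sup>2 * (real R)\<^sup>2 \<ge> x"
  shows "real (card (ellipsoid_lattice_points a x)) =
    (\<Sum>k=-int R..int R. \<Sum>j=-int R..int R. \<Sum>i=-int R..int R. if quad i j k \<le> x then 1 else 0)"
proof -
  define I where "I = {-int R..int R}"
  define S where "S = {p \<in> I \<times> I \<times> I. case p of (k, j, i) \<Rightarrow> quad i j k \<le> x}"
  have "(\<Sum>k\<in>I. \<Sum>j\<in>I. \<Sum>i\<in>I. if quad i j k \<le> x then 1 else 0 :: real)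
    = (\<Sum>p\<in>I \<times> I \<times> I. if (case p of (k, j, i) \<Rightarrow> quad i j k \<le> x) then 1 else 0)"
    by (simp add: sum.cartesian_product case_prod_unfold)
  also have "\<dots> = (\<Sum>p\<in>S. 1)" unfolding S_def by (intro sum.inter_filter[symmetric]) (auto simp: I_def)
  also have "\<dots> = real (card S)" by simp
  also have "card S = card (ellipsoid_lattice_points a x)"
  proof (rule bij_betw_same_card[of "\<lambda>(k, j, i). (i, j, k)"], rule bij_betw_byWitness[where f' = "\<lambda>(i, j, k). (k, j, i)"])
    show "(\<lambda>(k, j, i). (i, j, k)) ` S \<subseteq> ellipsoid_lattice_points a x"
      unfolding S_def ellipsoid_lattice_points_def quad_def by auto
    show "(\<lambda>(i, j, k). (k, j, i)) ` ellipsoid_lattice_points a x \<subseteq> S"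
    proof clarify
      fix i j k assume "(i, j, k) \<in> ellipsoid_lattice_points a x"
      hence q: "quad i j k \<le> x" by (simp add: ellipsoid_lattice_points_def quad_def)
      show "(k, j, i) \<in> S" using quad_bounded[OF R q] q unfolding S_def I_def by auto
    qed
  qed auto
  finally show ?thesis unfolding I_def by simp
qed

text \<open>Based at x, the smoothed indicator is 1 on the ellipsoid and nonnegative elsewhere;
  based at x - 2h, it is 0 outside the ellipsoid and at most 1 inside.\<close>

lemma riesz_sum_sandwich:
  assumes h: "h > 0" and R: "(1 / a) * (real R)\<^sup>2 \<ge> x" "a\<^sup>2 * (real R)\<^sup>2 \<ge> x"
  shows "h\<^sup>2 * real (card (ellipsoid_lattice_points a x)) \<le> sdiff h x (riesz_sum a R)"
    and "sdiff h (x - 2 * h) (riesz_sum a R) \<le> h\<^sup>2 * real (card (ellipsoid_lattice_points a x))"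
proof -
  have 1: "h\<^sup>2 * (if quad i j k \<le> x then 1 else 0) \<le> psi ((x - quad i j k) + 2 * h) - 2 * psi ((x - quad i j k) + h) + psi (x - quad i j k)" for i j k
    using psi_second_difference(1,3)[OF h, of "x - quad i j k"] by auto
  have 2: "psi ((x - 2 * h - quad i j k) + 2 * h) - 2 * psi ((x - 2 * h - quad i j k) + h) + psi (x - 2 * h - quad i j k)
    \<le> h\<^sup>2 * (if quad i j k \<le> x then 1 else 0)" for i j k
    using psi_second_difference(2,4)[OF h, of "x - 2 * h - quad i j k"] by (cases "quad i j k \<le> x") auto
  show "h\<^sup>2 * real (card (ellipsoid_lattice_points a x)) \<le> sdiff h x (riesz_sum a R)"
    unfolding card_lattice_points_sum[OF R] sdiff_riesz_sum sum_distrib_left by (intro sum_mono 1)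
  show "sdiff h (x - 2 * h) (riesz_sum a R) \<le> h\<^sup>2 * real (card (ellipsoid_lattice_points a x))"
    unfolding card_lattice_points_sum[OF R] sdiff_riesz_sum sum_distrib_left by (intro sum_mono 2)
qed

end

text \<open>\<open>gg 0\<close> is (16 pi/105) t^(7/2), and its second derivative (4 pi/3) t^(3/2)
  is the volume.\<close>

lemma sdiff_volume:
  assumes h: "h > 0" and x: "x > 0"
  shows "\<exists>\<xi>. x < \<xi> \<and> \<xi> < x + 2 * h \<and> sdiff h x (gg 0) = h\<^sup>2 * (4 * pi / 3 * sqrt \<xi> ^ 3)"
proof -
  have d: "((\<lambda>t. t ^ n * sqrt t) has_real_derivative (real n + 1/2) * (t ^ (n - 1) * sqrt t)) (at t)"
    if "t > 0" "n \<ge> 1" for t n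
  proof -
    have s: "sqrt t > 0" "t = sqrt t * sqrt t" using that by auto
    have "((\<lambda>t. t ^ n * sqrt t) has_real_derivative (real n * t ^ (n - 1) * sqrt t + t ^ n * (inverse (sqrt t) / 2))) (at t)"
      using that by (auto intro!: derivative_eq_intros)
    also have "t ^ n * (inverse (sqrt t) / 2) = t ^ (n - 1) * sqrt t / 2"
    proof -
      have "t ^ n * (inverse (sqrt t) / 2) = t ^ (n - 1) * (t * inverse (sqrt t)) / 2"
        using power_minus_mult[of n t] that by simp
      also have "t * inverse (sqrt t) = sqrt t" using real_div_sqrt[of t] that by (simp add: divide_inverse)
      finally show ?thesis .
    qed
    finally show ?thesis by (simp add: algebra_simps)
  qed
  have g: "(gg 0 has_real_derivative (8 * pi / 15 * (t\<^sup>2 * sqrt t))) (at t)" if t: "x \<le> t" for t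
  proof -
    have "((\<lambda>t. 16 * pi / 105 * (t ^ 3 * sqrt t)) has_real_derivative 16 * pi / 105 * ((real 3 + 1/2) * (t ^ (3 - 1) * sqrt t))) (at t)"
      using t x by (intro DERIV_cmult d) auto
    thus ?thesis by (simp add: gg_def[abs_def] mult_ac)
  qed
  have g': "((\<lambda>t. 8 * pi / 15 * (t\<^sup>2 * sqrt t)) has_real_derivative (4 * pi / 3 * (t * sqrt t))) (at t)" if t: "x \<le> t" for t
  proof -
    have "((\<lambda>t. 8 * pi / 15 * (t\<^sup>2 * sqrt t)) has_real_derivative 8 * pi / 15 * ((real 2 + 1/2) * (t ^ (2 - 1) * sqrt t))) (at t)"
      using t x by (intro DERIV_cmult d) auto
    thus ?thesis by (simp add: mult_ac)
  qed
  obtain \<xi> where xi: "x < \<xi>" "\<xi> < x + 2 * h" "sdiff h x (gg 0) = h\<^sup>2 * (4 * pi / 3 * (\<xi> * sqrt \<xi>))"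
    using second_difference_mvt[OF h, of x "gg 0" "\<lambda>t. 8 * pi / 15 * (t\<^sup>2 * sqrt t)" "\<lambda>t. 4 * pi / 3 * (t * sqrt t)"] g g'
    unfolding sdiff_def by blast
  have "\<xi> * sqrt \<xi> = sqrt \<xi> ^ 3" using xi(1) x by (simp add: power3_eq_cube)
  thus ?thesis using xi by auto
qed

text \<open>From (s^3 - r^3)(s + r) = (s^2 - r^2)(s^2 + sr + r^2), where the last factor is at most
  (33/20) r (s + r) for s \<le> (11/10) r. With pi < 4 this gives (16/3)(33/10) = 88/5.\<close>

lemma volume_error:
  fixes r s d :: real
  assumes r: "r > 0" and s: "0 \<le> s" "s \<le> 11/10 * r" and d: "\<bar>s\<^sup>2 - r\<^sup>2\<bar> \<le> 2 * d"
  shows "\<bar>4 * pi / 3 * s ^ 3 - 4 * pi / 3 * r ^ 3\<bar> \<le> 88/5 * (d * r)"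
proof -
  have "\<bar>s ^ 3 - r ^ 3\<bar> * (s + r) = \<bar>(s ^ 3 - r ^ 3) * (s + r)\<bar>" using s r by (simp add: abs_mult)
  also have "(s ^ 3 - r ^ 3) * (s + r) = (s\<^sup>2 - r\<^sup>2) * (s * s + s * r + r * r)" by (simp add: algebra_simps eval_nat_numeral)
  also have "\<bar>\<dots>\<bar> = \<bar>s\<^sup>2 - r\<^sup>2\<bar> * (s * s + s * r + r * r)" using s r by (simp add: abs_mult)
  also have "\<dots> \<le> 2 * d * (33/20 * r * (s + r))"
  proof (intro mult_mono d)
    have "s * s \<le> 11/10 * (s * r)" "s * r \<le> 11/10 * (r * r)"
      using mult_right_mono[OF s(2) s(1)] mult_right_mono[OF s(2), of r] r by (simp_all add: mult_ac)
    moreover have "0 \<le> r * r" using r by auto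
    moreover have "33/20 * r * (s + r) = 33/20 * (s * r) + 33/20 * (r * r)" by (simp add: algebra_simps)
    ultimately show "s * s + s * r + r * r \<le> 33/20 * r * (s + r)" by linarith
  qed (use s r d in auto)
  also have "\<dots> = (33/10 * (d * r)) * (s + r)" by simp
  finally have b: "\<bar>s ^ 3 - r ^ 3\<bar> \<le> 33/10 * (d * r)" using s r by simp
  have "\<bar>4 * pi / 3 * s ^ 3 - 4 * pi / 3 * r ^ 3\<bar> = 4 * pi / 3 * \<bar>s ^ 3 - r ^ 3\<bar>"
    unfolding right_diff_distrib[symmetric] abs_mult by simp
  also have "\<dots> \<le> 16 / 3 * (33/10 * (d * r))" using b pi_less_4 by (intro mult_mono) auto
  finally show ?thesis by simp
qed

lemma abs_diff_divide:
  fixes u v c :: real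
  assumes "c > 0"
  shows "\<bar>u - c * v\<bar> / c = \<bar>u / c - v\<bar>"
proof -
  have "u / c - v = (u - c * v) / c" using assms by (simp add: field_simps)
  thus ?thesis using assms by simp
qed

text \<open>The count lies between the second differences based at r^2 - 2h and at r^2. As 2h \<le>
  r^2/6, every t involved stays between 81/100 and 121/100 of r^2. The last summand is the error in
  the volume, the others bound the nonzero frequencies.\<close>

theorem lattice_discrepancy_bound:
  fixes a r h Z0 L :: real
  assumes a: "a > 0" and r: "r \<ge> 14" "a * r\<^sup>2 \<ge> 1" and h: "h > 0" "2 * h \<le> r\<^sup>2 / 6" and hZ: "h * Z0 = r"
    and L: "L \<ge> 10" "ln (Z0\<^sup>2 / a) + 6 \<le> L"
  shows "\<bar>lattice_discrepancy a (r\<^sup>2)\<bar> \<le> 24 * r * sqrt L * Bz a r Z0 + 6 * L * r / a + a ^ 3 + 2 * r * a\<^sup>2 + 88/5 * (h * r)"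
proof -
  define E where "E = 24 * r * sqrt L * Bz a r Z0 + 6 * L * r / a + a ^ 3 + 2 * r * a\<^sup>2"
  define X where "X = r\<^sup>2 + 2 * h"
  have r0: "r > 0" using r by simp
  have rr: "r\<^sup>2 > 0" using r0 by simp
  have Z0: "Z0 > 0" using hZ h r0 by (smt (verit) mult_nonneg_nonpos)
  \<comment> \<open>The cube has to contain the ellipsoids of all parameters up to r^2 + 2h; the
    size of R enters no bound.\<close>
  obtain R :: nat where Rb: "real R \<ge> max 1 (max (X * a) (X / a\<^sup>2))" using real_arch_simple by blast
  have "real R * 1 \<le> real R * real R" using Rb by (intro mult_left_mono) auto
  hence RR: "real R \<le> (real R)\<^sup>2" by (simp add: power2_eq_square)
  have "X * a \<le> (real R)\<^sup>2" "X / a\<^sup>2 \<le> (real R)\<^sup>2" using Rb RR unfolding max_def by (smt (verit))+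
  hence RX: "X \<le> (1 / a) * (real R)\<^sup>2" "X \<le> a\<^sup>2 * (real R)\<^sup>2" using a by (auto simp: field_simps)
  have Rx: "r\<^sup>2 \<le> (1 / a) * (real R)\<^sup>2" "r\<^sup>2 \<le> a\<^sup>2 * (real R)\<^sup>2" using RX h unfolding X_def by linarith+
  have key: "\<bar>sdiff h t (riesz_sum a R) / h\<^sup>2 - 4 * pi / 3 * r ^ 3\<bar> \<le> E + 88/5 * (h * r)"
    if t: "t = r\<^sup>2 \<or> t = r\<^sup>2 - 2 * h" for t
  proof -
    have tb: "81/100 * r\<^sup>2 \<le> t" "t + 2 * h \<le> 121/100 * r\<^sup>2" "t + 2 * h \<le> X" using t h rr unfolding X_def by auto
    have t0: "t > 0" using tb(1) rr by linarith
    obtain \<xi> where xi: "t < \<xi>" "\<xi> < t + 2 * h" and v: "sdiff h t (gg 0) = h\<^sup>2 * (4 * pi / 3 * sqrt \<xi> ^ 3)"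
      using sdiff_volume[OF h(1) t0] by blast
    have s: "0 \<le> sqrt \<xi>" "sqrt \<xi> \<le> 11/10 * r" "(sqrt \<xi>)\<^sup>2 = \<xi>" using sqrt_range[OF r0, of \<xi>] xi tb t0 by auto
    have "\<bar>\<xi> - r\<^sup>2\<bar> \<le> 2 * h" using xi t h by auto
    hence ve: "\<bar>4 * pi / 3 * sqrt \<xi> ^ 3 - 4 * pi / 3 * r ^ 3\<bar> \<le> 88/5 * (h * r)"
      using volume_error[OF r0 s(1,2), of h] s(3) by simp
    have "\<bar>sdiff h t (riesz_sum a R) - sdiff h t (gg 0)\<bar> \<le> h\<^sup>2 * E"
      unfolding E_def using RX tb(3) by (intro riesz_sum_second_difference[OF a r h(1) Z0 hZ tb(1,2) L]) linarith+
    hence "\<bar>sdiff h t (riesz_sum a R) - sdiff h t (gg 0)\<bar> / h\<^sup>2 \<le> E" using h by (simp add: divide_le_eq mult.commute)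
    moreover have "\<bar>sdiff h t (riesz_sum a R) - sdiff h t (gg 0)\<bar> / h\<^sup>2 = \<bar>sdiff h t (riesz_sum a R) / h\<^sup>2 - 4 * pi / 3 * sqrt \<xi> ^ 3\<bar>"
      unfolding v by (rule abs_diff_divide) (use h in simp)
    ultimately have "\<bar>sdiff h t (riesz_sum a R) / h\<^sup>2 - 4 * pi / 3 * sqrt \<xi> ^ 3\<bar> \<le> E" by simp
    thus ?thesis using ve by linarith
  qed
  define N where "N = real (card (ellipsoid_lattice_points a (r\<^sup>2)))"
  have sw: "N \<le> sdiff h (r\<^sup>2) (riesz_sum a R) / h\<^sup>2" "sdiff h (r\<^sup>2 - 2 * h) (riesz_sum a R) / h\<^sup>2 \<le> N"
    using riesz_sum_sandwich[OF a h(1) Rx] h by (simp_all add: N_def field_simps)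
  have "(r\<^sup>2) powr (3/2) = r ^ 3"
    using r0 by (simp add: powr_powr flip: powr_numeral)
  hence "lattice_discrepancy a (r\<^sup>2) = N - 4 * pi / 3 * r ^ 3" by (simp add: lattice_discrepancy_def N_def)
  thus ?thesis using sw key[of "r\<^sup>2"] key[of "r\<^sup>2 - 2 * h"] unfolding E_def by linarith
qed

section \<open>Numerical bounds\<close>

lemma powr_exp_scale:
  fixes k c u :: real
  assumes "0 \<le> k" "c > 0" "n > 0" "k \<le> c ^ n"
  shows "(k * exp u) powr (1 / real n) \<le> c * exp (u / real n)"
proof -
  have "exp u powr (1 / real n) = exp (u / real n)" by (simp add: powr_def)
  thus ?thesis using powr_inverse_scale[of "exp u" k c n] assms by simp
qed

text \<open>In the coordinates \<alpha> = ln a, \<xi> = ln x, l = ln L, power identities are linear.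
  The step h = (92/5) exp(\<alpha>/8 + 3\<xi>/16 + 3l/8) gives the first term of \<open>Bz\<close>
  the same exponent as the volume error h r, and (5/92) exp z is the corresponding r/h.\<close>

lemma Bz_at_optimal_step:
  fixes \<alpha> \<xi> l :: real
  defines "z \<equiv> 5 * \<xi> / 16 - \<alpha> / 8 - 3 * l / 8"
  shows "24 * exp (\<xi> / 2) * exp (l / 2) * Bz (exp \<alpha>) (exp (\<xi> / 2)) (5 / 92 * exp z)
    \<le> 473 * exp (\<alpha> / 8 + 11 * \<xi> / 16 + 3 * l / 8) + 920 * exp (\<alpha> / 4 + 5 * \<xi> / 8 + l / 4)
      + 34 * exp (- 9 * \<alpha> / 16 + 21 * \<xi> / 32 + 5 * l / 16) + 318 * exp (- 3 * \<alpha> / 32 + 39 * \<xi> / 64 + 7 * l / 32)"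
proof -
  define e where "e = exp (\<xi> / 2) * exp (l / 2)"
  define Z where "Z = 5 / 92 * exp z"
  have "Z\<^sup>2 * exp (\<xi> / 2) * exp \<alpha> = 25 / 8464 * exp (2 * z + \<xi> / 2 + \<alpha>)"
    by (simp add: Z_def power2_eq_square exp_add exp_double)
  \<comment> \<open>379/1000 is a rational upper bound for the sixth root of 25/8464; the constants
    of the other three terms arise in the same way.\<close>
  also have "\<dots> powr (1 / real 6) \<le> 379 / 1000 * exp ((2 * z + \<xi> / 2 + \<alpha>) / real 6)"
    by (rule powr_exp_scale) (simp_all add: eval_nat_numeral)
  finally have p1: "(Z\<^sup>2 * exp (\<xi> / 2) * exp \<alpha>) powr (1/6) \<le> 379 / 1000 * exp ((2 * z + \<xi> / 2 + \<alpha>) / 6)" by simp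
  have "Z ^ 4 * (exp \<alpha>)\<^sup>2 / exp (\<xi> / 2) = 625 / 71639296 * exp (4 * z + 2 * \<alpha> - \<xi> / 2)"
    by (simp add: Z_def power_mult_distrib exp_add exp_diff exp_of_nat_mult[symmetric] power_divide)
  also have "\<dots> powr (1 / real 6) \<le> 144 / 1000 * exp ((4 * z + 2 * \<alpha> - \<xi> / 2) / real 6)"
    by (rule powr_exp_scale) (simp_all add: eval_nat_numeral)
  finally have p2: "(Z ^ 4 * (exp \<alpha>)\<^sup>2 / exp (\<xi> / 2)) powr (1/6) \<le> 144 / 1000 * exp ((4 * z + 2 * \<alpha> - \<xi> / 2) / 6)" by simp
  have "Z / exp \<alpha> = 5 / 92 * exp (z - \<alpha>)" by (simp add: Z_def exp_diff)
  also have "\<dots> powr (1 / real 2) \<le> 234 / 1000 * exp ((z - \<alpha>) / real 2)"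
    by (rule powr_exp_scale) (simp_all add: eval_nat_numeral)
  finally have p3: "(Z / exp \<alpha>) powr (1/2) \<le> 234 / 1000 * exp ((z - \<alpha>) / 2)" by simp
  have "Z ^ 3 / exp (\<xi> / 2) = 125 / 778688 * exp (3 * z - \<xi> / 2)"
    by (simp add: Z_def power_mult_distrib exp_diff exp_of_nat_mult[symmetric] power_divide)
  also have "\<dots> powr (1 / real 4) \<le> 113 / 1000 * exp ((3 * z - \<xi> / 2) / real 4)"
    by (rule powr_exp_scale) (simp_all add: eval_nat_numeral)
  finally have p4: "(Z ^ 3 / exp (\<xi> / 2)) powr (1/4) \<le> 113 / 1000 * exp ((3 * z - \<xi> / 2) / 4)" by simp
  have "24 * exp (\<xi> / 2) * exp (l / 2) * Bz (exp \<alpha>) (exp (\<xi> / 2)) Z = 24 * e * Bz (exp \<alpha>) (exp (\<xi> / 2)) Z"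
    by (simp add: e_def)
  also have "\<dots> \<le> 24 * e * (52 * (379 / 1000 * exp ((2 * z + \<xi> / 2 + \<alpha>) / 6)) + 266 * (144 / 1000 * exp ((4 * z + 2 * \<alpha> - \<xi> / 2) / 6))
      + 6 * (234 / 1000 * exp ((z - \<alpha>) / 2)) + 117 * (113 / 1000 * exp ((3 * z - \<xi> / 2) / 4)))"
    unfolding Bz_def by (intro mult_left_mono add_mono p1 p2 p3 p4) (auto simp: e_def)
  also have "\<dots> = (24 * 52 * 379 / 1000) * (e * exp ((2 * z + \<xi> / 2 + \<alpha>) / 6)) + (24 * 266 * 144 / 1000) * (e * exp ((4 * z + 2 * \<alpha> - \<xi> / 2) / 6))
      + (24 * 6 * 234 / 1000) * (e * exp ((z - \<alpha>) / 2)) + (24 * 117 * 113 / 1000) * (e * exp ((3 * z - \<xi> / 2) / 4))"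
    by (simp add: distrib_left)
  also have "e * exp ((2 * z + \<xi> / 2 + \<alpha>) / 6) = exp (\<alpha> / 8 + 11 * \<xi> / 16 + 3 * l / 8)"
    unfolding e_def mult_exp_exp z_def by (rule arg_cong[where f = exp]) (simp add: field_simps)
  also have "e * exp ((4 * z + 2 * \<alpha> - \<xi> / 2) / 6) = exp (\<alpha> / 4 + 5 * \<xi> / 8 + l / 4)"
    unfolding e_def mult_exp_exp z_def by (rule arg_cong[where f = exp]) (simp add: field_simps)
  also have "e * exp ((z - \<alpha>) / 2) = exp (- 9 * \<alpha> / 16 + 21 * \<xi> / 32 + 5 * l / 16)"
    unfolding e_def mult_exp_exp z_def by (rule arg_cong[where f = exp]) (simp add: field_simps)
  also have "e * exp ((3 * z - \<xi> / 2) / 4) = exp (- 3 * \<alpha> / 32 + 39 * \<xi> / 64 + 7 * l / 32)"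
    unfolding e_def mult_exp_exp z_def by (rule arg_cong[where f = exp]) (simp add: field_simps)
  also have "(24 * 52 * 379 / 1000) * exp (\<alpha> / 8 + 11 * \<xi> / 16 + 3 * l / 8) + (24 * 266 * 144 / 1000) * exp (\<alpha> / 4 + 5 * \<xi> / 8 + l / 4)
      + (24 * 6 * 234 / 1000) * exp (- 9 * \<alpha> / 16 + 21 * \<xi> / 32 + 5 * l / 16) + (24 * 117 * 113 / 1000) * exp (- 3 * \<alpha> / 32 + 39 * \<xi> / 64 + 7 * l / 32)
    \<le> 473 * exp (\<alpha> / 8 + 11 * \<xi> / 16 + 3 * l / 8) + 920 * exp (\<alpha> / 4 + 5 * \<xi> / 8 + l / 4)
      + 34 * exp (- 9 * \<alpha> / 16 + 21 * \<xi> / 32 + 5 * l / 16) + 318 * exp (- 3 * \<alpha> / 32 + 39 * \<xi> / 64 + 7 * l / 32)"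
    by (intro add_mono mult_right_mono) auto
  finally show ?thesis unfolding Z_def .
qed

text \<open>The exponent of the second term, raised by 8l/7, is a convex combination of the
  exponents A and B of the target, so it lies below one of them by at least l, and exp l \<ge> 10
  gives a factor 10. The exponent of the third lies 2l below one of the two exponents with 5l/2,
  depending on the sign of \<alpha>. The excess of 920 over 543 is absorbed by the first of these
  two.\<close>

lemma absorb_secondary_terms:
  fixes \<alpha> \<xi> l :: real
  assumes L: "exp l \<ge> 10" and xi: "\<xi> \<ge> 0"
  shows "920 * exp (\<alpha> / 4 + 5 * \<xi> / 8 + l / 4) + 34 * exp (- 9 * \<alpha> / 16 + 21 * \<xi> / 32 + 5 * l / 16) + 318 * exp (- 3 * \<alpha> / 32 + 39 * \<xi> / 64 + 7 * l / 32)
    \<le> 400 * exp (\<alpha> / 8 + 11 * \<xi> / 16 + 3 * l / 8) + 12 * exp (- 69 * \<alpha> / 64 + 81 * \<xi> / 128 + 145 * l / 64)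
      + 134 * exp (\<alpha> / 4 + 5 * \<xi> / 8 + 5 * l / 2) + 543 * exp (\<alpha> / 4 + 5 * \<xi> / 8 + l / 4) + 20 * exp (- \<alpha> / 4 + 5 * \<xi> / 8 + 5 * l / 2)"
proof -
  have l: "l \<ge> 0"
  proof (rule ccontr)
    assume "\<not> l \<ge> 0"
    hence "exp l < 1" by simp
    thus False using L by linarith
  qed
  have ten: "10 * exp u \<le> exp v" if "u + l \<le> v" for u v
  proof -
    have "10 * exp u \<le> exp l * exp u" using L by simp
    also have "\<dots> \<le> exp v" using that by (simp add: mult_exp_exp add.commute)
    finally show ?thesis .
  qed
  have hundred: "100 * exp u \<le> exp v" if "u + 2 * l \<le> v" for u v
    using ten[of u "u + l"] ten[of "u + l" v] that by simp
  define w where "w = - 9 * \<alpha> / 16 + 21 * \<xi> / 32 + 5 * l / 16"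
  define A where "A = \<alpha> / 8 + 11 * \<xi> / 16 + 3 * l / 8"
  define B where "B = - 69 * \<alpha> / 64 + 81 * \<xi> / 128 + 145 * l / 64"
  define v where "v = - 3 * \<alpha> / 32 + 39 * \<xi> / 64 + 7 * l / 32"
  define C where "C = \<alpha> / 4 + 5 * \<xi> / 8 + 5 * l / 2"
  define D where "D = - \<alpha> / 4 + 5 * \<xi> / 8 + 5 * l / 2"
  define E where "E = \<alpha> / 4 + 5 * \<xi> / 8 + l / 4"
  have "w + 8 / 7 * l = 3 / 7 * A + 4 / 7 * B" by (simp add: w_def A_def B_def field_simps)
  hence "w + l \<le> A \<or> w + l \<le> B" using l by linarith
  hence "10 * exp w \<le> exp A \<or> 10 * exp w \<le> exp B" using ten by blast
  moreover have "v + 2 * l \<le> C \<or> v + 2 * l \<le> D"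
    using l xi unfolding v_def C_def D_def by (cases "\<alpha> \<ge> 0") (auto simp: field_simps)
  hence "100 * exp v \<le> exp C \<or> 100 * exp v \<le> exp D" using hundred by blast
  moreover have "100 * exp E \<le> exp C" using l by (intro hundred) (simp add: E_def C_def field_simps)
  moreover have "exp A > 0" "exp B > 0" "exp C > 0" "exp D > 0" "exp E > 0" by simp_all
  ultimately have "920 * exp E + 34 * exp w + 318 * exp v \<le> 400 * exp A + 12 * exp B + 134 * exp C + 543 * exp E + 20 * exp D"
    by linarith
  thus ?thesis unfolding w_def A_def B_def C_def D_def E_def v_def .
qed

lemma exp_1_le: "exp (1::real) \<le> 14/5"
proof -
  have "exp (1/16 :: real) \<le> 1 + 1/16 + (1/16)\<^sup>2" by (rule exp_bound) auto
  hence "exp (1/16 :: real) ^ 16 \<le> (1 + 1/16 + (1/16)\<^sup>2) ^ 16" by (rule power_mono) auto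
  also have "exp (1/16 :: real) ^ 16 = exp 1" by (simp flip: exp_of_nat_mult)
  also have "(1 + 1/16 + (1/16)\<^sup>2 :: real) ^ 16 \<le> 14/5" by (simp add: eval_nat_numeral)
  finally show ?thesis .
qed

text \<open>Comparing powers through e \<le> 14/5 reduces numerical logarithms to rational
  arithmetic.\<close>

lemma ln_ge_by_power:
  fixes x :: real
  assumes "(14/5) ^ n \<le> x ^ m" "m > 0" "x > 0"
  shows "real n / real m \<le> ln x"
proof -
  have "exp (real n) = exp 1 ^ n" by (simp flip: exp_of_nat_mult)
  also have "\<dots> \<le> (14/5) ^ n" using exp_1_le by (intro power_mono) auto
  finally have "exp (real n) \<le> x ^ m" using assms(1) by linarith
  hence "real n \<le> ln (x ^ m)" using assms(3) by (simp add: ln_ge_iff)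
  thus ?thesis using assms by (simp add: ln_realpow divide_le_eq mult.commute)
qed

text \<open>For a x < 1 only the points (0, 0, k) fit, and their number as well as the volume is at
  most of order sqrt x / a + 1. This covers the range in which the plane l = 0 contains frequencies
  with r \<kappa> < 1.\<close>

lemma lattice_discrepancy_degenerate:
  assumes a: "a > 0" and x: "x \<ge> 1" and ax: "a * x < 1"
  shows "\<bar>lattice_discrepancy a x\<bar> \<le> 16/3 * (sqrt x / a) + 1"
proof -
  define m where "m = \<lfloor>sqrt x / a\<rfloor>"
  have m0: "m \<ge> 0" using a x by (simp add: m_def)
  have sub: "ellipsoid_lattice_points a x \<subseteq> (\<lambda>k. (0, 0, k)) ` {-m..m}"
  proof clarify
    fix i j k assume "(i, j, k) \<in> ellipsoid_lattice_points a x"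
    hence q: "(real_of_int i)\<^sup>2 / a + (real_of_int j)\<^sup>2 / a + a\<^sup>2 * (real_of_int k)\<^sup>2 \<le> x"
      by (simp add: ellipsoid_lattice_points_def add_divide_distrib)
    have n: "0 \<le> (real_of_int i)\<^sup>2 / a" "0 \<le> (real_of_int j)\<^sup>2 / a" "0 \<le> a\<^sup>2 * (real_of_int k)\<^sup>2" using a by auto
    have z: "u = 0" if "(real_of_int u)\<^sup>2 / a \<le> x" for u
    proof -
      have "(real_of_int u)\<^sup>2 \<le> a * x" using that a by (simp add: field_simps)
      hence "(real_of_int u)\<^sup>2 < 1" using ax by linarith
      hence "\<bar>real_of_int u\<bar> < 1" using abs_square_less_1 by blast
      thus ?thesis by linarith
    qed
    have i: "i = 0" by (rule z) (use q n in linarith)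
    have j: "j = 0" by (rule z) (use q n in linarith)
    have "(a * \<bar>real_of_int k\<bar>)\<^sup>2 \<le> x" using q n by (simp add: power_mult_distrib i j)
    hence "a * \<bar>real_of_int k\<bar> \<le> sqrt x" using a real_le_rsqrt by blast
    hence "real_of_int \<bar>k\<bar> \<le> sqrt x / a" using a by (simp add: field_simps)
    hence "\<bar>k\<bar> \<le> m" unfolding m_def le_floor_iff .
    thus "(i, j, k) \<in> (\<lambda>k. (0, 0, k)) ` {-m..m}" unfolding i j by (intro image_eqI[of _ _ k]) auto
  qed
  have "card (ellipsoid_lattice_points a x) \<le> card ((\<lambda>k. (0::int, 0::int, k)) ` {-m..m})"
    by (rule card_mono[OF _ sub]) simp
  also have "\<dots> \<le> card {-m..m}" by (rule card_image_le) simp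
  also have "\<dots> = nat (2 * m + 1)" by simp
  finally have "real (card (ellipsoid_lattice_points a x)) \<le> real_of_int (2 * m + 1)" using m0 by linarith
  moreover have "real_of_int m \<le> sqrt x / a" by (simp add: m_def)
  ultimately have N: "real (card (ellipsoid_lattice_points a x)) \<le> 2 * (sqrt x / a) + 1" by linarith
  have "x powr (3/2) = x powr 1 * x powr (1/2)" by (subst powr_add[symmetric]) simp
  also have "\<dots> = x * sqrt x" using x by (simp add: powr_half_sqrt)
  also have "\<dots> \<le> (1 / a) * sqrt x" using ax a x by (intro mult_right_mono) (auto simp: field_simps)
  finally have p: "x powr (3/2) \<le> sqrt x / a" by simp
  have "4 * pi / 3 * x powr (3/2) \<le> 16/3 * (sqrt x / a)"
    using pi_less_4 p by (intro mult_mono) auto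
  moreover have "0 \<le> 4 * pi / 3 * x powr (3/2)" by simp
  moreover have "0 \<le> sqrt x / a" using a x by simp
  moreover have "0 \<le> real (card (ellipsoid_lattice_points a x))" by simp
  ultimately show ?thesis using N unfolding lattice_discrepancy_def by linarith
qed

theorem mainTheorem1:
  fixes a x L \<alpha>0 y :: real
  assumes "a > 0" and "x > 0"
    and "L = ln (100 * x) + \<bar>ln a\<bar>"
    and "\<alpha>0 = max a (1 / sqrt a)"
    and "y = 73.6 * a powr (1/8) * x powr (3/16) * L powr (3/8)"
    and "1 \<le> y" and "y \<le> x / 3"
  shows "\<bar>lattice_discrepancy a x\<bar> \<le>
      1237 * a powr (1/8) * x powr (11/16) * L powr (3/8)
    + 12 * a powr (- (69/64)) * x powr (81/128) * L powr (145/64)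
    + (a powr (1/4) * (134 * L powr (5/2) + 543 * L powr (1/4))
        + 20 * (L powr (5/2) / a powr (1/4))) * x powr (5/8)
    + 12 * a powr (- (39/64)) * x powr (75/128) * L powr (139/64)
    + (268 * (L / a) + 159 * \<alpha>0 ^ 3 + 2000) * x powr (1/2)
    + \<alpha>0 ^ 3 * (4.4 * L + 104.5)"
proof -
  note a = assms(1) and x0 = assms(2) and Ldef = assms(3) and al0 = assms(4) and ydef = assms(5) and y1 = assms(6) and y3 = assms(7)
  define \<alpha> where "\<alpha> = ln a"
  define \<xi> where "\<xi> = ln x"
  define l where "l = ln L"
  define r where "r = exp (\<xi> / 2)"
  have x3: "x \<ge> 3" using y1 y3 by linarith
  have ae: "a = exp \<alpha>" and xe: "x = exp \<xi>" using a x0 by (auto simp: \<alpha>_def \<xi>_def)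
  have xi0: "\<xi> \<ge> 0" using x3 by (simp add: \<xi>_def)
  have "(14/5::real) ^ 22 \<le> 100 ^ 5" by (simp add: eval_nat_numeral)
  hence ln100: "ln (100::real) \<ge> 22/5" using ln_ge_by_power[of 22 100 5] by simp
  have Leq: "L = ln 100 + \<xi> + \<bar>\<alpha>\<bar>" unfolding Ldef \<alpha>_def \<xi>_def using x0 by (simp add: ln_mult)
  have L4: "L \<ge> 4" using Leq ln100 xi0 by linarith
  hence L0: "L > 0" by linarith
  have Le: "L = exp l" using L0 by (simp add: l_def)
  have pa: "a powr p = exp (p * \<alpha>)" for p using a by (simp add: powr_def \<alpha>_def)
  have px: "x powr p = exp (p * \<xi>)" for p using x0 by (simp add: powr_def \<xi>_def)
  have pL: "L powr p = exp (p * l)" for p using L0 by (simp add: powr_def l_def)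
  have rx: "x powr (1/2) = r" by (simp add: px r_def)
  have r2: "r\<^sup>2 = x" by (simp add: r_def xe flip: exp_double)
  have rpos: "r > 0" by (simp add: r_def)
  have rs: "sqrt x = r" using r2 rpos real_sqrt_unique by fastforce
  have r1: "r \<ge> 1" using xi0 by (simp add: r_def)
  define M1 where "M1 = exp (\<alpha> / 8 + 11 * \<xi> / 16 + 3 * l / 8)"
  define M2 where "M2 = exp (- 69 * \<alpha> / 64 + 81 * \<xi> / 128 + 145 * l / 64)"
  define C1 where "C1 = exp (\<alpha> / 4 + 5 * \<xi> / 8 + 5 * l / 2)"
  define C2 where "C2 = exp (\<alpha> / 4 + 5 * \<xi> / 8 + l / 4)"
  define C3 where "C3 = exp (- \<alpha> / 4 + 5 * \<xi> / 8 + 5 * l / 2)"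
  have e1: "1237 * a powr (1/8) * x powr (11/16) * L powr (3/8) = 1237 * M1"
  proof -
    have q: "\<alpha> / 8 + 11 * \<xi> / 16 + 3 * l / 8 = 1/8 * \<alpha> + 11/16 * \<xi> + 3/8 * l" by simp
    show ?thesis unfolding M1_def q pa px pL mult.assoc mult_exp_exp ..
  qed
  have e2: "12 * a powr (- (69/64)) * x powr (81/128) * L powr (145/64) = 12 * M2"
  proof -
    have q: "- 69 * \<alpha> / 64 + 81 * \<xi> / 128 + 145 * l / 64 = - (69/64) * \<alpha> + 81/128 * \<xi> + 145/64 * l" by simp
    show ?thesis unfolding M2_def q pa px pL mult.assoc mult_exp_exp ..
  qed
  have e3: "(a powr (1/4) * (134 * L powr (5/2) + 543 * L powr (1/4)) + 20 * (L powr (5/2) / a powr (1/4))) * x powr (5/8)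
    = 134 * C1 + 543 * C2 + 20 * C3"
  proof -
    have q: "\<alpha> / 4 + 5 * \<xi> / 8 + 5 * l / 2 = 1/4 * \<alpha> + 5/2 * l + 5/8 * \<xi>"
      "\<alpha> / 4 + 5 * \<xi> / 8 + l / 4 = 1/4 * \<alpha> + 1/4 * l + 5/8 * \<xi>"
      "- \<alpha> / 4 + 5 * \<xi> / 8 + 5 * l / 2 = (5/2 * l - 1/4 * \<alpha>) + 5/8 * \<xi>" by simp_all
    have d: "(u * (134 * v + 543 * w) + 20 * t) * s = 134 * (u * v * s) + 543 * (u * w * s) + 20 * (t * s)" for u v w t s :: real
      by (simp add: algebra_simps)
    show ?thesis unfolding C1_def C2_def C3_def q pa px pL d exp_diff[symmetric] mult_exp_exp ..
  qed
  define E where "E = 16/3 * (r / a) + 1"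
  define rhs where "rhs = 1237 * a powr (1/8) * x powr (11/16) * L powr (3/8)
    + 12 * a powr (- (69/64)) * x powr (81/128) * L powr (145/64)
    + (a powr (1/4) * (134 * L powr (5/2) + 543 * L powr (1/4))
        + 20 * (L powr (5/2) / a powr (1/4))) * x powr (5/8)
    + 12 * a powr (- (39/64)) * x powr (75/128) * L powr (139/64)
    + (268 * (L / a) + 159 * \<alpha>0 ^ 3 + 2000) * x powr (1/2)
    + \<alpha>0 ^ 3 * (4.4 * L + 104.5)"
  have al1: "\<alpha>0 \<ge> 1"
  proof (cases "a \<ge> 1")
    case False
    hence "1 / 1 \<le> 1 / sqrt a" using a by (intro divide_left_mono) auto
    thus ?thesis by (simp add: al0)
  qed (simp add: al0)
  have ala: "\<alpha>0 \<ge> a" by (simp add: al0)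
  have a3: "a ^ 3 \<le> \<alpha>0 ^ 3" using ala a by (intro power_mono) auto
  have "a\<^sup>2 \<le> \<alpha>0\<^sup>2" using ala a by (intro power_mono) auto
  also have "\<alpha>0\<^sup>2 \<le> \<alpha>0 ^ 3" using al1 by (intro power_increasing) auto
  finally have a2: "r * a\<^sup>2 \<le> \<alpha>0 ^ 3 * r" using rpos by (simp add: mult.commute)
  have al3: "1 \<le> \<alpha>0 ^ 3" using al1 by simp
  have rhs: "1237 * M1 + 12 * M2 + 134 * C1 + 543 * C2 + 20 * C3 + 268 * (L * r / a) + 159 * (\<alpha>0 ^ 3 * r) + 104 * \<alpha>0 ^ 3 \<le> rhs"
  proof -
    have "104 * \<alpha>0 ^ 3 \<le> \<alpha>0 ^ 3 * (4.4 * L + 104.5)"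
      by (subst mult.commute, rule mult_left_mono) (use L0 al1 in auto)
    moreover have "0 \<le> 12 * a powr (- (39/64)) * x powr (75/128) * L powr (139/64)" by simp
    moreover have "(268 * (L / a) + 159 * \<alpha>0 ^ 3 + 2000) * r = 268 * (L * r / a) + 159 * (\<alpha>0 ^ 3 * r) + 2000 * r"
      by (simp add: distrib_right)
    ultimately show ?thesis unfolding rhs_def e1 e2 e3 rx using rpos by linarith
  qed
  have Mpos: "M1 > 0" "M2 > 0" "C1 > 0" "C2 > 0" "C3 > 0" by (simp_all add: M1_def M2_def C1_def C2_def C3_def)
  have "\<bar>lattice_discrepancy a x\<bar> \<le> rhs"
  proof (cases "a * x < 1")
    \<comment> \<open>The degenerate bound fits under the term with L/a, as L \<ge> 4, and the
      additive 1 under \<alpha>0^3.\<close>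
    case True
    have "\<bar>lattice_discrepancy a x\<bar> \<le> 16/3 * (r / a) + 1"
      using lattice_discrepancy_degenerate[OF a _ True] x3 unfolding rs by simp
    moreover have "1 * (r / a) \<le> L * (r / a)" using L4 rpos a by (intro mult_right_mono) auto
    hence "r / a \<le> L * r / a" by simp
    moreover have "0 \<le> r / a" using rpos a by simp
    moreover have "0 \<le> \<alpha>0 ^ 3 * r" using al1 rpos by simp
    ultimately show ?thesis using rhs Mpos al3 by linarith
  next
    case False
    define \<mu> where "\<mu> = \<alpha> / 8 + 3 * \<xi> / 16 + 3 * l / 8"
    define h where "h = 92 / 5 * exp \<mu>"
    define z where "z = 5 * \<xi> / 16 - \<alpha> / 8 - 3 * l / 8"
    define Z where "Z = 5 / 92 * exp z"
    have ax: "\<alpha> + \<xi> \<ge> 0"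
    proof -
      have "exp (\<alpha> + \<xi>) \<ge> 1" using False by (simp add: exp_add flip: ae xe)
      thus ?thesis by simp
    qed
    \<comment> \<open>73.6 = 4 * 92/5, so y \<le> x/3 becomes 12 h \<le> x, which is the condition
      2h \<le> r^2/6.\<close>
    have yh: "y = 4 * h"
    proof -
      have q: "\<mu> = 1/8 * \<alpha> + 3/16 * \<xi> + 3/8 * l" by (simp add: \<mu>_def)
      show ?thesis unfolding ydef h_def q pa px pL mult.assoc mult_exp_exp by simp
    qed
    \<comment> \<open>A bootstrap begins: L \<ge> 4 gives l \<ge> 1, so \<mu> \<ge> 0, and 12 h
      \<le> x gives \<xi> \<ge> 5 + \<mu>. This yields L \<ge> 9, hence l \<ge> 2, which raises
      \<mu> enough for L \<ge> 10.\<close>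
    have l1: "l \<ge> 1"
    proof -
      have "exp 1 \<le> L" using exp_1_le L4 by linarith
      thus ?thesis unfolding Le by simp
    qed
    have "exp 0 \<le> exp \<mu>" unfolding exp_le_cancel_iff \<mu>_def using ax xi0 l1 by linarith
    hence mu1: "exp \<mu> \<ge> 1" by simp
    have xh: "12 * h \<le> x" using y3 yh by linarith
    have x220: "x \<ge> 1104 / 5 * exp \<mu>" using xh unfolding h_def by linarith
    have ln220: "ln (1104/5::real) \<ge> 5" using ln_ge_by_power[of 5 "1104/5" 1] by (simp add: eval_nat_numeral)
    have "ln (1104 / 5 * exp \<mu>) \<le> \<xi>" unfolding \<xi>_def using x220 by (intro ln_mono) auto
    moreover have "ln (1104 / 5 * exp \<mu>) = ln (1104/5) + \<mu>" by (subst ln_mult) auto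
    ultimately have xi5: "\<xi> \<ge> 5 + \<mu>" using ln220 by linarith
    have L9: "L \<ge> 9" using xi5 Leq ln100 ax xi0 l1 unfolding \<mu>_def by linarith
    have l2: "l \<ge> 2"
    proof -
      have "exp (2::real) = exp 1 * exp 1" by (simp add: mult_exp_exp)
      also have "\<dots> \<le> 14/5 * (14/5)" using exp_1_le by (intro mult_mono) auto
      also have "\<dots> \<le> L" using L9 by simp
      finally show ?thesis unfolding Le by simp
    qed
    have L10: "L \<ge> 10" using xi5 Leq ln100 ax xi0 l2 unfolding \<mu>_def by linarith
    have "196 \<le> x" using x220 mu1 by linarith
    hence "14\<^sup>2 \<le> r\<^sup>2" unfolding r2 by simp
    hence r14: "14 \<le> r" by (rule power2_le_imp_le) (use rpos in simp)
    have Zpos: "Z > 0" by (simp add: Z_def)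
    have hZ: "h * Z = r"
    proof -
      have "h * Z = exp \<mu> * exp z" by (simp add: h_def Z_def)
      also have "\<dots> = r" unfolding mult_exp_exp r_def by (rule arg_cong[where f = exp]) (simp add: \<mu>_def z_def)
      finally show ?thesis .
    qed
    \<comment> \<open>The 100 inside L pays for the constants, since 2 ln(5/92) + 6 < ln 100. The
      factor L^(-3/4) in Z^2 contributes at most -3/2, and for \<alpha> < 0 the term -5\<alpha>/4 is
      covered because \<alpha> + \<xi> \<ge> 0.\<close>
    have lnZ: "ln (Z\<^sup>2 / a) + 6 \<le> L"
    proof -
      have "ln (Z\<^sup>2 / a) = 2 * ln Z - \<alpha>" using Zpos a by (simp add: ln_div ln_realpow \<alpha>_def)
      also have "ln Z = ln (5/92) + z" unfolding Z_def by (subst ln_mult) auto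
      finally have e: "ln (Z\<^sup>2 / a) = 2 * ln (5/92) + (2 * z - \<alpha>)" by simp
      have b: "ln (5/92 :: real) \<le> 5/92 - 1" by (rule ln_le_minus_one) simp
      have t: "2 * z - \<alpha> \<le> \<xi> + \<bar>\<alpha>\<bar> - 3/2"
      proof (cases "\<alpha> \<ge> 0")
        case True
        thus ?thesis using xi0 l2 unfolding z_def abs_of_nonneg[OF True] by (simp add: field_simps)
      next
        case neg: False
        hence "\<bar>\<alpha>\<bar> = - \<alpha>" by simp
        thus ?thesis using ax xi0 l2 unfolding z_def by (simp add: field_simps)
      qed
      have gen: "2 * u + w + 6 \<le> v + k + m" if "u \<le> 5/92 - 1" "w \<le> k + m - 3/2" "22/5 \<le> v" for u v w k m :: real
        using that by linarith
      show ?thesis unfolding e Leq by (rule gen[OF b t ln100])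
    qed
    have hr: "h * r = 92 / 5 * M1"
    proof -
      have "h * r = 92 / 5 * (exp \<mu> * exp (\<xi> / 2))" by (simp add: h_def r_def)
      also have "exp \<mu> * exp (\<xi> / 2) = M1" unfolding mult_exp_exp M1_def by (rule arg_cong[where f = exp]) (simp add: \<mu>_def)
      finally show ?thesis .
    qed
    have main: "\<bar>lattice_discrepancy a (r\<^sup>2)\<bar> \<le> 24 * r * sqrt L * Bz a r Z + 6 * L * r / a + a ^ 3 + 2 * r * a\<^sup>2 + 88/5 * (h * r)"
    proof (rule lattice_discrepancy_bound[OF a r14 _ _ _ hZ L10 lnZ])
      show "1 \<le> a * r\<^sup>2" using False by (simp add: r2)
      show "2 * h \<le> r\<^sup>2 / 6" using xh by (simp add: r2)
      show "h > 0" by (simp add: h_def)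
    qed
    have sL: "sqrt L = exp (l / 2)" unfolding Le by (rule sqrt_exp)
    have "24 * r * sqrt L * Bz a r Z \<le> 473 * M1 + 920 * C2 + 34 * exp (- 9 * \<alpha> / 16 + 21 * \<xi> / 32 + 5 * l / 16)
        + 318 * exp (- 3 * \<alpha> / 32 + 39 * \<xi> / 64 + 7 * l / 32)"
      unfolding sL r_def ae Z_def z_def M1_def C2_def by (rule Bz_at_optimal_step)
    moreover have "920 * C2 + 34 * exp (- 9 * \<alpha> / 16 + 21 * \<xi> / 32 + 5 * l / 16)
        + 318 * exp (- 3 * \<alpha> / 32 + 39 * \<xi> / 64 + 7 * l / 32) \<le> 400 * M1 + 12 * M2 + 134 * C1 + 543 * C2 + 20 * C3"
      unfolding M1_def M2_def C1_def C2_def C3_def using L10 xi0 unfolding Le by (rule absorb_secondary_terms)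
    moreover have "6 * L * r / a \<le> 268 * (L * r / a)"
    proof -
      have "0 \<le> L * r / a" using L0 rpos a by simp
      moreover have "6 * L * r / a = 6 * (L * r / a)" by simp
      ultimately show ?thesis by linarith
    qed
    moreover have "2 * r * a\<^sup>2 \<le> 159 * (\<alpha>0 ^ 3 * r)"
    proof -
      have "0 \<le> \<alpha>0 ^ 3 * r" using al1 rpos by simp
      moreover have "2 * r * a\<^sup>2 = 2 * (r * a\<^sup>2)" by simp
      ultimately show ?thesis using a2 by linarith
    qed
    \<comment> \<open>The coefficients of \<open>M1\<close> add up to 473 + 400 + (88/5)(92/5) <
      1197, below 1237.\<close>
    ultimately show ?thesis using main rhs hr a3 al3 Mpos unfolding r2 by linarith
  qed
  thus ?thesis unfolding rhs_def .
qed

end
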